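(* Let $X$, $G$, $c$, $r$, $\mathcal L$ be as in the context. Set $\Delta:=\{x\in\mathbb R^2_+:x_1=\alpha x_2\}$, $n:=(1,-\alpha)$, $q(x):=n^\top a(x)n=a_{11}(x)-2\alpha a_{12}(x)+\alpha^2a_{22}(x)$, $Y_t:=X^1_t-\alpha X^2_t$, and let $\sigma_\Delta$ be one-dimensional surface measure on $\Delta$. Then: (1) The singular finite-variation term of the semimartingale $G(X_t)=\frac12(X^1_t+\alpha X^2_t+|Y_t|)$ produced by the kink of $G$ is $\frac12L^0_t(Y)$, where $L^0(Y)$ is the symmetric local time of $Y$ at $0$, i.e. $d|Y_t|=\operatorname{sgn}(Y_t)\,dY_t+dL^0_t(Y)$ and $$L^0_t(Y)=\lim_{\varepsilon\downarrow0}\frac1{2\varepsilon}\int_0^t\mathbf 1_{\{|Y_s|<\varepsilon\}}\,q(X_s)\,ds .$$ (2) The singular part of $\mathcal LG$ is the measure $(\mathcal LG)^\Delta(dx)=\dfrac{q(x)}{2\sqrt{1+\alpha^2}}\,\sigma_\Delta(dx)$. (3) Consequently the stopping gain $\Gamma:=c+rG-\mathcal LG$ is the signed measure $$\Gamma=\Gamma^{\mathrm{ac}}\,dx+\Gamma^\Delta,\qquad \Gamma^\Delta(dx)=-\frac{q(x)}{2\sqrt{1+\alpha^2}}\,\sigma_\Delta(dx),$$ where $\Gamma^{\mathrm{ac}}(x)=c(x)+rx_1-\mu_1(x)$ if $x_1>\alpha x_2$ and $\Gamma^{\mathrm{ac}}(x)=c(x)+r\alpha x_2-\alpha\mu_2(x)$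 if $x_1<\alpha x_2$. Moreover $q\ge0$, so $\Gamma^\Delta\le0$ as a measure.
   Context: Setting. $\mathbb R^2_+=[0,\infty)^2$, $r>0$, $\alpha>0$, $G(x_1,x_2)=x_1\vee\alpha x_2$, $c:\mathbb R^2_+\to[0,\infty)$ continuous. $W$ is a two-dimensional Brownian motion on a filtered probability space satisfying the usual conditions, and $X$ is the unique strong solution (a strong Markov family, in the starting point $x$) of the normally reflected SDE $X_t=x+\int_0^t\mu(X_s)ds+\int_0^t\sigma(X_s)dW_s+L_t$ in $\mathbb R^2_+$, where $L=(L^1,L^2)$, each $L^i$ is continuous, nondecreasing, $L^i_0=0$, $\int_0^\infty\mathbf 1_{\{X^i_t>0\}}dL^i_t=0$. The coefficients $\mu:\mathbb R^2_+\to\mathbb R^2$, $\sigma:\mathbb R^2_+\to\mathbb R^{2\times2}$ are locally Lipschitz with at most linear growth, and $a=\sigma\sigma^\top$ is uniformly elliptic on each compact subset of $\mathbb R^2_+$. $\mathcal LG=\sum_i\mu_i\partial_iG+\frac12\sum_{i,j}a_{ij}\partial_{ij}G$ is understood in the sense of distributions on $(0,\infty)^2$: the second derivatives $\partial_{ij}G$ of the Lipschitz function $G$ are Radon measures, multiplied by the continuous functions $a_{ij}$. "Singular part" means the part singular with respect to Lebesgue measure $dx$. $\operatorname{sgn}(0)=0$. *)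

theory Defs
  imports "HOL-Probability.Probability"
begin

section \<open>Continuous-time processes\<close>

text \<open>
  Time is indexed by \<open>real\<close>, but only times \<open>t \<ge> 0\<close> are ever used; the values of filtrations
  and processes at negative times are irrelevant. Paths of the processes below are continuous
  for every sample point, while identities between stochastic integrals hold almost surely.
\<close>

definition filtered_space :: "'w measure \<Rightarrow> (real \<Rightarrow> 'w measure) \<Rightarrow> bool" where
  "filtered_space M F \<longleftrightarrow> prob_space M \<and> filtration (space M) F \<and> (\<forall>t. sets (F t) \<subseteq> sets M)"

definition usual_conditions :: "'w measure \<Rightarrow> (real \<Rightarrow> 'w measure) \<Rightarrow> bool" where
  "usual_conditions M F \<longleftrightarrow>
     complete_measure M \<and> null_sets M \<subseteq> sets (F 0) \<and>
     (\<forall>t\<ge>0. sets (F t) = (\<Inter>s\<in>{t<..}. sets (F s)))"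

definition adapted_process ::
  "(real \<Rightarrow> 'w measure) \<Rightarrow> (real \<Rightarrow> 'w \<Rightarrow> 'b::topological_space) \<Rightarrow> bool" where
  "adapted_process F Z \<longleftrightarrow> (\<forall>t\<ge>0. Z t \<in> borel_measurable (F t))"

definition continuous_process ::
  "'w measure \<Rightarrow> (real \<Rightarrow> 'w \<Rightarrow> 'b::topological_space) \<Rightarrow> bool" where
  "continuous_process M Z \<longleftrightarrow> (\<forall>\<omega>\<in>space M. continuous_on {0..} (\<lambda>t. Z t \<omega>))"

definition progressive_process ::
  "(real \<Rightarrow> 'w measure) \<Rightarrow> (real \<Rightarrow> 'w \<Rightarrow> real) \<Rightarrow> bool" where
  "progressive_process F H \<longleftrightarrow>
     (\<forall>T\<ge>0. (\<lambda>(s, \<omega>). H s \<omega>) \<in> borel_measurable (restrict_space borel {0..T} \<Otimes>\<^sub>M F T))"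

definition continuous_increasing ::
  "'w measure \<Rightarrow> (real \<Rightarrow> 'w measure) \<Rightarrow> (real \<Rightarrow> 'w \<Rightarrow> real) \<Rightarrow> bool" where
  "continuous_increasing M F A \<longleftrightarrow>
     adapted_process F A \<and> continuous_process M A \<and>
     (\<forall>\<omega>\<in>space M. A 0 \<omega> = 0 \<and> mono_on {0..} (\<lambda>t. A t \<omega>))"

text \<open>The Stieltjes measure \<open>dA\<^sub>t(\<omega>)\<close> on \<open>[0,\<infinity>)\<close> of a continuous increasing process.\<close>

definition path_measure :: "(real \<Rightarrow> 'w \<Rightarrow> real) \<Rightarrow> 'w \<Rightarrow> real measure" where
  "path_measure A \<omega> = interval_measure (\<lambda>t. A (max 0 t) \<omega>)"


section \<open>Continuous semimartingales and stochastic integration\<close>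

definition martingale ::
  "'w measure \<Rightarrow> (real \<Rightarrow> 'w measure) \<Rightarrow> (real \<Rightarrow> 'w \<Rightarrow> real) \<Rightarrow> bool" where
  "martingale M F N \<longleftrightarrow>
     adapted_process F N \<and> (\<forall>t\<ge>0. integrable M (N t)) \<and>
     (\<forall>s\<ge>0. \<forall>t\<ge>s. AE \<omega> in M. real_cond_exp M (F s) (N t) \<omega> = N s \<omega>)"

definition continuous_local_martingale ::
  "'w measure \<Rightarrow> (real \<Rightarrow> 'w measure) \<Rightarrow> (real \<Rightarrow> 'w \<Rightarrow> real) \<Rightarrow> bool" where
  "continuous_local_martingale M F N \<longleftrightarrow>
     adapted_process F N \<and> continuous_process M N \<and>
     (\<exists>\<tau> :: nat \<Rightarrow> 'w \<Rightarrow> real.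
        (\<forall>k. stopping_time F (\<tau> k) \<and> (\<forall>\<omega>\<in>space M. 0 \<le> \<tau> k \<omega>)) \<and>
        (AE \<omega> in M. incseq (\<lambda>k. \<tau> k \<omega>) \<and> filterlim (\<lambda>k. \<tau> k \<omega>) at_top sequentially) \<and>
        (\<forall>k. martingale M F (\<lambda>t \<omega>. N (min t (\<tau> k \<omega>)) \<omega> - N 0 \<omega>)))"

definition quadratic_variation ::
  "'w measure \<Rightarrow> (real \<Rightarrow> 'w measure) \<Rightarrow> (real \<Rightarrow> 'w \<Rightarrow> real) \<Rightarrow> (real \<Rightarrow> 'w \<Rightarrow> real) \<Rightarrow> bool" where
  "quadratic_variation M F N Q \<longleftrightarrow>
     continuous_increasing M F Q \<and>
     continuous_local_martingale M F (\<lambda>t \<omega>. (N t \<omega>)\<^sup>2 - Q t \<omega>)"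

text \<open>
  \<open>Z = Z\<^sub>0 + N + A - B\<close>; the finite variation part is written as a difference of two continuous
  increasing processes.
\<close>

definition semimartingale_decomposition ::
  "'w measure \<Rightarrow> (real \<Rightarrow> 'w measure) \<Rightarrow> (real \<Rightarrow> 'w \<Rightarrow> real) \<Rightarrow>
   (real \<Rightarrow> 'w \<Rightarrow> real) \<Rightarrow> (real \<Rightarrow> 'w \<Rightarrow> real) \<Rightarrow> (real \<Rightarrow> 'w \<Rightarrow> real) \<Rightarrow> bool" where
  "semimartingale_decomposition M F Z N A B \<longleftrightarrow>
     adapted_process F Z \<and> continuous_process M Z \<and>
     continuous_local_martingale M F N \<and> (\<forall>\<omega>\<in>space M. N 0 \<omega> = 0) \<and>
     continuous_increasing M F A \<and> continuous_increasing M F B \<and>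
     (AE \<omega> in M. \<forall>t\<ge>0. Z t \<omega> = Z 0 \<omega> + N t \<omega> + A t \<omega> - B t \<omega>)"

text \<open>
  A simple process \<open>\<Sum>i<n. \<xi>\<^sub>i 1\<close> on \<open>(u\<^sub>i, u\<^sub>i\<^sub>+\<^sub>1]\<close> with \<open>\<xi>\<^sub>i\<close> bounded and measurable at time \<open>u\<^sub>i\<close>,
  and its elementary integral with respect to \<open>Z\<close>.
\<close>

definition simple_data ::
  "'w measure \<Rightarrow> (real \<Rightarrow> 'w measure) \<Rightarrow> nat \<Rightarrow> (nat \<Rightarrow> real) \<Rightarrow> (nat \<Rightarrow> 'w \<Rightarrow> real) \<Rightarrow> bool" where
  "simple_data M F n u \<xi> \<longleftrightarrow>
     0 \<le> u 0 \<and>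
     (\<forall>i<n. u i \<le> u (Suc i) \<and> \<xi> i \<in> borel_measurable (F (u i)) \<and>
        (\<exists>C. \<forall>\<omega>\<in>space M. \<bar>\<xi> i \<omega>\<bar> \<le> C))"

definition simple_process ::
  "nat \<Rightarrow> (nat \<Rightarrow> real) \<Rightarrow> (nat \<Rightarrow> 'w \<Rightarrow> real) \<Rightarrow> real \<Rightarrow> 'w \<Rightarrow> real" where
  "simple_process n u \<xi> s \<omega> = (\<Sum>i<n. \<xi> i \<omega> * indicator {u i<..u (Suc i)} s)"

definition simple_integral ::
  "nat \<Rightarrow> (nat \<Rightarrow> real) \<Rightarrow> (nat \<Rightarrow> 'w \<Rightarrow> real) \<Rightarrow> (real \<Rightarrow> 'w \<Rightarrow> real) \<Rightarrow> real \<Rightarrow> 'w \<Rightarrow> real" where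
  "simple_integral n u \<xi> Z t \<omega> =
     (\<Sum>i<n. \<xi> i \<omega> * (Z (min (u (Suc i)) t) \<omega> - Z (min (u i) t) \<omega>))"

definition null_in_probability :: "'w measure \<Rightarrow> (nat \<Rightarrow> 'w \<Rightarrow> ennreal) \<Rightarrow> bool" where
  "null_in_probability M R \<longleftrightarrow>
     (\<forall>k. R k \<in> borel_measurable M) \<and>
     (\<forall>e>0. (\<lambda>k. measure M {\<omega> \<in> space M. R k \<omega> > ennreal e}) \<longlonglongrightarrow> 0)"

text \<open>
  \<open>stochastic_integral M F H Z I\<close>: \<open>I\<close> is (a continuous version of) \<open>\<integral>\<^sub>0 H dZ\<close> for the continuous
  semimartingale \<open>Z\<close>. The integral is the limit, uniformly on compacts in probability, of
  elementary integrals of simple processes approximating \<open>H\<close> in \<open>L\<^sup>2(d\<langle>N\<rangle>)\<close> and in \<open>L\<^sup>1(dA + dB)\<close>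
  on compact time intervals, in probability; it is unique up to indistinguishability. For a
  Brownian motion \<open>Z\<close> this is the Ito integral of progressive integrands which are a.s. locally
  square integrable in time.
\<close>

definition stochastic_integral ::
  "'w measure \<Rightarrow> (real \<Rightarrow> 'w measure) \<Rightarrow> (real \<Rightarrow> 'w \<Rightarrow> real) \<Rightarrow> (real \<Rightarrow> 'w \<Rightarrow> real) \<Rightarrow>
   (real \<Rightarrow> 'w \<Rightarrow> real) \<Rightarrow> bool" where
  "stochastic_integral M F H Z I \<longleftrightarrow>
     progressive_process F H \<and> adapted_process F I \<and> continuous_process M I \<and>
     (\<exists>N A B Q.
        semimartingale_decomposition M F Z N A B \<and> quadratic_variation M F N Q \<and>
        (\<exists>n u \<xi>.
           (\<forall>k. simple_data M F (n k) (u k) (\<xi> k)) \<and>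
           (\<forall>T\<ge>0.
              null_in_probability M (\<lambda>k \<omega>.
                \<integral>\<^sup>+ s\<in>{0..T}. ennreal ((simple_process (n k) (u k) (\<xi> k) s \<omega> - H s \<omega>)\<^sup>2)
                  \<partial>path_measure Q \<omega>) \<and>
              null_in_probability M (\<lambda>k \<omega>.
                \<integral>\<^sup>+ s\<in>{0..T}. ennreal \<bar>simple_process (n k) (u k) (\<xi> k) s \<omega> - H s \<omega>\<bar>
                  \<partial>path_measure (\<lambda>t \<omega>. A t \<omega> + B t \<omega>) \<omega>) \<and>
              null_in_probability M (\<lambda>k \<omega>.
                SUP t\<in>{0..T}. ennreal \<bar>simple_integral (n k) (u k) (\<xi> k) Z t \<omega> - I t \<omega>\<bar>))))"

text \<open>
  Symmetric local time at \<open>0\<close>, defined by Tanaka's formula with \<open>sgn 0 = 0\<close> (which is the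
  convention of the library constant).
\<close>

definition symmetric_local_time ::
  "'w measure \<Rightarrow> (real \<Rightarrow> 'w measure) \<Rightarrow> (real \<Rightarrow> 'w \<Rightarrow> real) \<Rightarrow> (real \<Rightarrow> 'w \<Rightarrow> real) \<Rightarrow> bool" where
  "symmetric_local_time M F Y l \<longleftrightarrow>
     continuous_increasing M F l \<and>
     (\<exists>J. stochastic_integral M F (\<lambda>s \<omega>. sgn (Y s \<omega>)) Y J \<and>
        (AE \<omega> in M. \<forall>t\<ge>0. \<bar>Y t \<omega>\<bar> = \<bar>Y 0 \<omega>\<bar> + J t \<omega> + l t \<omega>))"


section \<open>Reflected diffusions in the quadrant\<close>

definition quadrant :: "(real^2) set" where
  "quadrant = {x. 0 \<le> x$1 \<and> 0 \<le> x$2}"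

definition open_quadrant :: "(real^2) set" where
  "open_quadrant = {x. 0 < x$1 \<and> 0 < x$2}"

definition brownian_motion ::
  "'w measure \<Rightarrow> (real \<Rightarrow> 'w measure) \<Rightarrow> (real \<Rightarrow> 'w \<Rightarrow> real^2) \<Rightarrow> bool" where
  "brownian_motion M F W \<longleftrightarrow>
     adapted_process F W \<and> continuous_process M W \<and> (AE \<omega> in M. W 0 \<omega> = 0) \<and>
     (\<forall>s\<ge>0. \<forall>t>s.
        distributed M lborel (\<lambda>\<omega>. W t \<omega> - W s \<omega>)
          (\<lambda>x. ennreal (\<Prod>i\<in>UNIV. normal_density 0 (sqrt (t - s)) (x$i))) \<and>
        prob_space.indep_set M (sets (F s))
          (sets (vimage_algebra (space M) (\<lambda>\<omega>. W t \<omega> - W s \<omega>) borel)))"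

definition brownian_filtration ::
  "'w measure \<Rightarrow> (real \<Rightarrow> 'w \<Rightarrow> real^2) \<Rightarrow> real \<Rightarrow> 'w measure" where
  "brownian_filtration M W t =
     sigma (space M) ({W s -` B \<inter> space M | s B. 0 \<le> s \<and> s \<le> t \<and> B \<in> sets borel} \<union> null_sets M)"

definition locally_lipschitz_on :: "'a::metric_space set \<Rightarrow> ('a \<Rightarrow> 'b::metric_space) \<Rightarrow> bool" where
  "locally_lipschitz_on S f \<longleftrightarrow> (\<forall>x\<in>S. \<exists>u>0. \<exists>C. lipschitz_on C (cball x u \<inter> S) f)"

definition linear_growth_on ::
  "'a::real_normed_vector set \<Rightarrow> ('a \<Rightarrow> 'b::real_normed_vector) \<Rightarrow> bool" where
  "linear_growth_on S f \<longleftrightarrow> (\<exists>C. \<forall>x\<in>S. norm (f x) \<le> C * (1 + norm x))"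

definition diffusion_matrix :: "(real^2 \<Rightarrow> real^2^2) \<Rightarrow> real^2 \<Rightarrow> real^2^2" where
  "diffusion_matrix \<sigma> x = \<sigma> x ** transpose (\<sigma> x)"

definition uniformly_elliptic_on :: "(real^2) set \<Rightarrow> (real^2 \<Rightarrow> real^2^2) \<Rightarrow> bool" where
  "uniformly_elliptic_on K a \<longleftrightarrow> (\<exists>\<kappa>>0. \<forall>x\<in>K. \<forall>v. \<kappa> * (norm v)\<^sup>2 \<le> v \<bullet> (a x *v v))"

definition reflected_solution ::
  "'w measure \<Rightarrow> (real \<Rightarrow> 'w measure) \<Rightarrow> (real \<Rightarrow> 'w \<Rightarrow> real^2) \<Rightarrow>
   (real^2 \<Rightarrow> real^2) \<Rightarrow> (real^2 \<Rightarrow> real^2^2) \<Rightarrow> real^2 \<Rightarrow>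
   (real \<Rightarrow> 'w \<Rightarrow> real^2) \<Rightarrow> (real \<Rightarrow> 'w \<Rightarrow> real^2) \<Rightarrow> bool" where
  "reflected_solution M F W \<mu> \<sigma> x X L \<longleftrightarrow>
     adapted_process F X \<and> continuous_process M X \<and>
     (\<forall>\<omega>\<in>space M. \<forall>t\<ge>0. X t \<omega> \<in> quadrant) \<and>
     (\<forall>i. continuous_increasing M F (\<lambda>t \<omega>. L t \<omega> $ i) \<and>
        (AE \<omega> in M. (\<integral>\<^sup>+ t\<in>{0..}. indicator {t. X t \<omega> $ i > 0} t
           \<partial>path_measure (\<lambda>t \<omega>. L t \<omega> $ i) \<omega>) = 0)) \<and>
     (\<exists>I. (\<forall>i j. stochastic_integral M F (\<lambda>s \<omega>. \<sigma> (X s \<omega>) $ i $ j) (\<lambda>t \<omega>. W t \<omega> $ j) (I i j)) \<and>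
        (AE \<omega> in M. \<forall>t\<ge>0. \<forall>i.
           X t \<omega> $ i = x $ i + (LINT s:{0..t}|lborel. \<mu> (X s \<omega>) $ i)
             + (\<Sum>j\<in>UNIV. I i j t \<omega>) + L t \<omega> $ i))"

definition unique_strong_solution ::
  "'w measure \<Rightarrow> (real \<Rightarrow> 'w measure) \<Rightarrow> (real \<Rightarrow> 'w \<Rightarrow> real^2) \<Rightarrow>
   (real^2 \<Rightarrow> real^2) \<Rightarrow> (real^2 \<Rightarrow> real^2^2) \<Rightarrow> real^2 \<Rightarrow>
   (real \<Rightarrow> 'w \<Rightarrow> real^2) \<Rightarrow> (real \<Rightarrow> 'w \<Rightarrow> real^2) \<Rightarrow> bool" where
  "unique_strong_solution M F W \<mu> \<sigma> x X L \<longleftrightarrow>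
     reflected_solution M F W \<mu> \<sigma> x X L \<and>
     adapted_process (brownian_filtration M W) X \<and>
     (\<forall>X' L'. reflected_solution M F W \<mu> \<sigma> x X' L' \<longrightarrow>
        (AE \<omega> in M. \<forall>t\<ge>0. X' t \<omega> = X t \<omega> \<and> L' t \<omega> = L t \<omega>))"

text \<open>\<open>X x\<close> is the process started at \<open>x\<close>.\<close>

definition strong_markov_family ::
  "'w measure \<Rightarrow> (real \<Rightarrow> 'w measure) \<Rightarrow> (real^2 \<Rightarrow> real \<Rightarrow> 'w \<Rightarrow> real^2) \<Rightarrow> bool" where
  "strong_markov_family M F X \<longleftrightarrow>
     (\<forall>f s. f \<in> borel_measurable borel \<and> bounded (range f) \<and> 0 \<le> s \<longrightarrow>
        (let P = (\<lambda>y. LINT \<omega>|M. (f (X y s \<omega>) :: real)) in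
           P \<in> borel_measurable (restrict_space borel quadrant) \<and>
           (\<forall>x\<in>quadrant. \<forall>\<tau>. stopping_time F \<tau> \<and> (\<forall>\<omega>\<in>space M. 0 \<le> \<tau> \<omega>) \<longrightarrow>
              (AE \<omega> in M.
                 real_cond_exp M (filtration.pre_sigma (space M) F \<tau>)
                   (\<lambda>\<omega>. f (X x (\<tau> \<omega> + s) \<omega>)) \<omega>
                 = P (X x (\<tau> \<omega>) \<omega>)))))"


section \<open>Distributions and signed Radon measures on open subsets of the plane\<close>

definition partial_deriv :: "2 \<Rightarrow> (real^2 \<Rightarrow> real) \<Rightarrow> real^2 \<Rightarrow> real" where
  "partial_deriv i \<phi> x = frechet_derivative \<phi> (at x) (axis i 1)"

primrec Ck_function :: "nat \<Rightarrow> (real^2 \<Rightarrow> real) \<Rightarrow> bool" where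
  "Ck_function 0 \<phi> \<longleftrightarrow> continuous_on UNIV \<phi>"
| "Ck_function (Suc k) \<phi> \<longleftrightarrow>
     (\<forall>x. \<phi> differentiable (at x)) \<and> (\<forall>i. Ck_function k (partial_deriv i \<phi>))"

definition test_function :: "(real^2) set \<Rightarrow> (real^2 \<Rightarrow> real) \<Rightarrow> bool" where
  "test_function U \<phi> \<longleftrightarrow>
     (\<forall>k. Ck_function k \<phi>) \<and> (\<exists>K. compact K \<and> K \<subseteq> U \<and> (\<forall>x. x \<notin> K \<longrightarrow> \<phi> x = 0))"

type_synonym distribution = "(real^2 \<Rightarrow> real) \<Rightarrow> real"

definition function_distribution :: "(real^2) set \<Rightarrow> (real^2 \<Rightarrow> real) \<Rightarrow> distribution" where
  "function_distribution U f \<phi> = (LINT x:U|lborel. f x * \<phi> x)"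

definition dist_deriv :: "2 \<Rightarrow> distribution \<Rightarrow> distribution" where
  "dist_deriv i D \<phi> = - D (partial_deriv i \<phi>)"

text \<open>
  A signed Radon measure on \<open>U\<close> is written as a pair \<open>(P, N)\<close> standing for \<open>P - N\<close>, where \<open>P\<close> and
  \<open>N\<close> may both be infinite and are not required to be mutually singular. Its values
  \<open>signed_value\<close> are meaningful on relatively compact Borel subsets of \<open>U\<close>; two pairs represent
  the same signed measure iff they agree on those sets.
\<close>

type_synonym signed_measure = "(real^2) measure \<times> (real^2) measure"

definition radon_measure_on :: "(real^2) set \<Rightarrow> (real^2) measure \<Rightarrow> bool" where
  "radon_measure_on U P \<longleftrightarrow>
     sets P = sets borel \<and> emeasure P (- U) = 0 \<and> (\<forall>K. compact K \<and> K \<subseteq> U \<longrightarrow> emeasure P K < \<infinity>)"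

definition signed_radon_on :: "(real^2) set \<Rightarrow> signed_measure \<Rightarrow> bool" where
  "signed_radon_on U S \<longleftrightarrow> radon_measure_on U (fst S) \<and> radon_measure_on U (snd S)"

definition signed_value :: "signed_measure \<Rightarrow> (real^2) set \<Rightarrow> real" where
  "signed_value S A = measure (fst S) A - measure (snd S) A"

definition signed_integral :: "signed_measure \<Rightarrow> (real^2 \<Rightarrow> real) \<Rightarrow> real" where
  "signed_integral S \<phi> = (LINT x|fst S. \<phi> x) - (LINT x|snd S. \<phi> x)"

definition signed_density :: "(real^2 \<Rightarrow> real) \<Rightarrow> (real^2) measure \<Rightarrow> signed_measure" where
  "signed_density f P =
     (density P (\<lambda>x. ennreal (f x)), density P (\<lambda>x. ennreal (- f x)))"

definition relatively_compact_borel :: "(real^2) set \<Rightarrow> (real^2) set set" where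
  "relatively_compact_borel U = {A \<in> sets borel. \<exists>K. compact K \<and> A \<subseteq> K \<and> K \<subseteq> U}"

definition represents_distribution ::
  "(real^2) set \<Rightarrow> signed_measure \<Rightarrow> distribution \<Rightarrow> bool" where
  "represents_distribution U S D \<longleftrightarrow>
     signed_radon_on U S \<and> (\<forall>\<phi>. test_function U \<phi> \<longrightarrow> D \<phi> = signed_integral S \<phi>)"

text \<open>Lebesgue decomposition \<open>S = f dx + T\<close> with \<open>T\<close> concentrated on a Lebesgue null set.\<close>

definition lebesgue_decomposition ::
  "(real^2) set \<Rightarrow> signed_measure \<Rightarrow> (real^2 \<Rightarrow> real) \<Rightarrow> signed_measure \<Rightarrow> bool" where
  "lebesgue_decomposition U S f T \<longleftrightarrow>
     signed_radon_on U S \<and> signed_radon_on U T \<and>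
     (\<forall>K. compact K \<and> K \<subseteq> U \<longrightarrow> set_integrable lborel K f) \<and>
     (\<exists>Z\<in>null_sets lborel. \<forall>A\<in>relatively_compact_borel U. A \<inter> Z = {} \<longrightarrow> signed_value T A = 0) \<and>
     (\<forall>A\<in>relatively_compact_borel U.
        signed_value S A = (LINT x:A|lborel. f x) + signed_value T A)"

definition singular_part :: "(real^2) set \<Rightarrow> signed_measure \<Rightarrow> signed_measure \<Rightarrow> bool" where
  "singular_part U S T \<longleftrightarrow> (\<exists>f. lebesgue_decomposition U S f T)"

text \<open>
  \<open>S\<close> represents \<open>\<Sum>\<^sub>i b\<^sub>i \<partial>\<^sub>i f + 1/2 \<Sum>\<^sub>i\<^sub>j a\<^sub>i\<^sub>j \<partial>\<^sub>i\<^sub>j f\<close>, where the distributional derivatives of \<open>f\<close> are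
  signed Radon measures, multiplied by the continuous coefficients.
\<close>

definition generator_measure ::
  "(real^2) set \<Rightarrow> (real^2 \<Rightarrow> real^2) \<Rightarrow> (real^2 \<Rightarrow> real^2^2) \<Rightarrow> (real^2 \<Rightarrow> real) \<Rightarrow>
   signed_measure \<Rightarrow> bool" where
  "generator_measure U b a f S \<longleftrightarrow>
     (\<exists>D1 D2.
        (\<forall>i. represents_distribution U (D1 i) (dist_deriv i (function_distribution U f))) \<and>
        (\<forall>i j. represents_distribution U (D2 i j)
           (dist_deriv i (dist_deriv j (function_distribution U f)))) \<and>
        represents_distribution U S
          (\<lambda>\<phi>. (\<Sum>i\<in>UNIV. signed_integral (D1 i) (\<lambda>x. b x $ i * \<phi> x))
             + 1/2 * (\<Sum>i\<in>UNIV. \<Sum>j\<in>UNIV. signed_integral (D2 i j) (\<lambda>x. a x $ i $ j * \<phi> x))))"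


section \<open>The payoff, its kink and the stopping gain\<close>

definition payoff :: "real \<Rightarrow> real^2 \<Rightarrow> real" where
  "payoff \<alpha> x = max (x$1) (\<alpha> * x$2)"

definition kink_normal :: "real \<Rightarrow> real^2" where
  "kink_normal \<alpha> = vector [1, - \<alpha>]"

definition kink :: "real \<Rightarrow> (real^2) set" where
  "kink \<alpha> = {x \<in> quadrant. x$1 = \<alpha> * x$2}"

definition kink_coordinate :: "real \<Rightarrow> real^2 \<Rightarrow> real" where
  "kink_coordinate \<alpha> x = x$1 - \<alpha> * x$2"

definition kink_q :: "real \<Rightarrow> (real^2 \<Rightarrow> real^2^2) \<Rightarrow> real^2 \<Rightarrow> real" where
  "kink_q \<alpha> a x = kink_normal \<alpha> \<bullet> (a x *v kink_normal \<alpha>)"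

text \<open>Length measure on the half-line \<open>kink \<alpha>\<close>, through its unit-speed parametrization.\<close>

definition kink_surface_measure :: "real \<Rightarrow> (real^2) measure" where
  "kink_surface_measure \<alpha> =
     distr (restrict_space lborel {0..}) borel
       (\<lambda>s. (s / sqrt (1 + \<alpha>\<^sup>2)) *\<^sub>R (vector [\<alpha>, 1] :: real^2))"

text \<open>
  The indicator has no mathematical effect, as the surface measure lives on the kink; it makes
  the density Borel although \<open>a\<close> is unconstrained outside the quadrant.
\<close>

definition kink_density :: "real \<Rightarrow> (real^2 \<Rightarrow> real^2^2) \<Rightarrow> real^2 \<Rightarrow> real" where
  "kink_density \<alpha> a x = indicator (kink \<alpha>) x * (kink_q \<alpha> a x / (2 * sqrt (1 + \<alpha>\<^sup>2)))"

text \<open>The gradient of the payoff off the kink, extended to the kink by the mean of both sides.\<close>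

definition payoff_gradient :: "real \<Rightarrow> real^2 \<Rightarrow> real^2" where
  "payoff_gradient \<alpha> x =
     vector [(1 + sgn (kink_coordinate \<alpha> x)) / 2, \<alpha> * (1 - sgn (kink_coordinate \<alpha> x)) / 2]"

text \<open>
  \<open>K\<close> is the singular term produced by the kink in the semimartingale decomposition of
  \<open>payoff \<alpha> (X\<^sub>t)\<close>: what remains of the finite variation part after the absolutely continuous
  drift and the boundary reflection terms are removed, it only charges times at which \<open>X\<close> is on
  the kink, and these times are Lebesgue negligible.
\<close>

definition kink_singular_term ::
  "'w measure \<Rightarrow> (real \<Rightarrow> 'w measure) \<Rightarrow> (real^2 \<Rightarrow> real^2) \<Rightarrow> real \<Rightarrow>
   (real \<Rightarrow> 'w \<Rightarrow> real^2) \<Rightarrow> (real \<Rightarrow> 'w \<Rightarrow> real^2) \<Rightarrow> (real \<Rightarrow> 'w \<Rightarrow> real) \<Rightarrow> bool" where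
  "kink_singular_term M F \<mu> \<alpha> X L K \<longleftrightarrow>
     continuous_increasing M F K \<and>
     (\<exists>N. continuous_local_martingale M F N \<and> (\<forall>\<omega>\<in>space M. N 0 \<omega> = 0) \<and>
        (AE \<omega> in M. \<forall>t\<ge>0.
           payoff \<alpha> (X t \<omega>) = payoff \<alpha> (X 0 \<omega>) + N t \<omega>
             + (LINT s:{0..t}|lborel. payoff_gradient \<alpha> (X s \<omega>) \<bullet> \<mu> (X s \<omega>))
             + (\<Sum>i\<in>UNIV. LINT s:{0..t}|path_measure (\<lambda>t \<omega>. L t \<omega> $ i) \<omega>.
                  payoff_gradient \<alpha> (X s \<omega>) $ i)
             + K t \<omega>)) \<and>
     (AE \<omega> in M.
        emeasure (path_measure K \<omega>) {s. 0 \<le> s \<and> kink_coordinate \<alpha> (X s \<omega>) \<noteq> 0} = 0 \<and>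
        emeasure lborel {s. 0 \<le> s \<and> kink_coordinate \<alpha> (X s \<omega>) = 0} = 0)"

definition stopping_gain ::
  "real \<Rightarrow> (real^2 \<Rightarrow> real) \<Rightarrow> (real^2 \<Rightarrow> real^2) \<Rightarrow> (real^2 \<Rightarrow> real^2^2) \<Rightarrow> (real^2 \<Rightarrow> real) \<Rightarrow>
   signed_measure \<Rightarrow> bool" where
  "stopping_gain r c b a g S \<longleftrightarrow>
     (\<exists>\<Lambda>. generator_measure open_quadrant b a g \<Lambda> \<and>
        represents_distribution open_quadrant S
          (\<lambda>\<phi>. function_distribution open_quadrant (\<lambda>x. c x + r * g x) \<phi> - signed_integral \<Lambda> \<phi>))"

text \<open>The value on the (Lebesgue null) kink is immaterial.\<close>

definition gain_density ::
  "real \<Rightarrow> real \<Rightarrow> (real^2 \<Rightarrow> real) \<Rightarrow> (real^2 \<Rightarrow> real^2) \<Rightarrow> real^2 \<Rightarrow> real" where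
  "gain_density r \<alpha> c \<mu> x =
     (if x$1 > \<alpha> * x$2 then c x + r * x$1 - \<mu> x $ 1
      else if x$1 < \<alpha> * x$2 then c x + r * \<alpha> * x$2 - \<alpha> * \<mu> x $ 2
      else 0)"

end

(* Y is a semimartingale whose quadratic variation is the integral of q along X. Ito's formula,
   for integrands that are smooth with bounded derivatives, is applied to approximations of the absolute
   value whose second derivatives are trapezoids shrinking to the origin. Lenglart's inequality and
   the Borel-Cantelli lemma turn convergence in probability into almost sure locally uniform convergence
   along a sequence, and squeezing indicators between trapezoids gives the limit over all widths.

   On the analytic side, integration by parts in one variable at a time shows that the second derivatives
   of G are multiples of surface measure on the diagonal, and smooth bump functions determine a
   signed Radon measure. *)
theory Submission
  imports Defs "HOL-Real_Asymp.Real_Asymp"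
begin

text \<open>A stochastic integral is given only through some sequence of simple processes and some
  decomposition of the integrator. Brackets, Ito's formula and the integral of \<open>sgn\<close>
  are therefore limits of elementary integrals, and the limit must be shown independent of both
  choices.

  The core of the local time argument is a self-bounding estimate: the martingale parts of two
  successive smoothings differ by a martingale whose bracket is at most a multiple of
  \<open>ak k\<close> times the smoothed local time. The mean of the latter, after stopping, is
  bounded uniformly in \<open>k\<close>, since the martingale part has mean zero and all other terms
  are bounded. The widths \<open>ak k\<close>, eighth powers of 1 / (k + 1), are small enough for
  Borel-Cantelli, while ratios of neighbouring widths tend to 1, which lets the limit pass from the
  sequence to all widths.

  The generator refers to arbitrary measures representing the derivatives, paired with test
  functions times coefficients that are not smooth. Uniqueness is thus needed against bounded Borel
  functions of compact support.\<close>

abbreviation "pm == path_measure"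
abbreviation "bm == borel_measurable"
abbreviation "ind == indicator"
abbreviation eventually_seq (binder "EV " 10) where "eventually_seq P == eventually P sequentially"
abbreviation seq_limit (infixr "---->" 60) where "X ----> l == X \<longlonglongrightarrow> l"

text \<open>Vitali's theorem in the form in which optional stopping delivers it: if every
  \<open>X m\<close> is a conditional expectation of \<open>Z\<close>, then its tails are dominated
  as in \<open>tail\<close>. The case c = 0 bounds the first absolute moments, so Fatou makes
  \<open>Y\<close> integrable; clamping at a fixed level reduces the rest to dominated
  convergence.\<close>

lemma L1_convergence_of_dominated_tails:
 fixes X :: "nat => 'a => real" and Y Z :: "'a => real"
 assumes "prob_space M" and Z: "integrable M Z" and X: "!!m. integrable M (X m)"
  and lim: "!!w. w \<in> space M ==> (%m. X m w) ----> Y w"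
  and tail: "!!m c. 0 <= c ==> (LINT w|M. \<bar>X m w\<bar> * ind {w. \<bar>X m w\<bar> > c} w)
         <= (LINT w|M. \<bar>Z w\<bar> * ind {w. \<bar>X m w\<bar> > c} w)"
 shows "integrable M Y" and "(%m. \<integral>w. \<bar>X m w - Y w\<bar> \<partial>M) ----> 0"
proof -
 interpret prob_space M by fact
 have [measurable]: "X m \<in> bm M" "Z \<in> bm M" for m using X Z by auto
 have [measurable]: "Y \<in> bm M" by (rule borel_measurable_LIMSEQ_real[of _ X]) (use lim in auto)
 define e where "e = (LINT w|M. \<bar>Z w\<bar>)"
 have int_ind: "integrable M (%w. \<bar>V w\<bar> * ind {w. \<bar>V' w\<bar> > c} w)"
  if V: "integrable M V" and [measurable]: "V' \<in> bm M" for V V' :: "'a => real" and c :: real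
 proof (rule Bochner_Integration.integrable_bound[OF integrable_abs[OF V]])
  have [measurable]: "V \<in> bm M" using V by auto
  show "(%w. \<bar>V w\<bar> * ind {w. \<bar>V' w\<bar> > c} w) \<in> bm M" by measurable
 qed (auto simp: indicator_def)
 have EX: "(LINT w|M. \<bar>X m w\<bar>) <= e" for m
 proof -
  have "(LINT w|M. \<bar>X m w\<bar>) = (LINT w|M. \<bar>X m w\<bar> * ind {w. \<bar>X m w\<bar> > 0} w)"
   by (intro Bochner_Integration.integral_cong) (auto simp: indicator_def)
  also have "... <= (LINT w|M. \<bar>Z w\<bar> * ind {w. \<bar>X m w\<bar> > 0} w)" by (rule tail) simp
  also have "... <= e" unfolding e_def by (intro integral_mono int_ind Z integrable_abs) (auto simp: indicator_def)
  finally show ?thesis .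
 qed
 show Y: "integrable M Y"
 proof (rule integrableI_bounded)
  have "(\<integral>\<^sup>+w. ennreal (norm (Y w)) \<partial>M) = (\<integral>\<^sup>+w. liminf (%m. ennreal (norm (X m w))) \<partial>M)"
  proof (intro nn_integral_cong)
   fix w assume "w \<in> space M"
   hence "(%m. ennreal (norm (X m w))) ----> ennreal (norm (Y w))" by (intro tendsto_ennrealI tendsto_norm lim)
   thus "ennreal (norm (Y w)) = liminf (%m. ennreal (norm (X m w)))" by (rule lim_imp_Liminf[OF trivial_limit_sequentially, symmetric])
  qed
  also have "... <= liminf (%m. \<integral>\<^sup>+w. ennreal (norm (X m w)) \<partial>M)" by (rule nn_integral_liminf) auto
  also have "... <= liminf (%m::nat. ennreal e)"
  proof (intro Liminf_mono always_eventually allI)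
   fix m
   have "(\<integral>\<^sup>+w. ennreal (norm (X m w)) \<partial>M) = ennreal (LINT w|M. norm (X m w))"
    by (intro nn_integral_eq_integral integrable_norm X) auto
   also have "... <= ennreal e" using EX[of m] by (auto intro: ennreal_leI)
   finally show "(\<integral>\<^sup>+w. ennreal (norm (X m w)) \<partial>M) <= ennreal e" .
  qed
  also have "... < \<infinity>" by (simp add: Liminf_const)
  finally show "(\<integral>\<^sup>+w. ennreal (norm (Y w)) \<partial>M) < \<infinity>" .
 qed simp
 have tail0: "(%k. \<integral>w. \<bar>V w\<bar> * ind {w. \<bar>V w\<bar> > real k} w \<partial>M) ----> 0"
  if V: "integrable M V" for V :: "'a => real"
 proof -
  have [measurable]: "V \<in> bm M" using V by auto
  have "(%k. \<integral>w. \<bar>V w\<bar> * ind {w. \<bar>V w\<bar> > real k} w \<partial>M) ----> (LINT w|M. 0)"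
  proof (rule integral_dominated_convergence[where w="%w. \<bar>V w\<bar>"])
   show "AE w in M. (%k. \<bar>V w\<bar> * ind {w. \<bar>V w\<bar> > real k} w) ----> 0"
   proof (rule AE_I2)
    fix w
    obtain n where n: "\<bar>V w\<bar> <= real n" using real_arch_simple by blast
    show "(%k. \<bar>V w\<bar> * ind {w. \<bar>V w\<bar> > real k} w) ----> 0"
    proof (rule tendsto_eventually, rule eventually_sequentiallyI[of n])
     fix k assume "n <= k"
     hence "\<bar>V w\<bar> <= real k" using n by linarith
     thus "\<bar>V w\<bar> * ind {w. \<bar>V w\<bar> > real k} w = 0" by (simp add: indicator_def)
    qed
   qed
  qed (use V in \<open>auto simp: indicator_def\<close>)
  thus ?thesis by simp
 qed
 \<comment> \<open>Clamping to [-c, c] is bounded and continuous, and its error lives where the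
   modulus exceeds c. A difference thus splits into a dominated part and two tails.\<close>
 define cl where "cl = (%c x::real. max (- c) (min c x))"
 have clamp: "\<bar>x - cl c x\<bar> <= \<bar>x\<bar> * ind {x. \<bar>x\<bar> > c} x" if "0 <= c" for x c :: real
  using that by (auto simp: indicator_def cl_def)
 show "(%m. \<integral>w. \<bar>X m w - Y w\<bar> \<partial>M) ----> 0"
 proof (rule LIMSEQ_I)
  fix ep :: real assume "0 < ep"
  \<comment> \<open>The final sum stays below four times \<open>d\<close>: two for the tail of
    \<open>X m\<close>, one for the clamped difference, one for the tail of
    \<open>Y\<close>.\<close>
  define d where "d = ep / 5"
  have d: "0 < d" using \<open>0 < ep\<close> by (simp add: d_def)
  obtain K where K: "(LINT w|M. \<bar>Z w\<bar> * ind {w. \<bar>Z w\<bar> > real K} w) < d"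
   using order_tendstoD(2)[OF tail0[OF Z] d] unfolding eventually_sequentially by blast
  have "(%c. real K * e / real c) ----> 0" by real_asymp
  hence "EV c. real K * e / real c < d" using d by (rule order_tendstoD)
  moreover note order_tendstoD(2)[OF tail0[OF Y] d]
  ultimately have "EV c. real K * e / real c < d & (LINT w|M. \<bar>Y w\<bar> * ind {w. \<bar>Y w\<bar> > real c} w) < d & 0 < c"
   using eventually_gt_at_top[of 0] by eventually_elim auto
  then obtain c0 where c0: "real K * e / real c0 < d" "0 < c0" "(LINT w|M. \<bar>Y w\<bar> * ind {w. \<bar>Y w\<bar> > real c0} w) < d"
   unfolding eventually_sequentially by blast
  define c where "c = real c0"
  have c: "0 < c" "real K * e / c < d" "(LINT w|M. \<bar>Y w\<bar> * ind {w. \<bar>Y w\<bar> > c} w) < d" using c0 by (auto simp: c_def)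
  \<comment> \<open>Where |X m| > c, either |Z| > K, which is a tail of \<open>Z\<close>, or |Z| is
    at most K and hence at most (K / c) |X m|, which is Markov's inequality with c large compared to
    K.\<close>
  have tX: "(LINT w|M. \<bar>X m w\<bar> * ind {w. \<bar>X m w\<bar> > c} w) < 2 * d" for m
  proof -
   have i3: "integrable M (%w. (K / c) * \<bar>X m w\<bar>)" using X by auto
   have "(LINT w|M. \<bar>X m w\<bar> * ind {w. \<bar>X m w\<bar> > c} w)
     <= (LINT w|M. \<bar>Z w\<bar> * ind {w. \<bar>X m w\<bar> > c} w)" using c by (intro tail) auto
   also have "... <= (LINT w|M. \<bar>Z w\<bar> * ind {w. \<bar>Z w\<bar> > real K} w + (K / c) * \<bar>X m w\<bar>)"
   proof (intro integral_mono int_ind Z Bochner_Integration.integrable_add i3)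
    fix w
    have "real K <= real K / c * \<bar>X m w\<bar>" if "\<bar>X m w\<bar> > c"
     using that c mult_left_mono[of c "\<bar>X m w\<bar>" "real K"] by (simp add: field_simps)
    thus "\<bar>Z w\<bar> * ind {w. c < \<bar>X m w\<bar>} w
      <= \<bar>Z w\<bar> * ind {w. real K < \<bar>Z w\<bar>} w + real K / c * \<bar>X m w\<bar>" using c by (auto simp: indicator_def)
   qed auto
   also have "... = (LINT w|M. \<bar>Z w\<bar> * ind {w. \<bar>Z w\<bar> > real K} w) + (K / c) * (LINT w|M. \<bar>X m w\<bar>)"
    using int_ind[OF Z, of Z] i3 by (subst Bochner_Integration.integral_add) auto
   also have "(K / c) * (LINT w|M. \<bar>X m w\<bar>) <= (K / c) * e" using EX[of m] c by (intro mult_left_mono) auto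
   finally show ?thesis using K c by simp
  qed
  have "(%m. \<integral>w. \<bar>cl c (X m w) - cl c (Y w)\<bar> \<partial>M) ----> (LINT w|M. 0)"
  proof (rule integral_dominated_convergence[where w="%w. 2 * c"])
   show "AE w in M. (%m. \<bar>cl c (X m w) - cl c (Y w)\<bar>) ----> 0"
   proof (rule AE_I2)
    fix w assume "w \<in> space M"
    hence "(%m. \<bar>cl c (X m w) - cl c (Y w)\<bar>) ----> \<bar>cl c (Y w) - cl c (Y w)\<bar>" unfolding cl_def by (intro tendsto_intros lim)
    thus "(%m. \<bar>cl c (X m w) - cl c (Y w)\<bar>) ----> 0" by simp
   qed
  qed (use c in \<open>auto simp: cl_def\<close>)
  hence "EV m. (LINT w|M. \<bar>cl c (X m w) - cl c (Y w)\<bar>) < d" using d by (intro order_tendstoD(2)) auto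
  then obtain m0 where m0: "!!m. m >= m0 ==> (LINT w|M. \<bar>cl c (X m w) - cl c (Y w)\<bar>) < d" unfolding eventually_sequentially by blast
  have "(LINT w|M. \<bar>X m w - Y w\<bar>) < ep" if "m >= m0" for m
  proof -
   have i2: "integrable M (%w. \<bar>cl c (X m w) - cl c (Y w)\<bar>)"
    by (rule integrable_const_bound[where B="2*c"]) (use c in \<open>auto simp: cl_def\<close>)
   have "(LINT w|M. \<bar>X m w - Y w\<bar>) <= (LINT w|M. \<bar>X m w\<bar> * ind {w. \<bar>X m w\<bar> > c} w
     + \<bar>cl c (X m w) - cl c (Y w)\<bar> + \<bar>Y w\<bar> * ind {w. \<bar>Y w\<bar> > c} w)"
   proof (intro integral_mono Bochner_Integration.integrable_add int_ind X Y i2 integrable_abs Bochner_Integration.integrable_diff)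
    fix w
    show "\<bar>X m w - Y w\<bar> <= \<bar>X m w\<bar> * ind {w. \<bar>X m w\<bar> > c} w
     + \<bar>cl c (X m w) - cl c (Y w)\<bar> + \<bar>Y w\<bar> * ind {w. \<bar>Y w\<bar> > c} w"
    proof -
     have "\<bar>X m w - Y w\<bar> <= \<bar>X m w - cl c (X m w)\<bar> + \<bar>cl c (X m w) - cl c (Y w)\<bar> + \<bar>Y w - cl c (Y w)\<bar>"
      by linarith
     also have "... <= \<bar>X m w\<bar> * ind {w. \<bar>X m w\<bar> > c} w
       + \<bar>cl c (X m w) - cl c (Y w)\<bar> + \<bar>Y w\<bar> * ind {w. \<bar>Y w\<bar> > c} w" using clamp[of c "X m w"] clamp[of c "Y w"] c
      by (intro add_mono order_refl) (simp_all add: indicator_def)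
     finally show ?thesis .
    qed
   qed auto
   also have "... = (LINT w|M. \<bar>X m w\<bar> * ind {w. \<bar>X m w\<bar> > c} w)
     + (LINT w|M. \<bar>cl c (X m w) - cl c (Y w)\<bar>) + (LINT w|M. \<bar>Y w\<bar> * ind {w. \<bar>Y w\<bar> > c} w)"
    using int_ind[OF X, of "X m" m c] int_ind[OF Y, of Y c] i2 by (subst Bochner_Integration.integral_add; simp)
   also have "... < 2 * d + d + d" using tX[of m] m0[OF that] c by (intro add_strict_mono) auto
   also have "... < ep" using d by (simp add: d_def)
   finally show ?thesis .
  qed
  thus "\<exists>no. \<forall>m\<ge>no. norm ((LINT w|M. \<bar>X m w - Y w\<bar>) - 0) < ep" by (intro exI[of _ m0]) auto
 qed
qed

section \<open>Continuous adapted processes, optional stopping and hitting times\<close>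

locale stoch_base =
 fixes M :: "'w measure" and F :: "real => 'w measure"
 assumes filtered: "filtered_space M F" and usual: "usual_conditions M F"
begin

sublocale prob_space M using filtered by (simp add: filtered_space_def)

lemma space_F [simp]: "space (F t) = space M" using filtered by (simp add: filtered_space_def filtration_def)

lemma sets_F_mono: "s <= t ==> sets (F s) \<subseteq> sets (F t)" using filtered by (simp add: filtered_space_def filtration_def)

lemma sets_F: "sets (F t) \<subseteq> sets M" using filtered by (simp add: filtered_space_def)

lemma subalgebra_F: "subalgebra M (F t)" using sets_F by (simp add: subalgebra_def)

lemma subalgebra_F_mono: "s <= t ==> subalgebra (F t) (F s)" using sets_F_mono by (simp add: subalgebra_def)

lemma null_sets_in_F: "A \<in> null_sets M ==> 0 <= t ==> A \<in> sets (F t)" using usual sets_F_mono[of 0 t] unfolding usual_conditions_def by blast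

lemma measurable_F_mono: "f \<in> measurable (F s) N ==> s <= t ==> f \<in> measurable (F t) N"
 using measurable_from_subalg[OF subalgebra_F_mono] by blast

lemma measurable_F_M: "f \<in> measurable (F s) N ==> f \<in> measurable M N" using measurable_from_subalg[OF subalgebra_F] by blast

lemma sigma_finite_subalgebra_F: "sigma_finite_subalgebra M (F t)" by (intro finite_measure_subalgebra_is_sigma_finite)
   (simp add: finite_measure_subalgebra_def finite_measure_subalgebra_axioms_def finite_measure_axioms subalgebra_F)

definition cap :: "(real => 'w => real) => bool" where "cap Z \<longleftrightarrow> adapted_process F Z & continuous_process M Z"

lemma cap_measurable: "cap Z ==> 0 <= s ==> s <= t ==> Z s \<in> bm (F t)" unfolding cap_def adapted_process_def using measurable_F_mono by blast

lemma cap_measurable_M: "cap Z ==> 0 <= s ==> Z s \<in> bm M" using cap_measurable[of Z s s] measurable_F_M by blast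

lemma cap_continuous: "cap Z ==> w \<in> space M ==> continuous_on {0..} (%t. Z t w)" by (auto simp: cap_def continuous_process_def)

lemma capI: "(!!t. 0 <= t ==> Z t \<in> bm (F t)) ==> (!!w. w \<in> space M ==> continuous_on {0..} (%t. Z t w)) ==> cap Z"
 by (auto simp: cap_def adapted_process_def continuous_process_def)

lemma martingaleI:
 assumes ad: "adapted_process F N" and int: "!!t. 0 <= t ==> integrable M (N t)"
  and eq: "!!s t A. 0 <= s ==> s <= t ==> A \<in> sets (F s) ==> (LINT w|M. ind A w * N t w) = (LINT w|M. ind A w * N s w)"
 shows "martingale M F N" unfolding martingale_def
proof (intro conjI ad allI impI int)
 fix s t :: real assume st: "0 <= s" "s <= t"
 interpret S: sigma_finite_subalgebra M "F s" by (rule sigma_finite_subalgebra_F)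
 have m: "N s \<in> bm (F s)" using ad st by (simp add: adapted_process_def)
 have eq': "(\<integral>x\<in>A. N t x \<partial>M) = (\<integral>x\<in>A. N s x \<partial>M)" if "A \<in> sets (F s)" for A
  using eq[OF st that] by (simp add: set_lebesgue_integral_def)
 show "AE w in M. real_cond_exp M (F s) (N t) w = N s w" using st by (intro S.real_cond_exp_charact[OF eq' int int m]) auto
qed

text \<open>Integrability is asked of the product, not boundedness of \<open>g\<close>. This admits
  elementary integrals with unbounded coefficients, once they have been stopped.\<close>

lemma martingale_mult:
 assumes N: "martingale M F N" and st: "0 <= s" "s <= t" and g: "g \<in> bm (F s)"
  and int: "integrable M (%w. g w * (N t w - N s w))"
 shows "(LINT w|M. g w * (N t w - N s w)) = 0"
proof -
 interpret S: sigma_finite_subalgebra M "F s" by (rule sigma_finite_subalgebra_F)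
 have i: "integrable M (N t)" "integrable M (N s)" and m: "N s \<in> bm (F s)" using N st by (auto simp: martingale_def adapted_process_def)
 have [measurable]: "g \<in> bm M" using g measurable_F_M by blast
 have "AE w in M. real_cond_exp M (F s) (%w. N t w - N s w) w = 0"
 proof -
  have "AE w in M. real_cond_exp M (F s) (N t) w = N s w" using N st by (simp add: martingale_def)
  with S.real_cond_exp_diff[OF i] S.real_cond_exp_F_meas[OF i(2) m] show ?thesis by eventually_elim simp
 qed
 hence "(LINT w|M. g w * real_cond_exp M (F s) (%w. N t w - N s w) w) = (LINT w|M. 0)" by (intro integral_cong_AE) auto
 thus ?thesis using S.real_cond_exp_intg[OF int g] i by simp
qed

lemma martingale_indicator:
 assumes N: "martingale M F N" and st: "0 <= s" "s <= t" and A: "A \<in> sets (F s)"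
 shows "(LINT w|M. ind A w * N t w) = (LINT w|M. ind A w * N s w)"
proof -
 have [measurable]: "A \<in> sets M" using A sets_F by blast
 have i: "integrable M (N t)" "integrable M (N s)" using N st by (auto simp: martingale_def)
 hence ii: "integrable M (%w. ind A w * N t w)" "integrable M (%w. ind A w * N s w)"
  using integrable_mult_indicator[of A M "N t"] integrable_mult_indicator[of A M "N s"] by auto
 have "(LINT w|M. ind A w * (N t w - N s w)) = 0" using A ii by (intro martingale_mult[OF N st]) (auto simp: right_diff_distrib)
 thus ?thesis using ii by (simp add: right_diff_distrib)
qed

text \<open>Time is rounded down to a multiple of 1 / (m + 1), so it takes countably many values and
  on each of them the process is a single random variable; path continuity gives the limit. Clamping
  to [0, T] keeps all these variables \<open>F T\<close>-measurable.\<close>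

lemma cap_jointly_measurable:
 assumes Z: "cap Z" and T: "0 <= T"
 shows "(%p. Z (max 0 (min T (fst p))) (snd p)) \<in> bm (borel \<Otimes>\<^sub>M F T)"
proof (rule borel_measurable_LIMSEQ_real)
 fix p :: "real \<times> 'w" assume "p \<in> space (borel \<Otimes>\<^sub>M F T)"
 hence p: "snd p \<in> space M" by (auto simp: space_pair_measure)
 define s where "s = fst p"
 have "(%m. real_of_int \<lfloor>real (Suc m) * s\<rfloor> / real (Suc m)) ----> s"
 proof (rule tendsto_sandwich)
  have 1: "s - 1 / real (Suc m) <= real_of_int \<lfloor>real (Suc m) * s\<rfloor> / real (Suc m)"
   "real_of_int \<lfloor>real (Suc m) * s\<rfloor> / real (Suc m) <= s" for m
  proof -
   have "real (Suc m) * s - 1 <= real_of_int \<lfloor>real (Suc m) * s\<rfloor>" "real_of_int \<lfloor>real (Suc m) * s\<rfloor> <= real (Suc m) * s"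
    by linarith+
   from divide_right_mono[OF this(1), of "real (Suc m)"] divide_right_mono[OF this(2), of "real (Suc m)"]
   show "s - 1 / real (Suc m) <= real_of_int \<lfloor>real (Suc m) * s\<rfloor> / real (Suc m)"
    "real_of_int \<lfloor>real (Suc m) * s\<rfloor> / real (Suc m) <= s" by (simp_all add: diff_divide_distrib del: of_nat_Suc)
  qed
  show "EV m. s - 1 / real (Suc m) <= real_of_int \<lfloor>real (Suc m) * s\<rfloor> / real (Suc m)"
   "EV m. real_of_int \<lfloor>real (Suc m) * s\<rfloor> / real (Suc m) <= s" by (intro always_eventually allI 1)+
  show "(%m. s - 1 / real (Suc m)) ----> s" using tendsto_diff[OF tendsto_const LIMSEQ_Suc[OF lim_1_over_n], of s] by simp
 qed auto
 hence "(%m. max 0 (min T (real_of_int \<lfloor>real (Suc m) * s\<rfloor> / real (Suc m)))) ----> max 0 (min T s)" by (intro tendsto_intros)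
 thus "(%m. Z (max 0 (min T (real_of_int \<lfloor>real (Suc m) * fst p\<rfloor> / real (Suc m)))) (snd p)) ----> Z (max 0 (min T (fst p))) (snd p)"
  unfolding s_def by (intro continuous_on_tendsto_compose[OF cap_continuous[OF Z p]]) auto
next
 fix m
 show "(%p. Z (max 0 (min T (real_of_int \<lfloor>real (Suc m) * fst p\<rfloor> / real (Suc m)))) (snd p)) \<in> bm (borel \<Otimes>\<^sub>M F T)"
 proof (rule measurable_compose_countable[where g="%p. \<lfloor>real (Suc m) * fst p\<rfloor>" and
    f="%i p. Z (max 0 (min T (real_of_int i / real (Suc m)))) (snd p)"])
  fix i :: int
  have [measurable]: "Z (max 0 (min T (real_of_int i / real (Suc m)))) \<in> bm (F T)" by (rule cap_measurable[OF Z]) (use T in auto)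
  show "(%p. Z (max 0 (min T (real_of_int i / real (Suc m)))) (snd p)) \<in> bm (borel \<Otimes>\<^sub>M F T)" by measurable
 qed measurable
qed

text \<open>Stopping times are real valued throughout: the value infinity never occurs, and hitting
  times are cut off at a finite horizon instead.\<close>

definition stime :: "('w => real) => bool" where "stime ta \<longleftrightarrow> stopping_time F ta & (\<forall>w\<in>space M. 0 <= ta w)"

lemma stime_le: "stime ta ==> s <= t ==> {w \<in> space M. ta w <= s} \<in> sets (F t)"
 using sets_F_mono[of s t] by (auto simp: stime_def stopping_time_def pred_def)

lemma stime_const: "0 <= c ==> stime (%_. c)" by (auto simp: stime_def intro: stopping_time_const)

lemma stime_min_measurable:
 assumes ta: "stime ta"
 shows "(%w. min t (ta w)) \<in> bm (F t)"
proof (rule borel_measurableI_le)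
 fix y
 show "{w \<in> space (F t). min t (ta w) <= y} \<in> sets (F t)"
 proof (cases "t <= y")
  case False
  hence "{w \<in> space (F t). min t (ta w) <= y} = {w \<in> space M. ta w <= y}" by auto
  thus ?thesis using stime_le[OF ta, of y t] False by simp
 next
  case True
  thus ?thesis using sets.top[of "F t"] by (simp add: min_le_iff_disj)
 qed
qed

definition stp :: "('w => real) => (real => 'w => real) => real => 'w => real" where "stp ta Z t w = Z (min t (ta w)) w"

lemma cap_stp:
 assumes Z: "cap Z" and ta: "stime ta"
 shows "cap (stp ta Z)"
proof (rule capI)
 fix t :: real assume t: "0 <= t"
 have "(%w. (ta w, w)) = (%w. (ta w, w))" ..
 have [measurable]: "(%w. (min t (ta w), w)) \<in> measurable (F t) (borel \<Otimes>\<^sub>M F t)"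
  using stime_min_measurable[OF ta] by (intro measurable_Pair) auto
 have "(%w. Z (max 0 (min t (min t (ta w)))) w) \<in> bm (F t)"
  using measurable_compose[OF _ cap_jointly_measurable[OF Z t], of "%w. (min t (ta w), w)" "F t"] by simp
 moreover have "!!w. w \<in> space (F t) ==> Z (max 0 (min t (min t (ta w)))) w = stp ta Z t w" using t ta by (auto simp: stp_def stime_def max_def)
 ultimately show "stp ta Z t \<in> bm (F t)" using measurable_cong[of "F t" "%w. Z (max 0 (min t (min t (ta w)))) w" "stp ta Z t"] by blast
next
 fix w assume w: "w \<in> space M"
 show "continuous_on {0..} (%t. stp ta Z t w)" unfolding stp_def by (intro continuous_on_compose2[OF cap_continuous[OF Z w]] continuous_intros)
    (use ta w in \<open>auto simp: stime_def\<close>)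
qed

text \<open>Decompose over the finitely many level sets of \<open>si\<close> and apply the
  martingale property from each value up to t. The assumption on \<open>C\<close> says, value by
  value, that \<open>C\<close> belongs to the sigma-algebra of the stopping time.\<close>

lemma martingale_finite_stopping:
 assumes N: "martingale M F N" and V: "finite V" "V \<subseteq> {0..t}"
  and si: "!!w. w \<in> space M ==> si w \<in> V"
  and sim: "!!u. u \<in> V ==> {w \<in> space M. si w = u} \<in> sets (F u)"
  and C: "!!u. u \<in> V ==> {w \<in> space M. w \<in> C & si w = u} \<in> sets (F u)"
 shows "(LINT w|M. ind C w * N (si w) w) = (LINT w|M. ind C w * N t w)"
  and "integrable M (%w. N (si w) w)"
proof -
 have i: "integrable M (N u)" if "u >= 0" for u using N that by (auto simp: martingale_def)
 have ind: "integrable M (%w. ind {w \<in> space M. w \<in> D & si w = u} w * N v w)"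
  if "{w \<in> space M. w \<in> D & si w = u} \<in> sets (F u)" "0 <= v" for D u v
  using integrable_mult_indicator[of "{w \<in> space M. w \<in> D & si w = u}" M "N v"] that i sets_F by auto
 have dec: "ind D w * g (si w) w = (\<Sum>u\<in>V. ind {w \<in> space M. w \<in> D & si w = u} w * g u w)"
  if w: "w \<in> space M" for D w and g :: "real => 'w => real"
 proof -
  have "(\<Sum>u\<in>V. ind {w \<in> space M. w \<in> D & si w = u} w * g u w) = (\<Sum>u\<in>V. if u = si w then ind D w * g u w else 0)"
   using w by (intro sum.cong) (auto simp: indicator_def)
  thus ?thesis using si[OF w] V by (simp add: sum.delta)
 qed
 have "(LINT w|M. ind C w * N (si w) w) = (LINT w|M. (\<Sum>u\<in>V. ind {w \<in> space M. w \<in> C & si w = u} w * N u w))"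
  by (intro Bochner_Integration.integral_cong) (auto simp: dec)
 also have "... = (\<Sum>u\<in>V. \<integral>w. ind {w \<in> space M. w \<in> C & si w = u} w * N u w \<partial>M)"
  using C V by (intro Bochner_Integration.integral_sum ind) auto
 also have "... = (\<Sum>u\<in>V. \<integral>w. ind {w \<in> space M. w \<in> C & si w = u} w * N t w \<partial>M)"
  using V C by (intro sum.cong refl martingale_indicator[OF N, symmetric]) auto
 also have "... = (LINT w|M. (\<Sum>u\<in>V. ind {w \<in> space M. w \<in> C & si w = u} w * N t w))"
  using C V by (intro Bochner_Integration.integral_sum[symmetric] ind) auto
 also have "... = (LINT w|M. ind C w * N t w)" by (intro Bochner_Integration.integral_cong) (auto simp: dec[of _ C "%_. N t"])
 finally show "(LINT w|M. ind C w * N (si w) w) = (LINT w|M. ind C w * N t w)" .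
 have "integrable M (%w. \<Sum>u\<in>V. ind {w \<in> space M. w \<in> UNIV & si w = u} w * N u w)"
  using V sim by (intro Bochner_Integration.integrable_sum ind) auto
 thus "integrable M (%w. N (si w) w)" by (rule Bochner_Integration.integrable_cong[THEN iffD1, rotated -1]) (auto simp: dec[of _ UNIV N, simplified])
qed

text \<open>The stopping time is rounded up to grid-valued times \<open>si\<close>, for which finite
  optional stopping applies. The values at these times are conditional expectations of
  \<open>N t\<close>, hence uniformly integrable, so the identities survive the passage to the limit
  in mean.\<close>

lemma martingale_stp:
 assumes N: "martingale M F N" and cN: "cap N" and ta: "stime ta"
 shows "martingale M F (stp ta N)"
proof (rule martingaleI)
 show "adapted_process F (stp ta N)" using cap_stp[OF cN ta] by (simp add: cap_def)
 define si where "si t m w = min t (real (nat \<lceil>real (Suc m) * ta w\<rceil>) / real (Suc m))" for t :: real and m :: nat and w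
 define V where "V t m = (%k. min t (real k / real (Suc m))) ` {..nat \<lceil>real (Suc m) * t\<rceil>}" for t :: real and m :: nat
 have ta0: "0 <= ta w" if "w \<in> space M" for w using ta that by (auto simp: stime_def)
 have V: "finite (V t m)" "V t m \<subseteq> {0..t}" if "0 <= t" for t m using that by (auto simp: V_def)
 have siV: "si t m w \<in> V t m" if "0 <= t" for t m w
 proof (cases "nat \<lceil>real (Suc m) * ta w\<rceil> <= nat \<lceil>real (Suc m) * t\<rceil>")
  case False
  have ge: "t <= real k / real (Suc m)" if "nat \<lceil>real (Suc m) * t\<rceil> <= k" for k
  proof -
   have "real (Suc m) * t <= real k" using that by linarith
   thus ?thesis by (simp add: field_simps)
  qed
  have "si t m w = t" "min t (real (nat \<lceil>real (Suc m) * t\<rceil>) / real (Suc m)) = t"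
   using ge[of "nat \<lceil>real (Suc m) * ta w\<rceil>"] ge[of "nat \<lceil>real (Suc m) * t\<rceil>"] False
   unfolding si_def by (simp_all only: min_def if_True nat_le_linear not_le less_imp_le order_refl)
  thus ?thesis unfolding V_def by (intro image_eqI[of _ _ "nat \<lceil>real (Suc m) * t\<rceil>"]) auto
 qed (auto simp: V_def si_def)
 have ceil: "nat \<lceil>x\<rceil> = k \<longleftrightarrow> x <= real k & \<not> x <= real k - 1" if "0 <= x" for x :: real and k
  using that by (cases "k = 0") linarith+
 \<comment> \<open>Below t the rounded time determines the grid cell of \<open>ta\<close>, so the
   event is decided by time u. The value t itself collects everything else and is treated by
   complement.\<close>
 have siless: "si t m w = u \<longleftrightarrow> ta w <= u & \<not> ta w <= u - 1 / real (Suc m)"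
  if u: "u \<in> V t m" "u < t" "w \<in> space M" for t m u w
 proof -
  obtain k where k: "u = real k / real (Suc m)" using u(1,2) by (auto simp: V_def min_def split: if_splits)
  have "si t m w = u \<longleftrightarrow> real (nat \<lceil>real (Suc m) * ta w\<rceil>) / real (Suc m) = u"
   using u(2) by (auto simp: si_def min_def)
  also have "... \<longleftrightarrow> nat \<lceil>real (Suc m) * ta w\<rceil> = k" unfolding k by (simp del: of_nat_Suc)
  also have "... \<longleftrightarrow> real (Suc m) * ta w <= real k & \<not> real (Suc m) * ta w <= real k - 1"
   using ta0[OF u(3)] by (intro ceil) auto
  also have "... \<longleftrightarrow> ta w <= u & \<not> ta w <= u - 1 / real (Suc m)" unfolding k by (simp add: field_simps del: of_nat_Suc)
  finally show ?thesis .
 qed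
 have sim: "{w \<in> space M. si t m w = u} \<in> sets (F u)" if t: "0 <= t" and u: "u \<in> V t m" for t m u
 proof -
  have less: "{w \<in> space M. si t m w = u} \<in> sets (F u)" if u: "u \<in> V t m" "u < t" for u
  proof -
   have "{w \<in> space M. si t m w = u} = {w \<in> space M. ta w <= u} - {w \<in> space M. ta w <= u - 1 / real (Suc m)}" using siless[OF u] by auto
   thus ?thesis using stime_le[OF ta, of u u] stime_le[OF ta, of "u - 1 / real (Suc m)" u] by auto
  qed
  show ?thesis
  proof (cases "u < t")
   case False
   hence "u = t" using V[OF t] u by fastforce
   have "{w \<in> space M. si t m w = t} = space M - (\<Union>v\<in>{v\<in>V t m. v < t}. {w \<in> space M. si t m w = v})"
   proof -
    have "si t m w = t \<or> si t m w \<in> V t m & si t m w < t" for w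
     using siV[OF t, of m w] V(2)[OF t, of m] by (metis atLeastAtMost_iff less_eq_real_def subsetD)
    note * = this
    show ?thesis
    proof (rule set_eqI)
     fix w
     show "w \<in> {w \<in> space M. si t m w = t} \<longleftrightarrow>
       w \<in> space M - (\<Union>v\<in>{v\<in>V t m. v < t}. {w \<in> space M. si t m w = v})" using *[of w] by auto
    qed
   qed
   also have "... \<in> sets (F t)"
   proof (intro sets.Diff sets.finite_UN)
    show "space M \<in> sets (F t)" using sets.top[of "F t"] by simp
    fix v assume "v \<in> {v\<in>V t m. v < t}"
    thus "{w \<in> space M. si t m w = v} \<in> sets (F t)" using less[of v] sets_F_mono[of v t] by auto
   qed (use V[OF t] in auto)
   finally show ?thesis using \<open>u = t\<close> by simp
  qed (use less u in auto)
 qed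
 have conv: "(%m. N (si t m w) w) ----> stp ta N t w" if t: "0 <= t" and w: "w \<in> space M" for t w
 proof -
  have "(%m. real (nat \<lceil>real (Suc m) * ta w\<rceil>) / real (Suc m)) ----> ta w"
  proof (rule tendsto_sandwich)
   have 1: "ta w <= real (nat \<lceil>real (Suc m) * ta w\<rceil>) / real (Suc m)"
    "real (nat \<lceil>real (Suc m) * ta w\<rceil>) / real (Suc m) <= ta w + 1 / real (Suc m)" for m
   proof -
    have "0 <= real (Suc m) * ta w" using ta0[OF w] by simp
    hence "real (Suc m) * ta w <= real (nat \<lceil>real (Suc m) * ta w\<rceil>)"
     "real (nat \<lceil>real (Suc m) * ta w\<rceil>) <= real (Suc m) * ta w + 1" by linarith+
    from divide_right_mono[OF this(1), of "real (Suc m)"] divide_right_mono[OF this(2), of "real (Suc m)"]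
    show "ta w <= real (nat \<lceil>real (Suc m) * ta w\<rceil>) / real (Suc m)"
     "real (nat \<lceil>real (Suc m) * ta w\<rceil>) / real (Suc m) <= ta w + 1 / real (Suc m)" by (simp_all add: add_divide_distrib del: of_nat_Suc)
   qed
   show "EV m. ta w <= real (nat \<lceil>real (Suc m) * ta w\<rceil>) / real (Suc m)"
    "EV m. real (nat \<lceil>real (Suc m) * ta w\<rceil>) / real (Suc m) <= ta w + 1 / real (Suc m)" by (intro always_eventually allI 1)+
   show "(%m. ta w + 1 / real (Suc m)) ----> ta w" using tendsto_add[OF tendsto_const LIMSEQ_Suc[OF lim_1_over_n], of "ta w"] by simp
  qed auto
  hence "(%m. si t m w) ----> min t (ta w)" unfolding si_def by (intro tendsto_intros)
  moreover have "si t m w \<in> {0..}" for m using siV[OF t, of m w] V(2)[OF t, of m] by fastforce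
  ultimately show ?thesis unfolding stp_def using ta0[OF w] t by (intro continuous_on_tendsto_compose[OF cap_continuous[OF cN w]]) auto
 qed
 have int: "integrable M (N t)" if "0 <= t" for t using N that by (auto simp: martingale_def)
 have fin: "(LINT w|M. ind C w * N (si t m w) w) = (LINT w|M. ind C w * N t w)" "integrable M (%w. N (si t m w) w)"
  if t: "0 <= t" and C: "!!u. u \<in> V t m ==> {w \<in> space M. w \<in> C & si t m w = u} \<in> sets (F u)" for t m C
  using martingale_finite_stopping[OF N V[OF t, of m], of "si t m" C] siV[OF t, of m] sim[OF t, of _ m] C by auto
 have intX: "integrable M (%w. N (si t m w) w)" if "0 <= t" for t m using that by (intro fin(2)[of t m UNIV]) (auto intro: sim)
 \<comment> \<open>Whether the stopped value lies above c or below -c is known at the stopping time,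
   so on either event it may be replaced by \<open>N t\<close> under the integral. Adding both signs
   gives the domination of tails.\<close>
 have tail: "(LINT w|M. \<bar>N (si t m w) w\<bar> * ind {w. \<bar>N (si t m w) w\<bar> > c} w)
   <= (LINT w|M. \<bar>N t w\<bar> * ind {w. \<bar>N (si t m w) w\<bar> > c} w)" if t: "0 <= t" and c: "0 <= c" for t m c
 proof -
  let ?X = "%w. N (si t m w) w"
  let ?P = "{w. ?X w > c}" and ?N = "{w. ?X w < - c}"
  have [measurable]: "?X \<in> bm M" "N t \<in> bm M" using intX[OF t] int[OF t] by auto
  have C: "{w \<in> space M. w \<in> {w. N (si t m w) w \<in> S} & si t m w = u} \<in> sets (F u)"
   if "u \<in> V t m" and [measurable]: "S \<in> sets borel" for u S
  proof -
   have "0 <= u" using V(2)[OF t, of m] that(1) by fastforce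
   hence [measurable]: "N u \<in> bm (F u)" using cap_measurable[OF cN, of u u] by auto
   have "{w \<in> space M. w \<in> {w. N (si t m w) w \<in> S} & si t m w = u} =
     {w \<in> space (F u). N u w \<in> S} \<inter> {w \<in> space M. si t m w = u}" by auto
   also have "... \<in> sets (F u)"
   proof (rule sets.Int[OF _ sim[OF t that(1)]])
    show "{w \<in> space (F u). N u w \<in> S} \<in> sets (F u)" by measurable
   qed
   finally show ?thesis .
  qed
  have eP: "(LINT w|M. ind ?P w * ?X w) = (LINT w|M. ind ?P w * N t w)" using fin(1)[OF t, of m ?P] C[of _ "{c<..}"] by auto
  have eN: "(LINT w|M. ind ?N w * ?X w) = (LINT w|M. ind ?N w * N t w)" using fin(1)[OF t, of m ?N] C[of _ "{..<-c}"] by auto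
  have ii: "integrable M (%w. ind D w * g w)" if g: "integrable M g" and [measurable]: "D \<inter> space M \<in> sets M" for D and g :: "'w => real"
  proof -
   have "integrable M (%w. ind (D \<inter> space M) w * g w)" using integrable_mult_indicator[OF that(2) g] by simp
   thus ?thesis by (rule Bochner_Integration.integrable_cong[THEN iffD1, rotated -1]) (auto simp: indicator_def)
  qed
  have DP: "?P \<inter> space M \<in> sets M" "?N \<inter> space M \<in> sets M" "{w. \<bar>?X w\<bar> > c} \<inter> space M \<in> sets M"
  proof -
   have "{w \<in> space M. ?X w > c} \<in> sets M" "{w \<in> space M. ?X w < - c} \<in> sets M" "{w \<in> space M. \<bar>?X w\<bar> > c} \<in> sets M"
    by measurable
   thus "?P \<inter> space M \<in> sets M" "?N \<inter> space M \<in> sets M" "{w. \<bar>?X w\<bar> > c} \<inter> space M \<in> sets M"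
    by (simp_all add: Int_def conj_commute)
  qed
  have "(LINT w|M. \<bar>?X w\<bar> * ind {w. \<bar>?X w\<bar> > c} w) = (LINT w|M. ind ?P w * ?X w - ind ?N w * ?X w)"
   using c by (intro Bochner_Integration.integral_cong) (auto simp: indicator_def)
  also have "... = (LINT w|M. ind ?P w * N t w - ind ?N w * N t w)" using eP eN DP intX[OF t, of m] int[OF t] by (simp add: ii)
  also have "... <= (LINT w|M. \<bar>N t w\<bar> * ind {w. \<bar>?X w\<bar> > c} w)"
  proof (rule integral_mono)
   show "integrable M (%w. ind ?P w * N t w - ind ?N w * N t w)" by (intro Bochner_Integration.integrable_diff ii int[OF t] DP)
   show "integrable M (%w. \<bar>N t w\<bar> * ind {w. \<bar>?X w\<bar> > c} w)"
    using ii[OF integrable_abs[OF int[OF t]] DP(3)] by (simp only: mult.commute)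
   show "ind ?P w * N t w - ind ?N w * N t w <= \<bar>N t w\<bar> * ind {w. \<bar>?X w\<bar> > c} w" for w using c by (auto simp: indicator_def)
  qed
  finally show ?thesis .
 qed
 have L1: "integrable M (stp ta N t)" "(%m. \<integral>w. \<bar>N (si t m w) w - stp ta N t w\<bar> \<partial>M) ----> 0" if t: "0 <= t" for t
  using L1_convergence_of_dominated_tails[of M "N t" "%m w. N (si t m w) w" "stp ta N t"]
   prob_space_axioms int[OF t] intX[OF t] conv[OF t] tail[OF t] by auto
 note intS = L1(1)
 show "integrable M (stp ta N t)" if "0 <= t" for t by (rule intS[OF that])
 fix s t :: real and A assume st: "0 <= s" "s <= t" and A: "A \<in> sets (F s)"
 hence t: "0 <= t" by simp
 \<comment> \<open>On the rest of \<open>A\<close> the stopping time is at most s and the stopped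
   process no longer moves after s; only on \<open>B\<close> is the martingale property at
   work.\<close>
 define B where "B = A \<inter> {w \<in> space M. \<not> ta w <= s}"
 have ss: "{w \<in> space M. \<not> ta w <= s} \<in> sets (F s)"
 proof -
  have "{w \<in> space M. \<not> ta w <= s} = space (F s) - {w \<in> space M. ta w <= s}" by auto
  thus ?thesis using stime_le[OF ta, of s s] by (simp only:) (intro sets.compl_sets, auto)
 qed
 have B: "B \<in> sets (F s)" using A ss by (auto simp: B_def)
 have [measurable]: "A \<in> sets M" "B \<in> sets M" using A B sets_F by auto
 have BX: "(LINT w|M. ind B w * N (si t m w) w) = (LINT w|M. ind B w * N t w)" for m
 proof (rule fin(1)[OF t])
  fix u assume u: "u \<in> V t m"
  show "{w \<in> space M. w \<in> B & si t m w = u} \<in> sets (F u)"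
  proof (cases "s <= u")
   case True
   hence "B \<in> sets (F u)" using B sets_F_mono by blast
   hence "B \<inter> {w \<in> space M. si t m w = u} \<in> sets (F u)" using sim[OF t u] by auto
   also have "B \<inter> {w \<in> space M. si t m w = u} = {w \<in> space M. w \<in> B & si t m w = u}" by auto
   finally show ?thesis .
  next
   case False
   hence eq: "{w \<in> space M. w \<in> B & si t m w = u} = {}" using siless[OF u] st by (auto simp: B_def)
   show ?thesis unfolding eq by simp
  qed
 qed
 let ?S = "stp ta N t"
 have "(%m. (LINT w|M. ind B w * N (si t m w) w) - (LINT w|M. ind B w * ?S w)) ----> 0"
 proof (rule Lim_null_comparison[OF _ L1(2)[OF t]], rule always_eventually, rule allI)
  fix m
  have i: "integrable M (%w. ind B w * N (si t m w) w)" "integrable M (%w. ind B w * ?S w)"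
   using integrable_mult_indicator[OF _ intX[OF t, of m], of B] integrable_mult_indicator[OF _ intS[OF t], of B] by auto
  have "norm ((LINT w|M. ind B w * N (si t m w) w) - (LINT w|M. ind B w * ?S w))
    = norm (LINT w|M. ind B w * N (si t m w) w - ind B w * ?S w)" using i by simp
  also have "... <= (LINT w|M. norm (ind B w * N (si t m w) w - ind B w * ?S w))" by (rule integral_norm_bound)
  also have "... <= (LINT w|M. \<bar>N (si t m w) w - ?S w\<bar>)"
   using i intX[OF t, of m] intS[OF t] by (intro integral_mono) (auto simp: indicator_def)
  finally show "norm ((LINT w|M. ind B w * N (si t m w) w) - (LINT w|M. ind B w * ?S w)) <= (LINT w|M. \<bar>N (si t m w) w - ?S w\<bar>)" .
 qed
 hence "(LINT w|M. ind B w * ?S w) = (LINT w|M. ind B w * N t w)" unfolding BX by (simp add: LIMSEQ_const_iff)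
 also have "... = (LINT w|M. ind B w * N s w)" by (rule martingale_indicator[OF N st B])
 also have "... = (LINT w|M. ind B w * stp ta N s w)" by (intro Bochner_Integration.integral_cong) (auto simp: indicator_def B_def stp_def min_def)
 finally have 1: "(LINT w|M. ind B w * ?S w) = (LINT w|M. ind B w * stp ta N s w)" .
 have 2: "(LINT w|M. ind (A - B) w * ?S w) = (LINT w|M. ind (A - B) w * stp ta N s w)"
  using st by (intro Bochner_Integration.integral_cong) (auto simp: indicator_def B_def stp_def min_def)
 have split: "(LINT w|M. ind A w * g w) = (LINT w|M. ind B w * g w) + (LINT w|M. ind (A - B) w * g w)" if "integrable M g" for g :: "'w => real"
 proof -
  have "integrable M (%w. ind B w * g w)" "integrable M (%w. ind (A - B) w * g w)"
   using integrable_mult_indicator[OF _ that, of B] integrable_mult_indicator[OF _ that, of "A - B"] by auto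
  hence "(LINT w|M. ind B w * g w) + (LINT w|M. ind (A - B) w * g w) = (LINT w|M. ind B w * g w + ind (A - B) w * g w)" by simp
  also have "... = (LINT w|M. ind A w * g w)" by (intro Bochner_Integration.integral_cong) (auto simp: indicator_def B_def)
  finally show ?thesis by simp
 qed
 show "(LINT w|M. ind A w * ?S w) = (LINT w|M. ind A w * stp ta N s w)" using split[OF intS[OF t]] split[OF intS[OF st(1)]] 1 2 by simp
qed

lemma ex_gr_rational:
 assumes g: "continuous_on {0..} (g :: real => real)" and t: "0 <= t"
 shows "(\<exists>s\<in>{0..t}. g s > c) \<longleftrightarrow> (\<exists>r\<in>\<rat>. g (max 0 (min t r)) > c)"
proof
 assume "\<exists>s\<in>{0..t}. g s > c"
 then obtain s where s: "s \<in> {0..t}" "g s > c" by blast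
 have "continuous_on UNIV (%x. g (max 0 (min t x)))" by (intro continuous_on_compose2[OF g] continuous_intros) auto
 hence "open {x. g (max 0 (min t x)) > c}" by (intro open_Collect_less continuous_on_const)
 moreover have "s \<in> {x. g (max 0 (min t x)) > c}" using s by (auto simp: max_def min_def)
 ultimately obtain e where e: "e > 0" "ball s e \<subseteq> {x. g (max 0 (min t x)) > c}" unfolding open_contains_ball by blast
 obtain r where "r \<in> \<rat>" "s < r" "r < s + e" using Rats_dense_in_real[of s "s + e"] e by auto
 thus "\<exists>r\<in>\<rat>. g (max 0 (min t r)) > c" using e by (intro bexI[of _ r]) (auto simp: subset_eq dist_real_def)
next
 assume "\<exists>r\<in>\<rat>. g (max 0 (min t r)) > c"
 thus "\<exists>s\<in>{0..t}. g s > c" using t by (auto intro!: bexI[of _ "max 0 (min t _)"])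
qed

lemma ex_gr_measurable:
 assumes Z: "cap Z" and t: "0 <= t"
 shows "{w \<in> space M. \<exists>s\<in>{0..t}. Z s w > c} \<in> sets (F t)"
proof -
 have "{w \<in> space M. \<exists>s\<in>{0..t}. Z s w > c} = (\<Union>r\<in>\<rat>. {w \<in> space (F t). Z (max 0 (min t r)) w > c})"
  using ex_gr_rational[OF cap_continuous[OF Z] t] by auto
 also have "... \<in> sets (F t)"
 proof (intro sets.countable_UN'' countable_rat)
  fix r :: real
  have [measurable]: "Z (max 0 (min t r)) \<in> bm (F t)" using t by (intro cap_measurable[OF Z]) auto
  show "{w \<in> space (F t). Z (max 0 (min t r)) w > c} \<in> sets (F t)" by measurable
 qed
 finally show ?thesis .
qed

lemma ex_ge_iff:
 assumes g: "continuous_on {0..} (g :: real => real)" and t: "0 <= t"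
 shows "(\<exists>s\<in>{0..t}. g s >= c) \<longleftrightarrow> (\<forall>n. \<exists>s\<in>{0..t}. g s > c - 1 / real (Suc n))"
proof
 assume *: "\<forall>n. \<exists>s\<in>{0..t}. g s > c - 1 / real (Suc n)"
 obtain s where s: "s \<in> {0..t}" "!!y. y \<in> {0..t} ==> g y <= g s"
  using continuous_attains_sup[of "{0..t}" g] continuous_on_subset[OF g, of "{0..t}"] t by auto
 have "c - 1 / real (Suc n) <= g s" for n using * s(2) by (meson less_eq_real_def order_trans)
 hence "c <= g s" by (intro LIMSEQ_le_const2[of "%n. c - 1 / real (Suc n)" c])
    (use tendsto_diff[OF tendsto_const LIMSEQ_Suc[OF lim_1_over_n], of c] in auto)
 thus "\<exists>s\<in>{0..t}. g s >= c" using s by blast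
next
 assume "\<exists>s\<in>{0..t}. g s >= c"
 then obtain s where "s \<in> {0..t}" "g s >= c" by blast
 hence "g s > c - 1 / real (Suc n)" for n by (smt (verit) divide_pos_pos of_nat_0_less_iff zero_less_Suc)
 thus "\<forall>n. \<exists>s\<in>{0..t}. g s > c - 1 / real (Suc n)" using \<open>s \<in> {0..t}\<close> by blast
qed

lemma ex_ge_measurable:
 assumes Z: "cap Z" and t: "0 <= t"
 shows "{w \<in> space M. \<exists>s\<in>{0..t}. Z s w >= c} \<in> sets (F t)"
proof -
 have iff: "w \<in> space M ==> (\<exists>s\<in>{0..t}. Z s w >= c) \<longleftrightarrow> (\<forall>n. \<exists>s\<in>{0..t}. Z s w > c - 1 / real (Suc n))" for w
  by (rule ex_ge_iff[OF cap_continuous[OF Z] t])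
 have "{w \<in> space M. \<exists>s\<in>{0..t}. Z s w >= c} = (\<Inter>n. {w \<in> space M. \<exists>s\<in>{0..t}. Z s w > c - 1 / real (Suc n)})"
  by (rule set_eqI) (simp add: iff del: of_nat_Suc cong: conj_cong)
 also have "... \<in> sets (F t)" using ex_gr_measurable[OF Z t] by (intro sets.countable_INT) auto
 finally show ?thesis .
qed

text \<open>The level is normalised to 1: other levels, and the first violation of one of several
  bounds, are expressed by rescaling \<open>Z\<close> and taking maxima. The horizon K keeps the
  time finite.\<close>

definition hit :: "(real => 'w => real) => real => 'w => real" where
 "hit Z K w = (if \<exists>t\<in>{0..K}. Z t w >= 1 then Inf {t\<in>{0..K}. Z t w >= 1} else K)"

lemma hit_attained:
 assumes Z: "cap Z" and w: "w \<in> space M" and ex: "\<exists>t\<in>{0..K}. Z t w >= 1"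
 shows "hit Z K w \<in> {0..K}" "Z (hit Z K w) w >= 1" "!!t. t \<in> {0..K} ==> Z t w >= 1 ==> hit Z K w <= t"
proof -
 have "closed {t\<in>{0..K}. Z t w >= 1}"
  using continuous_closed_preimage[of "{0..K}" "%t. Z t w" "{1..}"] continuous_on_subset[OF cap_continuous[OF Z w], of "{0..K}"]
  by (auto simp: vimage_def Int_def)
 moreover have "bdd_below {t\<in>{0..K}. Z t w >= 1}" by (rule bdd_belowI[of _ 0]) auto
 ultimately have "Inf {t\<in>{0..K}. Z t w >= 1} \<in> {t\<in>{0..K}. Z t w >= 1}" using ex by (intro closed_contains_Inf) auto
 thus "hit Z K w \<in> {0..K}" "Z (hit Z K w) w >= 1" using ex by (auto simp: hit_def)
 show "hit Z K w <= t" if "t \<in> {0..K}" "Z t w >= 1" for t unfolding hit_def using ex that by (auto intro!: cInf_lower bdd_belowI[of _ 0])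
qed

lemma hit_less: "cap Z ==> w \<in> space M ==> 0 <= t ==> t < hit Z K w ==> Z t w < 1"
proof (rule ccontr)
 assume a: "cap Z" "w \<in> space M" "0 <= t" "t < hit Z K w" "\<not> Z t w < 1"
 show False
 proof (cases "\<exists>t\<in>{0..K}. Z t w >= 1")
  case True
  from hit_attained[OF a(1,2) this] a show False by (smt (verit) atLeastAtMost_iff)
 qed (use a in \<open>auto simp: hit_def not_less\<close>)
qed

lemma hit_bounds: "cap Z ==> w \<in> space M ==> 0 <= K ==> 0 <= hit Z K w & hit Z K w <= K"
 using hit_attained(1)[of Z w K] by (cases "\<exists>t\<in>{0..K}. Z t w >= 1") (auto simp: hit_def)

lemma hit_ge:
 assumes "cap Z" "w \<in> space M" "T <= K" "0 <= K" "\<forall>t\<in>{0..T}. Z t w < 1"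
 shows "T <= hit Z K w"
proof (cases "\<exists>t\<in>{0..K}. Z t w >= 1")
 case True
 thus ?thesis using hit_attained[OF assms(1,2) True] assms by (smt (verit) atLeastAtMost_iff)
qed (use assms in \<open>auto simp: hit_def\<close>)

text \<open>Strictly before the hitting time the level is not reached, and left continuity carries
  the bound to the hitting time itself. At time 0 there is no past, which explains the assumption on
  the initial value.\<close>

lemma hit_le_one:
 assumes Z: "cap Z" and w: "w \<in> space M" and K: "0 <= K" and Z0: "Z 0 w <= 1" and t: "0 <= t"
 shows "stp (hit Z K) Z t w <= 1"
proof (cases "min t (hit Z K w) < hit Z K w")
 case True
 thus ?thesis using hit_less[OF Z w, of "min t (hit Z K w)" K] hit_bounds[OF Z w K] t unfolding stp_def by (simp add: less_imp_le)
next
 case False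
 let ?h = "hit Z K w"
 have eq: "stp (hit Z K) Z t w = Z ?h w" using False by (cases "t <= ?h") (auto simp: stp_def)
 show ?thesis
 proof (cases "?h = 0")
  case False
  hence h: "0 < ?h" using hit_bounds[OF Z w K] by auto
  have "((%t. Z t w) \<longlongrightarrow> Z ?h w) (at_left ?h)"
  proof -
   have "continuous_on {0..?h} (%t. Z t w)" by (rule continuous_on_subset[OF cap_continuous[OF Z w]]) auto
   hence "((%t. Z t w) \<longlongrightarrow> Z ?h w) (at ?h within {0..?h})" using h by (auto simp: continuous_on_def)
   thus ?thesis using at_within_Icc_at_left[OF h] by simp
  qed
  moreover have "\<forall>\<^sub>F t in at_left ?h. Z t w <= 1"
   using eventually_at_left_real[OF h] by eventually_elim (auto intro!: less_imp_le hit_less[OF Z w])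
  ultimately show ?thesis unfolding eq by (rule tendsto_upperbound) simp
 qed (use eq Z0 in simp)
qed

lemma stime_hit:
 assumes Z: "cap Z" and K: "0 <= K"
 shows "stime (hit Z K)" unfolding stime_def
proof (intro conjI ballI stopping_timeI)
 fix t
 consider "t < 0" | "K <= t" | "0 <= t" "t < K" by linarith
 hence "{w \<in> space M. hit Z K w <= t} \<in> sets (F t)"
 proof cases
  case 1
  hence eq: "{w \<in> space M. hit Z K w <= t} = {}" using hit_bounds[OF Z _ K] by force
  show ?thesis unfolding eq by simp
 next
  case 2
  hence eq: "{w \<in> space M. hit Z K w <= t} = space (F t)" using hit_bounds[OF Z _ K] by force
  show ?thesis unfolding eq by (rule sets.top)
 next
  case 3
  have "hit Z K w <= t \<longleftrightarrow> (\<exists>s\<in>{0..t}. Z s w >= 1)" if w: "w \<in> space M" for w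
  proof
   assume "hit Z K w <= t"
   hence ex: "\<exists>t\<in>{0..K}. Z t w >= 1" using 3 by (auto simp: hit_def split: if_splits)
   show "\<exists>s\<in>{0..t}. Z s w >= 1" using hit_attained[OF Z w ex] \<open>hit Z K w <= t\<close> by (intro bexI[of _ "hit Z K w"]) auto
  next
   assume "\<exists>s\<in>{0..t}. Z s w >= 1"
   then obtain s where s: "s \<in> {0..t}" "Z s w >= 1" by blast
   hence "\<exists>t\<in>{0..K}. Z t w >= 1" using 3 by (intro bexI[of _ s]) auto
   from hit_attained(3)[OF Z w this, of s] s 3 show "hit Z K w <= t" by auto
  qed
  hence "{w \<in> space M. hit Z K w <= t} = {w \<in> space M. \<exists>s\<in>{0..t}. Z s w >= 1}" by auto
  thus ?thesis using ex_ge_measurable[OF Z 3(1)] by simp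
 qed
 thus "Measurable.pred (F t) (%w. hit Z K w <= t)" by (simp add: pred_def)
qed (use hit_bounds[OF Z _ K] in auto)

end

section \<open>Continuous local martingales and elementary integrals\<close>

context stoch_base
begin

lemma hit_le_iff:
 assumes Z: "cap Z" and w: "w \<in> space M" and t: "0 <= t" "t < K"
 shows "hit Z K w <= t \<longleftrightarrow> (\<exists>s\<in>{0..t}. Z s w >= 1)"
proof
 assume "hit Z K w <= t"
 hence ex: "\<exists>t\<in>{0..K}. Z t w >= 1" using t by (auto simp: hit_def split: if_splits)
 show "\<exists>s\<in>{0..t}. Z s w >= 1" using hit_attained[OF Z w ex] \<open>hit Z K w <= t\<close> by (intro bexI[of _ "hit Z K w"]) auto
next
 assume "\<exists>s\<in>{0..t}. Z s w >= 1"
 then obtain s where s: "s \<in> {0..t}" "Z s w >= 1" by blast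
 hence "\<exists>t\<in>{0..K}. Z t w >= 1" using t by (intro bexI[of _ s]) auto
 from hit_attained(3)[OF Z w this, of s] s t show "hit Z K w <= t" by auto
qed

text \<open>Serves to compare the stopping of a limit process with the stopping of its
  approximations, which are subject to a further constraint that is inactive while they are close to
  the limit.\<close>

lemma min_hit_cong:
 assumes Z: "cap Z" "cap Z'" and w: "w \<in> space M" and K: "0 <= K"
  and eq: "!!s. s \<in> {0..t} ==> Z s w >= 1 \<longleftrightarrow> Z' s w >= 1"
 shows "min t (hit Z K w) = min t (hit Z' K w)"
proof -
 have *: "hit Z K w <= r \<longleftrightarrow> hit Z' K w <= r" if "0 <= r" "r < t" "r < K" for r
  using hit_le_iff[OF Z(1) w, of r K] hit_le_iff[OF Z(2) w, of r K] eq that by auto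
 show ?thesis using *[of "hit Z K w"] *[of "hit Z' K w"] hit_bounds[OF Z(1) w K] hit_bounds[OF Z(2) w K] by (smt (verit))
qed

lemma cap_add: "cap Z ==> cap Z' ==> cap (%t w. Z t w + Z' t w)"
 by (rule capI) (auto intro!: borel_measurable_add continuous_on_add intro: cap_measurable cap_continuous)

lemma cap_diff: "cap Z ==> cap Z' ==> cap (%t w. Z t w - Z' t w)"
 by (rule capI) (auto intro!: borel_measurable_diff continuous_on_diff intro: cap_measurable cap_continuous)

lemma cap_mult: "cap Z ==> cap Z' ==> cap (%t w. Z t w * Z' t w)"
 by (rule capI) (auto intro!: borel_measurable_times continuous_on_mult intro: cap_measurable cap_continuous)

lemma cap_const: "cap (%t w. c)" by (rule capI) auto

lemma cap_cmult: "cap Z ==> cap (%t w. c * Z t w)" by (rule cap_mult[OF cap_const])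

lemma cap_divide: "cap Z ==> cap (%t w. Z t w / c)" using cap_cmult[of Z "1/c"] by simp

lemma cap_power: "cap Z ==> cap (%t w. (Z t w)^2)" unfolding power2_eq_square by (intro cap_mult)

lemma cap_compose:
 assumes "cap Z" "continuous_on UNIV f" shows "cap (%t w. f (Z t w))"
proof (rule capI)
 fix t :: real assume "0 <= t"
 thus "(%w. f (Z t w)) \<in> bm (F t)"
  using measurable_compose[OF cap_measurable[OF assms(1), of t t] borel_measurable_continuous_onI[OF assms(2)]] by simp
qed (rule continuous_on_compose2[OF assms(2) cap_continuous[OF assms(1)]], auto)

lemma cap_abs: "cap Z ==> cap (%t w. \<bar>Z t w\<bar>)" by (rule cap_compose[of Z abs]) (auto intro!: continuous_intros)

lemma cap_max: "cap Z ==> cap Z' ==> cap (%t w. max (Z t w) (Z' t w))"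
 by (rule capI) (auto intro!: borel_measurable_max continuous_on_max intro: cap_measurable cap_continuous)

lemma cap_sum: "(!!i. i \<in> I ==> cap (Z i)) ==> cap (%t w. \<Sum>i\<in>I. Z i t w)"
 by (rule capI) (auto intro!: borel_measurable_sum continuous_on_sum intro: cap_measurable cap_continuous)

lemma cap_initial: "cap Z ==> cap (%t. Z 0)" by (rule capI) (auto intro!: cap_measurable)

lemmas cap_intros = cap_add cap_diff cap_mult cap_const cap_divide cap_power cap_abs cap_max cap_sum cap_initial

lemma martingale_add: "martingale M F N ==> martingale M F N' ==> martingale M F (%t w. N t w + N' t w)"
proof (rule martingaleI)
 assume N: "martingale M F N" "martingale M F N'"
 from N have "adapted_process F N" "adapted_process F N'" by (simp_all add: martingale_def)
 thus "adapted_process F (%t w. N t w + N' t w)" by (auto simp: adapted_process_def intro!: borel_measurable_add)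
 show "0 <= t ==> integrable M (%w. N t w + N' t w)" for t using N by (auto simp: martingale_def)
 fix s t :: real and A assume st: "0 <= s" "s <= t" and A: "A \<in> sets (F s)"
 hence [measurable]: "A \<in> sets M" using sets_F by blast
 have "integrable M (%w. ind A w * L u w)" if "martingale M F L" "0 <= u" for L :: "real => 'w => real" and u
  using that integrable_mult_indicator[of A M "L u"] by (simp add: martingale_def)
 thus "(LINT w|M. ind A w * (N t w + N' t w)) = (LINT w|M. ind A w * (N s w + N' s w))"
  using martingale_indicator[OF N(1) st A] martingale_indicator[OF N(2) st A] N st by (simp add: distrib_left)
qed

lemma martingale_cmult: "martingale M F N ==> martingale M F (%t w. c * N t w)"
proof (rule martingaleI)
 assume N: "martingale M F N"
 thus "adapted_process F (%t w. c * N t w)" by (auto simp: martingale_def adapted_process_def)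
 show "0 <= t ==> integrable M (%w. c * N t w)" for t using N by (auto simp: martingale_def)
 fix s t :: real and A assume st: "0 <= s" "s <= t" and A: "A \<in> sets (F s)"
 show "(LINT w|M. ind A w * (c * N t w)) = (LINT w|M. ind A w * (c * N s w))" using martingale_indicator[OF N st A] by (simp add: mult.left_commute)
qed

lemma cap_cong:
 assumes cP: "cap P" and eq: "!!t w. 0 <= t ==> w \<in> space M ==> P t w = P' t w"
 shows "cap P'"
proof (rule capI)
 fix t :: real assume "0 <= t"
 thus "P' t \<in> bm (F t)" using cap_measurable[OF cP, of t t] measurable_cong[of "F t" "P t" "P' t"] eq by auto
next
 fix w assume "w \<in> space M"
 thus "continuous_on {0..} (%t. P' t w)" using cap_continuous[OF cP] continuous_on_cong[of "{0..}" "{0..}" "%t. P t w" "%t. P' t w"] eq by auto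
qed

lemma martingale_cong:
 assumes m: "martingale M F P" and eq: "!!t w. 0 <= t ==> w \<in> space M ==> P t w = P' t w"
 shows "martingale M F P'"
proof (rule martingaleI)
 show "adapted_process F P'" unfolding adapted_process_def
 proof (intro allI impI)
  fix t :: real assume t: "0 <= t"
  have "P t \<in> bm (F t)" using m t by (simp add: martingale_def adapted_process_def)
  thus "P' t \<in> bm (F t)" using measurable_cong[of "F t" "P t" "P' t"] eq[OF t] by auto
 qed
 show "integrable M (P' t)" if "0 <= t" for t using m that eq[OF that] Bochner_Integration.integrable_cong[OF refl, of M "P t" "P' t"]
  by (auto simp: martingale_def)
 fix s t :: real and A assume st: "0 <= s" "s <= t" and A: "A \<in> sets (F s)"
 have "(LINT w|M. ind A w * P' u w) = (LINT w|M. ind A w * P u w)" if "0 <= u" for u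
  using eq[OF that] by (intro Bochner_Integration.integral_cong) auto
 thus "(LINT w|M. ind A w * P' t w) = (LINT w|M. ind A w * P' s w)" using martingale_indicator[OF m st A] st by simp
qed

abbreviation clm :: "(real => 'w => real) => bool" where "clm == continuous_local_martingale M F"

lemma clm_cap: "clm N ==> cap N" by (simp add: continuous_local_martingale_def cap_def)

text \<open>Stop a second time along the localising sequence of \<open>N\<close>. The doubly stopped
  processes are martingales bounded by \<open>C\<close>, and dominated convergence removes the
  second stopping.\<close>

lemma clm_stopped_bounded:
 assumes N: "clm N" and rh: "stime rh"
  and C: "!!t w. 0 <= t ==> w \<in> space M ==> \<bar>stp rh N t w - N 0 w\<bar> <= C"
 shows "martingale M F (%t w. stp rh N t w - N 0 w)"
proof -
 obtain ta :: "nat => 'w => real" where st: "!!k. stime (ta k)"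
  and lim: "AE w in M. incseq (%k. ta k w) & filterlim (%k. ta k w) at_top sequentially"
  and mart: "!!k. martingale M F (%t w. N (min t (ta k w)) w - N 0 w)" using N unfolding continuous_local_martingale_def stime_def by auto
 have cN: "cap N" by (rule clm_cap[OF N])
 let ?P = "%t w. stp rh N t w - N 0 w"
 let ?Q = "%k t w. stp rh N (min t (ta k w)) w - N 0 w"
 have cP: "cap ?P" by (intro cap_diff cap_stp cN rh cap_initial)
 have Q: "martingale M F (?Q k)" for k
 proof -
  have "martingale M F (stp rh (%t w. stp (ta k) N t w - N 0 w))"
   using mart[of k] by (intro martingale_stp rh cap_diff cap_stp cN st cap_initial) (simp add: stp_def)
  also have "stp rh (%t w. stp (ta k) N t w - N 0 w) = ?Q k" by (auto simp: stp_def fun_eq_iff ac_simps)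
  finally show ?thesis .
 qed
 have Qm: "?Q k t \<in> bm M" if "0 <= t" for k t using Q[of k] that by (auto simp: martingale_def)
 have ta0: "0 <= ta k w" if "w \<in> space M" for k w using st that by (auto simp: stime_def)
 have bd: "\<bar>?Q k t w\<bar> <= C" if "0 <= t" "w \<in> space M" for k t w using that ta0[of w k] by (intro C) auto
 show ?thesis
 proof (rule martingaleI)
  show "adapted_process F ?P" using cP by (simp add: cap_def)
  show "integrable M (?P t)" if "0 <= t" for t using C[OF that] cap_measurable_M[OF cP that] by (intro integrable_const_bound[where B=C]) auto
  fix s t :: real and A assume st: "0 <= s" "s <= t" and A: "A \<in> sets (F s)"
  hence [measurable]: "A \<in> sets M" using sets_F by blast
  have L: "(%k. \<integral>w. ind A w * ?Q k u w \<partial>M) ----> (LINT w|M. ind A w * ?P u w)" if u: "0 <= u" for u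
  proof (rule integral_dominated_convergence[where w="%w. C"])
   have [measurable]: "?P u \<in> bm M" "?Q k u \<in> bm M" for k using cap_measurable_M[OF cP u] Qm[OF u] by auto
   show "(%w. ind A w * ?P u w) \<in> bm M" "(%w. ind A w * ?Q k u w) \<in> bm M" for k by measurable
   show "AE w in M. (%k. ind A w * ?Q k u w) ----> ind A w * ?P u w" using lim
   proof eventually_elim
    case (elim w)
    hence "EV k. u <= ta k w" by (auto simp: filterlim_at_top)
    hence "EV k. ind A w * ?Q k u w = ind A w * ?P u w" by eventually_elim (simp add: min_def)
    thus ?case by (rule tendsto_eventually)
   qed
   show "AE w in M. norm (ind A w * ?Q k u w) <= C" for k
   proof (rule AE_I2)
    fix w assume "w \<in> space M"
    from bd[OF u this, of k] show "norm (ind A w * ?Q k u w) <= C" by (auto simp: indicator_def)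
   qed
  qed auto
  have "(%k. \<integral>w. ind A w * ?Q k t w \<partial>M) = (%k. \<integral>w. ind A w * ?Q k s w \<partial>M)"
   by (intro ext martingale_indicator[OF Q st A])
  with L[of t] L[of s] st show "(LINT w|M. ind A w * ?P t w) = (LINT w|M. ind A w * ?P s w)" by (auto intro: LIMSEQ_unique)
 qed
qed

text \<open>A canonical localising sequence attached to a controlling process \<open>Z\<close>.
  Local martingales whose increments from time 0 are dominated by one and the same \<open>Z\<close>
  can be stopped at the same times, which makes sums and products tractable.\<close>

definition loc :: "(real => 'w => real) => nat => 'w => real" where "loc Z k = hit (%t w. Z t w / real (Suc k)) (real k)"

lemma stime_loc: "cap Z ==> stime (loc Z k)" unfolding loc_def by (intro stime_hit cap_divide) auto

lemma loc_le:
 assumes "cap Z" "w \<in> space M" "Z 0 w = 0" "0 <= t"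
 shows "stp (loc Z k) Z t w <= real (Suc k)"
 using hit_le_one[of "%t w. Z t w / real (Suc k)" w "real k" t] assms cap_divide[OF assms(1), of "real (Suc k)"]
 by (simp add: loc_def stp_def field_simps)

lemma loc_ge:
 assumes "cap Z" "w \<in> space M" "T <= real k" "!!t. t \<in> {0..T} ==> Z t w < real (Suc k)"
 shows "T <= loc Z k w" unfolding loc_def using assms by (intro hit_ge cap_divide) (auto simp: field_simps)

lemma cap_bounded_on: 
 assumes "cap Z" "w \<in> space M"
 obtains B where "!!t. t \<in> {0..T} ==> \<bar>Z t w\<bar> <= B"
proof -
 have "compact ((%t. Z t w) ` {0..T})" by (intro compact_continuous_image continuous_on_subset[OF cap_continuous[OF assms]]) auto
 from compact_imp_bounded[OF this] obtain B where "\<forall>x\<in>(%t. Z t w) ` {0..T}. norm x <= B" unfolding bounded_iff by blast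
 thus thesis by (intro that[of B]) auto
qed

lemma loc_at_top:
 assumes Z: "cap Z" and w: "w \<in> space M" and Z0: "Z 0 w = 0"
 shows "incseq (%k. loc Z k w)" "filterlim (%k. loc Z k w) at_top sequentially"
proof -
 show "incseq (%k. loc Z k w)"
 proof (rule incseq_SucI)
  fix k
  have b: "0 <= loc Z k w" "loc Z k w <= real k" using hit_bounds[OF cap_divide[OF Z] w, of "real k" "real (Suc k)"] by (auto simp: loc_def)
  show "loc Z k w <= loc Z (Suc k) w"
  proof (rule loc_ge[OF Z w])
   fix t assume "t \<in> {0..loc Z k w}"
   hence "Z t w <= real (Suc k)" using loc_le[OF Z w Z0, of t k] by (auto simp: stp_def min_def split: if_splits)
   thus "Z t w < real (Suc (Suc k))" by simp
  qed (use b in auto)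
 qed
 show "filterlim (%k. loc Z k w) at_top sequentially" unfolding filterlim_at_top
 proof
  fix T
  obtain B where B: "!!t. t \<in> {0..T} ==> \<bar>Z t w\<bar> <= B" using cap_bounded_on[OF Z w] by metis
  obtain k0 where k0: "max B T <= real k0" using real_arch_simple by blast
  show "EV k. T <= loc Z k w"
  proof (rule eventually_sequentiallyI[of k0])
   fix k assume "k0 <= k"
   hence k: "max B T <= real k" using k0 by (meson of_nat_mono order_trans)
   show "T <= loc Z k w"
   proof (rule loc_ge[OF Z w])
    fix t assume "t \<in> {0..T}"
    thus "Z t w < real (Suc k)" using B[of t] k by auto
   qed (use k in auto)
  qed
 qed
qed

lemma clmI:
 assumes P: "cap P" and Z: "cap Z" and Z0: "!!w. w \<in> space M ==> Z 0 w = 0"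
  and mart: "!!k. martingale M F (%t w. stp (loc Z k) P t w - P 0 w)"
 shows "clm P" unfolding continuous_local_martingale_def
proof (intro conjI exI[of _ "loc Z"] allI)
 show "AE w in M. incseq (%k. loc Z k w) & filterlim (%k. loc Z k w) at_top sequentially" using loc_at_top[OF Z _ Z0] by (intro AE_I2) auto
qed (use P stime_loc[OF Z] mart in \<open>auto simp: cap_def stime_def stp_def\<close>)

lemma clm_loc:
 assumes P: "clm P" and Z: "cap Z" and Z0: "!!w. w \<in> space M ==> Z 0 w = 0"
  and le: "!!t w. 0 <= t ==> w \<in> space M ==> \<bar>P t w - P 0 w\<bar> <= Z t w"
 shows "martingale M F (%t w. stp (loc Z k) P t w - P 0 w)"
proof (rule clm_stopped_bounded[OF P stime_loc[OF Z], where C="real (Suc k)"])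
 fix t :: real and w assume t: "0 <= t" and w: "w \<in> space M"
 have "0 <= min t (loc Z k w)" using stime_loc[OF Z, of k] w t by (auto simp: stime_def)
 from le[OF this w] loc_le[OF Z w Z0[OF w] t, of k]
 show "\<bar>stp (loc Z k) P t w - P 0 w\<bar> <= real (Suc k)" by (simp add: stp_def)
qed

lemma clm_cmult: assumes P: "clm P" shows "clm (%t w. c * P t w)"
proof (rule clmI)
 let ?Z = "%t w. \<bar>P t w - P 0 w\<bar>"
 have cP: "cap P" by (rule clm_cap[OF P])
 show "cap (%t w. c * P t w)" "cap ?Z" by (intro cap_intros cP)+
 show "martingale M F (%t w. stp (loc ?Z k) (%t w. c * P t w) t w - c * P 0 w)" for k
  using martingale_cmult[OF clm_loc[OF P, of ?Z k], of c] by (simp add: stp_def right_diff_distrib cap_intros cP)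
qed auto

lemma clm_add: assumes P: "clm P" "clm P'" shows "clm (%t w. P t w + P' t w)"
proof (rule clmI)
 let ?Z = "%t w. \<bar>P t w - P 0 w\<bar> + \<bar>P' t w - P' 0 w\<bar>"
 have c: "cap P" "cap P'" using clm_cap P by auto
 show "cap (%t w. P t w + P' t w)" "cap ?Z" by (intro cap_intros c)+
 show "martingale M F (%t w. stp (loc ?Z k) (%t w. P t w + P' t w) t w - (P 0 w + P' 0 w))" for k
  using martingale_add[OF clm_loc[OF P(1), of ?Z k] clm_loc[OF P(2), of ?Z k]] by (simp add: stp_def add_diff_add cap_intros c)
qed auto

lemma clm_diff: "clm P ==> clm P' ==> clm (%t w. P t w - P' t w)" using clm_add[of P "%t w. -1 * P' t w"] clm_cmult[of P' "-1"] by simp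

lemma clm_zero: "clm (%t w. 0)"
proof (rule clmI[where Z="%t w. 0"])
 show "martingale M F (%t w. stp (loc (%t w. 0) k) (%t w. 0) t w - 0)" for k by (rule martingaleI) (auto simp: adapted_process_def stp_def)
qed (auto intro: cap_const)

lemma clm_sum: "finite I ==> (!!i. i \<in> I ==> clm (P i)) ==> clm (%t w. \<Sum>i\<in>I. P i t w)"
 by (induction I rule: finite_induct) (auto intro: clm_zero clm_add)

lemma clm_cong:
 assumes P: "clm P" and eq: "!!t w. 0 <= t ==> w \<in> space M ==> P t w = P' t w"
 shows "clm P'"
proof (rule clmI)
 let ?Z = "%t w. \<bar>P t w - P 0 w\<bar>"
 have cP: "cap P" by (rule clm_cap[OF P])
 show "cap P'" by (rule cap_cong[OF cP eq])
 show cZ: "cap ?Z" by (intro cap_intros cP)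
 fix k
 have "martingale M F (%t w. stp (loc ?Z k) P t w - P 0 w)" by (rule clm_loc[OF P cZ]) auto
 thus "martingale M F (%t w. stp (loc ?Z k) P' t w - P' 0 w)"
  by (rule martingale_cong) (use stime_loc[OF cZ, of k] in \<open>simp add: stp_def stime_def eq\<close>)
qed auto

text \<open>The elementary integral of \<open>xi\<close> times the indicator of (u, infinity). A
  simple integral is a sum of differences of such terms, so closure properties are checked for a
  single jump of the integrand only.\<close>

definition el :: "real => ('w => real) => (real => 'w => real) => real => 'w => real" where "el u xi U t w = xi w * (U t w - U (min t u) w)"

lemma cap_el:
 assumes U: "cap U" and u: "0 <= u" and xi: "xi \<in> bm (F u)"
 shows "cap (el u xi U)"
proof (rule capI)
 fix t :: real assume t: "0 <= t"
 show "el u xi U t \<in> bm (F t)"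
 proof (cases "u <= t")
  case True
  have [measurable]: "xi \<in> bm (F t)" using measurable_F_mono[OF xi True] .
  have [measurable]: "U t \<in> bm (F t)" "U (min t u) \<in> bm (F t)" using t u by (auto intro!: cap_measurable[OF U])
  show ?thesis unfolding el_def[abs_def] by measurable
 next
  case False
  hence "el u xi U t = (%w. 0)" by (auto simp: el_def fun_eq_iff min_def)
  thus ?thesis by simp
 qed
next
 fix w assume w: "w \<in> space M"
 show "continuous_on {0..} (%t. el u xi U t w)" unfolding el_def
  by (intro continuous_intros cap_continuous[OF U w] continuous_on_compose2[OF cap_continuous[OF U w]]) (use u in auto)
qed

text \<open>The coefficient may be unbounded, so the localising process controls the integral itself
  together with \<open>U\<close>. After stopping, the integral is bounded, and its increments after
  time u are \<open>xi\<close> times martingale increments; before u it vanishes.\<close>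

lemma clm_el:
 assumes U: "clm U" and u: "0 <= u" and xi: "xi \<in> bm (F u)"
 shows "clm (el u xi U)"
proof -
 let ?P = "el u xi U"
 have cU: "cap U" by (rule clm_cap[OF U])
 have cP: "cap ?P" by (rule cap_el[OF cU u xi])
 have P0: "?P t w = 0" if "t <= u" for w t using that by (simp add: el_def min_def)
 let ?Z = "%t w. \<bar>U t w - U 0 w\<bar> + \<bar>?P t w\<bar>"
 have cZ: "cap ?Z" by (intro cap_intros cU cP)
 have Z0: "?Z 0 w = 0" for w using P0[OF u] by simp
 show ?thesis
 proof (rule clmI[OF cP cZ Z0])
  fix k
  define rh where "rh = loc ?Z k"
  have strh: "stime rh" unfolding rh_def by (rule stime_loc[OF cZ])
  have mU: "martingale M F (%t w. stp rh U t w - U 0 w)" unfolding rh_def by (rule clm_loc[OF U cZ Z0]) auto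
  have rh0: "0 <= rh w" if "w \<in> space M" for w using strh that by (auto simp: stime_def)
  have bP: "\<bar>stp rh ?P t w\<bar> <= real (Suc k)" if "0 <= t" "w \<in> space M" for t w
   using loc_le[OF cZ that(2) Z0 that(1), of k] unfolding rh_def[symmetric] by (simp add: stp_def)
  have cS: "cap (stp rh ?P)" by (intro cap_stp cP strh)
  have int: "integrable M (stp rh ?P t)" if "0 <= t" for t
   using bP[OF that] cap_measurable_M[OF cS that] by (intro integrable_const_bound[where B="real (Suc k)"]) auto
  have inc: "(LINT w|M. ind A w * (stp rh ?P t w - stp rh ?P s w)) = 0" if st: "u <= s" "s <= t" and A: "A \<in> sets (F s)" for s t A
  proof -
   have [measurable]: "A \<in> sets M" using A sets_F by blast
   have s0: "0 <= s" "0 <= t" using st u by auto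
   have eq: "stp rh ?P t w - stp rh ?P s w = xi w * ((stp rh U t w - U 0 w) - (stp rh U s w - U 0 w))" for w
   proof -
    have m: "min (min t (rh w)) u = min (rh w) u" "min (min s (rh w)) u = min (rh w) u" using st by auto
    show ?thesis unfolding stp_def el_def m by (simp add: algebra_simps)
   qed
   have "(LINT w|M. (ind A w * xi w) * ((stp rh U t w - U 0 w) - (stp rh U s w - U 0 w))) = 0"
   proof (rule martingale_mult[OF mU s0(1) st(2)])
    have [measurable]: "xi \<in> bm (F s)" using measurable_F_mono[OF xi st(1)] .
    show "(%w. ind A w * xi w) \<in> bm (F s)" using A by measurable
    have "integrable M (%w. ind A w * (stp rh ?P t w - stp rh ?P s w))"
     using integrable_mult_indicator[of A M "%w. stp rh ?P t w - stp rh ?P s w"] int[OF s0(1)] int[OF s0(2)] by simp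
    thus "integrable M (%w. (ind A w * xi w) * ((stp rh U t w - U 0 w) - (stp rh U s w - U 0 w)))" unfolding eq mult.assoc .
   qed
   thus ?thesis unfolding eq mult.assoc .
  qed
  have main: "(LINT w|M. ind A w * (stp rh ?P t w - stp rh ?P s w)) = 0" if st: "0 <= s" "s <= t" and A: "A \<in> sets (F s)" for s t A
  proof (cases "u <= s")
   case True thus ?thesis using inc st A by blast
  next
   case False
   have s: "stp rh ?P s w = 0" "stp rh ?P u w = 0" for w using False by (auto simp: stp_def intro!: P0)
   show ?thesis
   proof (cases "u <= t")
    case True
    have "A \<in> sets (F u)" using A False sets_F_mono[of s u] by auto
    from inc[OF order_refl True this] show ?thesis by (simp add: s)
   next
    case False
    hence "stp rh ?P t w = 0" for w by (auto simp: stp_def intro!: P0)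
    thus ?thesis by (simp add: s)
   qed
  qed
  show "martingale M F (%t w. stp (loc ?Z k) ?P t w - ?P 0 w)" unfolding rh_def[symmetric]
  proof (rule martingaleI)
   show "adapted_process F (%t w. stp rh ?P t w - ?P 0 w)" using cS P0[OF u] by (simp add: cap_def)
   show "integrable M (%w. stp rh ?P t w - ?P 0 w)" if "0 <= t" for t using int[OF that] P0[OF u] by simp
   fix s t :: real and A assume st: "0 <= s" "s <= t" and A: "A \<in> sets (F s)"
   have "integrable M (%w. ind A w * stp rh ?P v w)" if "0 <= v" for v
    using integrable_mult_indicator[of A M "stp rh ?P v"] int[OF that] A sets_F by auto
   thus "(LINT w|M. ind A w * (stp rh ?P t w - ?P 0 w)) = (LINT w|M. ind A w * (stp rh ?P s w - ?P 0 w))"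
    using main[OF st A] st P0[OF u] by (simp add: right_diff_distrib)
  qed
 qed
qed

end

section \<open>Convergence uniformly on compacts in probability, Lenglart's inequality and
  brackets\<close>

context stoch_base
begin

abbreviation supgt :: "(real => 'w => real) => real => real => 'w set" where
 "supgt D T e == {w \<in> space M. \<exists>t\<in>{0..T}. \<bar>D t w\<bar> > e}"

lemma supgt_measurable: "cap D ==> supgt D T e \<in> sets M"
proof (cases "0 <= T")
 case True
 assume "cap D"
 from ex_gr_measurable[OF cap_abs[OF this] True, of e] show ?thesis using sets_F by blast
qed simp

text \<open>Convergence to 0 uniformly on compact time intervals in probability, expressed by
  exceedance events instead of suprema.\<close>

definition ucp :: "(nat => real => 'w => real) => bool" where
 "ucp D \<longleftrightarrow> (\<forall>m. cap (D m)) & (\<forall>T e. e > 0 --> (%m. measure M (supgt (D m) T e)) ----> 0)"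

lemma ucpD: "ucp D ==> e > 0 ==> (%m. measure M (supgt (D m) T e)) ----> 0" by (auto simp: ucp_def)

lemma ucp_cap: "ucp D ==> cap (D m)" by (auto simp: ucp_def)

lemma ucp_eq:
 assumes E: "ucp E" and D: "!!m. cap (D m)"
  and eq: "!!m. AE w in M. \<forall>t\<ge>0. D m t w = E m t w"
 shows "ucp D" unfolding ucp_def
proof (intro conjI allI impI D)
 fix T e :: real assume e: "e > 0"
 have "measure M (supgt (D m) T e) = measure M (supgt (E m) T e)" for m
 proof (intro measure_eq_AE supgt_measurable D ucp_cap[OF E])
  show "AE w in M. w \<in> supgt (D m) T e \<longleftrightarrow> w \<in> supgt (E m) T e" using eq[of m] by eventually_elim auto
 qed
 thus "(%m. measure M (supgt (D m) T e)) ----> 0" using ucpD[OF E e, of T] by simp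
qed

lemma ucp_add:
 assumes D: "ucp D" and E: "ucp E"
 shows "ucp (%m t w. D m t w + E m t w)" unfolding ucp_def
proof (intro conjI allI impI)
 show "cap (%t w. D m t w + E m t w)" for m by (intro cap_add ucp_cap D E)
 fix T e :: real assume e: "e > 0"
 hence e2: "e/2 > 0" by simp
 show "(%m. measure M (supgt (%t w. D m t w + E m t w) T e)) ----> 0"
 proof (rule tendsto_sandwich[OF _ _ tendsto_const])
  show "(%m. measure M (supgt (D m) T (e/2)) + measure M (supgt (E m) T (e/2))) ----> 0" using tendsto_add[OF ucpD[OF D e2] ucpD[OF E e2]] by simp
  have "measure M (supgt (%t w. D m t w + E m t w) T e) <= measure M (supgt (D m) T (e/2) \<union> supgt (E m) T (e/2))" for m
  proof (intro finite_measure_mono sets.Un supgt_measurable ucp_cap[OF E] ucp_cap[OF D] subsetI)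
   fix w assume "w \<in> supgt (%t w. D m t w + E m t w) T e"
   then obtain t where t: "w \<in> space M" "t \<in> {0..T}" "\<bar>D m t w + E m t w\<bar> > e" by blast
   hence "\<bar>D m t w\<bar> > e/2 \<or> \<bar>E m t w\<bar> > e/2" by linarith
   thus "w \<in> supgt (D m) T (e/2) \<union> supgt (E m) T (e/2)" using t by blast
  qed
  also have "... m <= measure M (supgt (D m) T (e/2)) + measure M (supgt (E m) T (e/2))" for m
   by (intro measure_Un_le supgt_measurable ucp_cap[OF E] ucp_cap[OF D])
  finally show "EV m. measure M (supgt (%t w. D m t w + E m t w) T e) <= measure M (supgt (D m) T (e/2)) + measure M (supgt (E m) T (e/2))"
   by (intro always_eventually allI)
 qed auto
qed

lemma ucp_cmult: assumes D: "ucp D" shows "ucp (%m t w. c * D m t w)" unfolding ucp_def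
proof (intro conjI allI impI)
 show "cap (%t w. c * D m t w)" for m by (intro cap_cmult ucp_cap D)
 fix T e :: real assume e: "e > 0"
 show "(%m. measure M (supgt (%t w. c * D m t w) T e)) ----> 0"
 proof (cases "c = 0")
  case False
  have "supgt (%t w. c * D m t w) T e = supgt (D m) T (e / \<bar>c\<bar>)" for m using False by (auto simp: abs_mult divide_less_eq mult.commute)
  thus ?thesis using ucpD[OF D, of "e / \<bar>c\<bar>" T] False e by simp
 qed (use e in simp)
qed

lemma ucp_diff: "ucp D ==> ucp E ==> ucp (%m t w. D m t w - E m t w)" using ucp_add[of D "%m t w. -1 * E m t w"] ucp_cmult[of E "-1"] by simp

lemma ucp_zero: "ucp (%m t w. 0)" by (auto simp: ucp_def cap_const)

lemma measure_vanish:
 assumes A: "!!m. A m \<in> sets M" and lim: "AE w in M. EV m. w \<notin> A m"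
 shows "(%m. measure M (A m)) ----> 0"
proof -
 have "(%m. \<integral>w. ind (A m) w \<partial>M) ----> (LINT w|M. (0::real))"
 proof (rule integral_dominated_convergence[where w="%_. 1"])
  show "AE w in M. (%m. ind (A m) w :: real) ----> 0" using lim
  proof eventually_elim
   case (elim w)
   hence "EV m. (ind (A m) w :: real) = 0" by eventually_elim auto
   thus ?case by (rule tendsto_eventually)
  qed
 qed (use A in \<open>auto simp: indicator_def\<close>)
 thus ?thesis using A by simp
qed

lemma ucp_pathwise:
 assumes D: "!!m. cap (D m)"
  and lim: "!!T e. e > 0 ==> AE w in M. EV m. \<forall>t\<in>{0..T}. \<bar>D m t w\<bar> <= e"
 shows "ucp D" unfolding ucp_def
proof (intro conjI allI impI D measure_vanish supgt_measurable)
 fix T e :: real assume "e > 0"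
 from lim[OF this, of T] show "AE w in M. EV m. w \<notin> supgt (D m) T e" by eventually_elim (auto elim!: eventually_mono)
qed

lemma supgt_tail:
 assumes Z: "cap Z"
 shows "(%K. measure M (supgt Z T (real K))) ----> 0"
proof (rule measure_vanish)
 show "supgt Z T (real K) \<in> sets M" for K by (rule supgt_measurable[OF Z])
 show "AE w in M. EV K. w \<notin> supgt Z T (real K)"
 proof (rule AE_I2)
  fix w assume w: "w \<in> space M"
  obtain B where B: "!!t. t \<in> {0..T} ==> \<bar>Z t w\<bar> <= B" using cap_bounded_on[OF Z w] by metis
  obtain k0 where k0: "B <= real k0" using real_arch_simple by blast
  show "EV K. w \<notin> supgt Z T (real K)"
  proof (rule eventually_sequentiallyI[of k0])
   fix K assume "k0 <= K"
   hence "B <= real K" using k0 by linarith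
   thus "w \<notin> supgt Z T (real K)" using B by fastforce
  qed
 qed
qed

text \<open>A continuous process is bounded in probability on [0, T], so it is enough that
  \<open>D\<close> becomes small compared with a large constant.\<close>

lemma ucp_mult_cap:
 assumes D: "ucp D" and Z: "cap Z"
 shows "ucp (%m t w. Z t w * D m t w)" unfolding ucp_def
proof (intro conjI allI impI)
 show "cap (%t w. Z t w * D m t w)" for m by (intro cap_mult ucp_cap D Z)
 fix T e :: real assume e: "e > 0"
 show "(%m. measure M (supgt (%t w. Z t w * D m t w) T e)) ----> 0"
 proof (rule LIMSEQ_I)
  fix r :: real assume r: "0 < r"
  obtain K0 where K0: "!!K. K >= K0 ==> measure M (supgt Z T (real K)) < r/2"
   using order_tendstoD(2)[OF supgt_tail[OF Z, of T], of "r/2"] r unfolding eventually_sequentially by auto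
  define K where "K = Suc K0"
  have K: "measure M (supgt Z T (real K)) < r/2" "0 < real K" using K0[of K] by (auto simp: K_def)
  have eK: "e / real K > 0" using e K by simp
  obtain n where n: "!!m. m >= n ==> measure M (supgt (D m) T (e / real K)) < r/2"
   using order_tendstoD(2)[OF ucpD[OF D eK, of T], of "r/2"] r unfolding eventually_sequentially by auto
  have "measure M (supgt (%t w. Z t w * D m t w) T e) < r" if "m >= n" for m
  proof -
   have "measure M (supgt (%t w. Z t w * D m t w) T e) <= measure M (supgt Z T (real K) \<union> supgt (D m) T (e / real K))"
   proof (intro finite_measure_mono sets.Un supgt_measurable Z ucp_cap[OF D] subsetI)
    fix w assume "w \<in> supgt (%t w. Z t w * D m t w) T e"
    then obtain t where t: "w \<in> space M" "t \<in> {0..T}" "\<bar>Z t w * D m t w\<bar> > e" by blast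
    have "\<bar>Z t w\<bar> > real K \<or> \<bar>D m t w\<bar> > e / real K"
    proof (rule ccontr)
     assume "\<not> ?thesis"
     hence "\<bar>Z t w\<bar> * \<bar>D m t w\<bar> <= real K * (e / real K)" by (intro mult_mono) auto
     thus False using t K by (simp add: abs_mult)
    qed
    thus "w \<in> supgt Z T (real K) \<union> supgt (D m) T (e / real K)" using t by blast
   qed
   also have "... <= measure M (supgt Z T (real K)) + measure M (supgt (D m) T (e / real K))"
    by (intro measure_Un_le supgt_measurable Z ucp_cap[OF D])
   finally show ?thesis using K n[OF that] by simp
  qed
  thus "\<exists>no. \<forall>m\<ge>no. norm (measure M (supgt (%t w. Z t w * D m t w) T e) - 0) < r" by (intro exI[of _ n]) auto
 qed
qed

lemma ucp_mult:
 assumes D: "ucp D" and E: "ucp E"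
 shows "ucp (%m t w. D m t w * E m t w)" unfolding ucp_def
proof (intro conjI allI impI)
 show "cap (%t w. D m t w * E m t w)" for m by (intro cap_mult ucp_cap D E)
 fix T e :: real assume e: "e > 0"
 have e1: "(1::real) > 0" by simp
 show "(%m. measure M (supgt (%t w. D m t w * E m t w) T e)) ----> 0"
 proof (rule tendsto_sandwich[OF _ _ tendsto_const])
  show "(%m. measure M (supgt (D m) T 1) + measure M (supgt (E m) T e)) ----> 0" using tendsto_add[OF ucpD[OF D e1] ucpD[OF E e]] by simp
  have "measure M (supgt (%t w. D m t w * E m t w) T e) <= measure M (supgt (D m) T 1 \<union> supgt (E m) T e)" for m
  proof (intro finite_measure_mono sets.Un supgt_measurable ucp_cap[OF E] ucp_cap[OF D] subsetI)
   fix w assume "w \<in> supgt (%t w. D m t w * E m t w) T e"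
   then obtain t where t: "w \<in> space M" "t \<in> {0..T}" "\<bar>D m t w * E m t w\<bar> > e" by blast
   have "\<bar>D m t w\<bar> > 1 \<or> \<bar>E m t w\<bar> > e"
   proof (rule ccontr)
    assume "\<not> ?thesis"
    hence "\<bar>D m t w\<bar> * \<bar>E m t w\<bar> <= 1 * e" by (intro mult_mono) auto
    thus False using t by (simp add: abs_mult)
   qed
   thus "w \<in> supgt (D m) T 1 \<union> supgt (E m) T e" using t by blast
  qed
  also have "... m <= measure M (supgt (D m) T 1) + measure M (supgt (E m) T e)" for m
   by (intro measure_Un_le supgt_measurable ucp_cap[OF E] ucp_cap[OF D])
  finally show "EV m. measure M (supgt (%t w. D m t w * E m t w) T e) <= measure M (supgt (D m) T 1) + measure M (supgt (E m) T e)"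
   by (intro always_eventually allI)
 qed auto
qed

lemma ucp_products:
 assumes D: "ucp (%m t w. R m t w - R' t w)" and E: "ucp (%m t w. S m t w - S' t w)" and c: "cap R'" "cap S'"
 shows "ucp (%m t w. R m t w * S m t w - R' t w * S' t w)"
proof -
 have "ucp (%m t w. (R m t w - R' t w) * (S m t w - S' t w) + (R' t w * (S m t w - S' t w) + S' t w * (R m t w - R' t w)))"
  by (intro ucp_add ucp_mult ucp_mult_cap D E c)
 thus ?thesis by (simp add: algebra_simps)
qed

lemma ucp_const_zero:
 assumes D: "ucp (%m. D)"
 shows "AE w in M. \<forall>t\<ge>0. D t w = 0"
proof -
 have "AE w in M. w \<notin> supgt D (real k) (1 / real (Suc k))" for k
 proof -
  have "measure M (supgt D (real k) (1 / real (Suc k))) = 0" using ucpD[OF D, of "1 / real (Suc k)" "real k"] by (simp add: LIMSEQ_const_iff)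
  hence "supgt D (real k) (1 / real (Suc k)) \<in> null_sets M"
   using supgt_measurable[OF ucp_cap[OF D]] by (simp add: null_sets_def emeasure_eq_measure)
  thus ?thesis by (rule AE_not_in)
 qed
 hence "AE w in M. \<forall>k. w \<notin> supgt D (real k) (1 / real (Suc k))" by (simp add: AE_all_countable)
 thus ?thesis
 proof (rule AE_mp, intro AE_I2 impI allI)
  fix w and t :: real assume w: "w \<in> space M" and k: "\<forall>k. w \<notin> supgt D (real k) (1 / real (Suc k))" and t: "0 <= t"
  obtain k0 where k0: "t <= real k0" using real_arch_simple by blast
  have "\<bar>D t w\<bar> <= 1 / real (Suc k)" if "k >= k0" for k using k w t k0 that by (auto simp: not_less dest!: spec[of _ k] bspec[of _ _ t])
  hence "\<bar>D t w\<bar> <= 0" by (intro LIMSEQ_le_const[OF LIMSEQ_Suc[OF lim_1_over_n]]) (auto intro!: exI[of _ k0])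
  thus "D t w = 0" by simp
 qed
qed

lemma ucp_limit_unique:
 assumes "ucp (%m t w. R m t w - P t w)" "ucp (%m t w. R m t w - P' t w)"
 shows "AE w in M. \<forall>t\<ge>0. P t w = P' t w"
proof -
 have "ucp (%m t w. P' t w - P t w)" using ucp_diff[OF assms] by simp
 from ucp_const_zero[OF this] show ?thesis by eventually_elim auto
qed

text \<open>The obstacle is that natural stopping times of \<open>P m\<close> vary with m. Each
  \<open>P m\<close> is stopped when \<open>P'\<close> becomes large or when \<open>P m\<close> is
  at distance 1 from \<open>P'\<close>. This bounds the stopped processes uniformly, and on the
  event of uniform closeness the second condition never triggers, so the stopping times agree with
  that of \<open>P'\<close>. Stopped values therefore converge in mean, and the martingale
  identities pass to the limit.\<close>

lemma clm_ucp_limit: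
 assumes P: "!!m. clm (P m)" and lim: "ucp (%m t w. P m t w - P' t w)" and P': "cap P'"
  and P0: "!!m w. w \<in> space M ==> P m 0 w = 0" "!!w. w \<in> space M ==> P' 0 w = 0"
 shows "clm P'"
proof -
 let ?Z = "%t w. \<bar>P' t w\<bar>"
 have cZ: "cap ?Z" by (intro cap_abs P')
 have cP: "cap (P m)" for m by (rule clm_cap[OF P])
 show ?thesis
 proof (rule clmI[OF P' cZ])
  show "?Z 0 w = 0" if "w \<in> space M" for w using P0 that by simp
  fix k
  define rh where "rh = loc ?Z k"
  define Zm where "Zm m t w = max (\<bar>P' t w\<bar> / real (Suc k)) \<bar>P m t w - P' t w\<bar>" for m t w
  have cZm: "cap (Zm m)" for m unfolding Zm_def[abs_def] by (intro cap_intros P' cP)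
  define rhm where "rhm m = hit (Zm m) (real k)" for m
  have st: "stime rh" "stime (rhm m)" for m unfolding rh_def rhm_def using stime_loc[OF cZ] stime_hit[OF cZm] by auto
  \<comment> \<open>The bound k + 1 for the stopped \<open>P'\<close>, plus the distance 1 granted
    to \<open>P m\<close>.\<close>
  define B where "B = real (Suc k) + 1"
  have bP': "\<bar>stp rh P' t w\<bar> <= B" if "0 <= t" "w \<in> space M" for t w
   using loc_le[OF cZ that(2) _ that(1), of k] P0 that unfolding rh_def B_def by (simp add: stp_def)
  have bP: "\<bar>stp (rhm m) (P m) t w\<bar> <= B" if "0 <= t" "w \<in> space M" for t w m
  proof -
   have "stp (rhm m) (Zm m) t w <= 1" unfolding rhm_def using that P0 by (intro hit_le_one[OF cZm]) (auto simp: Zm_def)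
   hence "\<bar>P' (min t (rhm m w)) w\<bar> <= real (Suc k)" "\<bar>P m (min t (rhm m w)) w - P' (min t (rhm m w)) w\<bar> <= 1"
    by (auto simp: stp_def Zm_def field_simps)
   thus ?thesis unfolding stp_def B_def by linarith
  qed
  have mart: "martingale M F (stp (rhm m) (P m))" for m
  proof -
   have "martingale M F (%t w. stp (rhm m) (P m) t w - P m 0 w)" using bP P0 by (intro clm_stopped_bounded[OF P st(2), where C=B]) auto
   thus ?thesis by (rule martingale_cong) (simp add: P0)
  qed
  have cS: "cap (stp rh P')" by (intro cap_stp P' st)
  have [measurable]: "stp rh P' t \<in> bm M" "stp (rhm m) (P m) t \<in> bm M" if "0 <= t" for t m
   using cap_measurable_M[OF cS that] cap_measurable_M[OF cap_stp[OF cP st(2)] that] by auto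
  have int: "integrable M (stp rh P' t)" "integrable M (stp (rhm m) (P m) t)" if "0 <= t" for t m
   using bP'[OF that] bP[OF that] that by (auto intro!: integrable_const_bound[where B=B])
  \<comment> \<open>With e below 1, the distance condition inside \<open>Zm\<close> is not met
    before t, so \<open>rhm m\<close> and \<open>rh\<close> coincide up to t.\<close>
  have close: "\<bar>stp (rhm m) (P m) t w - stp rh P' t w\<bar> <= e" 
   if t: "0 <= t" and w: "w \<in> space M" and n: "w \<notin> supgt (%t w. P m t w - P' t w) t e" and e: "e < 1" for t w m e
  proof -
   have le: "\<bar>P m s w - P' s w\<bar> <= e" if "s \<in> {0..t}" for s using n w that by (auto simp: not_less)
   have "min t (hit (Zm m) (real k) w) = min t (hit (%t w. \<bar>P' t w\<bar> / real (Suc k)) (real k) w)"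
   proof (rule min_hit_cong[OF cZm cap_divide[OF cZ] w])
    fix s assume "s \<in> {0..t}"
    thus "(1 <= Zm m s w) = (1 <= \<bar>P' s w\<bar> / real (Suc k))" using le[of s] e unfolding Zm_def by linarith
   qed simp
   hence eq: "min t (rhm m w) = min t (rh w)" by (simp add: rhm_def rh_def loc_def)
   have "0 <= rh w" using st(1) w by (auto simp: stime_def)
   thus ?thesis unfolding stp_def eq using t by (intro le) auto
  qed
  have L1: "(%m. \<integral>w. \<bar>stp (rhm m) (P m) t w - stp rh P' t w\<bar> \<partial>M) ----> 0" if t: "0 <= t" for t
  proof (rule LIMSEQ_I)
   fix r :: real assume r: "0 < r"
   define e where "e = min (1/2) (r/2)"
   have e: "0 < e" "e < 1" "e <= r/2" using r by (auto simp: e_def)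
   have "(%m. 2 * B * measure M (supgt (%t w. P m t w - P' t w) t e)) ----> 0" using tendsto_mult_left[OF ucpD[OF lim e(1), of t], of "2*B"] by simp
   from order_tendstoD(2)[OF this, of "r/2"] r
   obtain n where n: "!!m. m >= n ==> 2 * B * measure M (supgt (%t w. P m t w - P' t w) t e) < r/2" unfolding eventually_sequentially by auto
   have "(LINT w|M. \<bar>stp (rhm m) (P m) t w - stp rh P' t w\<bar>) < r" if "m >= n" for m
   proof -
    let ?A = "supgt (%t w. P m t w - P' t w) t e"
    have [measurable]: "?A \<in> sets M" by (intro supgt_measurable cap_diff cP P')
    have "(LINT w|M. \<bar>stp (rhm m) (P m) t w - stp rh P' t w\<bar>) <= (LINT w|M. e + 2 * B * ind ?A w)"
    proof (intro integral_mono)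
     show "integrable M (%w. \<bar>stp (rhm m) (P m) t w - stp rh P' t w\<bar>)" using int[OF t] by auto
     show "integrable M (%w. e + 2 * B * ind ?A w)" by (intro Bochner_Integration.integrable_add integrable_const integrable_mult_right
        integrable_real_indicator \<open>?A \<in> sets M\<close>) (simp add: less_top[symmetric])
     fix w assume w: "w \<in> space M"
     show "\<bar>stp (rhm m) (P m) t w - stp rh P' t w\<bar> <= e + 2 * B * ind ?A w"
     proof (cases "w \<in> ?A")
      case True
      hence "ind ?A w = (1::real)" by (rule indicator_simps(1))
      thus ?thesis using bP'[OF t w] bP[OF t w, of m] e by simp
     next
      case False
      hence "ind ?A w = (0::real)" by (rule indicator_simps(2))
      thus ?thesis using close[OF t w False e(2)] by simp
     qed
    qed
    also have "... = (LINT w|M. e) + (LINT w|M. 2 * B * ind ?A w)" by (intro Bochner_Integration.integral_add integrable_const integrable_mult_right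
        integrable_real_indicator \<open>?A \<in> sets M\<close>) (simp add: less_top[symmetric])
    also have "... = e + 2 * B * measure M ?A" using Int_absorb2[OF sets.sets_into_space[OF \<open>?A \<in> sets M\<close>]] by (simp add: prob_space)
    finally show ?thesis using n[OF that] e by simp
   qed
   thus "\<exists>no. \<forall>m\<ge>no. norm ((LINT w|M. \<bar>stp (rhm m) (P m) t w - stp rh P' t w\<bar>) - 0) < r" by (intro exI[of _ n]) auto
  qed
  have "martingale M F (stp rh P')"
  proof (rule martingaleI)
   show "adapted_process F (stp rh P')" using cS by (simp add: cap_def)
   show "integrable M (stp rh P' t)" if "0 <= t" for t by (rule int(1)[OF that])
   fix s t :: real and A assume s: "0 <= s" "s <= t" and A: "A \<in> sets (F s)"
   hence [measurable]: "A \<in> sets M" using sets_F by blast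
   have L: "(%m. (LINT w|M. ind A w * stp (rhm m) (P m) u w)) ----> (LINT w|M. ind A w * stp rh P' u w)" if u: "0 <= u" for u
   proof (rule LIM_zero_cancel, rule Lim_null_comparison[OF _ L1[OF u]], rule always_eventually, rule allI)
    fix m
    have i: "integrable M (%w. ind A w * stp (rhm m) (P m) u w)" "integrable M (%w. ind A w * stp rh P' u w)"
     using integrable_mult_indicator[OF _ int(2)[OF u], of A m] integrable_mult_indicator[OF _ int(1)[OF u], of A] by auto
    have "norm ((LINT w|M. ind A w * stp (rhm m) (P m) u w) - (LINT w|M. ind A w * stp rh P' u w))
      = norm (LINT w|M. ind A w * stp (rhm m) (P m) u w - ind A w * stp rh P' u w)" using i by simp
    also have "... <= (LINT w|M. norm (ind A w * stp (rhm m) (P m) u w - ind A w * stp rh P' u w))" by (rule integral_norm_bound)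
    also have "... <= (LINT w|M. \<bar>stp (rhm m) (P m) u w - stp rh P' u w\<bar>)"
     using i int[OF u] by (intro integral_mono) (auto simp: indicator_def)
    finally show "norm ((LINT w|M. ind A w * stp (rhm m) (P m) u w) - (LINT w|M. ind A w * stp rh P' u w))
     <= (LINT w|M. \<bar>stp (rhm m) (P m) u w - stp rh P' u w\<bar>)" .
   qed
   have "(%m. (LINT w|M. ind A w * stp (rhm m) (P m) t w)) = (%m. (LINT w|M. ind A w * stp (rhm m) (P m) s w))"
    by (intro ext martingale_indicator[OF mart s A])
   with L[of t] L[of s] s show "(LINT w|M. ind A w * stp rh P' t w) = (LINT w|M. ind A w * stp rh P' s w)" by (auto intro: LIMSEQ_unique)
  qed
  thus "martingale M F (%t w. stp (loc ?Z k) P' t w - P' 0 w)" unfolding rh_def by (rule martingale_cong) (simp add: P0)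
 qed
qed

text \<open>Stop when |R| reaches \<open>de\<close> or \<open>V\<close> reaches \<open>et\<close>.
  The stopped R^2 - V is a bounded martingale, so the second moment of R equals the mean of V at the
  stopping time, and Chebyshev bounds the event that |R| exceeds \<open>de\<close> while
  \<open>V\<close> stays below \<open>et\<close>. Monotonicity of \<open>V\<close> is not assumed,
  because \<open>V\<close> will also be a sum of squared grid increments.\<close>

lemma lenglart_core:
 assumes U: "clm (%t w. (R t w)^2 - V t w)" and cR: "cap R" and cV: "cap V"
  and R0: "!!w. w \<in> space M ==> R 0 w = 0" and V0: "!!w. w \<in> space M ==> V 0 w = 0"
  and Vpos: "!!t w. 0 <= t ==> w \<in> space M ==> 0 <= V t w"
  and T: "0 <= T" and de: "0 < de" and et: "0 < et"
 obtains si where "!!w. w \<in> space M ==> 0 <= si w & si w <= T & V (si w) w <= et"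
  and "(%w. V (si w) w) \<in> bm M"
  and "measure M (supgt R T de) <= (LINT w|M. V (si w) w) / de^2 + measure M {w \<in> space M. \<exists>t\<in>{0..T}. V t w >= et}"
proof -
 define Z where "Z t w = max (\<bar>R t w\<bar> / de) (V t w / et)" for t w
 have cZ: "cap Z" unfolding Z_def[abs_def] by (intro cap_intros cR cV)
 define rh where "rh = hit Z (T + 1)"
 have st: "stime rh" unfolding rh_def using T by (intro stime_hit cZ) auto
 have rh0: "0 <= rh w" if "w \<in> space M" for w using st that by (auto simp: stime_def)
 have Zle: "stp rh Z t w <= 1" if "0 <= t" "w \<in> space M" for t w
  unfolding rh_def using T that R0 V0 by (intro hit_le_one[OF cZ]) (auto simp: Z_def)
 have Rle: "\<bar>stp rh R t w\<bar> <= de" and Vle: "stp rh V t w <= et" if "0 <= t" "w \<in> space M" for t w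
  using Zle[OF that] de et by (auto simp: stp_def Z_def field_simps)
 have V1: "0 <= stp rh V t w" if "0 <= t" "w \<in> space M" for t w unfolding stp_def using that rh0 by (intro Vpos) auto
 have "martingale M F (%t w. stp rh (%t w. (R t w)^2 - V t w) t w - ((R 0 w)^2 - V 0 w))"
 proof (rule clm_stopped_bounded[OF U st, where C="de^2 + et"])
  fix t :: real and w assume a: "0 <= t" "w \<in> space M"
  have "(stp rh R t w)^2 <= de^2" using Rle[OF a] de by (metis abs_le_square_iff abs_of_pos)
  moreover have "stp rh (%t w. (R t w)^2 - V t w) t w - ((R 0 w)^2 - V 0 w) = (stp rh R t w)^2 - stp rh V t w" by (simp add: stp_def R0 V0 a)
  ultimately show "\<bar>stp rh (%t w. (R t w)^2 - V t w) t w - ((R 0 w)^2 - V 0 w)\<bar> <= de^2 + et"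
   using Vle[OF a] V1[OF a] zero_le_power2[of "stp rh R t w"] zero_le_power2[of de] by linarith
 qed
 hence "martingale M F (%t w. (stp rh R t w)^2 - stp rh V t w)" by (rule martingale_cong) (simp add: stp_def R0 V0)
 from martingale_indicator[OF this order_refl T, of "space M"]
 have "(LINT w|M. ind (space M) w * ((stp rh R T w)^2 - stp rh V T w)) =
    (LINT w|M. ind (space M) w * ((stp rh R 0 w)^2 - stp rh V 0 w))" using sets.top[of "F 0"] by simp
 also have "(LINT w|M. ind (space M) w * ((stp rh R 0 w)^2 - stp rh V 0 w)) = (LINT w|M. 0)"
  using rh0 by (intro Bochner_Integration.integral_cong) (auto simp: stp_def R0 V0 min_def)
 also have "(LINT w|M. ind (space M) w * ((stp rh R T w)^2 - stp rh V T w)) = (LINT w|M. (stp rh R T w)^2 - stp rh V T w)"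
  by (intro Bochner_Integration.integral_cong) auto
 finally have E0: "(LINT w|M. (stp rh R T w)^2 - stp rh V T w) = 0" by simp
 have [measurable]: "stp rh R T \<in> bm M" "stp rh V T \<in> bm M"
  using cap_measurable_M[OF cap_stp[OF cR st] T] cap_measurable_M[OF cap_stp[OF cV st] T] by auto
 have iV: "integrable M (stp rh V T)" using Vle[OF T] V1[OF T] by (intro integrable_const_bound[where B=et]) (auto intro!: AE_I2)
 have iR: "integrable M (%w. (stp rh R T w)^2)"
 proof (rule integrable_const_bound[where B="de^2"])
  show "AE w in M. norm ((stp rh R T w)^2) <= de^2"
  proof (rule AE_I2)
   fix w assume "w \<in> space M"
   from Rle[OF T this] de show "norm ((stp rh R T w)^2) <= de^2" by (simp, metis abs_le_square_iff abs_of_pos)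
  qed
 qed measurable
 let ?B = "{w \<in> space M. \<exists>t\<in>{0..T}. V t w >= et}"
 have [measurable]: "?B \<in> sets M" using ex_ge_measurable[OF cV T] sets_F by blast
 have [measurable]: "supgt R T de \<in> sets M" by (rule supgt_measurable[OF cR])
 have Am: "supgt R T de - ?B \<in> sets M" by measurable
 have "de^2 * measure M (supgt R T de - ?B) = (LINT w|M. de^2 * ind (supgt R T de - ?B) w)" using Am by simp
 also have "... <= (LINT w|M. (stp rh R T w)^2)"
 proof (intro integral_mono iR)
  show "integrable M (%w. de^2 * ind (supgt R T de - ?B) w)"
   by (intro integrable_mult_right integrable_real_indicator Am) (simp add: less_top[symmetric])
  fix w assume w: "w \<in> space M"
  show "de^2 * ind (supgt R T de - ?B) w <= (stp rh R T w)^2"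
  proof (cases "w \<in> supgt R T de - ?B")
   case False
   hence "ind (supgt R T de - ?B) w = (0::real)" by (rule indicator_simps(2))
   thus ?thesis by simp
  next
   case True
   then obtain s where s: "s \<in> {0..T}" "\<bar>R s w\<bar> > de" by blast
   have V: "V t w < et" if "t \<in> {0..T}" for t
   proof (rule ccontr)
    assume "\<not> V t w < et"
    hence "w \<in> ?B" using w that by (intro CollectI conjI bexI[of _ t]) auto
    with True show False by blast
   qed
   have "Z s w >= 1" using s de by (simp add: Z_def le_max_iff_disj)
   hence ex: "\<exists>t\<in>{0..T+1}. Z t w >= 1" using s by (intro bexI[of _ s]) auto
   have h: "Z (rh w) w >= 1" "rh w <= s" "0 <= rh w" using hit_attained[OF cZ w ex] s \<open>Z s w >= 1\<close> unfolding rh_def by auto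
   hence "\<bar>R (rh w) w\<bar> >= de" using V[of "rh w"] s de et by (auto simp: Z_def le_max_iff_disj field_simps)
   hence "de^2 <= (stp rh R T w)^2" using h s de by (simp add: stp_def min_absorb2 abs_le_square_iff[symmetric])
   moreover have "ind (supgt R T de - ?B) w = (1::real)" using True by (rule indicator_simps(1))
   ultimately show ?thesis by simp
  qed
 qed
 also have "... = (LINT w|M. stp rh V T w)" using E0 iR iV by simp
 finally have "measure M (supgt R T de - ?B) * de^2 <= (LINT w|M. stp rh V T w)" by (simp only: mult.commute)
 hence "measure M (supgt R T de - ?B) <= (LINT w|M. stp rh V T w) / de^2" by (subst pos_le_divide_eq) (use de in simp_all)
 moreover have "measure M (supgt R T de) <= measure M ((supgt R T de - ?B) \<union> ?B)" by (intro finite_measure_mono) auto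
 moreover have "measure M ((supgt R T de - ?B) \<union> ?B) <= measure M (supgt R T de - ?B) + measure M ?B" by (intro measure_Un_le) auto
 ultimately have fin: "measure M (supgt R T de) <= (LINT w|M. stp rh V T w) / de^2 + measure M ?B" by linarith
 have eq: "stp rh V T = (%w. V (min T (rh w)) w)" by (auto simp: stp_def)
 show thesis
 proof (rule that[of "%w. min T (rh w)"])
  show "w \<in> space M ==> 0 <= min T (rh w) & min T (rh w) <= T & V (min T (rh w)) w <= et" for w using Vle[OF T, of w] rh0 T by (simp add: stp_def)
  show "(%w. V (min T (rh w)) w) \<in> bm M" unfolding eq[symmetric] by measurable
  show "measure M (supgt R T de) <= (LINT w|M. V (min T (rh w)) w) / de^2 + measure M ?B" using fin unfolding eq .
 qed
qed

lemma lenglart: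
 assumes U: "clm (%t w. (R t w)^2 - V t w)" and cR: "cap R" and cV: "cap V"
  and R0: "!!w. w \<in> space M ==> R 0 w = 0" and V0: "!!w. w \<in> space M ==> V 0 w = 0"
  and Vpos: "!!t w. 0 <= t ==> w \<in> space M ==> 0 <= V t w"
  and de: "0 < de" and et: "0 < et"
 shows "measure M (supgt R T de) <= et / de^2 + measure M {w \<in> space M. \<exists>t\<in>{0..T}. V t w >= et}"
proof (cases "0 <= T")
 case True
 from lenglart_core[OF U cR cV R0 V0 Vpos True de et]
 obtain si where si: "!!w. w \<in> space M ==> 0 <= si w & si w <= T & V (si w) w <= et"
  and m: "(%w. V (si w) w) \<in> bm M"
  and le: "measure M (supgt R T de) <= (LINT w|M. V (si w) w) / de^2 + measure M {w \<in> space M. \<exists>t\<in>{0..T}. V t w >= et}" by blast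
 have "(LINT w|M. V (si w) w) <= (LINT w|M. et)" using si m Vpos et by (intro integral_mono integrable_const_bound[where B=et]) auto
 also have "... = et" by (simp add: prob_space)
 finally have "(LINT w|M. V (si w) w) / de^2 <= et / de^2" using de by (intro divide_right_mono) auto
 with le show ?thesis by linarith
qed (use et in simp)

text \<open>A threshold above the bound \<open>B\<close> is never reached, so the second term of
  Lenglart's inequality disappears and the mean of \<open>V T\<close> takes the place of the
  threshold. This is the quantitative form from which summable tails are obtained.\<close>

lemma lenglart_bounded:
 assumes U: "clm (%t w. (R t w)^2 - V t w)" and cR: "cap R" and cV: "cap V"
  and R0: "!!w. w \<in> space M ==> R 0 w = 0" and V0: "!!w. w \<in> space M ==> V 0 w = 0"
  and mono: "!!s t w. 0 <= s ==> s <= t ==> w \<in> space M ==> V s w <= V t w"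
  and B: "!!w. w \<in> space M ==> V T w <= B"
  and de: "0 < de" and T: "0 <= T"
 shows "measure M (supgt R T de) <= (LINT w|M. V T w) / de^2"
proof -
 have Vpos: "0 <= V t w" if "0 <= t" "w \<in> space M" for t w using mono[of 0 t w] V0 that by simp
 define et where "et = \<bar>B\<bar> + 1"
 have et: "0 < et" by (simp add: et_def add_nonneg_pos)
 from lenglart_core[OF U cR cV R0 V0 Vpos T de et]
 obtain si where si: "!!w. w \<in> space M ==> 0 <= si w & si w <= T & V (si w) w <= et"
  and m: "(%w. V (si w) w) \<in> bm M"
  and le: "measure M (supgt R T de) <= (LINT w|M. V (si w) w) / de^2 + measure M {w \<in> space M. \<exists>t\<in>{0..T}. V t w >= et}" by blast
 have VB: "V t w < et" if "t \<in> {0..T}" "w \<in> space M" for t w using mono[of t T w] B[of w] that by (simp add: et_def)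
 hence e: "{w \<in> space M. \<exists>t\<in>{0..T}. V t w >= et} = {}" by force
 have "(LINT w|M. V (si w) w) <= (LINT w|M. V T w)"
 proof (intro integral_mono)
  show "integrable M (%w. V (si w) w)" using si m Vpos by (intro integrable_const_bound[where B=et]) auto
  show "integrable M (V T)"
   using VB[of T] T Vpos cap_measurable_M[OF cV T] by (intro integrable_const_bound[where B=et]) (auto intro!: AE_I2 less_imp_le)
  show "V (si w) w <= V T w" if "w \<in> space M" for w using mono[of "si w" T w] si[OF that] that by auto
 qed
 hence "(LINT w|M. V (si w) w) / de^2 <= (LINT w|M. V T w) / de^2" using de by (intro divide_right_mono) auto
 with le show ?thesis unfolding e by simp
qed

lemma lenglart_ucp:
 assumes U: "!!m. clm (%t w. (R m t w)^2 - V m t w)" and cR: "!!m. cap (R m)"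
  and R0: "!!m w. w \<in> space M ==> R m 0 w = 0" and V0: "!!m w. w \<in> space M ==> V m 0 w = 0"
  and Vpos: "!!m t w. 0 <= t ==> w \<in> space M ==> 0 <= V m t w"
  and V: "ucp V"
 shows "ucp R" unfolding ucp_def
proof (intro conjI allI impI cR)
 fix T de :: real assume de: "0 < de"
 show "(%m. measure M (supgt (R m) T de)) ----> 0"
 proof (rule LIMSEQ_I)
  fix r :: real assume r: "0 < r"
  \<comment> \<open>Makes the Chebyshev term equal to r / 2. For \<open>V\<close> half of the
    threshold is used, since Lenglart's inequality speaks of reaching a level and \<open>ucp\<close>
    of strictly exceeding it.\<close>
  define et where "et = de^2 * r / 2"
  have et: "0 < et" "et / 2 > 0" using de r by (auto simp: et_def)
  from order_tendstoD(2)[OF ucpD[OF V et(2), of T], of "r/2"] r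
  obtain n where n: "!!m. m >= n ==> measure M (supgt (V m) T (et/2)) < r/2" unfolding eventually_sequentially by auto
  have "measure M (supgt (R m) T de) < r" if "m >= n" for m
  proof -
   have "measure M {w \<in> space M. \<exists>t\<in>{0..T}. V m t w >= et} <= measure M (supgt (V m) T (et/2))"
   proof (intro finite_measure_mono supgt_measurable ucp_cap[OF V] subsetI)
    fix w assume "w \<in> {w \<in> space M. \<exists>t\<in>{0..T}. V m t w >= et}"
    then obtain t where "w \<in> space M" "t \<in> {0..T}" "V m t w >= et" by blast
    thus "w \<in> supgt (V m) T (et/2)" using et by (auto intro!: bexI[of _ t])
   qed
   moreover have bnd: "measure M (supgt (R m) T de) <= et / de^2 + measure M {w \<in> space M. \<exists>t\<in>{0..T}. V m t w >= et}"
    by (rule lenglart[OF U cR ucp_cap[OF V] R0 V0 Vpos de et(1)])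
   moreover have "et / de^2 = r / 2" using de by (simp add: et_def)
   ultimately show ?thesis using bnd n[OF that] by simp
  qed
  thus "\<exists>no. \<forall>m\<ge>no. norm (measure M (supgt (R m) T de) - 0) < r" by (intro exI[of _ n]) auto
 qed
qed

text \<open>\<open>C\<close> plays the role of the bracket of \<open>N\<close> and
  \<open>N'\<close>. It is asked to be continuous and adapted, not of bounded variation, so the
  relation is bilinear and closed under limits without further discussion.\<close>

definition cov :: "(real => 'w => real) => (real => 'w => real) => (real => 'w => real) => bool" where
 "cov N N' C \<longleftrightarrow> clm N & clm N' & cap C & clm (%t w. N t w * N' t w - C t w)"

lemma cov_sym: "cov N N' C ==> cov N' N C" by (simp add: cov_def mult.commute)

lemma cov_add_left: "cov N N' C ==> cov L N' D ==> cov (%t w. N t w + L t w) N' (%t w. C t w + D t w)"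
 using clm_add[of "%t w. N t w * N' t w - C t w" "%t w. L t w * N' t w - D t w"] by (simp add: cov_def clm_add cap_add algebra_simps)

lemma cov_cmult_left: "cov N N' C ==> cov (%t w. c * N t w) N' (%t w. c * C t w)" using clm_cmult[of "%t w. N t w * N' t w - C t w" c]
 by (simp add: cov_def clm_cmult cap_cmult algebra_simps)

lemma cov_diff_left: "cov N N' C ==> cov L N' D ==> cov (%t w. N t w - L t w) N' (%t w. C t w - D t w)"
 using cov_add_left[of N N' C "%t w. -1 * L t w" "%t w. -1 * D t w"] cov_cmult_left[of L N' D "-1"] by simp

lemma cov_diff_diff:
 assumes "cov N N C" "cov N L D" "cov L L E"
 shows "cov (%t w. N t w - L t w) (%t w. N t w - L t w) (%t w. C t w - D t w - (D t w - E t w))"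
 by (intro cov_diff_left cov_sym[OF cov_diff_left] cov_sym[OF assms(2)] assms)

lemma cov_zero_left: "clm N ==> cov (%t w. 0) N (%t w. 0)" by (simp add: cov_def clm_zero cap_const)

lemma cov_sum_left:
 "finite I ==> clm N' ==> (!!i. i \<in> I ==> cov (N i) N' (C i)) ==> cov (%t w. \<Sum>i\<in>I. N i t w) N' (%t w. \<Sum>i\<in>I. C i t w)"
 by (induction I rule: finite_induct) (auto intro: cov_zero_left cov_add_left)

text \<open>With P = N N' - C, the process el(N) N' - el(C) is the elementary integral of
  \<open>xi\<close> against P plus that of -xi N_u against N'. The second coefficient is unbounded
  in general, which is why \<open>clm_el\<close> imposes no bound.\<close>

lemma cov_el_left:
 assumes c: "cov N N' C" and u: "0 <= u" and xi: "xi \<in> bm (F u)"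
 shows "cov (el u xi N) N' (el u xi C)"
proof -
 have N: "clm N" "clm N'" "cap C" "clm (%t w. N t w * N' t w - C t w)" using c by (auto simp: cov_def)
 have Nu: "N u \<in> bm (F u)" using cap_measurable[OF clm_cap[OF N(1)] u order_refl] .
 have "clm (%t w. el u xi (%t w. N t w * N' t w - C t w) t w + el u (%w. - xi w * N u w) N' t w)"
  using xi Nu by (intro clm_add clm_el N u) (auto intro: borel_measurable_times borel_measurable_uminus)
 hence "clm (%t w. el u xi N t w * N' t w - el u xi C t w)"
 proof (rule clm_cong)
  fix t w
  show "el u xi (%t w. N t w * N' t w - C t w) t w + el u (%w. - xi w * N u w) N' t w = el u xi N t w * N' t w - el u xi C t w"
   by (cases "t <= u") (simp_all add: el_def min_def algebra_simps)
 qed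
 thus ?thesis using N by (auto simp: cov_def intro: clm_el[OF _ u xi] cap_el[OF _ u xi])
qed

text \<open>Like \<open>simple_data\<close>, but with possibly unbounded coefficients, so that
  left-point Riemann sums of every continuous adapted process qualify.\<close>

definition udata :: "nat => (nat => real) => (nat => 'w => real) => bool" where
 "udata n u xi \<longleftrightarrow> 0 <= u 0 & (\<forall>i<n. u i <= u (Suc i) & xi i \<in> bm (F (u i)))"

lemma simple_data_udata: "simple_data M F n u xi ==> udata n u xi" by (auto simp: simple_data_def udata_def)

lemma udata_mono: assumes "udata n u xi" "i <= j" "j <= n" shows "u i <= u j" using assms(2,3)
proof (induction j rule: dec_induct)
 case (step k) thus ?case using assms(1) unfolding udata_def by (meson Suc_le_eq less_imp_le order_trans)
qed simp

lemma udata_nonneg: "udata n u xi ==> i <= n ==> 0 <= u i" using udata_mono[of n u xi 0 i] by (auto simp: udata_def)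

lemma sint_eq_el: "simple_integral n u xi Z t w = (\<Sum>i<n. el (u i) (xi i) Z t w - el (u (Suc i)) (xi i) Z t w)"
 by (auto simp: simple_integral_def el_def min.commute algebra_simps intro!: sum.cong)

lemma udata_el: assumes "udata n u xi" "i < n"
 shows "0 <= u i" "0 <= u (Suc i)" "xi i \<in> bm (F (u i))" "xi i \<in> bm (F (u (Suc i)))"
 using udata_nonneg[OF assms(1)] assms measurable_F_mono[of "xi i" "u i" borel "u (Suc i)"] by (auto simp: udata_def)

lemma cap_sint: assumes "cap Z" "udata n u xi" shows "cap (simple_integral n u xi Z)"
 using udata_el[OF assms(2)] unfolding sint_eq_el[abs_def] by (intro cap_sum cap_diff cap_el assms) auto

lemma clm_sint: assumes "clm Z" "udata n u xi" shows "clm (simple_integral n u xi Z)"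
 using udata_el[OF assms(2)] unfolding sint_eq_el[abs_def] by (intro clm_sum clm_diff clm_el assms) auto

lemma cov_sint_left:
 assumes "cov N N' C" "udata n u xi"
 shows "cov (simple_integral n u xi N) N' (simple_integral n u xi C)" using udata_el[OF assms(2)] assms(1) unfolding sint_eq_el[abs_def]
 by (intro cov_sum_left cov_diff_left cov_el_left assms) (auto simp: cov_def)

lemma cov_sint:
 assumes "cov N N' C" "udata n u xi" "udata n' u' xi'"
 shows "cov (simple_integral n u xi N) (simple_integral n' u' xi' N') (simple_integral n u xi (simple_integral n' u' xi' C))"
 by (intro cov_sint_left[OF cov_sym[OF cov_sint_left[OF cov_sym]]] assms)

lemma sint_0: assumes "udata n u xi" shows "simple_integral n u xi Z 0 w = 0"
 unfolding simple_integral_def using udata_nonneg[OF assms] by (intro sum.neutral) (simp add: min_absorb2)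

lemma cov_ucp_limit:
 assumes c: "!!m. cov (R m) (R' m) (C m)"
  and lim: "ucp (%m t w. R m t w - P t w)" "ucp (%m t w. R' m t w - P' t w)" "ucp (%m t w. C m t w - D t w)"
  and cap: "cap P" "cap P'" "cap D"
  and z: "!!m w. w \<in> space M ==> R m 0 w = 0" "!!m w. w \<in> space M ==> R' m 0 w = 0" "!!m w. w \<in> space M ==> C m 0 w = 0"
   "!!w. w \<in> space M ==> P 0 w = 0" "!!w. w \<in> space M ==> P' 0 w = 0" "!!w. w \<in> space M ==> D 0 w = 0"
 shows "cov P P' D" unfolding cov_def
proof (intro conjI cap)
 show "clm P" "clm P'" using c cap z lim by (auto simp: cov_def intro!: clm_ucp_limit[of R P] clm_ucp_limit[of R' P'])
 show "clm (%t w. P t w * P' t w - D t w)"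
 proof (rule clm_ucp_limit[where P="%m t w. R m t w * R' m t w - C m t w"])
  have "ucp (%m t w. (R m t w * R' m t w - P t w * P' t w) - (C m t w - D t w))" by (intro ucp_diff ucp_products lim cap)
  thus "ucp (%m t w. R m t w * R' m t w - C m t w - (P t w * P' t w - D t w))" by (simp add: algebra_simps)
 qed (use c z in \<open>auto simp: cov_def intro!: cap_diff cap_mult cap\<close>)
qed

end

section \<open>Sums of measures and Riemann grids\<close>

definition msum :: "'a measure => 'a measure => 'a measure" where "msum P N = measure_of (space P) (sets P) (%A. emeasure P A + emeasure N A)"

lemma sets_msum [simp, measurable_cong]: "sets (msum P N) = sets P" by (simp add: msum_def)

lemma space_msum [simp]: "space (msum P N) = space P" by (simp add: msum_def space_measure_of_conv)

lemma emeasure_msum: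
 assumes "sets N = sets P" "A \<in> sets P"
 shows "emeasure (msum P N) A = emeasure P A + emeasure N A"
proof (rule emeasure_measure_of[OF msum_def])
 show "countably_additive (sets (msum P N)) (%A. emeasure P A + emeasure N A)"
  using assms(1) by (auto simp: countably_additive_def suminf_add[symmetric] suminf_emeasure)
qed (use assms sets.sets_into_space in \<open>auto simp: positive_def\<close>)

lemma nn_integral_msum:
 assumes s: "sets N = sets P" and f: "f \<in> bm P"
 shows "(\<integral>\<^sup>+x. f x \<partial>msum P N) = (\<integral>\<^sup>+x. f x \<partial>P) + (\<integral>\<^sup>+x. f x \<partial>N)" using f
proof (induction rule: borel_measurable_induct)
 case (cong f g)
 have "(\<integral>\<^sup>+x. f x \<partial>N) = (\<integral>\<^sup>+x. g x \<partial>N)" using cong(3) sets_eq_imp_space_eq[OF s] by (intro nn_integral_cong) auto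
 thus ?case using cong by (simp cong: nn_integral_cong_simp)
next
 case (set A)
 thus ?case using s by (simp add: emeasure_msum)
next
 case (mult u c)
 have "u \<in> bm N" using mult(2) s by (simp cong: measurable_cong_sets)
 moreover have "u \<in> bm (msum P N)" using mult(2) by (simp cong: measurable_cong_sets)
 ultimately show ?case using mult by (simp add: nn_integral_cmult distrib_left)
next
 case (add u v)
 have "u \<in> bm N" "v \<in> bm N" using add s by (simp_all cong: measurable_cong_sets)
 moreover have "u \<in> bm (msum P N)" "v \<in> bm (msum P N)" using add by (simp_all cong: measurable_cong_sets)
 ultimately show ?case using add by (simp add: nn_integral_add algebra_simps)
next
 case (seq U)
 have "U i \<in> bm N" "U i \<in> bm (msum P N)" for i using seq s by (simp_all cong: measurable_cong_sets)
 hence "(\<integral>\<^sup>+x. (SUP i. U i) x \<partial>msum P N) = (SUP i. \<integral>\<^sup>+x. U i x \<partial>P) + (SUP i. \<integral>\<^sup>+x. U i x \<partial>N)"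
  using seq by (simp add: nn_integral_monotone_convergence_SUP image_comp SUP_apply)
   (subst ennreal_SUP_add; simp add: incseq_def le_fun_def nn_integral_mono)
 thus ?case using seq \<open>!!i. U i \<in> bm N\<close> by (simp add: nn_integral_monotone_convergence_SUP image_comp SUP_apply)
qed

lemma measure_eqI_Ioc:
 fixes P N :: "real measure"
 assumes sets: "sets P = sets borel" "sets N = sets borel"
  and eq: "!!a b. a <= b ==> emeasure P {a<..b} = emeasure N {a<..b}"
  and fin: "!!a b. a <= b ==> emeasure P {a<..b} ~= \<infinity>"
 shows "P = N"
proof (rule measure_eqI_generator_eq)
 let ?E = "range (%(a, b). {a<..b::real})"
 show "Int_stable ?E" by (auto simp: Int_stable_def)
 show "sets P = sigma_sets UNIV ?E" "sets N = sigma_sets UNIV ?E" unfolding sets borel_sigma_sets_Ioc by auto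
 show "range (%n. {- real n<..real n}) \<subseteq> ?E" by auto
 show "(\<Union>n. {- real n<..real n}) = UNIV"
 proof (intro equalityI subsetI UN_iff[THEN iffD2])
  fix x :: real
  obtain n where "\<bar>x\<bar> < real n" using reals_Archimedean2 by blast
  thus "\<exists>n\<in>UNIV. x \<in> {- real n<..real n}" by (intro bexI[of _ n]) auto
 qed auto
 show "emeasure P {- real n<..real n} ~= \<infinity>" for n by (rule fin) simp
 fix X assume "X \<in> ?E"
 then obtain a b where X: "X = {a<..b}" by auto
 show "emeasure P X = emeasure N X" unfolding X by (cases "a <= b") (auto intro: eq)
qed simp

text \<open>Grid m has mesh 1 / (m + 1) and (m + 1)^2 cells, so it reaches up to time m + 1:
  refinement and growing horizon are governed by one index.\<close>

definition gr :: "nat => nat => real" where "gr m i = real i / real (Suc m)"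
definition gn :: "nat => nat" where "gn m = (Suc m)^2"

lemma gr_nonneg [simp]: "0 <= gr m i" by (simp add: gr_def)
lemma gr_mono [simp]: "gr m i <= gr m (Suc i)" by (simp add: gr_def divide_right_mono)
lemma gr_mono': "i <= j ==> gr m i <= gr m j" by (simp add: gr_def divide_right_mono)
lemma real_gn: "real (gn m) = real (Suc m) * real (Suc m)" by (simp only: gn_def power2_eq_square of_nat_mult)
lemma gr_last: "gr m (gn m) = real (Suc m)" by (simp add: gr_def real_gn)
lemma gr_step: "gr m (Suc i) = gr m i + 1 / real (Suc m)" by (simp add: gr_def add_divide_distrib)

abbreviation rp :: "nat => (real => 'w => real) => real => 'w => real" where "rp m H == simple_process (gn m) (gr m) (%i. H (gr m i))"

abbreviation rsum :: "nat => (real => 'w => real) => (real => 'w => real) => real => 'w => real" where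
 "rsum m H Z == simple_integral (gn m) (gr m) (%i. H (gr m i)) Z"

lemma rp_value:
 assumes s: "0 < s" "s <= real (Suc m)"
 shows "\<exists>i<gn m. gr m i < s & s <= gr m (Suc i) & rp m H s w = H (gr m i) w"
proof -
 define k where "k = nat \<lceil>real (Suc m) * s\<rceil>"
 have pos: "0 < real (Suc m) * s" using s by simp
 have k: "real (Suc m) * s <= real k" "real k < real (Suc m) * s + 1" "0 < k" using pos unfolding k_def by linarith+
 define i where "i = k - 1"
 have ki: "k = Suc i" using k by (simp add: i_def)
 have "real (Suc m) * s <= real (Suc m) * real (Suc m)" using s by (intro mult_left_mono) auto
 hence "real k < real (gn m) + 1" using k(2) unfolding real_gn by linarith
 hence i: "i < gn m" using ki by linarith
 have gs: "gr m i < s" "s <= gr m (Suc i)" using k ki by (simp_all add: gr_def pos_divide_less_eq pos_le_divide_eq mult.commute del: of_nat_Suc)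
 have "rp m H s w = H (gr m i) w"
 proof -
  have "ind {gr m j<..gr m (Suc j)} s = (if j = i then 1 else 0::real)" for j
  proof (cases "j = i")
   case False
   then consider "Suc j <= i" | "Suc i <= j" by linarith
   thus ?thesis using gr_mono'[of "Suc j" i m] gr_mono'[of "Suc i" j m] gs False by cases auto
  qed (use gs in auto)
  hence "rp m H s w = (\<Sum>j<gn m. if j = i then H (gr m j) w else 0)" unfolding simple_process_def by (intro sum.cong) auto
  thus ?thesis using i by (simp add: sum.delta)
 qed
 with i gs show ?thesis by blast
qed

text \<open>Uniform continuity on [0, T]. Time 0 is left out because simple processes are built from
  left-open intervals and vanish there.\<close>

lemma rp_uniform:
 assumes c: "continuous_on {0..} (%t. H t w)" and e: "0 < e"
 shows "EV m. \<forall>s\<in>{0<..T}. \<bar>rp m H s w - H s w\<bar> <= e"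
proof -
 have "uniformly_continuous_on {0..T} (%t. H t w)" by (intro compact_uniformly_continuous continuous_on_subset[OF c]) auto
 then obtain d where d: "d > 0" "!!x y. x \<in> {0..T} ==> y \<in> {0..T} ==> dist y x < d ==> dist (H y w) (H x w) < e"
  unfolding uniformly_continuous_on_def using e by metis
 have "(%m. 1 / real (Suc m)) ----> 0" by (rule LIMSEQ_Suc[OF lim_1_over_n])
 from order_tendstoD(2)[OF this d(1)] have "EV m. 1 / real (Suc m) < d" .
 moreover have "EV m. T <= real m" using filterlim_real_sequentially unfolding filterlim_at_top by blast
 ultimately show ?thesis
 proof eventually_elim
  case (elim m)
  show ?case
  proof
   fix s assume s: "s \<in> {0<..T}"
   hence "0 < s" "s <= real (Suc m)" using elim by auto
   then obtain i where i: "gr m i < s" "s <= gr m (Suc i)" "rp m H s w = H (gr m i) w" using rp_value[of s m H w] by blast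
   have "dist (gr m i) s < d" using i elim by (simp add: dist_real_def gr_step)
   moreover have "s \<in> {0..T}" "gr m i \<in> {0..T}" using i s by simp_all
   ultimately have "dist (H (gr m i) w) (H s w) < e" by (intro d(2)) auto
   thus "\<bar>rp m H s w - H s w\<bar> <= e" unfolding i(3) by (simp add: dist_real_def)
  qed
 qed
qed

lemma simple_process_measurable [measurable]: "(%s. simple_process n u xi s w) \<in> bm borel" unfolding simple_process_def by measurable

lemma simple_process_bounded: "\<bar>simple_process n u xi s w\<bar> <= (\<Sum>i<n. \<bar>xi i w\<bar>)" unfolding simple_process_def
proof (rule order_trans[OF sum_abs], rule sum_mono)
 show "\<bar>xi i w * ind {u i<..u (Suc i)} s\<bar> <= \<bar>xi i w\<bar>" for i by (simp add: indicator_def)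
qed

section \<open>Stieltjes integrals along the paths of increasing processes\<close>

context stoch_base
begin

abbreviation ci :: "(real => 'w => real) => bool" where "ci == continuous_increasing M F"

lemma ci_cap: "ci A ==> cap A" by (simp add: continuous_increasing_def cap_def)

lemma ci_0: "ci A ==> w \<in> space M ==> A 0 w = 0" by (simp add: continuous_increasing_def)

lemma ci_mono: "ci A ==> w \<in> space M ==> 0 <= s ==> s <= t ==> A s w <= A t w" by (auto simp: continuous_increasing_def mono_on_def)

lemma ci_nonneg: "ci A ==> w \<in> space M ==> 0 <= t ==> 0 <= A t w" using ci_mono[of A w 0 t] ci_0[of A w] by simp

lemma ci_add: "ci A ==> ci B ==> ci (%t w. A t w + B t w)"
 using cap_add[of A B] by (auto simp: continuous_increasing_def cap_def mono_on_def intro!: add_mono)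

lemma ci_cmult: "ci A ==> 0 <= c ==> ci (%t w. c * A t w)"
 using cap_cmult[of A c] by (auto simp: continuous_increasing_def cap_def mono_on_def intro!: mult_left_mono)

lemma ciI: "cap A ==> (!!w. w \<in> space M ==> A 0 w = 0) ==> (!!w s t. w \<in> space M ==> 0 <= s ==> s <= t ==> A s w <= A t w) ==> ci A"
 by (auto simp: continuous_increasing_def cap_def mono_on_def)

lemma sets_pm [simp, measurable_cong]: "sets (pm A w) = sets borel" by (simp add: path_measure_def)

lemma space_pm [simp]: "space (pm A w) = UNIV" by (simp add: path_measure_def)

lemma pm_function:
 assumes A: "ci A" and w: "w \<in> space M"
 shows "x <= y ==> A (max 0 x) w <= A (max 0 y) w" "continuous_on UNIV (%t. A (max 0 t) w)" "continuous (at_right a) (%t. A (max 0 t) w)"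
proof -
 show "x <= y ==> A (max 0 x) w <= A (max 0 y) w" by (rule ci_mono[OF A w]) auto
 show c: "continuous_on UNIV (%t. A (max 0 t) w)" by (intro continuous_on_compose2[OF cap_continuous[OF ci_cap[OF A] w]] continuous_intros) auto
 show "continuous (at_right a) (%t. A (max 0 t) w)" using c by (auto simp: continuous_on_eq_continuous_within intro: continuous_within_subset)
qed

lemma emeasure_pm_Ioc:
 assumes "ci A" "w \<in> space M" "a <= b"
 shows "emeasure (pm A w) {a<..b} = ennreal (A (max 0 b) w - A (max 0 a) w)"
 unfolding path_measure_def using pm_function[OF assms(1,2)] assms(3) by (intro emeasure_interval_measure_Ioc) auto

lemma emeasure_pm_Icc:
 assumes "ci A" "w \<in> space M" "0 <= t"
 shows "emeasure (pm A w) {0..t} = ennreal (A t w)"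
proof -
 have "emeasure (pm A w) {0..t} = ennreal (A (max 0 t) w - A (max 0 0) w)"
  unfolding path_measure_def using pm_function[OF assms(1,2)] assms(3) by (intro emeasure_interval_measure_Icc) auto
 thus ?thesis using assms ci_0[OF assms(1,2)] by (simp add: max_def)
qed

lemma pm_bounded_integrable:
 fixes g :: "real => real"
 assumes A: "ci A" and w: "w \<in> space M" and g: "g \<in> bm borel"
  and B: "!!s. s \<in> {0..t} ==> \<bar>g s\<bar> <= B"
 shows "set_integrable (pm A w) {0..t} g"
proof (cases "0 <= t")
 case True
 show ?thesis unfolding set_integrable_def
 proof (rule integrableI_bounded_set[where A="{0..t}" and B=B])
  show "(%x. ind {0..t} x *\<^sub>R g x) \<in> bm (pm A w)" using g by measurable
  show "emeasure (pm A w) {0..t} < \<infinity>" using emeasure_pm_Icc[OF A w True] by simp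
 qed (use B in \<open>auto simp: indicator_def\<close>)
qed (simp add: set_integrable_def)

text \<open>The indicator of (u i, u (i + 1)], restricted to [0, t], is the difference of the
  indicators of two intervals starting at 0 and cut at t; the rest is linearity.\<close>

lemma pm_simple_integral:
 assumes A: "ci A" and w: "w \<in> space M" and u: "udata n u xi" and t: "0 <= t"
  and g: "!!t. set_integrable (pm A w) {0..t} g"
 shows "(LINT s:{0..t}|pm A w. simple_process n u xi s w * g s) = simple_integral n u xi (%t _. LINT s:{0..t}|pm A w. g s) t w"
proof -
 let ?P = "pm A w"
 have g': "integrable ?P (%s. ind {0..t} s * g s)" for t using g[of t] by (simp add: set_integrable_def)
 have eq: "ind {0..t} s * (simple_process n u xi s w * g s) =
   (\<Sum>i<n. xi i w * (ind {0..min (u (Suc i)) t} s * g s - ind {0..min (u i) t} s * g s))" for s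
 proof -
  have "ind {0..t} s * (ind {u i<..u (Suc i)} s * g s) = ind {0..min (u (Suc i)) t} s * g s - ind {0..min (u i) t} s * g s" if "i < n" for i
   using udata_el[OF u that] that u by (auto simp: indicator_def udata_def)
  note * = this
  have "ind {0..t} s * (simple_process n u xi s w * g s) = (\<Sum>i<n. xi i w * (ind {0..t} s * (ind {u i<..u (Suc i)} s * g s)))"
   unfolding simple_process_def sum_distrib_left sum_distrib_right by (intro sum.cong refl) (simp only: ac_simps)
  also have "... = (\<Sum>i<n. xi i w * (ind {0..min (u (Suc i)) t} s * g s - ind {0..min (u i) t} s * g s))"
   by (intro sum.cong refl) (simp only: * lessThan_iff)
  finally show ?thesis .
 qed
 show ?thesis unfolding set_lebesgue_integral_def real_scaleR_def eq simple_integral_def using g'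
  by (subst Bochner_Integration.integral_sum) (auto intro!: sum.cong)
qed

lemma simple_integral_pm:
 assumes A: "ci A" and w: "w \<in> space M" and u: "udata n u xi" and t: "0 <= t"
 shows "simple_integral n u xi A t w = (LINT s:{0..t}|pm A w. simple_process n u xi s w)"
proof -
 have "(LINT s:{0..t}|pm A w. 1) = A t w" if "0 <= t" for t
  using emeasure_pm_Icc[OF A w that] ci_nonneg[OF A w that] by (simp add: set_lebesgue_integral_def measure_def)
 hence "simple_integral n u xi A t w = simple_integral n u xi (%t _. LINT s:{0..t}|pm A w. 1) t w"
  unfolding simple_integral_def using udata_el[OF u] t by (intro sum.cong) auto
 also have "... = (LINT s:{0..t}|pm A w. simple_process n u xi s w * 1)"
  by (rule pm_simple_integral[OF A w u t, symmetric]) (rule pm_bounded_integrable[OF A w, where B=1], auto)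
 finally show ?thesis by simp
qed

text \<open>Turns the iterated sum that \<open>cov_sint\<close> yields as a bracket into a pathwise
  integral of a product, where positivity and estimates are visible.\<close>

lemma simple_integral_pm2:
 assumes A: "ci A" and w: "w \<in> space M" and u: "udata n u xi" "udata n' u' xi'" and t: "0 <= t"
 shows "simple_integral n u xi (simple_integral n' u' xi' A) t w = (LINT s:{0..t}|pm A w. simple_process n u xi s w * simple_process n' u' xi' s w)"
proof -
 have "simple_integral n u xi (simple_integral n' u' xi' A) t w =
   simple_integral n u xi (%t _. LINT s:{0..t}|pm A w. simple_process n' u' xi' s w) t w"
  unfolding simple_integral_def[of n u] using udata_el[OF u(1)] t simple_integral_pm[OF A w u(2)] by (intro sum.cong) auto
 also have "... = (LINT s:{0..t}|pm A w. simple_process n u xi s w * simple_process n' u' xi' s w)"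
  by (rule pm_simple_integral[OF A w u(1) t, where g="%s. simple_process n' u' xi' s w", symmetric])
    (rule pm_bounded_integrable[OF A w _ simple_process_bounded], measurable)
 finally show ?thesis .
qed

lemma pm_simple_integrable:
 assumes A: "ci A" and w: "w \<in> space M"
 shows "set_integrable (pm A w) {0..t} (%s. simple_process n u xi s w * simple_process n' u' xi' s w)"
  and "set_integrable (pm A w) {0..t} (%s. simple_process n u xi s w)"
proof -
 show "set_integrable (pm A w) {0..t} (%s. simple_process n u xi s w * simple_process n' u' xi' s w)"
 proof (rule pm_bounded_integrable[OF A w])
  fix s
  show "\<bar>simple_process n u xi s w * simple_process n' u' xi' s w\<bar> <= (\<Sum>i<n. \<bar>xi i w\<bar>) * (\<Sum>i<n'. \<bar>xi' i w\<bar>)"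
   unfolding abs_mult by (intro mult_mono simple_process_bounded) (auto intro: sum_nonneg)
 qed measurable
 show "set_integrable (pm A w) {0..t} (%s. simple_process n u xi s w)" by (rule pm_bounded_integrable[OF A w _ simple_process_bounded]) measurable
qed

lemma pm_add:
 assumes "ci A" "ci B" "w \<in> space M"
 shows "pm (%t w. A t w + B t w) w = msum (pm A w) (pm B w)"
proof (rule measure_eqI_Ioc)
 fix a b :: real assume ab: "a <= b"
 show "emeasure (pm (%t w. A t w + B t w) w) {a<..b} = emeasure (msum (pm A w) (pm B w)) {a<..b}"
  using emeasure_pm_Ioc[OF ci_add[OF assms(1,2)] assms(3) ab] emeasure_pm_Ioc[OF assms(1,3) ab] emeasure_pm_Ioc[OF assms(2,3) ab]
   pm_function(1)[OF assms(1,3) ab] pm_function(1)[OF assms(2,3) ab] by (simp add: emeasure_msum ennreal_plus[symmetric] del: ennreal_plus)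
 show "emeasure (pm (%t w. A t w + B t w) w) {a<..b} ~= \<infinity>" using emeasure_pm_Ioc[OF ci_add[OF assms(1,2)] assms(3) ab] by simp
qed auto

text \<open>The mass of the path measure on [0, T] is finite but not bounded in w. Dividing by 1 +
  A_T makes the restricted measures a kernel of subprobabilities, whose measurability is tested on
  half-open intervals, where the mass is a difference of values of \<open>A\<close>.\<close>

lemma pm_integral_measurable:
 assumes A: "ci A" and T: "0 <= T" and g: "(%(w, s). g w s) \<in> bm (M \<Otimes>\<^sub>M borel)"
 shows "(%w. \<integral>\<^sup>+s\<in>{0..T}. g w s \<partial>pm A w) \<in> bm M"
proof -
 have Am[measurable]: "A s \<in> bm M" if "0 <= s" for s using cap_measurable_M[OF ci_cap[OF A] that] .
 define ka where "ka w = density (pm A w) (%s. ind {0..T} s / ennreal (1 + A T w))" for w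
 have [measurable]: "A T \<in> bm M" by (rule Am[OF T])
 have pos: "0 < 1 + A T w" if "w \<in> space M" for w using ci_nonneg[OF A that T] by simp
 have em: "emeasure (ka w) X = emeasure (pm A w) (X \<inter> {0..T}) / ennreal (1 + A T w)" if "X \<in> sets borel" for X w
 proof -
  have "emeasure (ka w) X = (\<integral>\<^sup>+s. ind {0..T} s / ennreal (1 + A T w) * ind X s \<partial>pm A w)"
   using that unfolding ka_def by (subst emeasure_density) auto
  also have "... = (\<integral>\<^sup>+s. ind (X \<inter> {0..T}) s / ennreal (1 + A T w) \<partial>pm A w)"
   by (intro nn_integral_cong) (auto simp: indicator_def)
  also have "... = emeasure (pm A w) (X \<inter> {0..T}) / ennreal (1 + A T w)" using that by (subst nn_integral_divide) auto
  finally show ?thesis .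
 qed
 have Ioc: "emeasure (pm A w) ({a<..b} \<inter> {0..T}) = ennreal (A (max 0 (min b T)) w - A (min T (max 0 a)) w)"
  if w: "w \<in> space M" and ab: "a <= b" for a b w
 proof -
  consider "b < 0" | "a < 0" "0 <= b" | "0 <= a" "a <= T" | "T < a" by linarith
  thus ?thesis
  proof cases
   case 1
   hence "{a<..b} \<inter> {0..T} = {}" by auto
   thus ?thesis using 1 ab T by (simp add: max_def min_def)
  next
   case 2
   hence "{a<..b} \<inter> {0..T} = {0..min b T}" by auto
   thus ?thesis using 2 T emeasure_pm_Icc[OF A w, of "min b T"] ci_0[OF A w] by (simp add: max_def)
  next
   case 3
   hence "{a<..b} \<inter> {0..T} = {a<..min b T}" by auto
   thus ?thesis using 3 T ab emeasure_pm_Ioc[OF A w, of a "min b T"] by (simp add: min_absorb2 max_absorb2)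
  next
   case 4
   hence "{a<..b} \<inter> {0..T} = {}" by auto
   thus ?thesis using 4 T ab by (simp add: min_absorb2 min_absorb1 max_absorb2)
  qed
 qed
 have ka: "ka \<in> measurable M (subprob_algebra borel)"
 proof (rule measurable_subprob_algebra_generated[where \<Omega>=UNIV and G="range (%(a, b). {a<..b::real})"])
  show "sets (borel :: real measure) = sigma_sets UNIV (range (%(a, b). {a<..b::real}))" unfolding borel_sigma_sets_Ioc by auto
  show "Int_stable (range (%(a, b). {a<..b::real}))" by (auto simp: Int_stable_def)
  fix w assume w: "w \<in> space M"
  show "subprob_space (ka w)"
  proof (rule subprob_spaceI)
   have "emeasure (ka w) UNIV = ennreal (A T w) / ennreal (1 + A T w)" using em[of UNIV w] emeasure_pm_Icc[OF A w T] by (simp del: ennreal_plus)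
   also have "... = ennreal (A T w / (1 + A T w))" by (rule divide_ennreal[OF ci_nonneg[OF A w T] pos[OF w]])
   also have "... <= 1" using pos[OF w] by simp
   finally show "emeasure (ka w) (space (ka w)) <= 1" by (simp add: ka_def)
   show "space (ka w) ~= {}" by (simp add: ka_def)
  qed
  show "sets (ka w) = sets borel" by (simp add: ka_def)
 next
  fix X assume "X \<in> range (%(a, b). {a<..b::real})"
  then obtain a b where X: "X = {a<..b}" by auto
  show "(%w. emeasure (ka w) X) \<in> bm M"
  proof (cases "a <= b")
   case True
   have "(%w. emeasure (ka w) X) \<in> bm M \<longleftrightarrow>
     (%w. ennreal (A (max 0 (min b T)) w - A (min T (max 0 a)) w) / ennreal (1 + A T w)) \<in> bm M"
    using Ioc[OF _ True] by (intro measurable_cong) (simp add: em X)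
   also have "..." using T by (measurable, use T in auto)
   finally show ?thesis .
  qed (simp add: X em)
 next
  have "(%w. emeasure (ka w) UNIV) \<in> bm M \<longleftrightarrow> (%w. ennreal (A T w) / ennreal (1 + A T w)) \<in> bm M"
   using emeasure_pm_Icc[OF A _ T] by (intro measurable_cong) (simp add: em)
  also have "..." by (measurable, rule T)
  finally show "(%w. emeasure (ka w) UNIV) \<in> bm M" .
 qed auto
 have m: "(%w. \<integral>\<^sup>+s. g w s \<partial>ka w) \<in> bm M" by (rule nn_integral_measurable_subprob_algebra2[OF g ka])
 have gs: "g w \<in> bm borel" if "w \<in> space M" for w using measurable_compose[OF measurable_Pair1'[OF that] g] by simp
 have "(\<integral>\<^sup>+s\<in>{0..T}. g w s \<partial>pm A w) = ennreal (1 + A T w) * (\<integral>\<^sup>+s. g w s \<partial>ka w)" if w: "w \<in> space M" for w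
 proof -
  have [measurable]: "g w \<in> bm borel" by (rule gs[OF w])
  have "(\<integral>\<^sup>+s. g w s \<partial>ka w) = (\<integral>\<^sup>+s. ind {0..T} s / ennreal (1 + A T w) * g w s \<partial>pm A w)"
   unfolding ka_def by (subst nn_integral_density) auto
  also have "ennreal (1 + A T w) * ... = (\<integral>\<^sup>+s. ennreal (1 + A T w) * (ind {0..T} s / ennreal (1 + A T w) * g w s) \<partial>pm A w)"
   by (subst nn_integral_cmult) auto
  also have "... = (\<integral>\<^sup>+s\<in>{0..T}. g w s \<partial>pm A w)"
  proof (intro nn_integral_cong)
   fix s
   have "ennreal (1 + A T w) / ennreal (1 + A T w) = 1" using pos[OF w] by (simp add: divide_ennreal)
   thus "ennreal (1 + A T w) * (ind {0..T} s / ennreal (1 + A T w) * g w s) = g w s * ind {0..T} s"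
    by (auto simp: indicator_def ennreal_times_divide mult.assoc[symmetric])
  qed
  finally show ?thesis by simp
 qed
 hence "(%w. \<integral>\<^sup>+s\<in>{0..T}. g w s \<partial>pm A w) \<in> bm M \<longleftrightarrow>
   (%w. ennreal (1 + A T w) * (\<integral>\<^sup>+s. g w s \<partial>ka w)) \<in> bm M" by (intro measurable_cong)
 also have "..." using m by measurable
 finally show ?thesis .
qed

end

section \<open>Stochastic integrals as limits of simple integrals\<close>

context stoch_base
begin

abbreviation nullp :: "(nat => 'w => ennreal) => bool" where "nullp == null_in_probability M"

lemma nullp_pathwise:
 assumes m: "!!k. R k \<in> bm M" and lim: "AE w in M. (%k. R k w) ----> 0"
 shows "nullp R" unfolding null_in_probability_def
proof (intro conjI allI impI m measure_vanish)
 have [measurable]: "R k \<in> bm M" for k by (rule m)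
 fix e :: real assume e: "e > 0"
 show "{w \<in> space M. R k w > ennreal e} \<in> sets M" for k by measurable
 show "AE w in M. EV k. w \<notin> {w \<in> space M. R k w > ennreal e}" using lim
 proof eventually_elim
  case (elim w)
  have "(0::ennreal) < ennreal e" using e by simp
  from order_tendstoD(2)[OF elim this] show ?case by eventually_elim auto
 qed
qed

lemma nullp_dom:
 assumes R': "nullp R'" and S': "nullp S'" and m: "!!k. R k \<in> bm M" and c: "0 < c"
  and le: "!!k w. w \<in> space M ==> R k w <= ennreal c * (R' k w + S' k w)"
 shows "nullp R" unfolding null_in_probability_def
proof (intro conjI allI impI m)
 have [measurable]: "R k \<in> bm M" "R' k \<in> bm M" "S' k \<in> bm M" for k using m R' S' by (auto simp: null_in_probability_def)
 fix e :: real assume e: "e > 0"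
 define d where "d = e / (2 * c)"
 have d: "0 < d" using e c by (simp add: d_def)
 show "(%k. measure M {w \<in> space M. R k w > ennreal e}) ----> 0"
 proof (rule tendsto_sandwich[OF _ _ tendsto_const])
  show "(%k. measure M {w \<in> space M. R' k w > ennreal d} + measure M {w \<in> space M. S' k w > ennreal d}) ----> 0"
   using R' S' d tendsto_add[of "%k. measure M {w \<in> space M. R' k w > ennreal d}" 0 sequentially "%k. measure M {w \<in> space M. S' k w > ennreal d}" 0]
   by (auto simp: null_in_probability_def)
  have "measure M {w \<in> space M. R k w > ennreal e} <= measure M ({w \<in> space M. R' k w > ennreal d} \<union> {w \<in> space M. S' k w > ennreal d})" for k
  proof (intro finite_measure_mono subsetI)
   fix w assume w: "w \<in> {w \<in> space M. R k w > ennreal e}"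
   show "w \<in> {w \<in> space M. R' k w > ennreal d} \<union> {w \<in> space M. S' k w > ennreal d}"
   proof (rule ccontr)
    assume "\<not> ?thesis"
    hence "R' k w <= ennreal d" "S' k w <= ennreal d" using w by auto
    hence "ennreal c * (R' k w + S' k w) <= ennreal c * (ennreal d + ennreal d)" by (intro mult_left_mono add_mono) auto
    also have "... = ennreal e" using d c by (simp add: ennreal_plus[symmetric] ennreal_mult[symmetric] d_def del: ennreal_plus)
    finally show False using le[of w k] w by (auto dest: order_trans)
   qed
  qed measurable
  also have "... k <= measure M {w \<in> space M. R' k w > ennreal d} + measure M {w \<in> space M. S' k w > ennreal d}" for k
   by (intro measure_Un_le) measurable
  finally show "EV k. measure M {w \<in> space M. R k w > ennreal e} <=
    measure M {w \<in> space M. R' k w > ennreal d} + measure M {w \<in> space M. S' k w > ennreal d}" by (intro always_eventually allI)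
 qed auto
qed

lemma ucp_of_nullp:
 assumes D: "!!k. cap (D k)" and R: "!!T. 0 <= T ==> nullp (R T)"
  and le: "!!T k t w. 0 <= t ==> t <= T ==> w \<in> space M ==> ennreal \<bar>D k t w\<bar> <= R T k w"
 shows "ucp D" unfolding ucp_def
proof (intro conjI allI impI D)
 fix T e :: real assume e: "e > 0"
 show "(%m. measure M (supgt (D m) T e)) ----> 0"
 proof (cases "0 <= T")
  case True
  have [measurable]: "R T k \<in> bm M" for k using R[OF True] by (auto simp: null_in_probability_def)
  show ?thesis
  proof (rule tendsto_sandwich[OF _ _ tendsto_const])
   show "(%k. measure M {w \<in> space M. R T k w > ennreal e}) ----> 0" using R[OF True] e by (auto simp: null_in_probability_def)
   show "EV k. measure M (supgt (D k) T e) <= measure M {w \<in> space M. R T k w > ennreal e}"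
   proof (intro always_eventually allI finite_measure_mono subsetI)
    fix k w assume "w \<in> supgt (D k) T e"
    then obtain t where t: "w \<in> space M" "t \<in> {0..T}" "e < \<bar>D k t w\<bar>" by blast
    have "ennreal e < ennreal \<bar>D k t w\<bar>" using t e by (simp add: ennreal_less_iff)
    also have "... <= R T k w" using t by (intro le) auto
    finally show "w \<in> {w \<in> space M. R T k w > ennreal e}" using t by simp
   qed measurable
  qed auto
 qed simp
qed

lemma SUP_gt_iff:
 assumes "0 <= e"
 shows "(SUP t\<in>{0..T}. ennreal \<bar>D t w\<bar>) > ennreal e \<longleftrightarrow> (\<exists>t\<in>{0..T}. \<bar>D t w\<bar> > e)"
 using assms by (simp add: less_SUP_iff ennreal_less_iff)

lemma SUP_measurable:
 assumes D: "cap D"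
 shows "(%w. SUP t\<in>{0..T}. ennreal \<bar>D t w\<bar>) \<in> bm M"
proof (rule borel_measurableI_greater)
 fix y :: ennreal
 show "{w \<in> space M. y < (SUP t\<in>{0..T}. ennreal \<bar>D t w\<bar>)} \<in> sets M"
 proof (cases y)
  case (real r)
  hence "{w \<in> space M. y < (SUP t\<in>{0..T}. ennreal \<bar>D t w\<bar>)} = supgt D T r" by (simp add: SUP_gt_iff)
  thus ?thesis using supgt_measurable[OF D] by simp
 qed simp
qed

lemma nullp_of_ucp: "ucp D ==> nullp (%k w. SUP t\<in>{0..T}. ennreal \<bar>D k t w\<bar>)" unfolding null_in_probability_def
 using ucpD[of D _ T] SUP_measurable[OF ucp_cap] by (auto simp: SUP_gt_iff)

lemma ucp_of_nullp_SUP: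
 assumes "!!k. cap (D k)" "!!T. 0 <= T ==> nullp (%k w. SUP t\<in>{0..T}. ennreal \<bar>D k t w\<bar>)"
 shows "ucp D" by (rule ucp_of_nullp[OF assms]) (auto intro!: SUP_upper)

lemma progressive_measurable:
 assumes H: "progressive_process F H" and T: "0 <= T"
 shows "(%(w, s). H (max 0 (min T s)) w) \<in> bm (M \<Otimes>\<^sub>M borel)"
proof -
 have "(%x. (max 0 (min T (snd x)), fst x)) \<in> measurable (M \<Otimes>\<^sub>M borel) (restrict_space borel {0..T} \<Otimes>\<^sub>M F T)"
 proof (rule measurable_Pair)
  show "(%x. max 0 (min T (snd x))) \<in> measurable (M \<Otimes>\<^sub>M borel) (restrict_space borel {0..T})"
   using T by (intro measurable_restrict_space2) auto
  show "fst \<in> measurable (M \<Otimes>\<^sub>M borel) (F T)"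
   by (rule measurable_compose[OF measurable_fst]) (use sets_F in \<open>auto simp: measurable_def\<close>)
 qed
 from measurable_compose[OF this, of "%(s, w). H s w" borel] show ?thesis using H T by (simp add: progressive_process_def case_prod_beta)
qed

lemma cap_progressive: assumes "cap H" shows "progressive_process F H" unfolding progressive_process_def
proof (intro allI impI)
 fix T :: real assume T: "0 <= T"
 have "(%p. (fst p, snd p)) \<in> measurable (restrict_space borel {0..T} \<Otimes>\<^sub>M F T) (borel \<Otimes>\<^sub>M F T)"
  by (intro measurable_Pair measurable_compose[OF measurable_fst] measurable_snd) (auto intro: measurable_restrict_space1)
 from measurable_compose[OF this cap_jointly_measurable[OF assms T]]
 have "(%p. H (max 0 (min T (fst p))) (snd p)) \<in> bm (restrict_space borel {0..T} \<Otimes>\<^sub>M F T)" by simp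
 moreover have "H (max 0 (min T (fst p))) (snd p) = (case p of (s, w) => H s w)"
  if "p \<in> space (restrict_space borel {0..T} \<Otimes>\<^sub>M F T)" for p using that by (auto simp: space_pair_measure space_restrict_space)
 ultimately show "(%(s, w). H s w) \<in> bm (restrict_space borel {0..T} \<Otimes>\<^sub>M F T)" by (subst measurable_cong[symmetric])
qed

lemma simple_process_jointly: assumes "udata n u xi"
 shows "(%(w, s). simple_process n u xi s w) \<in> bm (M \<Otimes>\<^sub>M borel)"
proof -
 have [measurable]: "i < n ==> xi i \<in> bm M" for i using udata_el[OF assms] measurable_F_M by blast
 show ?thesis unfolding simple_process_def by measurable
qed

lemma deviation_measurable:
 assumes A: "ci A" and T: "0 <= T" and H: "progressive_process F H" and u: "udata n u xi"
  and f: "f \<in> bm borel"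
 shows "(%w. \<integral>\<^sup>+s\<in>{0..T}. ennreal (f (simple_process n u xi s w - H s w)) \<partial>pm A w) \<in> bm M"
proof -
 note [measurable] = f simple_process_jointly[OF u] progressive_measurable[OF H T]
 have "(%(w, s). ennreal (f (simple_process n u xi s w - H (max 0 (min T s)) w))) \<in> bm (M \<Otimes>\<^sub>M borel)" by measurable
 from pm_integral_measurable[OF A T this]
 have "(%w. \<integral>\<^sup>+s\<in>{0..T}. ennreal (f (simple_process n u xi s w - H (max 0 (min T s)) w)) \<partial>pm A w) \<in> bm M" .
 also have "(%w. \<integral>\<^sup>+s\<in>{0..T}. ennreal (f (simple_process n u xi s w - H (max 0 (min T s)) w)) \<partial>pm A w)
   = (%w. \<integral>\<^sup>+s\<in>{0..T}. ennreal (f (simple_process n u xi s w - H s w)) \<partial>pm A w)"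
  by (intro ext nn_integral_cong) (auto simp: indicator_def max_def min_def)
 finally show ?thesis .
qed

text \<open>\<open>Q\<close> stands for the bracket of the martingale part of the integrator and
  \<open>V\<close> for the sum of its two increasing parts; these are the two distances used in
  \<open>stochastic_integral\<close>.\<close>

definition approx :: "(real => 'w => real) => (real => 'w => real) => (real => 'w => real) =>
  (nat => nat) => (nat => nat => real) => (nat => nat => 'w => real) => bool" where
 "approx Q V H n u xi \<longleftrightarrow> (\<forall>k. udata (n k) (u k) (xi k)) &
   (\<forall>T\<ge>0. nullp (%k w. \<integral>\<^sup>+s\<in>{0..T}. ennreal ((simple_process (n k) (u k) (xi k) s w - H s w)^2) \<partial>pm Q w) &
    nullp (%k w. \<integral>\<^sup>+s\<in>{0..T}. ennreal \<bar>simple_process (n k) (u k) (xi k) s w - H s w\<bar> \<partial>pm V w))"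

text \<open>The uniform bound is available on (0, T] only, since simple processes vanish at time 0;
  a continuous integrator gives that point no mass.\<close>

lemma pm_deviation_vanishes:
 assumes A: "ci A" and w: "w \<in> space M" and T: "0 <= T" and m: "!!k. g k \<in> bm borel"
  and lim: "!!e. 0 < e ==> EV k. \<forall>s\<in>{0<..T}. \<bar>g k s\<bar> <= e"
 shows "(%k. \<integral>\<^sup>+s\<in>{0..T}. ennreal (g k s) \<partial>pm A w) ----> 0"
proof (rule order_tendstoI)
 fix a :: ennreal assume a: "0 < a"
 define c where "c = A T w + 1"
 have c: "0 < c" "A T w < c" using ci_nonneg[OF A w T] by (auto simp: c_def)
 obtain e where e: "0 < e" "ennreal (e * A T w) < a"
 proof (cases a)
  case (real r)
  hence "0 < r" using a by simp
  show ?thesis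
  proof (rule that[of "r / c"])
   show "0 < r / c" using \<open>0 < r\<close> c by simp
   have "r / c * A T w < r / c * c" using \<open>0 < r\<close> c by (intro mult_strict_left_mono) auto
   thus "ennreal (r / c * A T w) < a" using c real \<open>0 < r\<close> by (simp add: ennreal_lessI)
  qed
 qed (use that[of 1] in simp)
 from lim[OF e(1)] show "EV k. (\<integral>\<^sup>+s\<in>{0..T}. ennreal (g k s) \<partial>pm A w) < a"
 proof eventually_elim
  case (elim k)
  have "AE s in pm A w. s ~= 0"
  proof (rule AE_I)
   show "{s \<in> space (pm A w). \<not> s ~= 0} \<subseteq> {0..0}" by auto
   show "emeasure (pm A w) {0..0} = 0" using emeasure_pm_Icc[OF A w, of 0] ci_0[OF A w] by simp
  qed auto
  hence "AE s in pm A w. ennreal (g k s) * ind {0..T} s <= ennreal e * ind {0..T} s"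
  proof (rule AE_mp, intro AE_I2 impI)
   fix s :: real assume "s ~= 0"
   hence "s \<in> {0..T} ==> g k s <= e" using elim by (auto simp: abs_le_iff)
   thus "ennreal (g k s) * ind {0..T} s <= ennreal e * ind {0..T} s" by (auto simp: indicator_def intro: ennreal_leI)
  qed
  hence "(\<integral>\<^sup>+s\<in>{0..T}. ennreal (g k s) \<partial>pm A w) <= (\<integral>\<^sup>+s\<in>{0..T}. ennreal e \<partial>pm A w)"
   by (rule nn_integral_mono_AE)
  also have "... = ennreal e * emeasure (pm A w) {0..T}" by (subst nn_integral_cmult_indicator) auto
  also have "... = ennreal (e * A T w)" using emeasure_pm_Icc[OF A w T] e by (simp add: ennreal_mult')
  finally show ?case using e by simp
 qed
qed simp

lemma udata_riemann: "cap H ==> udata (gn m) (gr m) (%i. H (gr m i))"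
 unfolding udata_def using cap_measurable[of H "gr m _" "gr m _"] by (auto simp: gr_def divide_right_mono)

lemma approx_riemann:
 assumes Q: "ci Q" and V: "ci V" and H: "cap H"
 shows "approx Q V H gn gr (%m i. H (gr m i))" unfolding approx_def
proof (intro conjI allI impI)
 show u: "udata (gn k) (gr k) (%i. H (gr k i))" for k by (rule udata_riemann[OF H])
 fix T :: real assume T: "0 <= T"
 have Hm: "H (max 0 (min T s)) w = H s w" if "s \<in> {0..T}" for s w using that by (simp add: min_absorb2)
 have conv: "(%k. \<integral>\<^sup>+s\<in>{0..T}. ennreal (f (rp k H s w - H s w)) \<partial>pm A w) ----> 0"
  if A: "ci A" and w: "w \<in> space M" and f[measurable]: "f \<in> bm borel"
   and f0: "!!e. 0 < e ==> \<exists>d>0. \<forall>x. \<bar>x\<bar> <= d --> \<bar>f x\<bar> <= e" for A w f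
 proof -
  have "continuous_on UNIV (%s. H (max 0 (min T s)) w)" by (intro continuous_on_compose2[OF cap_continuous[OF H w]] continuous_intros) auto
  hence [measurable]: "(%s. H (max 0 (min T s)) w) \<in> bm borel" by (rule borel_measurable_continuous_onI)
  have "(%k. \<integral>\<^sup>+s\<in>{0..T}. ennreal (f (rp k H s w - H (max 0 (min T s)) w)) \<partial>pm A w) ----> 0"
  proof (rule pm_deviation_vanishes[OF A w T])
   fix e :: real assume "0 < e"
   from f0[OF this] obtain d where d: "d > 0" "!!x. \<bar>x\<bar> <= d ==> \<bar>f x\<bar> <= e" by blast
   show "EV k. \<forall>s\<in>{0<..T}. \<bar>f (rp k H s w - H (max 0 (min T s)) w)\<bar> <= e"
    using rp_uniform[of H w d T, OF cap_continuous[OF H w] d(1)] by eventually_elim (auto intro!: d(2) simp: Hm)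
  qed measurable
  also have "(%k. \<integral>\<^sup>+s\<in>{0..T}. ennreal (f (rp k H s w - H (max 0 (min T s)) w)) \<partial>pm A w) =
   (%k. \<integral>\<^sup>+s\<in>{0..T}. ennreal (f (rp k H s w - H s w)) \<partial>pm A w)"
   by (intro ext nn_integral_cong) (auto simp: indicator_def Hm)
  finally show ?thesis .
 qed
 show "nullp (%k w. \<integral>\<^sup>+s\<in>{0..T}. ennreal ((rp k H s w - H s w)^2) \<partial>pm Q w)"
 proof (rule nullp_pathwise)
  show "AE w in M. (%k. \<integral>\<^sup>+s\<in>{0..T}. ennreal ((rp k H s w - H s w)^2) \<partial>pm Q w) ----> 0"
  proof (intro AE_I2 conv Q)
   fix e :: real assume "0 < e"
   thus "\<exists>d>0. \<forall>x. \<bar>x\<bar> <= d --> \<bar>x^2\<bar> <= e"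
    by (intro exI[of _ "sqrt e"]) (auto simp: real_le_rsqrt dest!: power_mono[of "\<bar>_\<bar>" _ 2])
  qed auto
 qed (rule deviation_measurable[OF Q T cap_progressive[OF H] u], measurable)
 show "nullp (%k w. \<integral>\<^sup>+s\<in>{0..T}. ennreal \<bar>rp k H s w - H s w\<bar> \<partial>pm V w)"
 proof (rule nullp_pathwise)
  show "AE w in M. (%k. \<integral>\<^sup>+s\<in>{0..T}. ennreal \<bar>rp k H s w - H s w\<bar> \<partial>pm V w) ----> 0"
   by (intro AE_I2 conv V) auto
 qed (rule deviation_measurable[OF V T cap_progressive[OF H] u], measurable)
qed

text \<open>One argument for both distances: \<open>f\<close> is the square with c = 2, or the
  modulus with c = 1. The comparison goes through the common integrand \<open>H\<close>.\<close>

lemma deviation_triangle: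
 assumes A: "ci A" and T: "0 <= T" and H: "progressive_process F H"
  and u: "!!k. udata (n k) (u k) (xi k)" "!!k. udata (n' k) (u' k) (xi' k)"
  and f[measurable]: "f \<in> bm borel" and f0: "!!x. 0 <= f x" and c: "0 < (c::real)"
  and tri: "!!a b h. f (a - b) <= c * (f (a - h) + f (b - h))"
  and D: "nullp (%k w. \<integral>\<^sup>+s\<in>{0..T}. ennreal (f (simple_process (n k) (u k) (xi k) s w - H s w)) \<partial>pm A w)"
   "nullp (%k w. \<integral>\<^sup>+s\<in>{0..T}. ennreal (f (simple_process (n' k) (u' k) (xi' k) s w - H s w)) \<partial>pm A w)"
 shows "nullp (%k w. \<integral>\<^sup>+s\<in>{0..T}. ennreal (f (simple_process (n k) (u k) (xi k) s w
   - simple_process (n' k) (u' k) (xi' k) s w)) \<partial>pm A w)"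
proof (rule nullp_dom[OF D, where c=c])
 let ?p = "%k s w. simple_process (n k) (u k) (xi k) s w" and ?p' = "%k s w. simple_process (n' k) (u' k) (xi' k) s w"
 fix k
 have "(%(w, s). ennreal (f (?p k s w - ?p' k s w))) \<in> bm (M \<Otimes>\<^sub>M borel)"
  using simple_process_jointly[OF u(1)[of k]] simple_process_jointly[OF u(2)[of k]] by measurable
 from pm_integral_measurable[OF A T this]
 show "(%w. \<integral>\<^sup>+s\<in>{0..T}. ennreal (f (?p k s w - ?p' k s w)) \<partial>pm A w) \<in> bm M" .
 fix w assume w: "w \<in> space M"
 have Hs: "(%s. H (max 0 (min T s)) w) \<in> bm borel" using measurable_compose[OF measurable_Pair1'[OF w] progressive_measurable[OF H T]] by simp
 have dm: "(%s. ennreal (f (simple_process m v ze s w - H s w)) * ind {0..T} s) \<in> bm borel" for m v ze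
 proof -
  have "(%s. ennreal (f (simple_process m v ze s w - H (max 0 (min T s)) w)) * ind {0..T} s) \<in> bm borel" using Hs by measurable
  also have "(%s. ennreal (f (simple_process m v ze s w - H (max 0 (min T s)) w)) * ind {0..T} s) =
   (%s. ennreal (f (simple_process m v ze s w - H s w)) * ind {0..T} s)" by (auto simp: indicator_def fun_eq_iff max_def min_def)
  finally show ?thesis .
 qed
 have "(\<integral>\<^sup>+s\<in>{0..T}. ennreal (f (?p k s w - ?p' k s w)) \<partial>pm A w) <=
  (\<integral>\<^sup>+s. ennreal c * (ennreal (f (?p k s w - H s w)) * ind {0..T} s + ennreal (f (?p' k s w - H s w)) * ind {0..T} s) \<partial>pm A w)"
 proof (intro nn_integral_mono)
  fix s
  from ennreal_leI[OF tri[of "?p k s w" "?p' k s w" "H s w"]]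
  show "ennreal (f (?p k s w - ?p' k s w)) * ind {0..T} s <=
   ennreal c * (ennreal (f (?p k s w - H s w)) * ind {0..T} s + ennreal (f (?p' k s w - H s w)) * ind {0..T} s)"
   using c f0 by (auto simp: indicator_def ennreal_mult)
 qed
 also have "... = ennreal c * ((\<integral>\<^sup>+s\<in>{0..T}. ennreal (f (?p k s w - H s w)) \<partial>pm A w) +
   (\<integral>\<^sup>+s\<in>{0..T}. ennreal (f (?p' k s w - H s w)) \<partial>pm A w))"
  using dm by (subst nn_integral_cmult, simp, subst nn_integral_add) simp_all
 finally show "(\<integral>\<^sup>+s\<in>{0..T}. ennreal (f (?p k s w - ?p' k s w)) \<partial>pm A w) <=
  ennreal c * ((\<integral>\<^sup>+s\<in>{0..T}. ennreal (f (?p k s w - H s w)) \<partial>pm A w) +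
   (\<integral>\<^sup>+s\<in>{0..T}. ennreal (f (?p' k s w - H s w)) \<partial>pm A w))" .
qed (rule c)

text \<open>The bracket of the difference of the two simple integrals is the integral of the squared
  difference of their integrands against \<open>Q\<close>. It tends to 0 by the triangle inequality,
  and Lenglart's inequality transfers this to the integrals.\<close>

lemma approx_ucp_martingale:
 assumes c: "cov N N Q" and Q: "ci Q" and N0: "!!w. w \<in> space M ==> N 0 w = 0"
  and H: "progressive_process F H"
  and ap: "approx Q V H n u xi" "approx Q V H n' u' xi'"
 shows "ucp (%k t w. simple_integral (n k) (u k) (xi k) N t w - simple_integral (n' k) (u' k) (xi' k) N t w)" (is "ucp ?R")
proof -
 have u: "udata (n k) (u k) (xi k)" "udata (n' k) (u' k) (xi' k)" for k using ap by (auto simp: approx_def)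
 let ?S = "%k. simple_integral (n k) (u k) (xi k)" and ?S' = "%k. simple_integral (n' k) (u' k) (xi' k)"
 let ?p = "%k s w. simple_process (n k) (u k) (xi k) s w" and ?p' = "%k s w. simple_process (n' k) (u' k) (xi' k) s w"
 define V' where "V' k t w = ?S k (?S k Q) t w - ?S k (?S' k Q) t w - (?S k (?S' k Q) t w - ?S' k (?S' k Q) t w)" for k t w
 have cR: "cov (?R k) (?R k) (V' k)" for k unfolding V'_def[abs_def] by (intro cov_diff_diff cov_sint c u)
 hence cap: "cap (?R k)" "cap (V' k)" for k by (auto simp: cov_def intro: clm_cap)
 have V'_eq: "V' k t w = (LINT s:{0..t}|pm Q w. (?p k s w - ?p' k s w)^2)"
  and V'_int: "set_integrable (pm Q w) {0..t} (%s. (?p k s w - ?p' k s w)^2)" if "0 <= t" "w \<in> space M" for k t w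
 proof -
  note i = pm_simple_integrable(1)[OF Q that(2)]
  have sq: "(?p k s w - ?p' k s w)^2 = ?p k s w * ?p k s w - ?p k s w * ?p' k s w - (?p k s w * ?p' k s w - ?p' k s w * ?p' k s w)" for s
   by (simp add: power2_eq_square algebra_simps)
  show "V' k t w = (LINT s:{0..t}|pm Q w. (?p k s w - ?p' k s w)^2)"
   unfolding sq V'_def simple_integral_pm2[OF Q that(2) u(1) u(1) that(1)] simple_integral_pm2[OF Q that(2) u(1) u(2) that(1)]
    simple_integral_pm2[OF Q that(2) u(2) u(2) that(1)] by (simp add: set_integral_diff i)
  show "set_integrable (pm Q w) {0..t} (%s. (?p k s w - ?p' k s w)^2)" unfolding sq by (intro set_integral_diff i)
 qed
 have V'_pos: "0 <= V' k t w" if "0 <= t" "w \<in> space M" for k t w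
  unfolding V'_eq[OF that] set_lebesgue_integral_def by (intro integral_nonneg_AE) auto
 have S0: "simple_integral m v ze Z 0 w = 0" if "udata m v ze" for m v ze Z w by (rule sint_0[OF that])
 have V'_ucp: "ucp V'"
 proof (rule ucp_of_nullp[where R="%T k w. \<integral>\<^sup>+s\<in>{0..T}. ennreal ((?p k s w - ?p' k s w)^2) \<partial>pm Q w"])
  show "cap (V' k)" for k by (rule cap(2))
  show "ennreal \<bar>V' k t w\<bar> <= (\<integral>\<^sup>+s\<in>{0..T}. ennreal ((?p k s w - ?p' k s w)^2) \<partial>pm Q w)"
   if t: "0 <= t" "t <= T" and w: "w \<in> space M" for T k t w
  proof -
   have "ennreal \<bar>V' k t w\<bar> = ennreal (\<integral>s. ind {0..t} s * (?p k s w - ?p' k s w)^2 \<partial>pm Q w)"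
    using V'_eq[OF t(1) w] V'_pos[OF t(1) w] by (simp add: set_lebesgue_integral_def)
   also have "... = (\<integral>\<^sup>+s. ennreal (ind {0..t} s * (?p k s w - ?p' k s w)^2) \<partial>pm Q w)"
    using V'_int[OF t(1) w, of k] by (intro nn_integral_eq_integral[symmetric]) (auto simp: set_integrable_def)
   also have "... <= (\<integral>\<^sup>+s\<in>{0..T}. ennreal ((?p k s w - ?p' k s w)^2) \<partial>pm Q w)"
    using t by (intro nn_integral_mono) (auto simp: indicator_def)
   finally show ?thesis .
  qed
  fix T :: real assume T: "0 <= T"
  have "(a - b)^2 <= 2 * ((a - h)^2 + (b - h)^2)" for a b h :: real
   using sum_squares_ge_zero[of "a + b - 2 * h" 0] by (simp add: power2_eq_square algebra_simps)
  thus "nullp (%k w. \<integral>\<^sup>+s\<in>{0..T}. ennreal ((?p k s w - ?p' k s w)^2) \<partial>pm Q w)"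
   using ap T by (intro deviation_triangle[OF Q T H u, where f="%x. x^2" and c=2]) (auto simp: approx_def)
 qed
 show ?thesis
 proof (rule lenglart_ucp[where V=V'])
  show "clm (%t w. (?R k t w)^2 - V' k t w)" for k using cR[of k] by (simp add: cov_def power2_eq_square)
 qed (use cap V'_ucp V'_pos in \<open>simp_all add: S0[OF u(1)] S0[OF u(2)] V'_def\<close>)
qed

lemma fv_deviation_bound:
 assumes AB: "ci A" "ci B" and w: "w \<in> space M" and u: "udata n u xi" "udata n' u' xi'" and t: "0 <= t" "t <= T"
 shows "ennreal \<bar>(simple_integral n u xi A t w - simple_integral n' u' xi' A t w)
    - (simple_integral n u xi B t w - simple_integral n' u' xi' B t w)\<bar>
  <= (\<integral>\<^sup>+s\<in>{0..T}. ennreal \<bar>simple_process n u xi s w - simple_process n' u' xi' s w\<bar> \<partial>pm (%t w. A t w + B t w) w)"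
proof -
 let ?d = "%s. simple_process n u xi s w - simple_process n' u' xi' s w"
 have int: "set_integrable (pm C w) {0..t} ?d" if "ci C" for C by (intro set_integral_diff pm_simple_integrable that w)
 have bd: "ennreal \<bar>simple_integral n u xi C t w - simple_integral n' u' xi' C t w\<bar> <= (\<integral>\<^sup>+s. ennreal \<bar>?d s\<bar> * ind {0..t} s \<partial>pm C w)"
  if C: "ci C" for C
 proof -
  have "simple_integral n u xi C t w - simple_integral n' u' xi' C t w = (LINT s:{0..t}|pm C w. ?d s)"
   using simple_integral_pm[OF C w u(1) t(1)] simple_integral_pm[OF C w u(2) t(1)] pm_simple_integrable(2)[OF C w] by (simp add: set_integral_diff)
  also have "ennreal \<bar>...\<bar> <= ennreal (\<integral>s. norm (ind {0..t} s *\<^sub>R ?d s) \<partial>pm C w)"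
   unfolding set_lebesgue_integral_def using integral_norm_bound[of "pm C w" "%s. ind {0..t} s *\<^sub>R ?d s"] by (intro ennreal_leI) simp
  also have "... = (\<integral>\<^sup>+s. ennreal (norm (ind {0..t} s *\<^sub>R ?d s)) \<partial>pm C w)"
   using int[OF C] by (intro nn_integral_eq_integral[symmetric]) (auto simp: set_integrable_def intro: integrable_norm)
  also have "... = (\<integral>\<^sup>+s. ennreal \<bar>?d s\<bar> * ind {0..t} s \<partial>pm C w)"
   by (intro nn_integral_cong) (auto simp: indicator_def)
  finally show ?thesis .
 qed
 have "ennreal \<bar>(simple_integral n u xi A t w - simple_integral n' u' xi' A t w)
    - (simple_integral n u xi B t w - simple_integral n' u' xi' B t w)\<bar>
   <= ennreal (\<bar>simple_integral n u xi A t w - simple_integral n' u' xi' A t w\<bar>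
    + \<bar>simple_integral n u xi B t w - simple_integral n' u' xi' B t w\<bar>)" by (intro ennreal_leI) linarith
 also have "... <= (\<integral>\<^sup>+s. ennreal \<bar>?d s\<bar> * ind {0..t} s \<partial>pm A w) + (\<integral>\<^sup>+s. ennreal \<bar>?d s\<bar> * ind {0..t} s \<partial>pm B w)"
  using bd[OF AB(1)] bd[OF AB(2)] by (subst ennreal_plus) (auto intro: add_mono)
 also have "... = (\<integral>\<^sup>+s. ennreal \<bar>?d s\<bar> * ind {0..t} s \<partial>pm (%t w. A t w + B t w) w)"
  unfolding pm_add[OF AB w] by (subst nn_integral_msum) auto
 also have "... <= (\<integral>\<^sup>+s\<in>{0..T}. ennreal \<bar>?d s\<bar> \<partial>pm (%t w. A t w + B t w) w)"
  using t by (intro nn_integral_mono) (auto simp: indicator_def)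
 finally show ?thesis .
qed

lemma decomposition_cov:
 assumes Z: "semimartingale_decomposition M F Z N A B" and Q: "quadratic_variation M F N Q"
 shows "cov N N Q" "ci Q" "ci A" "ci B" "!!w. w \<in> space M ==> N 0 w = 0" "cap Z"
  "AE w in M. \<forall>t\<ge>0. Z t w = Z 0 w + N t w + A t w - B t w"
proof -
 show "ci Q" "ci A" "ci B" "!!w. w \<in> space M ==> N 0 w = 0" "cap Z" "AE w in M. \<forall>t\<ge>0. Z t w = Z 0 w + N t w + A t w - B t w"
  using assms by (auto simp: semimartingale_decomposition_def quadratic_variation_def cap_def)
 thus "cov N N Q" using assms ci_cap[of Q] by (auto simp: cov_def semimartingale_decomposition_def quadratic_variation_def power2_eq_square)
qed

text \<open>Independence of the stochastic integral from the approximating sequence, for a fixed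
  decomposition. The martingale part uses closeness in L^2, the increasing parts closeness in
  L^1.\<close>

lemma approx_ucp_semimartingale:
 assumes Z: "semimartingale_decomposition M F Z N A B" and Q: "quadratic_variation M F N Q"
  and H: "progressive_process F H"
  and ap: "approx Q (%t w. A t w + B t w) H n u xi" "approx Q (%t w. A t w + B t w) H n' u' xi'"
 shows "ucp (%k t w. simple_integral (n k) (u k) (xi k) Z t w - simple_integral (n' k) (u' k) (xi' k) Z t w)"
proof -
 note d = decomposition_cov[OF Z Q]
 have u: "udata (n k) (u k) (xi k)" "udata (n' k) (u' k) (xi' k)" for k using ap by (auto simp: approx_def)
 let ?S = "%k. simple_integral (n k) (u k) (xi k)" and ?S' = "%k. simple_integral (n' k) (u' k) (xi' k)"
 have 1: "ucp (%k t w. ?S k N t w - ?S' k N t w)" by (rule approx_ucp_martingale[OF d(1,2,5) H ap])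
 have 2: "ucp (%k t w. (?S k A t w - ?S' k A t w) - (?S k B t w - ?S' k B t w))"
 proof (rule ucp_of_nullp[OF _ _ fv_deviation_bound[OF d(3,4) _ u]])
  show "cap (%t w. (?S k A t w - ?S' k A t w) - (?S k B t w - ?S' k B t w))" for k using d(3,4)[THEN ci_cap] u by (intro cap_diff cap_sint)
  show "nullp (%k w. \<integral>\<^sup>+s\<in>{0..T}. ennreal \<bar>simple_process (n k) (u k) (xi k) s w -
    simple_process (n' k) (u' k) (xi' k) s w\<bar> \<partial>pm (%t w. A t w + B t w) w)" if T: "0 <= T" for T
   using ap T by (intro deviation_triangle[OF ci_add[OF d(3,4)] T H u, where f=abs and c=1]) (auto simp: approx_def)
 qed auto
 show ?thesis
 proof (rule ucp_eq[OF ucp_add[OF 1 2]])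
  show "cap (%t w. ?S k Z t w - ?S' k Z t w)" for k using d(6) u by (intro cap_diff cap_sint)
  fix k
  show "AE w in M. \<forall>t\<ge>0. ?S k Z t w - ?S' k Z t w =
   (?S k N t w - ?S' k N t w) + ((?S k A t w - ?S' k A t w) - (?S k B t w - ?S' k B t w))" using d(7)
  proof eventually_elim
   case (elim w)
   have "simple_integral m v ze Z t w = simple_integral m v ze N t w + simple_integral m v ze A t w - simple_integral m v ze B t w"
    if v: "udata m v ze" and t: "0 <= t" for m v ze t
   proof -
    have "ze i w * (Z (min (v (Suc i)) t) w - Z (min (v i) t) w) =
     ze i w * (N (min (v (Suc i)) t) w - N (min (v i) t) w) + ze i w * (A (min (v (Suc i)) t) w - A (min (v i) t) w)
      - ze i w * (B (min (v (Suc i)) t) w - B (min (v i) t) w)" if "i < m" for i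
    proof -
     have nn: "0 <= min (v (Suc i)) t" "0 <= min (v i) t" using udata_el[OF v that] t by auto
     show ?thesis unfolding elim[rule_format, OF nn(1)] elim[rule_format, OF nn(2)] by (simp add: algebra_simps)
    qed
    thus ?thesis by (simp add: simple_integral_def sum.distrib sum_subtractf)
   qed
   thus ?case using u by simp
  qed
 qed
qed

lemma stochastic_integral_ucp:
 assumes I: "stochastic_integral M F H Z I"
 obtains N A B Q n u xi where "semimartingale_decomposition M F Z N A B" "quadratic_variation M F N Q" "approx Q (%t w. A t w + B t w) H n u xi"
  "ucp (%k t w. simple_integral (n k) (u k) (xi k) Z t w - I t w)"
proof -
 from I obtain N A B Q n u xi where 1: "semimartingale_decomposition M F Z N A B" "quadratic_variation M F N Q"
  and sd: "!!k. simple_data M F (n k) (u k) (xi k)"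
  and T: "!!T. 0 <= T ==>
   nullp (%k w. \<integral>\<^sup>+s\<in>{0..T}. ennreal ((simple_process (n k) (u k) (xi k) s w - H s w)^2) \<partial>pm Q w) &
   nullp (%k w. \<integral>\<^sup>+s\<in>{0..T}. ennreal \<bar>simple_process (n k) (u k) (xi k) s w - H s w\<bar> \<partial>pm (%t w. A t w + B t w) w) &
   nullp (%k w. SUP t\<in>{0..T}. ennreal \<bar>simple_integral (n k) (u k) (xi k) Z t w - I t w\<bar>)" unfolding stochastic_integral_def by blast
 have cI: "cap I" using I by (simp add: stochastic_integral_def cap_def)
 have ud: "udata (n k) (u k) (xi k)" for k using sd by (rule simple_data_udata)
 show thesis
 proof (rule that[OF 1])
  show "approx Q (%t w. A t w + B t w) H n u xi" using ud T by (simp add: approx_def)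
  show "ucp (%k t w. simple_integral (n k) (u k) (xi k) Z t w - I t w)"
   using T by (intro ucp_of_nullp_SUP cap_diff cap_sint cI ud decomposition_cov(6)[OF 1]) auto
 qed
qed

text \<open>Riemann sums of a continuous integrand approximate it for every bracket and every pair
  of increasing parts, in particular for the decomposition hidden in the given integral.\<close>

lemma stochastic_integral_riemann:
 assumes I: "stochastic_integral M F H Z I" and H: "cap H"
 shows "ucp (%m t w. rsum m H Z t w - I t w)"
proof -
 from I obtain N A B Q n u xi where d: "semimartingale_decomposition M F Z N A B" "quadratic_variation M F N Q"
  and ap: "approx Q (%t w. A t w + B t w) H n u xi"
  and lim: "ucp (%k t w. simple_integral (n k) (u k) (xi k) Z t w - I t w)" by (rule stochastic_integral_ucp)
 note dc = decomposition_cov[OF d]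
 have "approx Q (%t w. A t w + B t w) H gn gr (%m i. H (gr m i))" by (intro approx_riemann ci_add dc H)
 from ucp_add[OF approx_ucp_semimartingale[OF d cap_progressive[OF H] this ap] lim]
 show ?thesis by simp
qed

end

section \<open>Coordinates of the plane and brackets of Brownian motion\<close>

lemma Basis_real2: "(Basis :: (real^2) set) = {axis 1 1, axis 2 1}" by (auto simp: Basis_vec_def UNIV_2)

lemma vector2_measurable [measurable]: "(%p. vector [fst p, snd p] :: real^2) \<in> bm (borel \<Otimes>\<^sub>M borel)"
proof -
 have "(%p. (vector [fst p, snd p] :: real^2) \<bullet> b) \<in> bm (borel \<Otimes>\<^sub>M borel)" if "b \<in> Basis" for b
  using that unfolding Basis_real2 by (auto simp: inner_axis vector_2)
 thus ?thesis by (subst borel_measurable_euclidean_space) auto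
qed

lemma vec_nth_measurable [measurable]: "(%x::real^2. x $ i) \<in> bm borel" by (intro borel_measurable_continuous_onI continuous_intros)

text \<open>Used for the moments of Gaussian increments here, and for iterated integration against
  test functions in the analytic part.\<close>

lemma lborel_vector2: "(lborel :: (real^2) measure) = distr (lborel \<Otimes>\<^sub>M lborel) borel (%p. vector [fst p, snd p])"
proof (rule lborel_eqI)
 fix l u :: "real^2" assume le: "!!b. b \<in> Basis ==> l \<bullet> b <= u \<bullet> b"
 have lu: "l $ 1 <= u $ 1" "l $ 2 <= u $ 2" using le[of "axis 1 1"] le[of "axis 2 1"] by (auto simp: Basis_real2 inner_axis)
 have m: "(%p. vector [fst p, snd p] :: real^2) \<in> measurable (lborel \<Otimes>\<^sub>M lborel) borel"
  using vector2_measurable by (simp cong: measurable_cong_sets sets_pair_measure_cong)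
 have pre: "(%p. vector [fst p, snd p] :: real^2) -` box l u \<inter> space (lborel \<Otimes>\<^sub>M lborel) = {l $ 1<..<u $ 1} \<times> {l $ 2<..<u $ 2}"
  by (auto simp: mem_box Basis_real2 inner_axis vector_2 space_pair_measure)
 have "axis 1 1 ~= (axis 2 1 :: real^2)" by (simp add: axis_eq_axis)
 hence "(\<Prod>b\<in>Basis. (u - l) \<bullet> b) = (u $ 1 - l $ 1) * (u $ 2 - l $ 2)" by (simp add: Basis_real2 inner_axis)
 moreover have "emeasure (distr (lborel \<Otimes>\<^sub>M lborel) borel (%p. vector [fst p, snd p])) (box l u) =
   emeasure lborel {l $ 1<..<u $ 1} * emeasure lborel {l $ 2<..<u $ 2}" using m by (simp add: emeasure_distr pre lborel.emeasure_pair_measure_Times)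
 ultimately show "emeasure (distr (lborel \<Otimes>\<^sub>M lborel) borel (%p. vector [fst p, snd p])) (box l u) = ennreal (\<Prod>b\<in>Basis. (u - l) \<bullet> b)"
  using lu by (simp add: ennreal_mult)
qed simp

lemma lborel2_product_integral:
 fixes f g :: "real => real"
 assumes f: "integrable lborel f" and g: "integrable lborel g"
 shows "integrable lborel (%x::real^2. f (x $ 1) * g (x $ 2))"
  and "(LINT x|lborel. f ((x::real^2) $ 1) * g (x $ 2)) = (LINT x|lborel. f x) * (LINT x|lborel. g x)"
proof -
 have [measurable]: "f \<in> bm borel" "g \<in> bm borel" using f g by auto
 have m: "(%p. vector [fst p, snd p] :: real^2) \<in> measurable (lborel \<Otimes>\<^sub>M lborel) borel"
  using vector2_measurable by (simp cong: measurable_cong_sets sets_pair_measure_cong)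
 have i: "integrable (lborel \<Otimes>\<^sub>M lborel) (%p. f (fst p) * g (snd p))"
 proof (rule lborel_pair.Fubini_integrable)
  show "(%p. f (fst p) * g (snd p)) \<in> bm (lborel \<Otimes>\<^sub>M lborel)" by measurable
  have "(%x. \<integral>y. norm (f (fst (x, y)) * g (snd (x, y))) \<partial>lborel) = (%x. \<bar>f x\<bar> * (LINT y|lborel. \<bar>g y\<bar>))"
   by (simp add: abs_mult)
  thus "integrable lborel (%x. \<integral>y. norm (f (fst (x, y)) * g (snd (x, y))) \<partial>lborel)" using f by simp
  show "AE x in lborel. integrable lborel (%y. f (fst (x, y)) * g (snd (x, y)))" using g by auto
 qed
 have mm: "(%x::real^2. f (x $ 1) * g (x $ 2)) \<in> bm borel" by measurable
 show "integrable lborel (%x::real^2. f (x $ 1) * g (x $ 2))"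
  unfolding lborel_vector2 using i by (subst integrable_distr_eq[OF m mm]) (simp add: vector_2)
 have "(LINT x|lborel. f ((x::real^2) $ 1) * g (x $ 2)) = (LINT p|(lborel \<Otimes>\<^sub>M lborel). f (fst p) * g (snd p))"
  unfolding lborel_vector2 by (subst integral_distr[OF m mm]) (simp add: vector_2)
 also have "... = (LINT x|lborel. \<integral>y. f x * g y \<partial>lborel)" using lborel_pair.integral_fst'[OF i] by simp
 also have "... = (LINT x|lborel. f x) * (LINT x|lborel. g x)" by simp
 finally show "(LINT x|lborel. f ((x::real^2) $ 1) * g (x $ 2)) = (LINT x|lborel. f x) * (LINT x|lborel. g x)" .
qed

context stoch_base
begin

lemma gaussian_increment:
 assumes D: "distributed M lborel X (%x::real^2. ennreal (\<Prod>i\<in>UNIV. normal_density 0 si (x$i)))" and si: "0 < si"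
 shows "integrable M (%w. X w $ i)" "(LINT w|M. X w $ i) = 0"
  "integrable M (%w. X w $ i * X w $ j)" "(LINT w|M. X w $ i * X w $ j) = (if i = j then si^2 else 0)"
proof -
 let ?n = "normal_density 0 si"
 have gen: "integrable M (%w. f (X w $ 1) * g (X w $ 2))"
  "(LINT w|M. f (X w $ 1) * g (X w $ 2)) = (LINT x|lborel. ?n x * f x) * (LINT x|lborel. ?n x * g x)"
  if [measurable]: "f \<in> bm borel" "g \<in> bm borel"
   and i: "integrable lborel (%x. ?n x * f x)" "integrable lborel (%x. ?n x * g x)" for f g
 proof -
  have eq: "(\<Prod>i\<in>UNIV. ?n (x$i)) * (f (x $ 1) * g (x $ 2)) = (?n (x$1) * f (x$1)) * (?n (x$2) * g (x$2))" for x :: "real^2"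
   by (simp add: UNIV_2)
  have gm: "(%x::real^2. f (x $ 1) * g (x $ 2)) \<in> bm lborel" by measurable
  have nn: "!!x::real^2. 0 <= (\<Prod>i\<in>UNIV. ?n (x$i))" by (intro prod_nonneg) simp
  show "integrable M (%w. f (X w $ 1) * g (X w $ 2))" using distributed_integrable[OF D gm nn] lborel2_product_integral(1)[OF i] unfolding eq by simp
  show "(LINT w|M. f (X w $ 1) * g (X w $ 2)) = (LINT x|lborel. ?n x * f x) * (LINT x|lborel. ?n x * g x)"
   using distributed_integral[OF D gm nn] lborel2_product_integral(2)[OF i] unfolding eq by simp
 qed
 have m: "integrable lborel (%x. ?n x * 1)" "(LINT x|lborel. ?n x * 1) = 1" "integrable lborel (%x. ?n x * x)" "(LINT x|lborel. ?n x * x) = 0"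
  "integrable lborel (%x. ?n x * (x * x))" "(LINT x|lborel. ?n x * (x * x)) = si^2"
  using si integral_normal_moment_even[OF si, of 0 1] integrable_normal_moment[OF si, of 0 2]
  by (simp_all add: integrable_normal_moment_nz_1 integral_normal_moment_nz_1 power2_eq_square)
 have c: "(%x::real. 1::real) \<in> bm borel" "(%x::real. x) \<in> bm borel" "(%x::real. x * x) \<in> bm borel" by measurable
 note r = mult_1 mult_1_right mult_zero_left mult_zero_right
 have 1: "integrable M (%w. X w $ 1)" "(LINT w|M. X w $ 1) = 0" using gen[OF c(2,1) m(3,1)] unfolding m(2,4) r by simp_all
 have 2: "integrable M (%w. X w $ 2)" "(LINT w|M. X w $ 2) = 0" using gen[OF c(1,2) m(1,3)] unfolding m(2,4) r by simp_all
 have 3: "integrable M (%w. X w $ 1 * X w $ 2)" "(LINT w|M. X w $ 1 * X w $ 2) = 0" using gen[OF c(2,2) m(3,3)] unfolding m(2,4) r by simp_all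
 have 4: "integrable M (%w. X w $ 1 * X w $ 1)" "(LINT w|M. X w $ 1 * X w $ 1) = si^2"
  using gen[OF c(3,1) m(5,1)] unfolding m(6) r by (simp_all add: integral_normal_density[OF si])
 have 5: "integrable M (%w. X w $ 2 * X w $ 2)" "(LINT w|M. X w $ 2 * X w $ 2) = si^2"
  using gen[OF c(1,3) m(1,5)] unfolding m(6) r by (simp_all add: integral_normal_density[OF si])
 show "integrable M (%w. X w $ i)" "(LINT w|M. X w $ i) = 0" using exhaust_2[of i] 1 2 by auto
 show "integrable M (%w. X w $ i * X w $ j)" "(LINT w|M. X w $ i * X w $ j) = (if i = j then si^2 else 0)"
  using exhaust_2[of i] exhaust_2[of j] 3 4 5 by (auto simp: mult.commute)
qed

lemma indep_increment:
 assumes ind: "indep_set (sets (F s)) (sets (vimage_algebra (space M) X borel))"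
  and Z: "Z \<in> bm (F s)" "integrable M Z" and g: "g \<in> bm borel" "integrable M (%w. g (X w))"
 shows "integrable M (%w. Z w * (g (X w) :: real))" "(LINT w|M. Z w * g (X w)) = (LINT w|M. Z w) * (LINT w|M. g (X w))"
proof -
 have "indep_var borel Z borel (%w. g (X w))" unfolding indep_var_eq
 proof (intro conjI indep_setI)
  have 1: "sigma_sets (space M) {Z -` A \<inter> space M |A. A \<in> sets borel} \<subseteq> sets (F s)"
  proof -
   have "{Z -` A \<inter> space M |A. A \<in> sets borel} \<subseteq> sets (F s)" using Z(1) by (auto dest: measurable_sets)
   from sets.sigma_sets_subset[OF this] show ?thesis by simp
  qed
  have 2: "sigma_sets (space M) {(%w. g (X w)) -` A \<inter> space M |A. A \<in> sets borel} \<subseteq> sets (vimage_algebra (space M) X borel)"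
  proof -
   have "{(%w. g (X w)) -` A \<inter> space M |A. A \<in> sets borel} \<subseteq> sets (vimage_algebra (space M) X borel)"
   proof (intro subsetI, clarify)
    fix A :: "real set" assume "A \<in> sets borel"
    hence "g -` A \<in> sets borel" using measurable_sets[OF g(1), of A] by simp
    from in_vimage_algebra[OF this, of X "space M"]
    show "(%w. g (X w)) -` A \<inter> space M \<in> sets (vimage_algebra (space M) X borel)" by (simp add: vimage_def)
   qed
   from sets.sigma_sets_subset[OF this] show ?thesis by simp
  qed
  show "sigma_sets (space M) {Z -` A \<inter> space M |A. A \<in> sets borel} \<subseteq> events"
   "sigma_sets (space M) {(%w. g (X w)) -` A \<inter> space M |A. A \<in> sets borel} \<subseteq> events"
   using 1 2 sets_F indep_setD_ev2[OF ind] by blast+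
  fix a b assume "a \<in> sigma_sets (space M) {Z -` A \<inter> space M |A. A \<in> sets borel}"
   "b \<in> sigma_sets (space M) {(%w. g (X w)) -` A \<inter> space M |A. A \<in> sets borel}"
  thus "prob (a \<inter> b) = prob a * prob b" using 1 2 by (intro indep_setD[OF ind]) auto
 qed (use Z(2) g(2) in auto)
 from indep_var_integrable[OF this Z(2) g(2)] indep_var_lebesgue_integral[OF this Z(2) g(2)]
 show "integrable M (%w. Z w * g (X w))" "(LINT w|M. Z w * g (X w)) = (LINT w|M. Z w) * (LINT w|M. g (X w))" by simp_all
qed

lemma clm_of_martingale:
 assumes "martingale M F P" "cap P" "!!w. w \<in> space M ==> P 0 w = 0"
 shows "clm P"
proof (rule clmI[OF assms(2) cap_const[of 0]])
 fix k
 have "martingale M F (stp (loc (%t w. 0) k) P)" by (intro martingale_stp assms stime_loc cap_const)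
 thus "martingale M F (%t w. stp (loc (%t w. 0) k) P t w - P 0 w)" by (rule martingale_cong) (simp add: assms(3))
qed simp

text \<open>\<open>W\<close> starts at 0 only almost surely, so its initial value is subtracted. For
  the product, both factors are expanded around time s: the mixed terms have mean zero by
  independence, and the product of the two increments contributes t - s on the diagonal.\<close>

lemma brownian_cov:
 assumes W: "brownian_motion M F W"
 shows "cov (%t w. W t w $ i - W 0 w $ i) (%t w. W t w $ j - W 0 w $ j) (%t w. if i = j then t else 0)"
proof -
 let ?D = "%i t w. W t w $ i - W 0 w $ i"
 have cW: "cap (%t w. W t w $ i)" for i
 proof (rule capI)
  fix t :: real assume "0 <= t"
  hence [measurable]: "W t \<in> bm (F t)" using W by (auto simp: brownian_motion_def adapted_process_def)
  show "(%w. W t w $ i) \<in> bm (F t)" by measurable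
 qed (use W in \<open>auto simp: brownian_motion_def continuous_process_def intro!: continuous_intros\<close>)
 have cD: "cap (?D i)" for i by (rule cap_diff[OF cW cap_initial[OF cW]])
 have D0: "?D i 0 w = 0" for i w by simp
 have mD: "?D i s \<in> bm (F s)" if "0 <= s" for i s using cap_measurable[OF cD that order_refl] .
 have inc: "distributed M lborel (%w. W t w - W s w) (%x. ennreal (\<Prod>i\<in>UNIV. normal_density 0 (sqrt (t - s)) (x$i)))"
  "indep_set (sets (F s)) (sets (vimage_algebra (space M) (%w. W t w - W s w) borel))" if "0 <= s" "s < t" for s t
  using W that by (auto simp: brownian_motion_def)
 have gi: "integrable M (%w. (W t w - W s w) $ i)" "(LINT w|M. (W t w - W s w) $ i) = 0"
  "integrable M (%w. (W t w - W s w) $ i * (W t w - W s w) $ j)"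
  "(LINT w|M. (W t w - W s w) $ i * (W t w - W s w) $ j) = (if i = j then t - s else 0)" if st: "0 <= s" "s < t" for s t i j
 proof -
  have sq: "0 < sqrt (t - s)" "(sqrt (t - s))^2 = t - s" using st by simp_all
  note g = gaussian_increment[OF inc(1)[OF st] sq(1)]
  show "integrable M (%w. (W t w - W s w) $ i)" "(LINT w|M. (W t w - W s w) $ i) = 0" by (rule g)+
  show "integrable M (%w. (W t w - W s w) $ i * (W t w - W s w) $ j)" by (rule g)
  show "(LINT w|M. (W t w - W s w) $ i * (W t w - W s w) $ j) = (if i = j then t - s else 0)" using g(4)[of i j] sq(2) by simp
 qed
 have iD: "integrable M (?D i t)" and iDD: "integrable M (%w. ?D i t w * ?D j t w)" if "0 <= t" for i j t
 proof -
  consider "t = 0" | "0 < t" using \<open>0 <= t\<close> by linarith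
  hence "integrable M (?D i t) & integrable M (%w. ?D i t w * ?D j t w)"
  proof cases
   case 2
   thus ?thesis using gi(1)[OF order_refl 2, of i] gi(3)[OF order_refl 2, of i j] by simp
  qed simp
  thus "integrable M (?D i t)" "integrable M (%w. ?D i t w * ?D j t w)" by simp_all
 qed
 have iind: "integrable M (%w. ind A w * f w)" if "integrable M f" "A \<in> sets (F s)" for A s and f :: "'w => real"
  using integrable_mult_indicator[OF _ that(1), of A] that(2) sets_F by auto
 have comp: "(%x::real^2. x $ i) \<in> bm borel" "(%x::real^2. x $ i * x $ j) \<in> bm borel" for i j by measurable
 have m1: "martingale M F (?D i)" for i
 proof (rule martingaleI)
  show "adapted_process F (?D i)" using cD by (simp add: cap_def)
  show "integrable M (?D i t)" if "0 <= t" for t by (rule iD[OF that])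
  fix s t :: real and A assume st: "0 <= s" "s <= t" and A: "A \<in> sets (F s)"
  show "(LINT w|M. ind A w * ?D i t w) = (LINT w|M. ind A w * ?D i s w)"
  proof (cases "s = t")
   case False
   hence st': "0 <= s" "s < t" using st by auto
   have Am: "A \<in> sets M" using A sets_F by blast
   have iA: "integrable M (ind A :: 'w => real)" using Am by (intro integrable_real_indicator) (auto simp: less_top[symmetric])
   have "(LINT w|M. ind A w * (W t w - W s w) $ i) = (LINT w|M. ind A w) * (LINT w|M. (W t w - W s w) $ i)"
    using A iA by (intro indep_increment(2)[OF inc(2)[OF st'] _ _ comp(1) gi(1)[OF st']]) auto
   hence "(LINT w|M. ind A w * ?D i t w - ind A w * ?D i s w) = 0" using gi(2)[OF st'] by (simp add: algebra_simps)
   thus ?thesis using iind[OF iD A] st by simp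
  qed simp
 qed
 have m2: "martingale M F (%t w. ?D i t w * ?D j t w - (if i = j then t else 0))"
 proof (rule martingaleI)
  have "cap (%t w. (if i = j then t else 0))" by (rule capI) (cases "i = j"; simp)+
  thus "adapted_process F (%t w. ?D i t w * ?D j t w - (if i = j then t else 0))" using cap_diff[OF cap_mult[OF cD cD]] by (simp add: cap_def)
  show "integrable M (%w. ?D i t w * ?D j t w - (if i = j then t else 0))" if "0 <= t" for t using iDD[OF that] by auto
  fix s t :: real and A assume st: "0 <= s" "s <= t" and A: "A \<in> sets (F s)"
  show "(LINT w|M. ind A w * (?D i t w * ?D j t w - (if i = j then t else 0))) =
   (LINT w|M. ind A w * (?D i s w * ?D j s w - (if i = j then s else 0)))"
  proof (cases "s = t")
   case False
   hence st': "0 <= s" "s < t" using st by auto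
   have Am: "A \<in> sets M" using A sets_F by blast
   let ?\<Delta> = "%w. W t w - W s w"
   note ii = indep_increment[OF inc(2)[OF st']]
   have iA: "integrable M (ind A :: 'w => real)" using Am by (intro integrable_real_indicator) (auto simp: less_top[symmetric])
   have iAD: "integrable M (%w. ind A w * ?D i s w)" "(%w. ind A w * ?D i s w) \<in> bm (F s)" for i
    using iind[OF iD A] st mD[of s i] A by (auto intro!: borel_measurable_times)
   have e1: "integrable M (%w. ind A w * ?D i s w * ?\<Delta> w $ j)" "(LINT w|M. ind A w * ?D i s w * ?\<Delta> w $ j) = 0" for i j
    using ii[OF iAD(2,1) comp(1) gi(1)[OF st'], of i j] gi(2)[OF st', of j] by simp_all
   have e2: "integrable M (%w. ind A w * (?\<Delta> w $ i * ?\<Delta> w $ j))"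
    "(LINT w|M. ind A w * (?\<Delta> w $ i * ?\<Delta> w $ j)) = measure M A * (if i = j then t - s else 0)"
    using ii[OF _ iA comp(2) gi(3)[OF st'], of i j] gi(4)[OF st', of i j] A Am by auto
   have e3: "integrable M (%w. ind A w * (?D i s w * ?D j s w - (if i = j then s else 0)))" using iDD[OF st(1), of i j] by (intro iind[OF _ A]) auto
   have e4: "integrable M (%w. ind A w * (if i = j then t - s else 0))" using iA by auto
   have "(LINT w|M. ind A w * (?D i t w * ?D j t w - (if i = j then t else 0))) =
    (LINT w|M. ind A w * (?D i s w * ?D j s w - (if i = j then s else 0)) + ind A w * ?D i s w * ?\<Delta> w $ j
     + ind A w * ?D j s w * ?\<Delta> w $ i + ind A w * (?\<Delta> w $ i * ?\<Delta> w $ j) - ind A w * (if i = j then t - s else 0))"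
    by (intro Bochner_Integration.integral_cong) (auto simp: algebra_simps)
   also have "... = (LINT w|M. ind A w * (?D i s w * ?D j s w - (if i = j then s else 0)))
     + (LINT w|M. ind A w * ?D i s w * ?\<Delta> w $ j) + (LINT w|M. ind A w * ?D j s w * ?\<Delta> w $ i)
     + (LINT w|M. ind A w * (?\<Delta> w $ i * ?\<Delta> w $ j)) - (LINT w|M. ind A w * (if i = j then t - s else 0))"
    by (subst Bochner_Integration.integral_diff Bochner_Integration.integral_add; (intro Bochner_Integration.integrable_add e1 e2 e3 e4)?)+ simp
   also have "... = (LINT w|M. ind A w * (?D i s w * ?D j s w - (if i = j then s else 0)))"
    unfolding e1 e2 using Am sets.sets_into_space[OF Am] by (auto simp: Int_absorb2)
   finally show ?thesis .
  qed simp
 qed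
 show ?thesis unfolding cov_def
 proof (intro conjI)
  show "clm (?D i)" "clm (?D j)" by (intro clm_of_martingale m1 cD; simp)+
  show c: "cap (%t w. (if i = j then t else 0))" by (rule capI) (cases "i = j"; simp)+
  show "clm (%t w. ?D i t w * ?D j t w - (if i = j then t else 0))" by (intro clm_of_martingale m2 cap_diff cap_mult cD c) simp
 qed
qed

end

section \<open>Path integrals of continuous processes and boundedness in probability\<close>

context stoch_base
begin

definition pint :: "(real => 'w => real) => (real => 'w => real) => real => 'w => real" where "pint C h t w = (LINT s:{0..t}|pm C w. h s w)"

lemma pint_0: "ci C ==> w \<in> space M ==> pint C h 0 w = 0"
proof -
 assume C: "ci C" and w: "w \<in> space M"
 have "AE s in pm C w. s ~= 0"
 proof (rule AE_I)
  show "emeasure (pm C w) {0..0} = 0" using emeasure_pm_Icc[OF C w, of 0] ci_0[OF C w] by simp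
 qed auto
 hence "AE s in pm C w. ind {0..0} s *\<^sub>R h s w = 0" by eventually_elim (auto simp: indicator_def)
 thus ?thesis unfolding pint_def set_lebesgue_integral_def by (rule integral_eq_zero_AE)
qed

lemma pint_difference_bound:
 assumes C: "ci C" and w: "w \<in> space M" and t: "0 <= t" "t <= T"
  and i: "set_integrable (pm C w) {0..t} f" "set_integrable (pm C w) {0..t} g"
  and le: "!!s. s \<in> {0<..T} ==> \<bar>f s - g s\<bar> <= e"
 shows "\<bar>(LINT s:{0..t}|pm C w. f s) - (LINT s:{0..t}|pm C w. g s)\<bar> <= \<bar>e\<bar> * C T w"
proof -
 have AE0: "AE s in pm C w. s ~= 0"
 proof (rule AE_I)
  show "emeasure (pm C w) {0..0} = 0" using emeasure_pm_Icc[OF C w, of 0] ci_0[OF C w] by simp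
 qed auto
 have ie: "set_integrable (pm C w) {0..t} (%s. \<bar>e\<bar>)" by (rule pm_bounded_integrable[OF C w, where B="\<bar>e\<bar>"]) auto
 have id: "set_integrable (pm C w) {0..t} (%s. f s - g s)" by (rule set_integral_diff(1)[OF i])
 have "\<bar>(LINT s:{0..t}|pm C w. f s) - (LINT s:{0..t}|pm C w. g s)\<bar> = \<bar>LINT s:{0..t}|pm C w. f s - g s\<bar>"
  using set_integral_diff(2)[OF i] by simp
 also have "... <= (\<integral>s. norm (ind {0..t} s *\<^sub>R (f s - g s)) \<partial>pm C w)"
  unfolding set_lebesgue_integral_def using integral_norm_bound[of "pm C w" "%s. ind {0..t} s *\<^sub>R (f s - g s)"] by simp
 also have "... <= (\<integral>s. ind {0..t} s *\<^sub>R \<bar>e\<bar> \<partial>pm C w)"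
 proof (intro integral_mono_AE)
  show "integrable (pm C w) (%s. norm (ind {0..t} s *\<^sub>R (f s - g s)))" using id unfolding set_integrable_def by (rule integrable_norm)
  show "integrable (pm C w) (%s. ind {0..t} s *\<^sub>R \<bar>e\<bar>)" using ie unfolding set_integrable_def .
  show "AE s in pm C w. norm (ind {0..t} s *\<^sub>R (f s - g s)) <= ind {0..t} s *\<^sub>R \<bar>e\<bar>" using AE0
  proof eventually_elim
   case (elim s)
   show ?case
   proof (cases "s \<in> {0..t}")
    case True
    hence "\<bar>f s - g s\<bar> <= \<bar>e\<bar>" using le[of s] elim t by auto
    thus ?thesis using True by simp
   qed simp
  qed
 qed
 also have "... = \<bar>e\<bar> * C t w" using emeasure_pm_Icc[OF C w t(1)] ci_nonneg[OF C w t(1)] by (simp add: measure_def)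
 also have "... <= \<bar>e\<bar> * C T w" using ci_mono[OF C w t] by (intro mult_left_mono) auto
 finally show ?thesis .
qed

lemma path_measurable:
 assumes h: "cap h" and w: "w \<in> space M"
 shows "(%s. h (max 0 s) w) \<in> bm borel"
 by (intro borel_measurable_continuous_onI continuous_on_compose2[OF cap_continuous[OF h w]] continuous_intros) auto

lemma cap_pm_integrable:
 assumes C: "ci C" and h: "cap h" and w: "w \<in> space M"
 shows "set_integrable (pm C w) {0..t} (%s. h s w)"
proof -
 obtain B where B: "!!s. s \<in> {0..t} ==> \<bar>h s w\<bar> <= B" using cap_bounded_on[OF h w] by metis
 have "set_integrable (pm C w) {0..t} (%s. h (max 0 s) w)"
  by (rule pm_bounded_integrable[OF C w path_measurable[OF h w], where B=B]) (use B in \<open>auto simp: max_def\<close>)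
 thus ?thesis by (rule set_integrable_cong[THEN iffD1, rotated -1]) (auto simp: max_def)
qed

lemma rsum_pint:
 assumes C: "ci C" and h: "cap h" and w: "w \<in> space M" and e: "0 < e"
 shows "EV m. \<forall>t\<in>{0..T}. \<bar>rsum m h C t w - pint C h t w\<bar> <= e"
proof (cases "0 <= T")
 case True
 define d where "d = e / (C T w + 1)"
 have pos: "0 < C T w + 1" using ci_nonneg[OF C w True] by simp
 have d: "0 < d" using e pos by (simp add: d_def)
 from rp_uniform[of h w d T, OF cap_continuous[OF h w] d] show ?thesis
 proof eventually_elim
  case (elim m)
  show ?case
  proof
   fix t assume t: "t \<in> {0..T}"
   have "\<bar>rsum m h C t w - pint C h t w\<bar> <= \<bar>d\<bar> * C T w"
    unfolding pint_def simple_integral_pm[OF C w udata_riemann[OF h], of t m, OF atLeastAtMost_iff[THEN iffD1, OF t, THEN conjunct1]]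
    using t elim by (intro pint_difference_bound[OF C w] pm_simple_integrable[OF C w] cap_pm_integrable[OF C h w]) auto
   also have "... <= e" using d pos e by (simp add: d_def divide_simps)
   finally show "\<bar>rsum m h C t w - pint C h t w\<bar> <= e" .
  qed
 qed
qed simp

lemma cap_of_uniform_limit:
 assumes Z: "!!m. cap (Z m)"
  and lim: "!!w T e. w \<in> space M ==> 0 < e ==> EV m. \<forall>t\<in>{0..T}. \<bar>Z m t w - Z' t w\<bar> <= e"
 shows "cap Z'"
proof (rule capI)
 fix t :: real assume t: "0 <= t"
 show "Z' t \<in> bm (F t)"
 proof (rule borel_measurable_LIMSEQ_real[of _ "%m. Z m t"])
  fix w assume "w \<in> space (F t)"
  hence w: "w \<in> space M" by simp
  show "(%m. Z m t w) ----> Z' t w"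
  proof (rule tendstoI)
   fix e :: real assume "0 < e"
   hence "0 < e/2" by simp
   from lim[OF w this, of t] show "EV m. dist (Z m t w) (Z' t w) < e"
   proof eventually_elim
    case (elim m)
    have "\<bar>Z m t w - Z' t w\<bar> <= e/2" using elim t by auto
    thus ?case using \<open>0 < e\<close> by (simp add: dist_real_def)
   qed
  qed
 qed (rule cap_measurable[OF Z t order_refl])
next
 fix w assume w: "w \<in> space M"
 have "continuous_on {0..T} (%t. Z' t w)" for T
 proof (rule uniform_limit_theorem[where F=sequentially and f="%m t. Z m t w"])
  show "EV m. continuous_on {0..T} (%t. Z m t w)" by (intro always_eventually allI continuous_on_subset[OF cap_continuous[OF Z w]]) auto
  show "uniform_limit {0..T} (%m t. Z m t w) (%t. Z' t w) sequentially"
  proof (rule uniform_limitI)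
   fix e :: real assume "0 < e"
   hence "0 < e/2" by simp
   from lim[OF w this, of T] show "EV m. \<forall>t\<in>{0..T}. dist (Z m t w) (Z' t w) < e"
   proof eventually_elim
    case (elim m)
    show ?case
    proof
     fix t assume "t \<in> {0..T}"
     hence "\<bar>Z m t w - Z' t w\<bar> <= e/2" using elim by blast
     thus "dist (Z m t w) (Z' t w) < e" using \<open>0 < e\<close> by (simp add: dist_real_def)
    qed
   qed
  qed
 qed simp

 show "continuous_on {0..} (%t. Z' t w)" unfolding continuous_on_eq_continuous_within
 proof
  fix t :: real assume t: "t \<in> {0..}"
  have "continuous (at t within {0..t+1}) (%t. Z' t w)"
   using \<open>!!T. continuous_on {0..T} (%t. Z' t w)\<close>[of "t + 1"] t by (auto simp: continuous_on_eq_continuous_within)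
  moreover have "at t within {0..t+1} = at t within {0..}" by (rule at_within_nhd[of _ "{..<t+1}"]) auto
  ultimately show "continuous (at t within {0..}) (%t. Z' t w)" by simp
 qed
qed

lemma cap_pint: assumes C: "ci C" and h: "cap h" shows "cap (pint C h)" by (rule cap_of_uniform_limit[where Z="%m. rsum m h C"])
   (use rsum_pint[OF C h] cap_sint[OF ci_cap[OF C] udata_riemann[OF h]] in auto)

lemma ucp_rsum_pint: assumes C: "ci C" and h: "cap h" shows "ucp (%m t w. rsum m h C t w - pint C h t w)"
 by (rule ucp_pathwise) (use rsum_pint[OF C h] cap_diff[OF cap_sint[OF ci_cap[OF C] udata_riemann[OF h]] cap_pint[OF C h]] in auto)

lemma pint_mono:
 assumes C: "ci C" and h: "cap h" and w: "w \<in> space M" and pos: "!!s. 0 <= s ==> 0 <= h s w" and st: "0 <= s" "s <= t"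
 shows "pint C h s w <= pint C h t w" unfolding pint_def set_lebesgue_integral_def
 using cap_pm_integrable[OF C h w] st pos unfolding set_integrable_def by (intro integral_mono) (auto simp: indicator_def)

lemma ci_pint:
 assumes C: "ci C" and h: "cap h" and pos: "!!s w. 0 <= s ==> w \<in> space M ==> 0 <= h s w"
 shows "ci (pint C h)" using pint_mono[OF C h] pos pint_0[OF C] by (intro ciI cap_pint C h) auto

lemma pint_le:
 assumes C: "ci C" and h: "cap h" "cap h'" and w: "w \<in> space M" and le: "!!s. 0 <= s ==> s <= t ==> h s w <= h' s w"
 shows "pint C h t w <= pint C h' t w" unfolding pint_def set_lebesgue_integral_def
 using cap_pm_integrable[OF C h(1) w] cap_pm_integrable[OF C h(2) w] le unfolding set_integrable_def
 by (intro integral_mono) (auto simp: indicator_def)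

lemma clm_AE:
 assumes P: "clm P" and P': "cap P'" and eq: "AE w in M. \<forall>t\<ge>0. P t w = P' t w"
  and 0: "!!w. w \<in> space M ==> P 0 w = 0" "!!w. w \<in> space M ==> P' 0 w = 0"
 shows "clm P'"
proof (rule clm_ucp_limit[OF P _ P' 0])
 show "ucp (%m t w. P t w - P' t w)" by (rule ucp_eq[OF ucp_zero]) (use eq in \<open>auto intro!: cap_diff clm_cap[OF P] P' elim!: AE_mp\<close>)
qed

text \<open>Boundedness in probability, eventually uniform in the index, of the suprema over compact
  intervals. Sums of squared increments are controlled in this weak sense long before anything is
  known about their limit.\<close>

definition tight :: "(nat => real => 'w => real) => bool" where
 "tight S \<longleftrightarrow> (\<forall>m. cap (S m)) & (\<forall>T r. 0 < r --> (\<exists>K. EV m. measure M (supgt (S m) T K) < r))"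

lemma tight_cap: "tight S ==> cap (S m)" by (simp add: tight_def)

lemma tight_const: assumes "cap Z" shows "tight (%m. Z)" unfolding tight_def
proof (intro conjI allI impI assms)
 fix T r :: real assume "0 < r"
 from order_tendstoD(2)[OF supgt_tail[OF assms, of T] this]
 obtain K where "measure M (supgt Z T (real K)) < r" unfolding eventually_sequentially by blast
 thus "\<exists>K. EV m. measure M (supgt Z T K) < r" by (intro exI[of _ "real K"]) simp
qed

text \<open>Error terms have the form of a factor that vanishes along every path, times
  \<open>S m\<close>, which is merely bounded in probability. Off an event of small probability
  \<open>S m\<close> is below a constant, and there the pathwise factor decides.\<close>

lemma ucp_tight:
 assumes D: "!!m. cap (D m)" and S: "tight S"
  and le: "!!w T d. w \<in> space M ==> 0 < d ==> EV m. \<forall>t\<in>{0..T}. \<bar>D m t w\<bar> <= d * (\<bar>S m t w\<bar> + 1)"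
 shows "ucp D" unfolding ucp_def
proof (intro conjI allI impI D)
 fix T e :: real assume e: "0 < e"
 show "(%m. measure M (supgt (D m) T e)) ----> 0"
 proof (rule LIMSEQ_I)
  fix r :: real assume r: "0 < r"
  then obtain K where K: "EV m. measure M (supgt (S m) T K) < r/2" using S unfolding tight_def by (meson half_gt_zero)
  define A where "A m = supgt (D m) T e - supgt (S m) T K" for m
  have Am: "A m \<in> sets M" for m unfolding A_def by (intro sets.Diff supgt_measurable D tight_cap[OF S])
  define d where "d = e / (\<bar>K\<bar> + 1)"
  have d: "0 < d" using e by (simp add: d_def add_nonneg_pos)
  have "(%m. measure M (A m)) ----> 0"
  proof (rule measure_vanish[OF Am], rule AE_I2)
   fix w assume w: "w \<in> space M"
   from le[OF w d, of T] show "EV m. w \<notin> A m"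
   proof eventually_elim
    case (elim m)
    show ?case
    proof
     assume A: "w \<in> A m"
     then obtain t where t: "t \<in> {0..T}" "e < \<bar>D m t w\<bar>" by (auto simp: A_def)
     have "\<bar>S m t w\<bar> <= K" using A t w by (auto simp: A_def not_less)
     hence "d * (\<bar>S m t w\<bar> + 1) <= d * (\<bar>K\<bar> + 1)" using d by (intro mult_left_mono) auto
     also have "... = e" using e by (simp add: d_def)
     finally show False using elim t by fastforce
    qed
   qed
  qed
  from order_tendstoD(2)[OF this, of "r/2"] r K
  have "EV m. measure M (A m) < r/2 & measure M (supgt (S m) T K) < r/2" by (simp add: eventually_conj)
  then obtain n where n: "!!m. m >= n ==> measure M (A m) < r/2 & measure M (supgt (S m) T K) < r/2" unfolding eventually_sequentially by blast
  have "measure M (supgt (D m) T e) < r" if "m >= n" for m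
  proof -
   have "measure M (supgt (D m) T e) <= measure M (A m \<union> supgt (S m) T K)"
    by (intro finite_measure_mono sets.Un Am supgt_measurable tight_cap[OF S]) (auto simp: A_def)
   also have "... <= measure M (A m) + measure M (supgt (S m) T K)" by (intro measure_Un_le Am supgt_measurable tight_cap[OF S])
   finally show ?thesis using n[OF that] by simp
  qed
  thus "\<exists>no. \<forall>m\<ge>no. norm (measure M (supgt (D m) T e) - 0) < r" by (intro exI[of _ n]) auto
 qed
qed

lemma tight_dominated:
 assumes S: "tight S" and S': "tight S'" and D: "!!m. cap (D m)"
  and le: "!!T. EV m. \<forall>w\<in>space M. \<forall>t\<in>{0..T}. \<bar>D m t w\<bar> <= \<bar>S m t w\<bar> + 2 * \<bar>S' m t w\<bar>"
 shows "tight D" unfolding tight_def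
proof (intro conjI allI impI D)
 fix T r :: real assume r: "0 < r"
 then obtain K K' where K: "EV m. measure M (supgt (S m) T K) < r/2" "EV m. measure M (supgt (S' m) T K') < r/2"
  using S S' unfolding tight_def by (meson half_gt_zero)
 from K le[of T] have "EV m. measure M (supgt (D m) T (K + 2 * K')) < r"
 proof eventually_elim
  case (elim m)
  have "measure M (supgt (D m) T (K + 2 * K')) <= measure M (supgt (S m) T K \<union> supgt (S' m) T K')"
  proof (intro finite_measure_mono sets.Un supgt_measurable tight_cap[OF S] tight_cap[OF S'] subsetI)
   fix w assume "w \<in> supgt (D m) T (K + 2 * K')"
   then obtain t where t: "w \<in> space M" "t \<in> {0..T}" "K + 2 * K' < \<bar>D m t w\<bar>" by blast
   hence "\<bar>D m t w\<bar> <= \<bar>S m t w\<bar> + 2 * \<bar>S' m t w\<bar>" using elim by blast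
   hence "\<bar>S m t w\<bar> > K \<or> \<bar>S' m t w\<bar> > K'" using t by linarith
   thus "w \<in> supgt (S m) T K \<union> supgt (S' m) T K'" using t by blast
  qed
  also have "... <= measure M (supgt (S m) T K) + measure M (supgt (S' m) T K')"
   by (intro measure_Un_le supgt_measurable tight_cap[OF S] tight_cap[OF S'])
  finally show ?case using elim by simp
 qed
 thus "\<exists>K. EV m. measure M (supgt (D m) T K) < r" by blast
qed

text \<open>The bracket of the Riemann sum is an integral of squared values of \<open>h\<close>,
  hence at most K^2 K' when |h| is at most K and Q at most K' on [0, T]. Lenglart's inequality is
  used with a threshold just above this value.\<close>

lemma tight_rsum:
 assumes c: "cov N N Q" and Q: "ci Q" and N0: "!!w. w \<in> space M ==> N 0 w = 0" and h: "cap h"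
 shows "tight (%m. rsum m h N)" unfolding tight_def
proof (intro conjI allI impI)
 have cN: "cap N" using c by (auto simp: cov_def intro: clm_cap)
 note u = udata_riemann[OF h]
 show "cap (rsum m h N)" for m by (rule cap_sint[OF cN u])
 fix T r :: real assume r: "0 < r"
 obtain K where K: "measure M (supgt h T (real K)) < r/3"
  using order_tendstoD(2)[OF supgt_tail[OF h, of T], of "r/3"] r unfolding eventually_sequentially by auto
 obtain K' where K': "measure M (supgt Q T (real K')) < r/3"
  using order_tendstoD(2)[OF supgt_tail[OF ci_cap[OF Q], of T], of "r/3"] r unfolding eventually_sequentially by auto
 define et where "et = (real K)^2 * real K' + 1"
 have et: "0 < et" by (simp add: et_def add_nonneg_pos)
 \<comment> \<open>Makes the Chebyshev term r / 4; with two further events of probability below r /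
   3 each, the total stays below r.\<close>
 define de where "de = sqrt (4 * et / r)"
 have de: "0 < de" "et / de^2 = r / 4" using et r by (auto simp: de_def)
 let ?V = "%m. rsum m h (rsum m h Q)"
 have "measure M (supgt (rsum m h N) T de) < r" for m
 proof -
  have cR: "cov (rsum m h N) (rsum m h N) (?V m)" by (rule cov_sint[OF c u u])
  have Veq: "?V m t w = (LINT s:{0..t}|pm Q w. rp m h s w * rp m h s w)" if "0 <= t" "w \<in> space M" for t w
   by (rule simple_integral_pm2[OF Q that(2) u u that(1)])
  have Vpos: "0 <= ?V m t w" if "0 <= t" "w \<in> space M" for t w unfolding Veq[OF that] set_lebesgue_integral_def by (intro integral_nonneg_AE) auto
  have "measure M (supgt (rsum m h N) T de) <= et / de^2 + measure M {w \<in> space M. \<exists>t\<in>{0..T}. ?V m t w >= et}"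
  proof (rule lenglart)
   show "clm (%t w. (rsum m h N t w)^2 - ?V m t w)" using cR by (simp add: cov_def power2_eq_square)
   show "cap (rsum m h N)" "cap (?V m)" using cR by (auto simp: cov_def intro: clm_cap)
  qed (use Vpos de et sint_0[OF u] in auto)
  also have "measure M {w \<in> space M. \<exists>t\<in>{0..T}. ?V m t w >= et} <= measure M (supgt h T (real K) \<union> supgt Q T (real K'))"
  proof (intro finite_measure_mono sets.Un supgt_measurable h ci_cap[OF Q] subsetI)
   fix w assume "w \<in> {w \<in> space M. \<exists>t\<in>{0..T}. ?V m t w >= et}"
   then obtain t where t: "w \<in> space M" "t \<in> {0..T}" "?V m t w >= et" by blast
   show "w \<in> supgt h T (real K) \<union> supgt Q T (real K')"
   proof (rule ccontr)
    assume "\<not> ?thesis"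
    hence hK: "!!s. s \<in> {0..T} ==> \<bar>h s w\<bar> <= real K" and QK: "\<bar>Q t w\<bar> <= real K'" using t by (auto simp: not_less)
    have bd: "rp m h s w * rp m h s w <= (real K)^2" if s: "s \<in> {0<..t}" for s
    proof (cases "s <= real (Suc m)")
     case True
     have "0 < s" using s by simp
     from rp_value[OF this True, of h w] obtain i where i: "gr m i < s" "rp m h s w = h (gr m i) w" by blast
     hence "\<bar>rp m h s w\<bar> <= \<bar>real K\<bar>" using hK[of "gr m i"] s t by auto
     thus ?thesis using power2_le_iff_abs_le[of "real K" "rp m h s w"] by (simp add: power2_eq_square)
    next
     case False
     have "ind {gr m i<..gr m (Suc i)} s = (0::real)" if "i < gn m" for i
      using gr_mono'[of "Suc i" "gn m" m] that False by (auto simp: gr_last indicator_def)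
     hence "rp m h s w = 0" unfolding simple_process_def by (intro sum.neutral) auto
     thus ?thesis by simp
    qed
    have "?V m t w = \<bar>(LINT s:{0..t}|pm Q w. rp m h s w * rp m h s w) - (LINT s:{0..t}|pm Q w. 0)\<bar>" using Veq[of t w] Vpos[of t w] t by simp
    also have "... <= \<bar>(real K)^2\<bar> * Q t w"
     using t bd by (intro pint_difference_bound[OF Q] pm_simple_integrable[OF Q]) (auto simp: set_integrable_def abs_mult_self_eq)
    also have "... <= (real K)^2 * real K'" using QK by (simp add: mult_left_mono)
    finally show False using t by (simp add: et_def)
   qed
  qed
  also have "... <= measure M (supgt h T (real K)) + measure M (supgt Q T (real K'))" by (intro measure_Un_le supgt_measurable h ci_cap[OF Q])
  finally show ?thesis using K K' de(2) r by linarith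
 qed
 thus "\<exists>K. EV m. measure M (supgt (rsum m h N) T K) < r" by (intro exI[of _ de]) simp
qed

end

section \<open>Increments over grid cells and sums of their squares\<close>

definition inc :: "(real => 'w => real) => nat => nat => real => 'w => real" where "inc Z m i t w = Z (min (gr m (Suc i)) t) w - Z (min (gr m i) t) w"

lemma rsum_inc: "rsum m h Z t w = (\<Sum>i<gn m. h (gr m i) w * inc Z m i t w)" by (simp add: simple_integral_def inc_def)

text \<open>A cell that begins after t has increment 0, so the coefficient may be read at a time not
  later than t. This reconciles algebra with stopped times and Riemann sums with unstopped
  coefficients.\<close>

lemma inc_left: "h (min (gr m i) t) w * inc Z m i t w = h (gr m i) w * inc Z m i t w"
proof (cases "gr m i <= t")
 case False
 hence "t <= gr m i" "t <= gr m (Suc i)" using gr_mono[of m i] by linarith+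
 thus ?thesis by (simp add: inc_def min_absorb2)
qed (simp add: min_def)

lemma inc_min: "inc Z m j (min (gr m k) t) w = (if j < k then inc Z m j t w else 0)"
proof (cases "j < k")
 case True
 hence "min (gr m (Suc j)) (min (gr m k) t) = min (gr m (Suc j)) t" "min (gr m j) (min (gr m k) t) = min (gr m j) t"
  using gr_mono'[of "Suc j" k m] gr_mono'[of j k m] by auto
 thus ?thesis using True by (simp add: inc_def)
next
 case False
 hence "min (gr m (Suc j)) (min (gr m k) t) = min (gr m k) t" "min (gr m j) (min (gr m k) t) = min (gr m k) t"
  using gr_mono'[of k "Suc j" m] gr_mono'[of k j m] by auto
 thus ?thesis using False by (simp add: inc_def)
qed

lemma rsum_min: assumes "k <= gn m"
 shows "rsum m h Z (min (gr m k) t) w = (\<Sum>j<k. h (gr m j) w * inc Z m j t w)"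
proof -
 have "rsum m h Z (min (gr m k) t) w = (\<Sum>j<gn m. if j < k then h (gr m j) w * inc Z m j t w else 0)"
  unfolding rsum_inc by (intro sum.cong) (auto simp: inc_min)
 also have "... = (\<Sum>j<k. h (gr m j) w * inc Z m j t w)" using assms by (intro sum.mono_neutral_cong_right) auto
 finally show ?thesis .
qed

lemma inc_rsum: assumes "i < gn m" shows "inc (rsum m h Z) m i t w = h (gr m i) w * inc Z m i t w"
 unfolding inc_def[of "rsum m h Z"] using rsum_min[of "Suc i" m h Z t w] rsum_min[of i m h Z t w] assms by simp

text \<open>Associativity on a common grid: over one cell, the inner sum moves by its coefficient
  times the increment of the integrator.\<close>

lemma rsum_rsum: "rsum m f (rsum m h Z) t w = rsum m (%s w. f s w * h s w) Z t w"
 unfolding rsum_inc[of m f] rsum_inc[of m "%s w. f s w * h s w"] by (intro sum.cong) (auto simp: inc_rsum)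

lemma sum_inc: "0 <= t ==> (\<Sum>i<gn m. inc Z m i t w) = Z (min (real (Suc m)) t) w - Z 0 w"
 using sum_lessThan_telescope[of "%i. Z (min (gr m i) t) w" "gn m"] by (simp add: inc_def gr_last) (simp add: gr_def)

definition qs :: "(real => 'w => real) => nat => real => 'w => real" where "qs Z m t w = (\<Sum>i<gn m. (inc Z m i t w)^2)"

lemma qs_nonneg: "0 <= qs Z m t w" by (simp add: qs_def sum_nonneg)

text \<open>Discrete integration by parts. For a local martingale it makes the sum of squared
  increments a discrete bracket, since the difference from the square is an elementary integral up
  to the horizon of the grid.\<close>

lemma qs_eq:
 assumes "0 <= t"
 shows "(Z (min (real (Suc m)) t) w)^2 - (Z 0 w)^2 = qs Z m t w + 2 * rsum m Z Z t w"
proof -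
 have "(Z (min (real (Suc m)) t) w)^2 - (Z 0 w)^2 = (\<Sum>i<gn m. inc (%t w. (Z t w)^2) m i t w)"
  using sum_inc[OF assms, of "%t w. (Z t w)^2" m w] by simp
 also have "... = (\<Sum>i<gn m. (inc Z m i t w)^2 + 2 * (Z (gr m i) w * inc Z m i t w))"
 proof (intro sum.cong refl)
  fix i
  have "inc (%t w. (Z t w)^2) m i t w = (inc Z m i t w)^2 + 2 * (Z (min (gr m i) t) w * inc Z m i t w)"
   by (simp add: inc_def power2_eq_square algebra_simps)
  thus "inc (%t w. (Z t w)^2) m i t w = (inc Z m i t w)^2 + 2 * (Z (gr m i) w * inc Z m i t w)" by (simp add: inc_left)
 qed
 finally show ?thesis by (simp add: qs_def rsum_inc sum.distrib sum_distrib_left)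
qed

context stoch_base
begin

lemma cap_inc: assumes "cap Z" shows "cap (inc Z m i)"
proof -
 have "cap (%t w. stp (%_. gr m (Suc i)) Z t w - stp (%_. gr m i) Z t w)" by (intro cap_diff cap_stp assms stime_const) auto
 thus ?thesis by (rule cap_cong) (simp add: inc_def stp_def min.commute)
qed

lemma cap_qs: "cap Z ==> cap (qs Z m)" unfolding qs_def[abs_def] by (intro cap_sum cap_power cap_inc)

lemma inc_small:
 assumes Z: "cap Z" and w: "w \<in> space M" and d: "0 < d"
 shows "EV m. \<forall>t\<in>{0..T}. \<forall>i. \<bar>inc Z m i t w\<bar> <= d"
proof -
 have "uniformly_continuous_on {0..T} (%t. Z t w)" by (intro compact_uniformly_continuous continuous_on_subset[OF cap_continuous[OF Z w]]) auto
 then obtain e where e: "e > 0" "!!x y. x \<in> {0..T} ==> y \<in> {0..T} ==> dist y x < e ==> dist (Z y w) (Z x w) < d"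
  unfolding uniformly_continuous_on_def using d by metis
 from order_tendstoD(2)[OF LIMSEQ_Suc[OF lim_1_over_n] e(1)]
 show ?thesis
 proof eventually_elim
  case (elim m)
  show ?case
  proof (intro ballI allI)
   fix t i assume t: "t \<in> {0..T}"
   have "dist (min (gr m (Suc i)) t) (min (gr m i) t) <= gr m (Suc i) - gr m i" unfolding dist_real_def by (smt (verit) gr_mono)
   also have "... < e" using elim by (simp add: gr_step)
   finally have "dist (Z (min (gr m (Suc i)) t) w) (Z (min (gr m i) t) w) < d" using t by (intro e(2)) auto
   thus "\<bar>inc Z m i t w\<bar> <= d" by (simp add: inc_def dist_real_def)
  qed
 qed
qed

lemma ci_inc_nonneg: "ci C ==> w \<in> space M ==> 0 <= t ==> 0 <= inc C m i t w"
 using ci_mono[of C w "min (gr m i) t" "min (gr m (Suc i)) t"] min.mono[OF gr_mono order_refl, of m i t] by (simp add: inc_def)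

lemma ci_sum_inc_le:
 assumes "ci C" "w \<in> space M" "0 <= t" "t <= T"
 shows "(\<Sum>i<gn m. inc C m i t w) <= C T w"
proof -
 have "C (min (real (Suc m)) t) w <= C T w" using assms by (intro ci_mono[OF assms(1,2)]) auto
 thus ?thesis using sum_inc[OF assms(3), of C m w] ci_0[OF assms(1,2)] by simp
qed

end

section \<open>Ito's formula for a continuous semimartingale\<close>

locale ito = stoch_base M F for M :: "'w measure" and F +
 fixes Y N A B Q :: "real => 'w => real"
 assumes cY: "cap Y" and cNN: "cov N N Q" and cQ: "ci Q" and cA: "ci A" and cB: "ci B"
  and N0: "!!w. w \<in> space M ==> N 0 w = 0"
  and Yeq: "!!w t. w \<in> space M ==> 0 <= t ==> Y t w = Y 0 w + N t w + A t w - B t w"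
begin

lemma cN: "cap N" and mN: "clm N" and mU: "clm (%t w. N t w * N t w - Q t w)" using cNN by (auto simp: cov_def intro: clm_cap)

text \<open>By discrete integration by parts, up to the horizon of the grid \<open>qs N\<close> is
  the fixed process N^2 minus twice a Riemann sum, and the Riemann sums are bounded in
  probability.\<close>

lemma tight_qs: "tight (qs N)"
proof (rule tight_dominated[OF tight_const[OF cap_power[OF cN]] tight_rsum[OF cNN cQ N0 cN] cap_qs[OF cN]])
 fix T
 obtain n where n: "T <= real n" using real_arch_simple by blast
 show "EV m. \<forall>w\<in>space M. \<forall>t\<in>{0..T}. \<bar>qs N m t w\<bar> <= \<bar>(N t w)^2\<bar> + 2 * \<bar>rsum m N N t w\<bar>"
 proof (rule eventually_sequentiallyI[of n], intro ballI)
  fix m w t assume m: "n <= m" and w: "w \<in> space M" and t: "t \<in> {0..T}"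
  have "t <= real m" using n m t by (auto intro: order_trans)
  hence "min (real (Suc m)) t = t" by simp
  thus "\<bar>qs N m t w\<bar> <= \<bar>(N t w)^2\<bar> + 2 * \<bar>rsum m N N t w\<bar>" using qs_eq[of t N m w] N0[OF w] t by simp
 qed
qed

text \<open>This is the sum over cells of g times (squared increment of N minus increment of Q), see
  \<open>Eg_sum\<close>. The form chosen here shows that it is a local martingale.\<close>

definition Eg :: "(real => 'w => real) => nat => real => 'w => real" where
 "Eg g m t w = rsum m g (%t w. N t w * N t w - Q t w) t w - 2 * rsum m (%t w. g t w * N t w) N t w"

lemma Eg_term: "g (gr m i) w * inc (%t w. N t w * N t w - Q t w) m i t w - 2 * (g (gr m i) w * N (gr m i) w * inc N m i t w)
   = g (gr m i) w * ((inc N m i t w)^2 - inc Q m i t w)"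
proof -
 have eq: "inc (%t w. N t w * N t w - Q t w) m i t w = (inc N m i t w)^2 - inc Q m i t w + 2 * (N (min (gr m i) t) w * inc N m i t w)"
  by (simp add: inc_def power2_eq_square algebra_simps)
 show ?thesis unfolding eq inc_left by (simp add: algebra_simps)
qed

lemma Eg_sum: "Eg g m t w = (\<Sum>i<gn m. g (gr m i) w * ((inc N m i t w)^2 - inc Q m i t w))"
 unfolding Eg_def rsum_inc[of m g] rsum_inc[of m "%t w. g t w * N t w" N] Eg_term[symmetric] by (simp only: sum_subtractf sum_distrib_left)

lemma inc_Eg: "i < gn m ==> inc (Eg g m) m i t w = g (gr m i) w * ((inc N m i t w)^2 - inc Q m i t w)"
 using inc_rsum[of i m g "%t w. N t w * N t w - Q t w" t w] inc_rsum[of i m "%t w. g t w * N t w" N t w] Eg_term[of g m i w t]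
 by (simp add: inc_def Eg_def)

lemma clm_Eg: assumes "cap g" shows "clm (Eg g m)"
 unfolding Eg_def[abs_def] by (intro clm_diff clm_cmult clm_sint mU mN udata_riemann cap_mult assms cN)

lemma Eg_0: assumes "cap g" shows "Eg g m 0 w = 0"
 unfolding Eg_def by (simp add: sint_0[OF udata_riemann[OF assms]] sint_0[OF udata_riemann[OF cap_mult[OF assms cN]]])

text \<open>Lenglart's inequality with the squared increments of \<open>Eg g m\<close> itself in the
  role of \<open>V\<close>, as discrete integration by parts permits. A squared increment of
  \<open>Eg\<close> is at most a small multiple of the squared increment of N plus the increment of
  Q, and \<open>qs N\<close> is tight.\<close>

lemma ucp_Eg:
 assumes g: "cap g" and G: "!!t w. 0 <= t ==> w \<in> space M ==> \<bar>g t w\<bar> <= G"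
 shows "ucp (Eg g)"
proof -
 have cE: "cap (Eg g m)" for m by (rule clm_cap[OF clm_Eg[OF g]])
 have qs0: "qs (Eg g m) m 0 w = 0" for m w by (simp add: qs_def inc_def min_absorb2)
 show ?thesis
 proof (rule lenglart_ucp[where V="%m. qs (Eg g m) m"])
  fix m
  have "clm (%t w. 2 * rsum m (Eg g m) (Eg g m) t w)" by (intro clm_cmult clm_sint clm_Eg g udata_riemann cE)
  thus "clm (%t w. (Eg g m t w)^2 - qs (Eg g m) m t w)"
  proof (rule clm_cong)
   fix t :: real and w assume t: "0 <= t"
   \<comment> \<open>Riemann sums stop moving beyond the horizon m + 1 of the grid, so the cut-off
     in \<open>qs_eq\<close> has no effect on them.\<close>
   have "Eg g m (min (real (Suc m)) t) w = Eg g m t w"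
   proof -
    have *: "rsum m h Z (min (gr m (gn m)) t) w = rsum m h Z t w" for h Z unfolding rsum_min[OF order_refl] by (rule rsum_inc[symmetric])
    show ?thesis using *[of g "%t w. N t w * N t w - Q t w"] *[of "%t w. g t w * N t w" N] unfolding Eg_def gr_last by simp
   qed
   thus "2 * rsum m (Eg g m) (Eg g m) t w = (Eg g m t w)^2 - qs (Eg g m) m t w" using qs_eq[OF t, of "Eg g m" m w] Eg_0[OF g] by simp
  qed
 next
  show "ucp (%m. qs (Eg g m) m)"
  proof (rule ucp_tight[OF cap_qs[OF cE] tight_qs])
   fix w and T d :: real assume w: "w \<in> space M" and d: "0 < d"
   show "EV m. \<forall>t\<in>{0..T}. \<bar>qs (Eg g m) m t w\<bar> <= d * (\<bar>qs N m t w\<bar> + 1)"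
   proof (cases "0 <= T")
    case True
    \<comment> \<open>Collects the constants of the estimate below, so that cell increments of at
      most \<open>e\<close> with e K bounded by \<open>d\<close> suffice.\<close>
    define K where "K = 2 * (G^2 + 1) * (Q T w + 1)"
    have K: "0 < K" using ci_nonneg[OF cQ w True] by (simp add: K_def add_nonneg_pos)
    define e where "e = min 1 (d / K)"
    have e: "0 < e" "e <= 1" "e * K <= d" using d K by (auto simp: e_def min_def field_simps)
    from inc_small[OF cN w e(1), of T] inc_small[OF ci_cap[OF cQ] w e(1), of T] show ?thesis
    proof eventually_elim
     case (elim m)
     show ?case
     proof
      fix t assume t: "t \<in> {0..T}"
      have le: "(inc (Eg g m) m i t w)^2 <= 2 * (G^2 + 1) * e * ((inc N m i t w)^2 + inc Q m i t w)" if i: "i < gn m" for i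
      proof -
       let ?x = "inc N m i t w" and ?q = "inc Q m i t w"
       have x: "\<bar>?x\<bar> <= e" "0 <= ?q" "?q <= e" using elim t ci_inc_nonneg[OF cQ w, of t m i] by (auto simp: abs_le_iff)
       have "(g (gr m i) w)^2 <= G^2" using G[of "gr m i" w] w abs_le_square_iff[of "g (gr m i) w" G] by (auto intro: order_trans)
       hence g2: "(g (gr m i) w)^2 <= G^2 + 1" by simp
       have "?x^2 <= e^2" using x(1) e abs_le_square_iff[of ?x e] by simp
       moreover have "e^2 <= e" using e mult_left_mono[of e 1 e] by (simp add: power2_eq_square)
       ultimately have x2: "?x^2 <= e" by linarith
       have "(?x^2 - ?q)^2 <= 2 * (?x^2 * ?x^2 + ?q * ?q)" using zero_le_power2[of "?x^2 + ?q"] by (simp add: power2_eq_square algebra_simps)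
       also have "... <= 2 * (e * ?x^2 + e * ?q)" using x x2 by (intro mult_left_mono add_mono mult_right_mono) auto
       finally have q2: "(?x^2 - ?q)^2 <= 2 * e * (?x^2 + ?q)" by (simp add: algebra_simps)
       have "(inc (Eg g m) m i t w)^2 = (g (gr m i) w)^2 * (?x^2 - ?q)^2" by (simp add: inc_Eg[OF i] power_mult_distrib)
       also have "... <= (G^2 + 1) * (2 * e * (?x^2 + ?q))" by (intro mult_mono g2 q2) auto
       finally show ?thesis by (simp add: algebra_simps)
      qed
      have "qs (Eg g m) m t w <= (\<Sum>i<gn m. 2 * (G^2 + 1) * e * ((inc N m i t w)^2 + inc Q m i t w))" unfolding qs_def by (intro sum_mono le) auto
      also have "... = 2 * (G^2 + 1) * e * (qs N m t w + (\<Sum>i<gn m. inc Q m i t w))"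
       by (simp only: qs_def sum_distrib_left[symmetric] sum.distrib)
      also have "... <= 2 * (G^2 + 1) * e * ((Q T w + 1) * (qs N m t w + 1))"
      proof (intro mult_left_mono)
       have "(\<Sum>i<gn m. inc Q m i t w) <= Q T w" using t by (intro ci_sum_inc_le[OF cQ w]) auto
       moreover have "0 <= Q T w * qs N m t w" by (intro mult_nonneg_nonneg qs_nonneg ci_nonneg[OF cQ w True])
       ultimately show "qs N m t w + (\<Sum>i<gn m. inc Q m i t w) <= (Q T w + 1) * (qs N m t w + 1)" by (simp add: algebra_simps)
      qed (use e in auto)
      also have "... = e * K * (qs N m t w + 1)" by (simp add: K_def algebra_simps)
      also have "... <= d * (qs N m t w + 1)" using e qs_nonneg[of N m t w] by (intro mult_right_mono) auto
      finally show "\<bar>qs (Eg g m) m t w\<bar> <= d * (\<bar>qs N m t w\<bar> + 1)" using qs_nonneg[of N m t w] qs_nonneg[of "Eg g m" m t w] by simp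
     qed
    qed
   qed simp
  qed
 qed (use cE Eg_0[OF g] qs0 qs_nonneg in auto)
qed

text \<open>The value that Ito's formula assigns to the integral of f'(Y) against \<open>N\<close>,
  with \<open>f'\<close> and \<open>g\<close> in place of the first two derivatives of
  \<open>f\<close>. Taking the formula as definition provides a continuous adapted version at once;
  that Riemann sums converge to it is the theorem.\<close>

definition Theta :: "(real => real) => (real => real) => (real => real) => real => 'w => real" where
 "Theta f f' g t w = f (Y t w) - f (Y 0 w) - 1/2 * pint Q (%s w. g (Y s w)) t w - (pint A (%s w. f' (Y s w)) t w - pint B (%s w. f' (Y s w)) t w)"

lemma cap_Theta:
 assumes "continuous_on UNIV f" "continuous_on UNIV f'" "continuous_on UNIV g"
 shows "cap (Theta f f' g)"
proof -
 have "cap (%t w. f (Y t w) - f (Y 0 w))" using cap_compose[OF cY assms(1)] cap_initial[OF cap_compose[OF cY assms(1)]] by (rule cap_diff)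
 thus ?thesis unfolding Theta_def[abs_def]
  by (intro cap_diff[OF cap_diff] cap_diff[of "pint A _"] cap_cmult cap_pint cQ cA cB cap_compose[OF cY] assms)
qed

text \<open>Smoothness enters through a Taylor estimate with cubic remainder and a bound on
  \<open>g\<close>, which fits piecewise cubic functions. The Riemann sum differs from
  \<open>Theta\<close> by half of \<open>Eg\<close>, a vanishing martingale, and by
  \<open>R\<close>, which along each path is at most a small multiple of \<open>qs N\<close> +
  1.\<close>

theorem ito_formula:
 assumes cont: "continuous_on UNIV f" "continuous_on UNIV f'" "continuous_on UNIV g"
  and G: "!!x. \<bar>g x\<bar> <= G"
  and taylor: "!!x y. \<bar>f y - f x - f' x * (y - x) - 1/2 * g x * (y - x)^2\<bar> <= C * \<bar>y - x\<bar>^3"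
 shows "ucp (%m t w. rsum m (%s w. f' (Y s w)) N t w - Theta f f' g t w)"
proof -
 let ?f' = "%s w. f' (Y s w)" and ?g = "%s w. g (Y s w)"
 have cf': "cap ?f'" and cg: "cap ?g" by (intro cap_compose[OF cY] cont)+
 have G0: "0 <= G" using G[of 0] by simp
 have C0: "0 <= C" using order_trans[OF abs_ge_zero taylor[of 1 0]] by simp
 define R where "R m t w = Theta f f' g t w - rsum m ?f' N t w - 1/2 * Eg ?g m t w" for m t w
 have cR: "cap (R m)" for m unfolding R_def[abs_def] by (intro cap_diff cap_cmult cap_Theta cont cap_sint cN udata_riemann cf' clm_cap[OF clm_Eg] cg)
 have "ucp R"
 proof (rule ucp_tight[OF cR tight_qs])
  fix w and T d :: real assume w: "w \<in> space M" and d: "0 < d"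
  show "EV m. \<forall>t\<in>{0..T}. \<bar>R m t w\<bar> <= d * (\<bar>qs N m t w\<bar> + 1)"
  proof (cases "0 <= T")
   case True
   define K where "K = 2 * C + (2 * C + G) * (A T w + B T w) + 3"
   have AB: "0 <= A T w" "0 <= B T w" using ci_nonneg[OF cA w True] ci_nonneg[OF cB w True] by auto
   have K: "0 < K" "2 * C <= K" "(2 * C + G) * (A T w + B T w) + 3 <= K" using AB C0 G0 by (auto simp: K_def intro!: add_nonneg_pos)
   define e where "e = min 1 (d / K)"
   have e: "0 < e" "e <= 1" "e * K <= d" using d K by (auto simp: e_def min_def field_simps)
   have e2: "0 < e / 2" using e by simp
   obtain n where n: "T <= real n" using real_arch_simple by blast
   from inc_small[OF cN w e(1), of T] inc_small[OF cY w e(1), of T] inc_small[OF ci_cap[OF cA] w e2, of T] inc_small[OF ci_cap[OF cB] w e2, of T]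
    rsum_pint[OF cA cf' w e(1), of T] rsum_pint[OF cB cf' w e(1), of T] rsum_pint[OF cQ cg w e(1), of T] eventually_ge_at_top[of n]
   show ?thesis
   proof eventually_elim
    case (elim m)
    show ?case
    proof
     fix t assume t: "t \<in> {0..T}"
     hence t0: "0 <= t" "t <= T" by auto
     have "t <= real m" using n elim(8) t0 by (auto intro: order_trans)
     hence mt: "min (real (Suc m)) t = t" by simp
     let ?x = "%i. inc N m i t w" and ?y = "%i. inc Y m i t w" and ?a = "%i. inc A m i t w" and ?b = "%i. inc B m i t w"
     have y: "?y i = ?x i + ?a i - ?b i" for i using Yeq[OF w, of "min (gr m (Suc i)) t"] Yeq[OF w, of "min (gr m i) t"] t0 by (simp add: inc_def)
     \<comment> \<open>The Taylor remainder of one cell, with the squared increment of N instead of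
       that of Y. The exchange costs only a product of a small increment with an increment of A +
       B.\<close>
     define wt where "wt i = inc (%t w. f (Y t w)) m i t w - f' (Y (gr m i) w) * ?y i - 1/2 * (g (Y (gr m i) w) * (?x i)^2)" for i
     have fsum: "f (Y t w) - f (Y 0 w) = (\<Sum>i<gn m. inc (%t w. f (Y t w)) m i t w)" using sum_inc[OF t0(1), of "%t w. f (Y t w)" m w] mt by simp
     have s1: "(\<Sum>i<gn m. f' (Y (gr m i) w) * ?y i) = rsum m ?f' N t w + rsum m ?f' A t w - rsum m ?f' B t w"
      unfolding rsum_inc[of m ?f'] y by (simp add: algebra_simps sum.distrib sum_subtractf)
     have s2: "(\<Sum>i<gn m. g (Y (gr m i) w) * (?x i)^2) = Eg ?g m t w + rsum m ?g Q t w"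
      unfolding Eg_sum rsum_inc[of m ?g] by (simp add: algebra_simps sum.distrib[symmetric])
     have wsum: "(\<Sum>i<gn m. wt i) = f (Y t w) - f (Y 0 w) - (rsum m ?f' N t w + rsum m ?f' A t w - rsum m ?f' B t w)
       - 1/2 * (Eg ?g m t w + rsum m ?g Q t w)" unfolding wt_def sum_subtractf fsum s1[symmetric] s2[symmetric] sum_distrib_left by simp
     have Req: "R m t w = (\<Sum>i<gn m. wt i) + (rsum m ?f' A t w - pint A ?f' t w) - (rsum m ?f' B t w - pint B ?f' t w)
       + 1/2 * (rsum m ?g Q t w - pint Q ?g t w)" unfolding wsum R_def Theta_def by (simp add: algebra_simps)
     have wle: "\<bar>wt i\<bar> <= 2 * C * e * (?x i)^2 + (2 * C + G) * e * (?a i + ?b i)" for i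
     proof -
      let ?v = "?a i + ?b i"
      have ab: "0 <= ?a i" "0 <= ?b i" using ci_inc_nonneg[OF cA w t0(1)] ci_inc_nonneg[OF cB w t0(1)] by auto
      have "\<bar>?a i\<bar> <= e/2" "\<bar>?b i\<bar> <= e/2" using elim(3,4) t by blast+
      hence v: "0 <= ?v" "?v <= e" "\<bar>?a i - ?b i\<bar> <= ?v" using ab by auto
      have xy: "\<bar>?x i\<bar> <= e" "\<bar>?y i\<bar> <= e" using elim(1,2) t by blast+
      let ?c = "Y (min (gr m i) t) w"
      \<comment> \<open>Expansion is around the clamped left end \<open>?c\<close>. For a cell
        starting after t all increments vanish and both sides are 0.\<close>
      have w': "wt i = (f (?c + ?y i) - f ?c - f' ?c * ?y i - 1/2 * g ?c * (?y i)^2) + 1/2 * g ?c * ((?y i)^2 - (?x i)^2)"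
      proof (cases "gr m i <= t")
       case True
       hence "?c = Y (gr m i) w" by (simp add: min_def)
       moreover have "inc (%t w. f (Y t w)) m i t w = f (?c + ?y i) - f ?c" by (simp add: inc_def)
       ultimately show ?thesis unfolding wt_def by (simp add: algebra_simps)
      next
       case False
       hence "t <= gr m i" "t <= gr m (Suc i)" using gr_mono[of m i] by linarith+
       hence z: "inc Z m i t w = 0" for Z :: "real => 'w => real" by (simp add: inc_def min_absorb2)
       show ?thesis unfolding wt_def z by simp
      qed
      have y2: "(?y i)^2 <= 2 * (?x i)^2 + 2 * ?v"
      proof -
       have "(?y i)^2 <= 2 * (?x i)^2 + 2 * (?a i - ?b i)^2"
        unfolding y using zero_le_power2[of "?x i - (?a i - ?b i)"] by (simp add: power2_eq_square algebra_simps)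
       moreover have "(?a i - ?b i)^2 <= ?v"
       proof -
        have "(?a i - ?b i)^2 <= ?v^2" using v abs_le_square_iff[of "?a i - ?b i" ?v] by simp
        also have "... <= ?v" using v e mult_left_mono[of ?v 1 ?v] by (simp add: power2_eq_square)
        finally show ?thesis .
       qed
       ultimately show ?thesis by simp
      qed
      have "\<bar>f (?c + ?y i) - f ?c - f' ?c * ?y i - 1/2 * g ?c * (?y i)^2\<bar> <= C * \<bar>?y i\<bar>^3" using taylor[of "?c + ?y i" ?c] by simp
      also have "... = C * (\<bar>?y i\<bar> * (?y i)^2)" by (simp add: power3_eq_cube power2_eq_square mult.assoc)
      also have "... <= C * (e * (2 * (?x i)^2 + 2 * ?v))" using xy y2 C0 e by (intro mult_left_mono mult_mono) auto
      finally have p1: "\<bar>f (?c + ?y i) - f ?c - f' ?c * ?y i - 1/2 * g ?c * (?y i)^2\<bar> <= C * (e * (2 * (?x i)^2 + 2 * ?v))" .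
      have "\<bar>(?y i)^2 - (?x i)^2\<bar> = \<bar>?a i - ?b i\<bar> * \<bar>?y i + ?x i\<bar>"
       unfolding y abs_mult[symmetric] by (simp add: power2_eq_square algebra_simps)
      also have "... <= ?v * (2 * e)" using v xy by (intro mult_mono) auto
      finally have "\<bar>g ?c\<bar> * \<bar>(?y i)^2 - (?x i)^2\<bar> <= G * (?v * (2 * e))" using G G0 by (intro mult_mono) auto
      hence p2: "\<bar>1/2 * g ?c * ((?y i)^2 - (?x i)^2)\<bar> <= G * (?v * e)" by (simp add: abs_mult)
      show ?thesis using p1 p2 unfolding w' by (simp add: algebra_simps abs_le_iff)
     qed
     have "\<bar>\<Sum>i<gn m. wt i\<bar> <= (\<Sum>i<gn m. \<bar>wt i\<bar>)" by (rule sum_abs)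
     also have "... <= (\<Sum>i<gn m. 2 * C * e * (?x i)^2 + (2 * C + G) * e * (?a i + ?b i))" by (intro sum_mono wle)
     also have "... = 2 * C * e * qs N m t w + (2 * C + G) * e * ((\<Sum>i<gn m. ?a i) + (\<Sum>i<gn m. ?b i))"
      by (simp only: qs_def sum.distrib sum_distrib_left[symmetric])
     also have "... <= 2 * C * e * qs N m t w + (2 * C + G) * e * (A T w + B T w)"
      using ci_sum_inc_le[OF cA w t0] ci_sum_inc_le[OF cB w t0] C0 G0 e by (intro add_left_mono mult_left_mono add_mono) auto
     finally have ws: "\<bar>\<Sum>i<gn m. wt i\<bar> <= 2 * C * e * qs N m t w + (2 * C + G) * e * (A T w + B T w)" .
     have el: "\<bar>rsum m ?f' A t w - pint A ?f' t w\<bar> <= e" "\<bar>rsum m ?f' B t w - pint B ?f' t w\<bar> <= e" "\<bar>rsum m ?g Q t w - pint Q ?g t w\<bar> <= e"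
      using elim(5,6,7) t by blast+
     have aux: "\<bar>wt + p - q + 1/2 * r\<bar> <= X + 3 * e"
      if "\<bar>wt\<bar> <= X" "\<bar>p\<bar> <= e" "\<bar>q\<bar> <= e" "\<bar>r\<bar> <= e" for wt p q r X :: real using that by linarith
     have "\<bar>R m t w\<bar> <= 2 * C * e * qs N m t w + (2 * C + G) * e * (A T w + B T w) + 3 * e" unfolding Req by (rule aux[OF ws el])
     also have "... = e * (2 * C * qs N m t w + ((2 * C + G) * (A T w + B T w) + 3))" by (simp add: algebra_simps)
     also have "... <= e * (K * qs N m t w + K)" using K e qs_nonneg[of N m t w] by (intro mult_left_mono add_mono mult_right_mono) auto
     also have "... = e * K * (qs N m t w + 1)" by (simp add: algebra_simps)
     also have "... <= d * (qs N m t w + 1)" using e qs_nonneg[of N m t w] by (intro mult_right_mono) auto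
     finally show "\<bar>R m t w\<bar> <= d * (\<bar>qs N m t w\<bar> + 1)" using qs_nonneg[of N m t w] by simp
    qed
   qed
  qed simp
 qed
 hence "ucp (%m t w. -1 * (R m t w + 1/2 * Eg ?g m t w))" by (intro ucp_cmult ucp_add ucp_Eg[OF cg, of G] G)
 moreover have "-1 * (R m t w + 1/2 * Eg ?g m t w) = rsum m ?f' N t w - Theta f f' g t w" for m t w by (simp add: R_def)
 ultimately show ?thesis by (simp only:)
qed

lemma ucp_rsum_product:
 assumes "cap f" "cap h"
 shows "ucp (%m t w. rsum m f (rsum m h Q) t w - pint Q (%s w. f s w * h s w) t w)" unfolding rsum_rsum by (intro ucp_rsum_pint cQ cap_mult assms)

lemma cov_limits:
 assumes f: "cap f" "cap P" "ucp (%m t w. rsum m f N t w - P t w)" "!!w. w \<in> space M ==> P 0 w = 0"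
  and h: "cap h" "cap P'" "ucp (%m t w. rsum m h N t w - P' t w)" "!!w. w \<in> space M ==> P' 0 w = 0"
 shows "cov P P' (pint Q (%s w. f s w * h s w))"
proof (rule cov_ucp_limit[OF cov_sint[OF cNN udata_riemann[OF f(1)] udata_riemann[OF h(1)]] f(3) h(3) ucp_rsum_product[OF f(1) h(1)]])
 show "cap P" "cap P'" by fact+
 show "cap (pint Q (%s w. f s w * h s w))" by (intro cap_pint cQ cap_mult f h)
qed (use sint_0[OF udata_riemann[OF f(1)]] sint_0[OF udata_riemann[OF h(1)]] f(4) h(4) pint_0[OF cQ] in auto)

lemma Theta_0: "w \<in> space M ==> Theta f f' g 0 w = 0" by (simp add: Theta_def pint_0 cQ cA cB)

end

section \<open>Trapezoidal smoothing of the absolute value\<close>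

definition pp0 :: "real => real" where "pp0 x = (max 0 x)^3 / 6"
definition pp1 :: "real => real" where "pp1 x = (max 0 x)^2 / 2"
definition pp2 :: "real => real" where "pp2 x = max 0 x"

lemma pp_continuous: "continuous_on UNIV pp0" "continuous_on UNIV pp1" "continuous_on UNIV pp2"
 unfolding pp0_def[abs_def] pp1_def[abs_def] pp2_def[abs_def] by (intro continuous_intros; simp)+

text \<open>\<open>pp2\<close> is the second derivative of \<open>pp0\<close> and Lipschitz with
  constant 1, whence the factor 1/6. The cases distinguish the sides of 0 on which x and y
  lie.\<close>

lemma pp0_taylor: "\<bar>pp0 y - pp0 x - pp1 x * (y - x) - 1/2 * pp2 x * (y - x)^2\<bar> <= 1/6 * \<bar>y - x\<bar>^3"
proof -
 define d where "d = y - x"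
 have y: "y = x + d" by (simp add: d_def)
 consider "0 <= x" "0 <= y" | "x < 0" "y <= 0" | "x < 0" "0 < y" | "0 <= x" "y < 0" by linarith
 hence "\<bar>pp0 y - pp0 x - pp1 x * d - 1/2 * pp2 x * d^2\<bar> <= 1/6 * \<bar>d\<bar>^3"
 proof cases
  case 1
  hence eq: "pp0 y - pp0 x - pp1 x * d - 1/2 * pp2 x * d^2 = d^3 / 6"
   unfolding pp0_def pp1_def pp2_def max_absorb2[OF 1(1)] max_absorb2[OF 1(2)] y by (simp add: field_simps power2_eq_square power3_eq_cube)
  show ?thesis unfolding eq by (simp add: power_abs)
 next
  case 2
  thus ?thesis by (simp add: pp0_def pp1_def pp2_def max_def)
 next
  case 3
  hence "pp0 y <= 1/6 * d^3" using power_mono[of y d 3] by (simp add: pp0_def d_def max_def)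
  moreover have "0 <= pp0 y" by (simp add: pp0_def)
  ultimately show ?thesis using 3 by (simp add: pp0_def pp1_def pp2_def max_def d_def)
 next
  case 4
  have "pp0 y - pp0 x - pp1 x * d - 1/2 * pp2 x * d^2 = (d^3 - y^3) / 6"
   using 4 unfolding pp0_def pp1_def pp2_def y by (simp add: max_def field_simps power2_eq_square power3_eq_cube)
  also have "\<bar>...\<bar> <= 1/6 * \<bar>d\<bar>^3"
  proof -
   have "(- y)^3 <= (- d)^3" using 4 by (intro power_mono) (auto simp: d_def)
   moreover have "0 <= (- y)^3" using 4 by (intro zero_le_power) auto
   moreover have "\<bar>d\<bar>^3 = (- d)^3" using 4 by (simp add: d_def)
   ultimately show ?thesis by simp
  qed
  finally show ?thesis .
 qed
 thus ?thesis by (simp add: d_def)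
qed

lemma pp1_mono: "x <= y ==> pp1 x <= pp1 y" unfolding pp1_def by (intro divide_right_mono power_mono) auto

lemma pp0_increment: "x <= y ==> 0 <= pp0 y - pp0 x & pp0 y - pp0 x <= (y - x) * pp1 y"
proof -
 assume xy: "x <= y"
 define u v where "u = max 0 x" "v = max 0 y"
 have uv: "0 <= u" "u <= v" "v - u <= y - x" using xy by (auto simp: u_v_def)
 have "v^3 - u^3 = (v - u) * (v^2 + v * u + u^2)" by (simp add: power2_eq_square power3_eq_cube algebra_simps)
 also have "... <= (v - u) * (v^2 + v^2 + v^2)"
  using uv power_mono[of u v 2] mult_left_mono[of u v v] by (intro mult_left_mono add_mono) (auto simp: power2_eq_square)
 also have "... <= (y - x) * (3 * v^2)" using uv by (intro mult_mono) auto
 finally have "v^3 - u^3 <= (y - x) * (3 * v^2)" .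
 moreover have "u^3 <= v^3" using uv by (intro power_mono) auto
 ultimately show ?thesis by (simp add: pp0_def pp1_def u_v_def)
qed

text \<open>\<open>T2\<close> is a trapezoid of height \<open>2 / (a + b)\<close>, equal to it on \<open>[-b, b]\<close> and vanishing off \<open>(-a, a)\<close>;
 \<open>T1\<close> and \<open>T0\<close> are its first and second antiderivatives, normalised so that \<open>T1\<close> interpolates \<open>sgn\<close>
 and \<open>T0\<close> interpolates the absolute value.\<close>

definition T0 :: "real => real => real => real" where "T0 a b y = 2 / (a^2 - b^2) * (pp0 (y + a) - pp0 (y + b) - pp0 (y - b) + pp0 (y - a)) - y"
definition T1 :: "real => real => real => real" where "T1 a b y = 2 / (a^2 - b^2) * (pp1 (y + a) - pp1 (y + b) - pp1 (y - b) + pp1 (y - a)) - 1"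
definition T2 :: "real => real => real => real" where "T2 a b y = 2 / (a^2 - b^2) * (pp2 (y + a) - pp2 (y + b) - pp2 (y - b) + pp2 (y - a))"

lemma T_continuous: "continuous_on UNIV (T0 a b)" "continuous_on UNIV (T1 a b)" "continuous_on UNIV (T2 a b)"
 unfolding T0_def[abs_def] T1_def[abs_def] T2_def[abs_def]
 by (intro continuous_intros continuous_on_compose2[OF pp_continuous(1)] continuous_on_compose2[OF pp_continuous(2)]
   continuous_on_compose2[OF pp_continuous(3)]; simp)+

context
 fixes a b :: real
 assumes ab: "0 < b" "b < a"
begin

lemma ab_sq: "0 < a^2 - b^2" "a^2 - b^2 = (a - b) * (a + b)"
proof -
 show "a^2 - b^2 = (a - b) * (a + b)" by (simp add: power2_eq_square algebra_simps)
 thus "0 < a^2 - b^2" using ab by simp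
qed

text \<open>Four shifted copies of \<open>pp0\<close>, each with remainder at most |y - x|^3 / 6;
  the sum 4/6 is rounded up to 1 before multiplication by the prefactor.\<close>

lemma T0_taylor: "\<bar>T0 a b y - T0 a b x - T1 a b x * (y - x) - 1/2 * T2 a b x * (y - x)^2\<bar> <= 2 / (a^2 - b^2) * \<bar>y - x\<bar>^3"
proof -
 define c where "c = 2 / (a^2 - b^2)"
 have c: "0 < c" using ab_sq(1) by (simp add: c_def)
 define r where "r s = pp0 (y + s) - pp0 (x + s) - pp1 (x + s) * (y - x) - 1/2 * pp2 (x + s) * (y - x)^2" for s
 have r: "\<bar>r s\<bar> <= 1/6 * \<bar>y - x\<bar>^3" for s using pp0_taylor[of "y + s" "x + s"] by (simp add: r_def)
 have "T0 a b y - T0 a b x - T1 a b x * (y - x) - 1/2 * T2 a b x * (y - x)^2 = c * (r a - r b - r (- b) + r (- a))"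
  unfolding T0_def T1_def T2_def r_def c_def[symmetric] by (simp add: algebra_simps)
 also have "\<bar>...\<bar> <= c * \<bar>y - x\<bar>^3"
 proof -
  have "\<bar>r a - r b - r (- b) + r (- a)\<bar> <= \<bar>y - x\<bar>^3"
   using r[of a] r[of b] r[of "- a"] r[of "- b"] zero_le_power[of "\<bar>y - x\<bar>" 3] by linarith
  thus ?thesis using c by (simp add: abs_mult)
 qed
 finally show ?thesis by (simp add: c_def)
qed

lemma T2_values: "\<bar>y\<bar> <= b ==> T2 a b y = 2 / (a + b)" "a <= \<bar>y\<bar> ==> T2 a b y = 0" "0 <= T2 a b y" "T2 a b y <= 2 / (a + b)"
proof -
 define wt where "wt = pp2 (y + a) - pp2 (y + b) - pp2 (y - b) + pp2 (y - a)"
 have wt: "0 <= wt" "wt <= a - b" "\<bar>y\<bar> <= b ==> wt = a - b" "a <= \<bar>y\<bar> ==> wt = 0"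
  using ab by (auto simp: wt_def pp2_def max_def abs_if split: if_splits)
 have eq: "T2 a b y = 2 * (wt / (a - b)) / (a + b)" by (simp add: T2_def wt_def ab_sq(2))
 show "\<bar>y\<bar> <= b ==> T2 a b y = 2 / (a + b)" "a <= \<bar>y\<bar> ==> T2 a b y = 0" using wt ab by (auto simp: eq)
 show "0 <= T2 a b y" using wt ab by (simp add: eq)
 have "wt / (a - b) <= 1" using wt ab by simp
 hence "2 * (wt / (a - b)) / (a + b) <= 2 * 1 / (a + b)" using ab by (intro divide_right_mono mult_left_mono) auto
 thus "T2 a b y <= 2 / (a + b)" using ab by (simp add: eq)
qed

lemma T1_values: "a <= \<bar>y\<bar> ==> T1 a b y = sgn y" "T1 a b 0 = 0" "\<bar>T1 a b y\<bar> <= 1"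
proof -
 define wt where "wt = pp1 (y + a) - pp1 (y + b) - pp1 (y - b) + pp1 (y - a)"
 have eq: "T1 a b y = 2 * (wt / (a^2 - b^2)) - 1" by (simp add: T1_def wt_def)
 have w0: "wt = 0" if "y <= - a" using that ab by (simp add: wt_def pp1_def max_def)
 have w1: "wt = a^2 - b^2" if "a <= y" using that ab by (simp add: wt_def pp1_def max_def power2_eq_square field_simps)
 have "wt / (a^2 - b^2) = 1" if "a <= y" using w1[OF that] ab_sq(1) by (metis divide_self less_irrefl)
 thus "a <= \<bar>y\<bar> ==> T1 a b y = sgn y" using w0 ab by (auto simp: eq abs_if split: if_splits)
 show "T1 a b 0 = 0" using ab ab_sq(1) by (simp add: T1_def pp1_def max_def field_simps)
 have "0 <= wt" "wt <= a^2 - b^2"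
 proof -
  consider "y <= - a" | "- a <= y" "y <= - b" | "- b <= y" "y <= b" | "b <= y" "y <= a" | "a <= y" by linarith
  hence "0 <= wt & wt <= a^2 - b^2"
  proof cases
   case 1 thus ?thesis using w0 ab_sq(1) by simp
  next
   case 2
   hence "wt = (y + a)^2 / 2" using ab by (auto simp: wt_def pp1_def max_def power2_eq_square)
   moreover have "(y + a)^2 <= (a - b)^2" using 2 by (intro power_mono) auto
   moreover have "(a - b)^2 <= a^2 - b^2" unfolding ab_sq(2) unfolding power2_eq_square using ab by (intro mult_left_mono) auto
   moreover have "0 <= (y + a)^2" by simp
   ultimately show ?thesis by linarith
  next
   case 3
   define z where "z = (2 * y + a + b) / 2"
   have "wt = (a - b) * z" unfolding z_def using 3 ab by (auto simp: wt_def pp1_def max_def power2_eq_square field_simps)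
   moreover have "0 <= (a - b) * z" "(a - b) * z <= (a - b) * (a + b)" using 3 ab by (auto simp: z_def intro!: mult_nonneg_nonneg mult_left_mono)
   ultimately show ?thesis by (simp only: ab_sq(2))
  next
   case 4
   hence "wt = a^2 - b^2 - (a - y)^2 / 2" using ab by (auto simp: wt_def pp1_def max_def power2_eq_square field_simps)
   moreover have "(a - y)^2 <= (a - b)^2" using 4 by (intro power_mono) auto
   moreover have "(a - b)^2 <= a^2 - b^2" unfolding ab_sq(2) unfolding power2_eq_square using ab by (intro mult_left_mono) auto
   moreover have "0 <= (a - y)^2" by simp
   ultimately show ?thesis by linarith
  next
   case 5 thus ?thesis using w1 ab_sq(1) by simp
  qed
  thus "0 <= wt" "wt <= a^2 - b^2" by auto
 qed
 hence "0 <= 2 * wt / (a^2 - b^2)" "2 * wt / (a^2 - b^2) <= 2" using ab_sq(1) by (auto simp: field_simps)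
 thus "\<bar>T1 a b y\<bar> <= 1" by (simp add: eq abs_le_iff)
qed

text \<open>A crude constant, as the order in a is what matters: for |y| at most a the scaled cubics
  contribute at most 4 a, and the two further terms of modulus |y| at most 2 a. Outside, the cubics
  reproduce the modulus exactly.\<close>

lemma T0_close: "\<bar>T0 a b y - \<bar>y\<bar>\<bar> <= 10 * a"
proof -
 define wt where "wt = pp0 (y + a) - pp0 (y + b) - pp0 (y - b) + pp0 (y - a)"
 have eq: "T0 a b y = 2 * wt / (a^2 - b^2) - y" by (simp add: T0_def wt_def)
 consider "y <= - a" | "a <= y" | "\<bar>y\<bar> <= a" by linarith
 thus ?thesis
 proof cases
  case 1
  hence "wt = 0" using ab by (simp add: wt_def pp0_def max_def)
  thus ?thesis using 1 ab by (simp add: eq)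
 next
  case 2
  hence "wt = y * (a^2 - b^2)" using ab by (simp add: wt_def pp0_def max_def power2_eq_square power3_eq_cube field_simps)
  hence "T0 a b y = y" using ab_sq(1) by (simp add: eq)
  thus ?thesis using 2 ab by simp
 next
  case 3
  have p1: "pp1 (y + a) <= 2 * a^2" "pp1 (y - b) <= 2 * a^2"
   using pp1_mono[of "y + a" "2 * a"] pp1_mono[of "y - b" "2 * a"] 3 ab by (auto simp: pp1_def max_def power2_eq_square split: if_splits)
  have "0 <= pp0 (y + a) - pp0 (y + b)" "pp0 (y + a) - pp0 (y + b) <= (a - b) * pp1 (y + a)"
   "0 <= pp0 (y - b) - pp0 (y - a)" "pp0 (y - b) - pp0 (y - a) <= (a - b) * pp1 (y - b)"
   using pp0_increment[of "y + b" "y + a"] pp0_increment[of "y - a" "y - b"] ab by auto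
  moreover have "(a - b) * pp1 (y + a) <= (a - b) * (2 * a^2)" "(a - b) * pp1 (y - b) <= (a - b) * (2 * a^2)"
   using p1 ab by (auto intro!: mult_left_mono)
  ultimately have "\<bar>wt\<bar> <= (a - b) * (2 * a^2)" unfolding wt_def by linarith
  hence "\<bar>2 * wt / (a^2 - b^2)\<bar> <= 2 * ((a - b) * (2 * a^2)) / (a^2 - b^2)" using ab_sq(1) by (simp add: abs_mult divide_right_mono)
  also have "... = 4 * a * (a / (a + b))" unfolding ab_sq(2) using ab by (simp add: divide_simps power2_eq_square)
  also have "... <= 4 * a * 1" using ab by (intro mult_left_mono) auto
  finally show ?thesis using 3 ab unfolding eq by linarith
 qed
qed

end

text \<open>With tolerances (k + 1)^-2 the tail bounds below have order \<open>ak k\<close> (k +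
  1)^4, so the eighth power makes them summable. A polynomial rate also makes ratios of neighbouring
  widths tend to 1, which a geometric rate would not.\<close>

definition ak :: "nat => real" where "ak k = 1 / (real (Suc k))^8"

lemma ak_pos: "0 < ak k" by (simp add: ak_def)
lemma ak_less: "ak (Suc k) < ak k" unfolding ak_def by (intro divide_strict_left_mono power_strict_mono) auto
lemma ak_antimono: "j <= k ==> ak k <= ak j" by (rule lift_Suc_antimono_le[of ak]) (simp_all add: ak_less less_imp_le)
lemma ak_lim: "ak ----> 0" unfolding ak_def by real_asymp
lemma ak_le_1: "ak k <= 1" using ak_antimono[of 0 k] by (simp add: ak_def)

text \<open>Consecutive widths serve as outer and inner half-width, so the plateau of one trapezoid
  is the support interval of the next.\<close>

abbreviation "F0 k == T0 (ak k) (ak (Suc k))"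
abbreviation "F1 k == T1 (ak k) (ak (Suc k))"
abbreviation "F2 k == T2 (ak k) (ak (Suc k))"

lemmas F_ab = ak_pos[of "Suc _"] ak_less

lemma F1_sgn_lim: "(%k. F1 k y) ----> sgn y"
proof (cases "y = 0")
 case True
 thus ?thesis by (simp add: T1_values(2)[OF F_ab])
next
 case False
 hence "EV k. ak k < \<bar>y\<bar>" using order_tendstoD(2)[OF ak_lim, of "\<bar>y\<bar>"] by simp
 hence "EV k. F1 k y = sgn y" by eventually_elim (simp add: T1_values(1)[OF F_ab])
 thus ?thesis by (rule tendsto_eventually)
qed

text \<open>Outside the interval of half-width \<open>ak (Suc k)\<close> both functions equal
  \<open>sgn\<close>. That interval is the plateau of \<open>F2 k\<close>, whose height is at least
  1 / \<open>ak k\<close>, enough to absorb a squared difference of at most 4. Shifting the index by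
  one is what aligns support and plateau.\<close>

lemma F1_difference: "(F1 (Suc k) y - F1 (Suc (Suc k)) y)^2 <= 4 * ak k * F2 k y"
proof (cases "\<bar>y\<bar> <= ak (Suc k)")
 case True
 have "\<bar>F1 (Suc k) y - F1 (Suc (Suc k)) y\<bar> <= 2"
  using T1_values(3)[OF F_ab, of "Suc k" y] T1_values(3)[OF F_ab, of "Suc (Suc k)" y] by linarith
 hence "(F1 (Suc k) y - F1 (Suc (Suc k)) y)^2 <= 2^2" using abs_le_square_iff[of "F1 (Suc k) y - F1 (Suc (Suc k)) y" 2] by simp
 also have "... <= 4 * ak k * (2 / (ak k + ak (Suc k)))" using ak_pos[of k] ak_pos[of "Suc k"] ak_less[of k] by (simp add: field_simps)
 also have "... = 4 * ak k * F2 k y" using T2_values(1)[OF F_ab True] by simp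
 finally show ?thesis .
next
 case False
 hence "F1 (Suc k) y = sgn y" "F1 (Suc (Suc k)) y = sgn y"
  using T1_values(1)[OF F_ab, of "Suc k" y] T1_values(1)[OF F_ab, of "Suc (Suc k)" y] ak_less[of "Suc k"] by auto
 thus ?thesis using T2_values(3)[OF F_ab, of k y] ak_pos[of k] by simp
qed

section \<open>Almost sure convergence of the smoothed local times\<close>

context stoch_base
begin

lemma clm_stp:
 assumes P: "clm P" and ta: "stime ta"
 shows "clm (stp ta P)"
proof -
 let ?Z = "%t w. \<bar>P t w - P 0 w\<bar>"
 have cZ: "cap ?Z" by (intro cap_abs cap_diff clm_cap[OF P] cap_initial)
 show ?thesis
 proof (rule clmI[of _ ?Z])
  fix k
  have m: "martingale M F (%t w. stp (loc ?Z k) P t w - P 0 w)" (is "martingale M F ?P") by (rule clm_loc[OF P cZ]) auto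
  have "cap ?P" by (intro cap_diff cap_stp clm_cap[OF P] stime_loc cZ cap_initial)
  from martingale_stp[OF m this ta] show "martingale M F (%t w. stp (loc ?Z k) (stp ta P) t w - stp ta P 0 w)"
  proof (rule martingale_cong)
   fix t w assume "0 <= (t::real)" and w: "w \<in> space M"
   have "0 <= ta w" using ta w by (simp add: stime_def)
   thus "stp ta ?P t w = stp (loc ?Z k) (stp ta P) t w - stp ta P 0 w" by (simp add: stp_def min.commute min.left_commute)
  qed
 qed (auto intro: cap_stp clm_cap[OF P] ta cZ)
qed

lemma pint_abs_le:
 assumes C: "ci C" and h: "cap h" and w: "w \<in> space M" and t: "0 <= t" and K: "!!s. 0 <= s ==> \<bar>h s w\<bar> <= K"
 shows "\<bar>pint C h t w\<bar> <= K * C t w"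
proof -
 have "0 <= K" using K[of 0] by simp
 thus ?thesis using pint_difference_bound[OF C w t order_refl cap_pm_integrable[OF C h w], of "%_. 0" K] K by (simp add: pint_def set_integrable_def)
qed

lemma pint_cmult: "pint C (%s w. c * h s w) t w = c * pint C h t w" by (simp add: pint_def)

lemma pm_dct:
 fixes g :: "nat => real => real"
 assumes C: "ci C" and w: "w \<in> space M" and T: "0 <= T"
  and m: "!!k. g k \<in> bm borel"
  and K: "!!k s. s \<in> {0..T} ==> \<bar>g k s\<bar> <= K" and lim: "!!s. s \<in> {0..T} ==> (%k. g k s) ----> 0"
 shows "(%k. \<integral>\<^sup>+s\<in>{0..T}. ennreal \<bar>g k s\<bar> \<partial>pm C w) ----> 0"
proof -
 have "(%k. \<integral>\<^sup>+s. ennreal \<bar>g k s\<bar> * ind {0..T} s \<partial>pm C w) ----> (\<integral>\<^sup>+s. 0 \<partial>pm C w)"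
 proof (rule nn_integral_dominated_convergence[where w="%s. ennreal K * ind {0..T} s"])
  show "(\<integral>\<^sup>+s. ennreal K * ind {0..T} s \<partial>pm C w) < \<infinity>"
   by (simp add: nn_integral_cmult emeasure_pm_Icc[OF C w T] ennreal_mult_less_top)
  show "AE s in pm C w. (%k. ennreal \<bar>g k s\<bar> * ind {0..T} s) ----> 0"
  proof (rule AE_I2)
   fix s show "(%k. ennreal \<bar>g k s\<bar> * ind {0..T} s) ----> 0"
   proof (cases "s \<in> {0..T}")
    case True
    hence "(%k. ennreal \<bar>g k s\<bar>) ----> ennreal 0" by (intro tendsto_ennrealI tendsto_rabs_zero lim)
    thus ?thesis using True by simp
   qed simp
  qed
 qed (use m K in \<open>auto simp: indicator_def intro!: ennreal_leI\<close>)
 thus ?thesis by simp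
qed

text \<open>Combines smallness along each path with exceptional events that depend on k and have
  vanishing probability.\<close>

lemma nullp_off:
 assumes m: "!!k. R k \<in> bm M" and U: "!!k. U k \<in> sets M" "(%k. measure M (U k)) ----> 0"
  and le: "!!w e. w \<in> space M ==> 0 < e ==> EV k. w \<notin> U k --> R k w <= ennreal e"
 shows "nullp R" unfolding null_in_probability_def
proof (intro conjI allI impI m)
 fix e :: real assume e: "0 < e"
 let ?V = "%k. {w \<in> space M. R k w > ennreal e} - U k"
 have [measurable]: "!!k. R k \<in> bm M" "!!k. U k \<in> sets M" by fact+
 have V: "?V k \<in> sets M" for k by measurable
 have "(%k. measure M (?V k)) ----> 0"
 proof (rule measure_vanish[OF V AE_I2])
  fix w assume "w \<in> space M"
  from le[OF this e] show "EV k. w \<notin> ?V k" by eventually_elim auto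
 qed
 from tendsto_add[OF this U(2)] have "(%k. measure M (?V k) + measure M (U k)) ----> 0" by simp
 thus "(%k. measure M {w \<in> space M. R k w > ennreal e}) ----> 0"
 proof (rule Lim_null_comparison[rotated], intro always_eventually allI)
  fix k
  have "measure M {w \<in> space M. R k w > ennreal e} <= measure M (?V k \<union> U k)" by (intro finite_measure_mono) auto
  also have "... <= measure M (?V k) + measure M (U k)" by (intro measure_Un_le V U)
  finally show "norm (measure M {w \<in> space M. R k w > ennreal e}) <= measure M (?V k) + measure M (U k)" by simp
 qed
qed

end

context ito
begin

text \<open>Notation for the smoothed Tanaka formula: \<open>Th\<close> is the martingale part,
  \<open>Lk\<close> the increasing part that approximates the local time, and \<open>Dk\<close> the
  drift part.\<close>

abbreviation "G k == %s w. F1 k (Y s w)"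
abbreviation "Th k == Theta (F0 k) (F1 k) (F2 k)"
abbreviation "Lk k t w == 1/2 * pint Q (%s w. F2 k (Y s w)) t w"
abbreviation "Dk k t w == pint A (G k) t w - pint B (G k) t w"

lemma cap_F: "cap (%s w. F0 k (Y s w))" "cap (G k)" "cap (%s w. F2 k (Y s w))" by (intro cap_compose[OF cY] T_continuous)+

lemma cap_Th: "cap (Th k)" by (intro cap_Theta T_continuous)

lemma ci_Lk: "ci (Lk k)" by (intro ci_cmult ci_pint cQ cap_F) (auto simp: T2_values[OF F_ab])

lemma Lk_decomposition: "F0 k (Y t w) - F0 k (Y 0 w) = Th k t w + Lk k t w + Dk k t w" by (simp add: Theta_def)

lemma ucp_Th: "ucp (%m t w. rsum m (G k) N t w - Th k t w)"
proof (rule ito_formula[OF T_continuous _ T0_taylor[OF F_ab]])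
 show "\<bar>F2 k x\<bar> <= 2 / (ak k + ak (Suc k))" for x using T2_values(3,4)[OF F_ab, of k x] by simp
qed

lemma clm_Th: "clm (Th k)"
 by (rule clm_ucp_limit[OF clm_sint[OF mN udata_riemann[OF cap_F(2)]] ucp_Th cap_Th]) (simp_all add: sint_0[OF udata_riemann[OF cap_F(2)]] Theta_0)

abbreviation "DG k == %s w. G (Suc k) s w - G (Suc (Suc k)) s w"
abbreviation "DTh k == %t w. Th (Suc k) t w - Th (Suc (Suc k)) t w"
abbreviation "VTh k == pint Q (%s w. DG k s w * DG k s w)"

lemma clm_DTh: "clm (%t w. (DTh k t w)^2 - VTh k t w)"
proof -
 have eq: "rsum m (DG k) N t w - DTh k t w = (rsum m (G (Suc k)) N t w - Th (Suc k) t w) - (rsum m (G (Suc (Suc k))) N t w - Th (Suc (Suc k)) t w)" for m t w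
  by (simp add: simple_integral_def left_diff_distrib sum_subtractf)
 have u: "ucp (%m t w. rsum m (DG k) N t w - DTh k t w)" unfolding eq by (intro ucp_diff ucp_Th)
 have "cov (DTh k) (DTh k) (VTh k)" by (intro cov_limits u cap_diff cap_F cap_Th) (simp_all add: Theta_0)
 thus ?thesis by (simp add: cov_def power2_eq_square)
qed

text \<open>The pivotal inequality: the bracket of a successive difference is controlled by the
  smoothed local time itself, with a factor tending to 0.\<close>

lemma VTh_le: assumes "w \<in> space M" shows "VTh k t w <= 8 * ak k * Lk k t w"
proof -
 have "VTh k t w <= pint Q (%s w. (4 * ak k) * F2 k (Y s w)) t w"
  by (intro pint_le cQ cap_mult cap_diff cap_cmult cap_F assms) (simp add: F1_difference power2_eq_square[symmetric])
 thus ?thesis by (simp add: pint_cmult)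
qed

text \<open>Stopping along this process bounds the martingale, both increasing parts and the bracket
  at once, by a constant independent of k.\<close>

definition Zl where "Zl t w = \<bar>N t w\<bar> + A t w + B t w + Q t w"
abbreviation "rh n == loc Zl n"

lemma cap_Zl: "cap Zl" unfolding Zl_def[abs_def] by (intro cap_add cap_abs cN ci_cap cA cB cQ)
lemma Zl_0: "w \<in> space M ==> Zl 0 w = 0" by (simp add: Zl_def N0 ci_0[OF cA] ci_0[OF cB] ci_0[OF cQ])
lemma stime_rh: "stime (rh n)" by (rule stime_loc[OF cap_Zl])

text \<open>In n + 21, the part n + 1 bounds the displacement of Y and 10 is the error between
  \<open>F0 k\<close> and the modulus at each of the two endpoints. The bound on \<open>Lk\<close>
  blows up with k; it secures boundedness and integrability only, the uniform control being that of
  the mean.\<close>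

lemma stopped_bounds:
 fixes n :: nat and t :: real and w :: 'w
 assumes w: "w \<in> space M" and t: "0 <= t"
 defines "s == min t (rh n w)"
 shows "0 <= s" "\<bar>F0 k (Y s w) - F0 k (Y 0 w)\<bar> <= real n + 21" "\<bar>Dk k s w\<bar> <= real n + 1"
  "0 <= Lk k s w" "Lk k s w <= (real n + 1) / (ak k + ak (Suc k))"
proof -
 show s: "0 <= s" using t stime_rh[of n] w by (simp add: s_def stime_def)
 have Z: "\<bar>N s w\<bar> + A s w + B s w + Q s w <= real n + 1"
  using loc_le[OF cap_Zl w Zl_0[OF w] t, of n] unfolding stp_def s_def[symmetric] by (simp add: Zl_def)
 have pos: "0 <= A s w" "0 <= B s w" "0 <= Q s w" using ci_nonneg[OF _ w s] cA cB cQ by auto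
 have T0: "\<bar>F0 k y - \<bar>y\<bar>\<bar> <= 10" for y using T0_close[OF F_ab, of k y] ak_le_1[of k] by linarith
 show "\<bar>F0 k (Y s w) - F0 k (Y 0 w)\<bar> <= real n + 21" using T0[of "Y s w"] T0[of "Y 0 w"] Z pos Yeq[OF w s] by linarith
 have "\<bar>pint A (G k) s w\<bar> <= 1 * A s w" "\<bar>pint B (G k) s w\<bar> <= 1 * B s w"
  by (intro pint_abs_le cA cB cap_F w s T1_values(3)[OF F_ab])+
 thus "\<bar>Dk k s w\<bar> <= real n + 1" using Z pos by linarith
 show "0 <= Lk k s w" by (rule ci_nonneg[OF ci_Lk w s])
 have a: "0 < ak k + ak (Suc k)" using ak_pos[of k] ak_pos[of "Suc k"] by simp
 have "\<bar>pint Q (%s w. F2 k (Y s w)) s w\<bar> <= 2 / (ak k + ak (Suc k)) * Q s w"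
  by (intro pint_abs_le cQ cap_F w s) (simp add: T2_values(3,4)[OF F_ab])
 hence "Lk k s w <= Q s w / (ak k + ak (Suc k))" by (simp add: mult.commute)
 also have "... <= (real n + 1) / (ak k + ak (Suc k))" using Z pos a by (intro divide_right_mono) auto
 finally show "Lk k s w <= (real n + 1) / (ak k + ak (Suc k))" .
qed

text \<open>Solve the smoothed Tanaka formula for \<open>Lk\<close>: the stopped martingale part has
  mean zero, and the other two terms are at most n + 21 and n + 1, whatever k is.\<close>

lemma mean_Lk:
 assumes t: "0 <= t"
 shows "integrable M (%w. Lk k (min t (rh n w)) w)" "(LINT w|M. Lk k (min t (rh n w)) w) <= 2 * real n + 22"
proof -
 let ?K = "(real n + 1) / (ak k + ak (Suc k))"
 have mart: "martingale M F (%t w. stp (rh n) (Th k) t w - Th k 0 w)"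
 proof (rule clm_stopped_bounded[OF clm_Th stime_rh])
  fix t w assume "0 <= (t::real)" and w: "w \<in> space M"
  from stopped_bounds(2-5)[OF w this(1), of k n]
  show "\<bar>stp (rh n) (Th k) t w - Th k 0 w\<bar> <= 2 * real n + 22 + ?K"
   using Lk_decomposition[of k "min t (rh n w)" w] unfolding stp_def Theta_0[OF w] by linarith
 qed
 have "cap (stp (rh n) (Lk k))" by (intro cap_stp ci_cap ci_Lk stime_rh)
 from cap_measurable_M[OF this t]
 have mL: "(%w. Lk k (min t (rh n w)) w) \<in> bm M" by (simp add: stp_def[abs_def])
 show iL: "integrable M (%w. Lk k (min t (rh n w)) w)"
 proof (rule integrable_const_bound[of _ ?K])
  show "AE w in M. norm (Lk k (min t (rh n w)) w) <= ?K" using stopped_bounds(4,5)[OF _ t] by (intro AE_I2) (simp only: real_norm_def abs_of_nonneg)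
 qed (rule mL)
 have iT: "integrable M (%w. stp (rh n) (Th k) t w - Th k 0 w)" using mart t by (simp add: martingale_def)
 have "(LINT w|M. stp (rh n) (Th k) t w - Th k 0 w) = (LINT w|M. ind (space M) w * (stp (rh n) (Th k) t w - Th k 0 w))"
  by (intro Bochner_Integration.integral_cong) auto
 also have "... = (LINT w|M. ind (space M) w * (stp (rh n) (Th k) 0 w - Th k 0 w))"
  by (rule martingale_indicator[OF mart order_refl t]) (use sets.top[of "F 0"] in simp)
 also have "... = (LINT w|M. 0)"
 proof (intro Bochner_Integration.integral_cong refl)
  fix w assume "w \<in> space M"
  thus "ind (space M) w * (stp (rh n) (Th k) 0 w - Th k 0 w) = (0::real)" using stime_rh[of n] by (simp add: stp_def stime_def)
 qed
 finally have T0: "(LINT w|M. stp (rh n) (Th k) t w - Th k 0 w) = 0" by simp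
 have "(LINT w|M. Lk k (min t (rh n w)) w + (stp (rh n) (Th k) t w - Th k 0 w)) <= (LINT w|M. 2 * real n + 22)"
 proof (rule integral_mono)
  fix w assume w: "w \<in> space M"
  from stopped_bounds(2-5)[OF w t, of k n]
  show "Lk k (min t (rh n w)) w + (stp (rh n) (Th k) t w - Th k 0 w) <= 2 * real n + 22"
   using Lk_decomposition[of k "min t (rh n w)" w] unfolding stp_def Theta_0[OF w] by linarith
 qed (use iL iT in auto)
 thus "(LINT w|M. Lk k (min t (rh n w)) w) <= 2 * real n + 22" unfolding Bochner_Integration.integral_add[OF iL iT] T0 by (simp add: prob_space)
qed

text \<open>The bracket of \<open>DTh k\<close> is at most 8 \<open>ak k\<close>
  \<open>Lk k\<close>, and the mean of the stopped \<open>Lk k\<close> is at most 2 n + 22.\<close>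

lemma DTh_tail:
 assumes de: "0 < de"
 shows "measure M (supgt (stp (rh n) (DTh k)) (real n) de) <= 8 * ak k * (2 * real n + 22) / de^2"
proof -
 let ?K = "(real n + 1) / (ak k + ak (Suc k))"
 have capV: "cap (VTh k)" and capD: "cap (DTh k)" by (intro cap_pint cQ cap_mult cap_diff cap_F cap_Th)+
 have r0: "0 <= rh n w" if "w \<in> space M" for w using stime_rh[of n] that by (simp add: stime_def)
 have Vmono: "VTh k s w <= VTh k t w" if "0 <= s" "s <= t" "w \<in> space M" for s t w using that by (intro pint_mono cQ cap_mult cap_diff cap_F) auto
 have Vle: "VTh k (min (real n) (rh n w)) w <= 8 * ak k * Lk k (min (real n) (rh n w)) w" if "w \<in> space M" for w by (rule VTh_le[OF that])
 have Vbound: "VTh k (min (real n) (rh n w)) w <= 8 * ak k * ?K" if "w \<in> space M" for w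
 proof -
  have "8 * ak k * Lk k (min (real n) (rh n w)) w <= 8 * ak k * ?K"
   using stopped_bounds(5)[OF that, of "real n" k n] ak_pos[of k] by (intro mult_left_mono) auto
  thus ?thesis using Vle[OF that] by linarith
 qed
 have V0: "0 <= VTh k (min (real n) (rh n w)) w" if "w \<in> space M" for w
  using Vmono[of 0 "min (real n) (rh n w)" w] r0[OF that] that by (simp add: pint_0[OF cQ])
 have "measure M (supgt (stp (rh n) (DTh k)) (real n) de) <= (LINT w|M. stp (rh n) (VTh k) (real n) w) / de^2"
 proof (rule lenglart_bounded[where R="stp (rh n) (DTh k)" and V="stp (rh n) (VTh k)" and T="real n" and B="8 * ak k * ?K", OF _ _ _ _ _ _ _ de])
  show "clm (%t w. (stp (rh n) (DTh k) t w)^2 - stp (rh n) (VTh k) t w)" using clm_stp[OF clm_DTh stime_rh] by (simp add: stp_def[abs_def])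
  show "stp (rh n) (VTh k) s w <= stp (rh n) (VTh k) t w" if "0 <= s" "s <= t" "w \<in> space M" for s t w
   unfolding stp_def using that r0[of w] by (intro Vmono) auto
  show "stp (rh n) (VTh k) (real n) w <= 8 * ak k * ?K" if "w \<in> space M" for w unfolding stp_def by (rule Vbound[OF that])
  show "cap (stp (rh n) (DTh k))" "cap (stp (rh n) (VTh k))" by (intro cap_stp capV capD stime_rh)+
  show "stp (rh n) (DTh k) 0 w = 0" "stp (rh n) (VTh k) 0 w = 0" if "w \<in> space M" for w
   using r0[OF that] by (simp_all add: stp_def Theta_0[OF that] pint_0[OF cQ that])
 qed simp
 also have "... <= 8 * ak k * (2 * real n + 22) / de^2"
 proof (intro divide_right_mono)
  have "(LINT w|M. stp (rh n) (VTh k) (real n) w) <= (LINT w|M. 8 * ak k * Lk k (min (real n) (rh n w)) w)" unfolding stp_def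
  proof (rule integral_mono)
   have "stp (rh n) (VTh k) (real n) \<in> bm M" by (rule cap_measurable_M[OF cap_stp[OF capV stime_rh]]) simp
   hence m: "(%w. VTh k (min (real n) (rh n w)) w) \<in> bm M" by (simp only: stp_def[abs_def])
   show "integrable M (%w. VTh k (min (real n) (rh n w)) w)"
   proof (rule integrable_const_bound[OF AE_I2 m])
    fix w assume w: "w \<in> space M"
    show "norm (VTh k (min (real n) (rh n w)) w) <= 8 * ak k * ?K" unfolding real_norm_def abs_of_nonneg[OF V0[OF w]] by (rule Vbound[OF w])
   qed
   show "integrable M (%w. 8 * ak k * Lk k (min (real n) (rh n w)) w)" by (intro integrable_mult_right mean_Lk(1)) simp
  qed (rule Vle)
  also have "... = 8 * ak k * (LINT w|M. Lk k (min (real n) (rh n w)) w)" by (rule integral_mult_right_zero)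
  also have "... <= 8 * ak k * (2 * real n + 22)" using mean_Lk(2)[of "real n" k n] ak_pos[of k] by (intro mult_left_mono) auto
  finally show "(LINT w|M. stp (rh n) (VTh k) (real n) w) <= 8 * ak k * (2 * real n + 22)" .
 qed simp
 finally show ?thesis .
qed

end

section \<open>The local time as a uniform limit\<close>

context ito
begin

text \<open>Borel-Cantelli: tolerance (k + 1)^-2 turns the tail bound into a multiple of (k +
  1)^-4.\<close>

lemma DTh_small: "AE w in M. \<forall>n. EV k. \<forall>t\<in>{0..real n}. \<bar>stp (rh n) (DTh k) t w\<bar> <= 1 / (real (Suc k))^2"
 unfolding AE_all_countable
proof
 fix n
 let ?U = "%k. supgt (stp (rh n) (DTh k)) (real n) (1 / (real (Suc k))^2)"
 have U: "?U k \<in> sets M" for k by (intro supgt_measurable cap_stp cap_diff cap_Th stime_rh)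
 have "summable (%k. 8 * (2 * real n + 22) * inverse ((real (Suc k))^4))"
  using summable_Suc_iff[of "%k. inverse ((real k)^4)"] inverse_power_summable[of 4, where 'a=real] by (intro summable_mult) simp
 hence "summable (%k. measure M (?U k))"
 proof (rule summable_comparison_test'[of _ 0])
  fix k
  let ?r = "real (Suc k)"
  have r: "0 < ?r" by simp
  have "measure M (?U k) <= 8 * ak k * (2 * real n + 22) / (1 / ?r^2)^2" by (intro DTh_tail) simp
  also have "... = 8 * (2 * real n + 22) * (?r^4 / ?r^8)" by (simp add: ak_def power_divide power_mult[symmetric] del: of_nat_Suc)
  also have "?r^4 / ?r^8 = inverse (?r^4)" using r power_add[of ?r 4 4] by (simp add: field_simps del: of_nat_Suc)
  finally show "norm (measure M (?U k)) <= 8 * (2 * real n + 22) * inverse (?r^4)" by simp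
 qed
 from borel_cantelli_AE1[OF U _ this] have "AE w in M. EV k. w \<in> space M - ?U k" by (simp add: emeasure_eq_measure)
 thus "AE w in M. EV k. \<forall>t\<in>{0..real n}. \<bar>stp (rh n) (DTh k) t w\<bar> <= 1 / (real (Suc k))^2"
  by eventually_elim (erule eventually_mono, auto simp: not_less)
qed

abbreviation "sg == %s w. sgn (Y s w)"

lemma sg_path: "w \<in> space M ==> (%s. sgn (Y (max 0 s) w)) \<in> bm borel"
 by (rule measurable_compose[OF path_measurable[OF cY] borel_measurable_sgn])

lemma G_sg: "\<bar>G k s w - sg s w\<bar> <= 2"
proof -
 have "\<bar>sgn (Y s w)\<bar> <= 1" by (simp add: sgn_real_def)
 thus ?thesis using T1_values(3)[OF F_ab, of k "Y s w"] by linarith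
qed

lemma dev_G:
 assumes "ci C" "w \<in> space M" "0 <= T"
 shows "(%k. \<integral>\<^sup>+s\<in>{0..T}. ennreal \<bar>G k s w - sg s w\<bar> \<partial>pm C w) ----> 0"
proof -
 have "(%k. \<integral>\<^sup>+s\<in>{0..T}. ennreal \<bar>G k (max 0 s) w - sg (max 0 s) w\<bar> \<partial>pm C w) ----> 0"
 proof (rule pm_dct[OF assms])
  show "\<bar>G k (max 0 s) w - sg (max 0 s) w\<bar> <= 2" for k s by (rule G_sg)
  show "(%s. G k (max 0 s) w - sg (max 0 s) w) \<in> bm borel" for k by (intro borel_measurable_diff path_measurable cap_F sg_path assms)
  show "(%k. G k (max 0 s) w - sg (max 0 s) w) ----> 0" for s using F1_sgn_lim[of "Y (max 0 s) w"] by (simp add: LIM_zero)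
 qed
 also have "(%k. \<integral>\<^sup>+s\<in>{0..T}. ennreal \<bar>G k (max 0 s) w - sg (max 0 s) w\<bar> \<partial>pm C w) =
   (%k. \<integral>\<^sup>+s\<in>{0..T}. ennreal \<bar>G k s w - sg s w\<bar> \<partial>pm C w)"
  by (intro ext nn_integral_cong) (auto simp: indicator_def max_def)
 finally show ?thesis .
qed

lemma sg_integrable:
 assumes "ci C" "w \<in> space M" shows "set_integrable (pm C w) {0..t} (%s. sg s w)"
proof -
 have "set_integrable (pm C w) {0..t} (%s. sg (max 0 s) w)"
  by (rule pm_bounded_integrable[OF assms sg_path[OF assms(2)], of _ 1]) (auto simp: sgn_real_def)
 thus ?thesis by (rule set_integrable_cong[THEN iffD1, rotated 3]) auto
qed

lemma pint_uniform:
 assumes C: "ci C" and w: "w \<in> space M"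
 shows "uniform_limit {0..T} (%k t. pint C (G k) t w) (%t. pint C sg t w) sequentially"
proof (cases "0 <= T")
 case True
 show ?thesis
 proof (rule uniform_limitI)
  fix e :: real assume e: "0 < e"
  have "EV k. (\<integral>\<^sup>+s\<in>{0..T}. ennreal \<bar>G k s w - sg s w\<bar> \<partial>pm C w) < ennreal e"
   using dev_G[OF C w True] e by (intro order_tendstoD(2)) auto
  thus "EV k. \<forall>t\<in>{0..T}. dist (pint C (G k) t w) (pint C sg t w) < e"
  proof eventually_elim
   case (elim k)
   show ?case
   proof
    fix t assume t: "t \<in> {0..T}"
    have i: "set_integrable (pm C w) {0..t} (%s. G k s w - sg s w)"
     by (intro set_integral_diff cap_pm_integrable[OF C cap_F(2) w] sg_integrable[OF C w])
    have "ennreal \<bar>pint C (G k) t w - pint C sg t w\<bar> = ennreal (norm (LINT s:{0..t}|pm C w. G k s w - sg s w))"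
     using set_integral_diff(2)[OF cap_pm_integrable[OF C cap_F(2) w] sg_integrable[OF C w]] by (simp add: pint_def)
    also have "... <= (\<integral>\<^sup>+s. ennreal (norm (ind {0..t} s *\<^sub>R (G k s w - sg s w))) \<partial>pm C w)"
     unfolding set_lebesgue_integral_def using i by (intro integral_norm_bound_ennreal) (simp add: set_integrable_def)
    also have "... <= (\<integral>\<^sup>+s\<in>{0..T}. ennreal \<bar>G k s w - sg s w\<bar> \<partial>pm C w)"
     using t by (intro nn_integral_mono) (auto simp: indicator_def)
    also have "... < ennreal e" by (rule elim)
    finally show "dist (pint C (G k) t w) (pint C sg t w) < e" using e by (simp add: dist_real_def ennreal_less_iff)
   qed
  qed
 qed
qed (simp add: uniform_limit_iff)

lemma F0_uniform: "uniform_limit S (%k t. F0 k (f t)) (%t. \<bar>f t\<bar>) sequentially"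
proof (rule uniform_limitI)
 fix e :: real assume e: "0 < e"
 hence "EV k. ak k < e / 10" by (intro order_tendstoD(2)[OF ak_lim]) simp
 thus "EV k. \<forall>t\<in>S. dist (F0 k (f t)) \<bar>f t\<bar> < e"
 proof (eventually_elim, intro ballI)
  fix k t assume "ak k < e / 10"
  thus "dist (F0 k (f t)) \<bar>f t\<bar> < e" using T0_close[OF F_ab, of k "f t"] unfolding dist_real_def by linarith
 qed
qed

text \<open>Differences of \<open>Th\<close> are eventually below a summable sequence, so
  \<open>Th\<close> converges uniformly by telescoping; the other terms of the smoothed Tanaka
  formula converge uniformly, hence so does \<open>Lk\<close>. The stopping is removed by an index
  n' whose stopping time lies beyond the interval.\<close>

lemma Lk_converges: "AE w in M. \<forall>n. uniformly_convergent_on {0..real n} (%k t. Lk k t w)" using DTh_small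
proof (rule AE_mp, intro AE_I2 impI allI)
 fix w n assume w: "w \<in> space M"
  and s: "\<forall>n. EV k. \<forall>t\<in>{0..real n}. \<bar>stp (rh n) (DTh k) t w\<bar> <= 1 / (real (Suc k))^2"
 have "EV k. real n <= rh k w & n <= k"
  using loc_at_top(2)[OF cap_Zl w Zl_0[OF w]] unfolding filterlim_at_top by (intro eventually_conj eventually_ge_at_top) blast
 from eventually_happens'[OF sequentially_bot this]
 obtain n' where n': "real n <= rh n' w" "n <= n'" by blast
 have "EV k. \<forall>t\<in>{0..real n}. norm (DTh k t w) <= 1 / (real (Suc k))^2" using s[rule_format, of n']
 proof eventually_elim
  case (elim k)
  show ?case
  proof
   fix t assume t: "t \<in> {0..real n}"
   hence "min t (rh n' w) = t" "t \<in> {0..real n'}" using n' by auto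
   with elim show "norm (DTh k t w) <= 1 / (real (Suc k))^2" by (auto simp: stp_def dest!: bspec[of _ _ t])
  qed
 qed
 moreover have "summable (%k. 1 / (real (Suc k))^2)"
  using summable_Suc_iff[of "%k. inverse ((real k)^2)"] inverse_power_summable[of 2, where 'a=real] by (simp add: inverse_eq_divide)
 ultimately have "uniform_limit {0..real n} (%m t. \<Sum>k<m. DTh k t w) (%t. \<Sum>k. DTh k t w) sequentially" by (rule Weierstrass_m_test_ev)
 moreover have "(\<Sum>k<m. DTh k t w) = Th 1 t w - Th (Suc m) t w" for m t using sum_lessThan_telescope'[of "%k. Th (Suc k) t w" m] by simp
 ultimately have u: "uniform_limit {0..real n} (%m t. Th 1 t w - Th (Suc m) t w) (%t. \<Sum>k. DTh k t w) sequentially" by simp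
 have Suc: "uniform_limit S (%k. f (Suc k)) l sequentially" if "uniform_limit S f l sequentially" for S l and f :: "nat => real => real"
  using that by (simp add: filterlim_sequentially_Suc)
 have eq: "Lk k t w = F0 k (Y t w) - F0 k (Y 0 w) + (Th 1 t w - Th k t w) - Th 1 t w - Dk k t w" for k t using Lk_decomposition[of k t w] by linarith
 let ?l = "%t. \<bar>Y t w\<bar> - \<bar>Y 0 w\<bar> + (\<Sum>k. DTh k t w) - Th 1 t w - (pint A sg t w - pint B sg t w)"
 have "uniform_limit {0..real n} (%k t. Lk (Suc k) t w) ?l sequentially" unfolding eq[of "Suc _"]
  by (intro uniform_limit_minus uniform_limit_add uniform_limit_const u Suc[OF F0_uniform] Suc[OF pint_uniform] w cA cB)
 thus "uniformly_convergent_on {0..real n} (%k t. Lk k t w)"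
  using filterlim_sequentially_Suc[of "%k t. Lk k t w"] by (auto simp: uniformly_convergent_on_def)
qed

text \<open>One null set outside which all limits exist. Fixing it as a set allows the local time to
  be put to 0 there, so that it is continuous and increasing at every sample point, as
  \<open>continuous_increasing\<close> demands. The usual conditions make the set known at time 0,
  so the modification stays adapted.\<close>

definition bad where
 "bad = (SOME E. E \<in> null_sets M & (\<forall>w\<in>space M - E. \<forall>n. uniformly_convergent_on {0..real n} (%k t. Lk k t w)))"

lemma bad_null: "bad \<in> null_sets M"
 and Lk_converges_off: "w \<in> space M ==> w \<notin> bad ==> uniformly_convergent_on {0..real n} (%k t. Lk k t w)"
proof -
 have "\<exists>E. E \<in> null_sets M & (\<forall>w\<in>space M - E. \<forall>n. uniformly_convergent_on {0..real n} (%k t. Lk k t w))"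
  using Lk_converges unfolding eventually_ae_filter by blast
 from someI_ex[OF this] have "bad \<in> null_sets M & (\<forall>w\<in>space M - bad. \<forall>n. uniformly_convergent_on {0..real n} (%k t. Lk k t w))"
  unfolding bad_def .
 thus "bad \<in> null_sets M" "w \<in> space M ==> w \<notin> bad ==> uniformly_convergent_on {0..real n} (%k t. Lk k t w)" by auto
qed

lemma AE_not_bad: "AE w in M. w \<notin> bad" by (rule AE_not_in[OF bad_null])

definition lt :: "real => 'w => real" where "lt t w = (if w \<in> bad then 0 else lim (%k. Lk k t w))"

lemma lt_uniform:
 assumes w: "w \<in> space M" "w \<notin> bad"
 shows "uniform_limit {0..T} (%k t. Lk k t w) (%t. lt t w) sequentially"
proof -
 obtain n where "T <= real n" using real_arch_simple by blast
 hence "{0..T} \<subseteq> {0..real n}" by auto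
 moreover have "uniform_limit {0..real n} (%k t. Lk k t w) (%t. lt t w) sequentially"
  using Lk_converges_off[OF w, of n] w by (simp add: lt_def uniformly_convergent_uniform_limit_iff)
 ultimately show ?thesis by (rule uniform_limit_on_subset[rotated])
qed

lemma lt_lim: "w \<in> space M ==> w \<notin> bad ==> 0 <= t ==> (%k. Lk k t w) ----> lt t w"
 using tendsto_uniform_limitI[OF lt_uniform[of w t], of t] by simp

lemma ci_lt: "ci lt"
proof -
 let ?L = "%m t w. if w \<in> bad then 0 else Lk m t w"
 have cL: "cap (?L m)" for m
 proof (rule capI)
  fix t :: real assume t: "0 <= t"
  have "bad \<in> sets (F t)" by (rule null_sets_in_F[OF bad_null t])
  hence b: "{w \<in> space (F t). w \<in> bad} \<in> sets (F t)" by (metis Collect_mem_eq sets.Int_space_eq1 Int_def inf_commute)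
  show "?L m t \<in> bm (F t)" by (intro measurable_If b borel_measurable_const cap_measurable[OF ci_cap[OF ci_Lk] t order_refl])
 next
  fix w assume "w \<in> space M"
  thus "continuous_on {0..} (%t. ?L m t w)" using cap_continuous[OF ci_cap[OF ci_Lk], of w m] by (cases "w \<in> bad") auto
 qed
 have lim: "(%m. ?L m t w) ----> lt t w" if "w \<in> space M" "0 <= t" for t w
  using that lt_lim[of w t] by (cases "w \<in> bad") (simp_all add: lt_def)
 show ?thesis
 proof (rule ciI)
  show "cap lt"
  proof (rule cap_of_uniform_limit[of ?L, OF cL])
   fix w and T e :: real assume w: "w \<in> space M" and e: "0 < e"
   show "EV m. \<forall>t\<in>{0..T}. \<bar>?L m t w - lt t w\<bar> <= e"
   proof (cases "w \<in> bad")
    case False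
    from uniform_limitD[OF lt_uniform[OF w False] e, of T] show ?thesis
     by eventually_elim (use False in \<open>auto simp: dist_real_def less_imp_le\<close>)
   qed (simp add: lt_def e less_imp_le)
  qed
  show "lt 0 w = 0" if "w \<in> space M" for w
  proof -
   have "?L m 0 w = 0" for m using ci_0[OF ci_Lk that, of m] by (simp only: if_cancel)
   thus ?thesis using lim[OF that order_refl] by (simp only: LIMSEQ_const_iff)
  qed
  show "lt s w <= lt t w" if "w \<in> space M" "0 <= s" "s <= t" for w s t
  proof (rule LIMSEQ_le[OF lim[OF that(1,2)] lim[OF that(1)]])
   show "0 <= t" using that by simp
   show "\<exists>N. \<forall>m\<ge>N. ?L m s w <= ?L m t w" using ci_mono[OF ci_Lk that] by auto
  qed
 qed
qed

lemma cap_pint_sg: assumes "ci C" shows "cap (pint C sg)"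
proof (rule cap_of_uniform_limit[of "%k. pint C (G k)"])
 fix w and T e :: real assume w: "w \<in> space M" and e: "0 < e"
 from uniform_limitD[OF pint_uniform[OF assms w] e, of T]
 show "EV m. \<forall>t\<in>{0..T}. \<bar>pint C (G m) t w - pint C sg t w\<bar> <= e" by eventually_elim (auto simp: dist_real_def less_imp_le)
qed (intro cap_pint assms cap_F)

text \<open>Tanaka's formula with integral \<open>Jt\<close> holds by definition; the content lies
  in showing that \<open>Jt\<close> is a stochastic integral of the sign in the sense of
  \<open>stochastic_integral\<close>.\<close>

definition Jt :: "real => 'w => real" where "Jt t w = \<bar>Y t w\<bar> - \<bar>Y 0 w\<bar> - lt t w"
definition Mt :: "real => 'w => real" where "Mt t w = Jt t w - (pint A sg t w - pint B sg t w)"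

lemma cap_Jt: "cap Jt" unfolding Jt_def[abs_def] by (intro cap_diff cap_abs cY ci_cap ci_lt cap_initial)
lemma cap_Mt: "cap Mt" unfolding Mt_def[abs_def] by (intro cap_diff cap_Jt cap_pint_sg cA cB)

lemma Jt_uniform:
 assumes w: "w \<in> space M" "w \<notin> bad"
 shows "uniform_limit {0..T} (%k t. Th k t w + Dk k t w) (%t. Jt t w) sequentially"
proof -
 have eq: "Th k t w + Dk k t w = F0 k (Y t w) - F0 k (Y 0 w) - Lk k t w" for k t using Lk_decomposition[of k t w] by linarith
 show ?thesis unfolding eq Jt_def by (intro uniform_limit_minus F0_uniform lt_uniform w)
qed

lemma ucp_of_uniform_off_bad:
 assumes D: "!!k. cap (D k)" "cap D'"
  and u: "!!w T. w \<in> space M ==> w \<notin> bad ==> uniform_limit {0..T} (%k t. D k t w) (%t. D' t w) sequentially"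
 shows "ucp (%k t w. D k t w - D' t w)"
proof (rule ucp_pathwise)
 show "cap (%t w. D k t w - D' t w)" for k by (intro cap_diff D)
 fix T e :: real assume e: "0 < e"
 show "AE w in M. EV k. \<forall>t\<in>{0..T}. \<bar>D k t w - D' t w\<bar> <= e" using AE_not_bad
 proof (rule AE_mp, intro AE_I2 impI)
  fix w assume "w \<in> space M" "w \<notin> bad"
  from uniform_limitD[OF u[OF this] e, of T]
  show "EV k. \<forall>t\<in>{0..T}. \<bar>D k t w - D' t w\<bar> <= e" by eventually_elim (auto simp: dist_real_def less_imp_le)
 qed
qed

lemma cap_Dk: "cap (Dk k)" by (intro cap_diff cap_pint cA cB cap_F)

lemma ucp_Jt: "ucp (%k t w. (Th k t w + Dk k t w) - Jt t w)" by (intro ucp_of_uniform_off_bad cap_add cap_Th cap_Dk cap_Jt Jt_uniform)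

lemma Mt_0: "w \<in> space M ==> Mt 0 w = 0" by (simp add: Mt_def Jt_def ci_0[OF ci_lt] pint_0[OF cA] pint_0[OF cB])

lemma clm_Mt: "clm Mt"
proof (rule clm_ucp_limit[OF clm_Th _ cap_Mt])
 show "ucp (%k t w. Th k t w - Mt t w)"
 proof (rule ucp_of_uniform_off_bad[OF cap_Th cap_Mt])
  fix w T assume w: "w \<in> space M" "w \<notin> bad"
  have "uniform_limit {0..T} (%k t. (Th k t w + Dk k t w) - Dk k t w) (%t. Mt t w) sequentially"
   unfolding Mt_def by (intro uniform_limit_minus Jt_uniform[OF w] pint_uniform w cA cB)
  thus "uniform_limit {0..T} (%k t. Th k t w) (%t. Mt t w) sequentially" by simp
 qed
qed (simp_all add: Theta_0 Mt_0)

end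

section \<open>Tanaka's formula: the stochastic integral of the sign, and its uniqueness\<close>

lemma (in stoch_base) stochastic_integralI:
 assumes "progressive_process F H" "cap I" "semimartingale_decomposition M F Z N A B" "quadratic_variation M F N Q"
  "!!k. simple_data M F (n k) (u k) (xi k)" and ap: "approx Q (%t w. A t w + B t w) H n u xi"
  and l: "ucp (%k t w. simple_integral (n k) (u k) (xi k) Z t w - I t w)"
 shows "stochastic_integral M F H Z I" unfolding stochastic_integral_def
proof (intro conjI)
 show "\<exists>N A B Q. semimartingale_decomposition M F Z N A B & quadratic_variation M F N Q & (\<exists>n u xi.
      (\<forall>k. simple_data M F (n k) (u k) (xi k)) & (\<forall>T\<ge>0.
       nullp (%k w. \<integral>\<^sup>+ s\<in>{0..T}. ennreal ((simple_process (n k) (u k) (xi k) s w - H s w)^2) \<partial>pm Q w) &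
       nullp (%k w. \<integral>\<^sup>+ s\<in>{0..T}. ennreal \<bar>simple_process (n k) (u k) (xi k) s w - H s w\<bar> \<partial>pm (%t w. A t w + B t w) w) &
       nullp (%k w. SUP t\<in>{0..T}. ennreal \<bar>simple_integral (n k) (u k) (xi k) Z t w - I t w\<bar>)))"
  apply (rule exI[of _ N], rule exI[of _ A], rule exI[of _ B], rule exI[of _ Q])
  apply (intro conjI assms)
  apply (rule exI[of _ n], rule exI[of _ u], rule exI[of _ xi])
  apply (intro conjI allI impI assms nullp_of_ucp[OF l]) using ap by (auto simp: approx_def)
qed (use assms in \<open>auto simp: cap_def\<close>)

context ito
begin

lemma decomposition_Y: "semimartingale_decomposition M F Y N A B" "quadratic_variation M F N Q"
proof -
 show "semimartingale_decomposition M F Y N A B" unfolding semimartingale_decomposition_def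
  by (intro conjI ballI AE_I2 allI impI mN N0 cA cB Yeq) (use cY in \<open>auto simp: cap_def\<close>)
 show "quadratic_variation M F N Q" using mU cQ by (simp add: quadratic_variation_def power2_eq_square)
qed

lemma ucp_rsum_Y: "ucp (%m t w. rsum m (G k) Y t w - (Th k t w + Dk k t w))"
proof (rule ucp_eq)
 show "ucp (%m t w. (rsum m (G k) N t w - Th k t w) + ((rsum m (G k) A t w - pint A (G k) t w) - (rsum m (G k) B t w - pint B (G k) t w)))"
  by (intro ucp_add ucp_diff ucp_Th ucp_rsum_pint cA cB cap_F)
 show "cap (%t w. rsum m (G k) Y t w - (Th k t w + Dk k t w))" for m by (intro cap_diff[OF cap_sint cap_add] cY udata_riemann cap_F cap_Th cap_Dk)
 fix m
 have "rsum m (G k) Y t w = rsum m (G k) N t w + rsum m (G k) A t w - rsum m (G k) B t w" if w: "w \<in> space M" and t: "0 <= t" for t w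
 proof -
  have i: "inc Y m i t w = inc N m i t w + inc A m i t w - inc B m i t w" for i
   using Yeq[OF w, of "min (gr m (Suc i)) t"] Yeq[OF w, of "min (gr m i) t"] t by (simp add: inc_def)
  show ?thesis unfolding rsum_inc[of m "G k"] i by (simp add: algebra_simps sum.distrib sum_subtractf)
 qed
 thus "AE w in M. \<forall>t\<ge>0. rsum m (G k) Y t w - (Th k t w + Dk k t w) = (rsum m (G k) N t w - Th k t w) +
   ((rsum m (G k) A t w - pint A (G k) t w) - (rsum m (G k) B t w - pint B (G k) t w))" by (intro AE_I2) auto
qed

abbreviation "U m k == (\<Union>i. supgt (inc (G k) m i) (real k) (1 / real (Suc k)))"

lemma U_sets: "U m k \<in> sets M" by (intro sets.countable_UN image_subsetI supgt_measurable cap_inc cap_F)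

text \<open>The sign is discontinuous, so sampling it on grids gives no direct approximation. For
  each k a grid \<open>mm k\<close> is chosen so fine that the Riemann sum of the continuous
  \<open>G k\<close> is near its integral and that \<open>G k\<close> hardly varies within a cell;
  along this diagonal both errors vanish.\<close>

lemma diagonal:
 obtains mm where "ucp (%k t w. rsum (mm k) (G k) Y t w - Jt t w)" "!!k. k <= mm k" "(%k. measure M (U (mm k) k)) ----> 0"
proof -
 let ?R = "%k m t w. rsum m (G k) Y t w - (Th k t w + Dk k t w)"
 have "\<exists>m. measure M (supgt (?R k m) (real k) (1 / real (Suc k))) < 1 / real (Suc k) & measure M (U m k) < 1 / real (Suc k) & k <= m" for k
 proof -
  have "(%m. measure M (U m k)) ----> 0"
  proof (rule measure_vanish[OF U_sets AE_I2])
   fix w assume "w \<in> space M"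
   have "0 < 1 / real (Suc k)" by simp
   from inc_small[OF cap_F(2) \<open>w \<in> space M\<close> this, of "real k" k]
   show "EV m. w \<notin> U m k"
   proof (eventually_elim, intro notI)
    fix m assume le: "\<forall>t\<in>{0..real k}. \<forall>i. \<bar>inc (G k) m i t w\<bar> <= 1 / real (Suc k)" and "w \<in> U m k"
    then obtain i t where "t \<in> {0..real k}" "\<bar>inc (G k) m i t w\<bar> > 1 / real (Suc k)" by blast
    with le show False by (meson not_less)
   qed
  qed
  hence "EV m. measure M (U m k) < 1 / real (Suc k)" by (rule order_tendstoD(2)) simp
  moreover have "EV m. measure M (supgt (?R k m) (real k) (1 / real (Suc k))) < 1 / real (Suc k)"
   by (rule order_tendstoD(2)[OF ucpD[OF ucp_rsum_Y]]) simp_all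
  ultimately have "EV m. measure M (supgt (?R k m) (real k) (1 / real (Suc k))) < 1 / real (Suc k) & measure M (U m k) < 1 / real (Suc k) & k <= m"
   using eventually_ge_at_top[of k] by eventually_elim simp
  from eventually_happens'[OF sequentially_bot this] show ?thesis .
 qed
 hence "\<forall>k. \<exists>m. measure M (supgt (?R k m) (real k) (1 / real (Suc k))) < 1 / real (Suc k) &
   measure M (U m k) < 1 / real (Suc k) & k <= m" by blast
 from choice[OF this] obtain mm where "\<forall>k. measure M (supgt (?R k (mm k)) (real k) (1 / real (Suc k))) < 1 / real (Suc k) &
   measure M (U (mm k) k) < 1 / real (Suc k) & k <= mm k" ..
 hence mm: "!!k. measure M (supgt (?R k (mm k)) (real k) (1 / real (Suc k))) < 1 / real (Suc k)"
   "!!k. measure M (U (mm k) k) < 1 / real (Suc k)" "!!k. k <= mm k" by blast+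
 have l: "(%k. 1 / real (Suc k)) ----> 0" using LIMSEQ_Suc[OF lim_1_over_n] by simp
 have cR: "cap (?R k m)" for k m by (rule ucp_cap[OF ucp_rsum_Y])
 have "ucp (%k. ?R k (mm k))" unfolding ucp_def
 proof (intro conjI allI impI cR)
  fix T e :: real assume e: "0 < e"
  obtain n where n: "T <= real n" using real_arch_simple by blast
  show "(%k. measure M (supgt (?R k (mm k)) T e)) ----> 0"
  proof (rule Lim_null_comparison[OF _ l])
   show "EV k. norm (measure M (supgt (?R k (mm k)) T e)) <= 1 / real (Suc k)" using order_tendstoD(2)[OF l e] eventually_ge_at_top[of n]
   proof eventually_elim
    case (elim k)
    have "measure M (supgt (?R k (mm k)) T e) <= measure M (supgt (?R k (mm k)) (real k) (1 / real (Suc k)))"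
    proof (intro finite_measure_mono subsetI supgt_measurable cR)
     fix w assume "w \<in> supgt (?R k (mm k)) T e"
     then obtain t where "w \<in> space M" "t \<in> {0..T}" "\<bar>?R k (mm k) t w\<bar> > e" by blast
     moreover have "t \<in> {0..real k}" using \<open>t \<in> {0..T}\<close> n elim(2) by (auto intro: order_trans)
     ultimately show "w \<in> supgt (?R k (mm k)) (real k) (1 / real (Suc k))" using elim(1) less_trans[of "1 / real (Suc k)" e] by blast
    qed
    with mm(1)[of k] show ?case by simp
   qed
  qed
 qed
 from ucp_add[OF this ucp_Jt] have u: "ucp (%k t w. rsum (mm k) (G k) Y t w - Jt t w)" by simp
 have "(%k. measure M (U (mm k) k)) ----> 0"
  using mm(2) by (intro Lim_null_comparison[OF _ l] always_eventually) (simp add: less_imp_le del: of_nat_Suc)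
 with u mm(3) show thesis by (rule that)
qed

lemma progressive_sg: "progressive_process F sg" unfolding progressive_process_def
proof (intro allI impI)
 fix T :: real assume "0 <= T"
 hence "(%(s, w). Y s w) \<in> bm (restrict_space borel {0..T} \<Otimes>\<^sub>M F T)"
  using cap_progressive[OF cY] by (simp add: progressive_process_def)
 from measurable_compose[OF this borel_measurable_sgn]
 show "(%(s, w). sgn (Y s w)) \<in> bm (restrict_space borel {0..T} \<Otimes>\<^sub>M F T)" by (simp add: case_prod_beta)
qed

text \<open>Off the exceptional event the deviation is at most 3: at most 1 from the variation of
  \<open>G k\<close> within a cell and at most 2 from its distance to the sign. On that range the
  modulus and the square are both bounded by 3 |x|, so one estimate serves both distances.\<close>

lemma deviation_diagonal:
 assumes mm: "!!k. k <= mm k" "(%k. measure M (U (mm k) k)) ----> 0"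
  and C: "ci C" and T: "0 <= T" and f: "f \<in> bm borel" "!!x. \<bar>x\<bar> <= 3 ==> f x <= 3 * \<bar>x\<bar>"
 shows "nullp (%k w. \<integral>\<^sup>+s\<in>{0..T}. ennreal (f (rp (mm k) (G k) s w - sg s w)) \<partial>pm C w)"
proof (rule nullp_off[OF _ U_sets mm(2)])
 show "(%w. \<integral>\<^sup>+s\<in>{0..T}. ennreal (f (rp (mm k) (G k) s w - sg s w)) \<partial>pm C w) \<in> bm M" for k
  by (rule deviation_measurable[OF C T progressive_sg udata_riemann[OF cap_F(2)] f(1)])
 fix w and e :: real assume w: "w \<in> space M" and e: "0 < e"
 define g where "g k s = 3 * (1 / real (Suc k) + \<bar>G k (max 0 s) w - sg (max 0 s) w\<bar>)" for k s
 have "(%k. \<integral>\<^sup>+s\<in>{0..T}. ennreal \<bar>g k s\<bar> \<partial>pm C w) ----> 0"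
 proof (rule pm_dct[OF C w T])
  have m: "(%s. G k (max 0 s) w - sg (max 0 s) w) \<in> bm borel" for k by (intro borel_measurable_diff path_measurable cap_F sg_path w)
  show "g k \<in> bm borel" for k
   unfolding g_def[abs_def] by (intro borel_measurable_times borel_measurable_add borel_measurable_const borel_measurable_abs m)
  show "\<bar>g k s\<bar> <= 9" for k s
  proof -
   have "0 <= 1 / real (Suc k)" "1 / real (Suc k) <= 1" by simp_all
   moreover have "\<bar>3 * (a + \<bar>b\<bar>)\<bar> <= 9" if "0 <= a" "a <= 1" "\<bar>b\<bar> <= 2" for a b :: real using that by (simp add: abs_mult)
   ultimately show ?thesis unfolding g_def using G_sg by blast
  qed
  have "(%k. 3 * (1 / real (Suc k) + \<bar>G k (max 0 s) w - sg (max 0 s) w\<bar>)) ----> 3 * (0 + \<bar>0\<bar>)" for s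
   using LIMSEQ_Suc[OF lim_1_over_n] F1_sgn_lim[of "Y (max 0 s) w"] by (intro tendsto_intros) (simp_all add: LIM_zero)
  thus "(%k. g k s) ----> 0" for s by (simp add: g_def)
 qed
 hence lim: "EV k. (\<integral>\<^sup>+s\<in>{0..T}. ennreal \<bar>g k s\<bar> \<partial>pm C w) < ennreal e"
  using e by (intro order_tendstoD(2)) auto
 obtain n where n: "T <= real n" using real_arch_simple by blast
 from lim show "EV k. w \<notin> U (mm k) k -->
   (\<integral>\<^sup>+s\<in>{0..T}. ennreal (f (rp (mm k) (G k) s w - sg s w)) \<partial>pm C w) <= ennreal e" using eventually_ge_at_top[of n]
 proof (eventually_elim, intro impI)
  fix k assume le: "(\<integral>\<^sup>+s\<in>{0..T}. ennreal \<bar>g k s\<bar> \<partial>pm C w) < ennreal e" and k: "n <= k" and U: "w \<notin> U (mm k) k"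
  have "{0} \<in> null_sets (pm C w)" using emeasure_pm_Icc[OF C w order_refl] ci_0[OF C w] by (simp add: null_sets_def)
  hence "AE s in pm C w. s ~= 0" using AE_not_in by fastforce
  hence "(\<integral>\<^sup>+s\<in>{0..T}. ennreal (f (rp (mm k) (G k) s w - sg s w)) \<partial>pm C w) <=
    (\<integral>\<^sup>+s\<in>{0..T}. ennreal \<bar>g k s\<bar> \<partial>pm C w)"
  proof (intro nn_integral_mono_AE, eventually_elim)
   fix s :: real assume s0: "s ~= 0"
   show "ennreal (f (rp (mm k) (G k) s w - sg s w)) * ind {0..T} s <= ennreal \<bar>g k s\<bar> * ind {0..T} s"
   proof (cases "s \<in> {0..T}")
    case True
    have "s <= real k" "real k <= real (mm k)" using True n k mm(1)[of k] by auto
    hence sm: "s <= real (Suc (mm k))" "s \<in> {0..real k}" using True by auto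
    obtain i where i: "gr (mm k) i < s" "s <= gr (mm k) (Suc i)" "rp (mm k) (G k) s w = G k (gr (mm k) i) w"
     using rp_value[of s "mm k" "G k" w] True s0 sm by auto
    have "inc (G k) (mm k) i s w = G k s w - G k (gr (mm k) i) w" using i by (simp add: inc_def)
    moreover have "\<bar>inc (G k) (mm k) i s w\<bar> <= 1 / real (Suc k)" using U w sm(2) by (force simp: not_less)
    ultimately have b: "\<bar>rp (mm k) (G k) s w - sg s w\<bar> <= 1 / real (Suc k) + \<bar>G k s w - sg s w\<bar>" unfolding i(3) by linarith
    have "1 / real (Suc k) <= 1" by simp
    with b G_sg[of k s w] have "\<bar>rp (mm k) (G k) s w - sg s w\<bar> <= 3" by linarith
    from f(2)[OF this] b have "f (rp (mm k) (G k) s w - sg s w) <= g k s" using True by (simp add: g_def max_absorb2)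
    thus ?thesis using True by (auto intro: ennreal_leI)
   qed simp
  qed
  with le show "(\<integral>\<^sup>+s\<in>{0..T}. ennreal (f (rp (mm k) (G k) s w - sg s w)) \<partial>pm C w) <= ennreal e" by simp
 qed
qed

lemma approx_diagonal:
 assumes mm: "!!k. k <= mm k" "(%k. measure M (U (mm k) k)) ----> 0" and C: "ci Q'" "ci V'"
 shows "approx Q' V' sg (%k. gn (mm k)) (%k. gr (mm k)) (%k i. G k (gr (mm k) i))"
proof -
 have sq: "x^2 <= 3 * \<bar>x\<bar>" if "\<bar>x\<bar> <= 3" for x :: real
  using mult_right_mono[OF that abs_ge_zero[of x]] by (simp add: power2_eq_square)
 show ?thesis unfolding approx_def
 proof (intro conjI allI impI udata_riemann[OF cap_F(2)])
  fix T :: real assume T: "0 <= T"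
  show "nullp (%k w. \<integral>\<^sup>+s\<in>{0..T}. ennreal ((rp (mm k) (G k) s w - sg s w)^2) \<partial>pm Q' w)"
   by (rule deviation_diagonal[OF mm C(1) T _ sq]) simp_all
  show "nullp (%k w. \<integral>\<^sup>+s\<in>{0..T}. ennreal \<bar>rp (mm k) (G k) s w - sg s w\<bar> \<partial>pm V' w)"
   by (rule deviation_diagonal[OF mm C(2) T, of abs]) simp_all
 qed
qed

theorem stochastic_integral_Jt: "stochastic_integral M F sg Y Jt"
proof -
 obtain mm where mm: "ucp (%k t w. rsum (mm k) (G k) Y t w - Jt t w)" "!!k. k <= mm k" "(%k. measure M (U (mm k) k)) ----> 0" by (rule diagonal) blast
 have "simple_data M F (gn (mm k)) (gr (mm k)) (%i. G k (gr (mm k) i))" for k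
  using udata_riemann[OF cap_F(2)[of k], of "mm k"] T1_values(3)[OF F_ab, of k] by (auto simp: simple_data_def udata_def)
 thus ?thesis by (rule stochastic_integralI[OF progressive_sg cap_Jt decomposition_Y _ approx_diagonal[OF mm(2,3) cQ ci_add[OF cA cB]] mm(1)])
qed

text \<open>The given integral may rest on another decomposition of Y. The diagonal approximation is
  valid for every bracket and every pair of increasing parts, so it is compared with the given
  approximation inside that other decomposition.\<close>

lemma stochastic_integral_unique:
 assumes J': "stochastic_integral M F sg Y J'"
 shows "AE w in M. \<forall>t\<ge>0. J' t w = Jt t w"
proof -
 obtain mm where mm: "ucp (%k t w. rsum (mm k) (G k) Y t w - Jt t w)" "!!k. k <= mm k" "(%k. measure M (U (mm k) k)) ----> 0" by (rule diagonal) blast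
 obtain N' A' B' Q' n u xi where d: "semimartingale_decomposition M F Y N' A' B'" "quadratic_variation M F N' Q'"
   and ap: "approx Q' (%t w. A' t w + B' t w) sg n u xi"
   and l: "ucp (%k t w. simple_integral (n k) (u k) (xi k) Y t w - J' t w)" by (rule stochastic_integral_ucp[OF J'])
 note dc = decomposition_cov[OF d]
 have "ucp (%k t w. simple_integral (n k) (u k) (xi k) Y t w - rsum (mm k) (G k) Y t w)"
  by (rule approx_ucp_semimartingale[OF d progressive_sg ap approx_diagonal[OF mm(2,3) dc(2) ci_add[OF dc(3,4)]]])
 from ucp_add[OF this mm(1)] have "ucp (%k t w. simple_integral (n k) (u k) (xi k) Y t w - Jt t w)" by simp
 from ucp_limit_unique[OF l this] show ?thesis .
qed

theorem symmetric_local_time_lt: "symmetric_local_time M F Y lt" unfolding symmetric_local_time_def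
 by (intro conjI exI[of _ Jt] ci_lt stochastic_integral_Jt AE_I2 allI impI) (simp add: Jt_def)

theorem symmetric_local_time_unique:
 assumes "symmetric_local_time M F Y l"
 shows "AE w in M. \<forall>t\<ge>0. l t w = lt t w"
proof -
 obtain J where J: "stochastic_integral M F sg Y J" "AE w in M. \<forall>t\<ge>0. \<bar>Y t w\<bar> = \<bar>Y 0 w\<bar> + J t w + l t w"
  using assms by (auto simp: symmetric_local_time_def)
 from stochastic_integral_unique[OF J(1)] J(2) show ?thesis
 proof (eventually_elim, intro allI impI)
  fix w and t :: real assume "\<forall>t\<ge>0. J t w = Jt t w" "\<forall>t\<ge>0. \<bar>Y t w\<bar> = \<bar>Y 0 w\<bar> + J t w + l t w" and t: "0 <= t"
  from this(1)[rule_format, OF t] this(2)[rule_format, OF t] show "l t w = lt t w" unfolding Jt_def by linarith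
 qed
qed

end

section \<open>Occupation limit and support of the local time\<close>

context ito
begin

lemma fY_integrable:
 assumes C: "ci C" and w: "w \<in> space M" and f: "f \<in> bm borel" "!!y. \<bar>f y :: real\<bar> <= K"
 shows "set_integrable (pm C w) {0..t} (%s. f (Y s w))"
proof -
 have "set_integrable (pm C w) {0..t} (%s. f (Y (max 0 s) w))"
  by (rule pm_bounded_integrable[OF C w measurable_compose[OF path_measurable[OF cY w] f(1)] f(2)])
 thus ?thesis by (rule set_integrable_cong[THEN iffD1, rotated 3]) auto
qed

abbreviation "occ S t w == pint Q (%s w. ind S (Y s w)) t w"

lemma pint_mono_Y:
 assumes C: "ci C" and w: "w \<in> space M"
  and f: "f \<in> bm borel" "!!y. \<bar>f y :: real\<bar> <= K" and g: "g \<in> bm borel" "!!y. \<bar>g y :: real\<bar> <= K'"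
  and le: "!!y. f y <= g y"
 shows "pint C (%s w. f (Y s w)) t w <= pint C (%s w. g (Y s w)) t w"
 unfolding pint_def by (intro set_integral_mono fY_integrable[OF C w f] fY_integrable[OF C w g] le)

lemma occ_mono: "w \<in> space M ==> S \<in> sets borel ==> S' \<in> sets borel ==> S \<subseteq> S' ==> occ S t w <= occ S' t w"
 by (rule pint_mono_Y[OF cQ, of _ _ 1 _ 1]) (auto simp: indicator_def)

lemma occ_nonneg: "0 <= occ S t w" unfolding pint_def set_lebesgue_integral_def by (intro integral_nonneg_AE AE_I2) simp

lemma a_sum: "0 < ak k + ak (Suc k)" using ak_pos[of k] ak_pos[of "Suc k"] by simp

lemma F2_measurable: "F2 k \<in> bm borel" by (intro borel_measurable_continuous_onI T_continuous)

lemma F2_bound: "\<bar>F2 k y\<bar> <= 2 / (ak k + ak (Suc k))" using T2_values(3,4)[OF F_ab, of k y] by simp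

text \<open>A trapezoid is at most its height times the indicator of its support; in
  \<open>occ_upper\<close> it is at least its height times the indicator of its plateau.\<close>

lemma occ_lower:
 assumes w: "w \<in> space M" shows "(ak k + ak (Suc k)) * Lk k t w <= occ {y. \<bar>y\<bar> < ak k} t w"
proof -
 have "pint Q (%s w. F2 k (Y s w)) t w <= pint Q (%s w. 2 / (ak k + ak (Suc k)) * ind {y. \<bar>y\<bar> < ak k} (Y s w)) t w"
 proof (rule pint_mono_Y[OF cQ w F2_measurable F2_bound])
  show "F2 k y <= 2 / (ak k + ak (Suc k)) * ind {y. \<bar>y\<bar> < ak k} y" for y using T2_values(2,4)[OF F_ab, of k y] by (auto simp: indicator_def)
  show "\<bar>2 / (ak k + ak (Suc k)) * ind {y. \<bar>y\<bar> < ak k} y\<bar> <= 2 / (ak k + ak (Suc k))" for y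
   using a_sum[of k] by (auto simp: indicator_def)
 qed simp
 thus ?thesis using a_sum[of k] unfolding pint_cmult by (simp add: field_simps)
qed

lemma occ_upper:
 assumes w: "w \<in> space M" shows "occ {y. \<bar>y\<bar> < ak (Suc k)} t w <= (ak k + ak (Suc k)) * Lk k t w"
proof -
 have "pint Q (%s w. 2 / (ak k + ak (Suc k)) * ind {y. \<bar>y\<bar> < ak (Suc k)} (Y s w)) t w <= pint Q (%s w. F2 k (Y s w)) t w"
 proof (rule pint_mono_Y[OF cQ w _ _ F2_measurable F2_bound])
  show "2 / (ak k + ak (Suc k)) * ind {y. \<bar>y\<bar> < ak (Suc k)} y <= F2 k y" for y
   using T2_values(1)[OF F_ab, of y k] T2_values(3)[OF F_ab, of k y] by (auto simp: indicator_def)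
  show "\<bar>2 / (ak k + ak (Suc k)) * ind {y. \<bar>y\<bar> < ak (Suc k)} y\<bar> <= 2 / (ak k + ak (Suc k))" for y
   using a_sum[of k] by (auto simp: indicator_def)
 qed simp
 thus ?thesis using a_sum[of k] unfolding pint_cmult by (simp add: field_simps)
qed

lemma ak_ratios: "(%j. (ak j + ak (Suc j)) / (2 * ak (Suc (Suc j)))) ----> 1"
 "(%j. (ak (Suc (Suc j)) + ak (Suc (Suc (Suc j)))) / (2 * ak (Suc j))) ----> 1" unfolding ak_def by real_asymp+

text \<open>With m least such that \<open>ak m\<close> < ep, the width ep lies between two
  consecutive widths. Occupation is monotone in the width, so smoothed local times of nearby index
  bound the quotient on both sides, up to ratios of widths that tend to 1.\<close>

theorem occupation_limit:
 assumes w: "w \<in> space M" "w \<notin> bad" and t: "0 <= t"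
 shows "((%ep. 1 / (2 * ep) * occ {y. \<bar>y\<bar> < ep} t w) \<longlongrightarrow> lt t w) (at_right 0)"
proof (rule tendstoI)
 fix e :: real assume e: "0 < e"
 define u where "u j = (ak j + ak (Suc j)) / (2 * ak (Suc (Suc j))) * Lk j t w" for j
 define v where "v j = (ak (Suc (Suc j)) + ak (Suc (Suc (Suc j)))) / (2 * ak (Suc j)) * Lk (Suc (Suc j)) t w" for j
 note l = lt_lim[OF w t]
 have uv: "u ----> 1 * lt t w" "v ----> 1 * lt t w"
  unfolding u_def[abs_def] v_def[abs_def] by (intro tendsto_mult ak_ratios l LIMSEQ_Suc[OF LIMSEQ_Suc[OF l]])+
 have "1 * lt t w < lt t w + e" "lt t w - e < 1 * lt t w" using e by simp_all
 from eventually_conj[OF order_tendstoD(2)[OF uv(1) this(1)] order_tendstoD(1)[OF uv(2) this(2)]]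
 obtain J where J: "!!j. J <= j ==> u j < lt t w + e & lt t w - e < v j" unfolding eventually_sequentially by blast
 have "dist (1 / (2 * ep) * occ {y. \<bar>y\<bar> < ep} t w) (lt t w) < e" if ep: "0 < ep" "ep < ak (Suc J)" for ep
 proof -
  have "\<exists>m. ak m < ep" using order_tendstoD(2)[OF ak_lim ep(1)] by (auto simp: eventually_sequentially)
  define m where "m = (LEAST m. ak m < ep)"
  have m: "ak m < ep" unfolding m_def by (rule LeastI_ex) fact
  have "Suc J < m" using m ep ak_antimono[of m "Suc J"] by (cases "m <= Suc J") auto
  \<comment> \<open>The upper bound needs the trapezoid whose plateau has half-width
    \<open>ak (m - 1)\<close>, and that one carries the index m - 2.\<close>
  hence "m = Suc (Suc (m - 2))" "J <= m - 2" by arith+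
  then obtain j where j: "m = Suc (Suc j)" "J <= j" by blast
  have j1: "ep <= ak (Suc j)" using not_less_Least[of "Suc j" "%m. ak m < ep"] j by (simp add: m_def[symmetric] not_less)
  have L0: "0 <= Lk k t w" for k by (rule ci_nonneg[OF ci_Lk w(1) t])
  have "occ {y. \<bar>y\<bar> < ep} t w <= occ {y. \<bar>y\<bar> < ak (Suc j)} t w" using j1 by (intro occ_mono w) auto
  also have "... <= (ak j + ak (Suc j)) * Lk j t w" by (rule occ_upper[OF w(1)])
  finally have "1 / (2 * ep) * occ {y. \<bar>y\<bar> < ep} t w <= 1 / (2 * ak m) * ((ak j + ak (Suc j)) * Lk j t w)"
   using m ep ak_pos[of m] L0[of j] a_sum[of j] by (intro mult_mono frac_le occ_nonneg) auto
  hence up: "1 / (2 * ep) * occ {y. \<bar>y\<bar> < ep} t w <= u j" by (simp add: u_def j)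
  have "(ak m + ak (Suc m)) * Lk m t w <= occ {y. \<bar>y\<bar> < ak m} t w" by (rule occ_lower[OF w(1)])
  also have "... <= occ {y. \<bar>y\<bar> < ep} t w" using m by (intro occ_mono w) auto
  finally have "1 / (2 * ak (Suc j)) * ((ak m + ak (Suc m)) * Lk m t w) <= 1 / (2 * ep) * occ {y. \<bar>y\<bar> < ep} t w"
   using j1 ep L0[of m] a_sum[of m] by (intro mult_mono frac_le) auto
  hence "v j <= 1 / (2 * ep) * occ {y. \<bar>y\<bar> < ep} t w" by (simp add: v_def j)
  with up J[OF j(2)] show ?thesis unfolding dist_real_def by linarith
 qed
 thus "\<forall>\<^sub>F ep in at_right 0. dist (1 / (2 * ep) * occ {y. \<bar>y\<bar> < ep} t w) (lt t w) < e"
  unfolding eventually_at_right_field using ak_pos[of "Suc J"] by blast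
qed

text \<open>Level 0 lies in every plateau, and the occupation of a plateau is at most a sum of two
  widths times a convergent sequence.\<close>

lemma occ_zero:
 assumes w: "w \<in> space M" "w \<notin> bad" and t: "0 <= t"
 shows "occ {0} t w = 0"
proof (rule antisym)
 have lim: "(%k. (ak k + ak (Suc k)) * Lk k t w) ----> (0 + 0) * lt t w" by (intro tendsto_mult tendsto_add ak_lim LIMSEQ_Suc[OF ak_lim] lt_lim w t)
 have "occ {0} t w <= (ak k + ak (Suc k)) * Lk k t w" for k
  using occ_mono[OF w(1), of "{0}" "{y. \<bar>y\<bar> < ak (Suc k)}" t] occ_upper[OF w(1), of k t] ak_pos[of "Suc k"] by auto
 hence "occ {0} t w <= (0 + 0) * lt t w" by (intro LIMSEQ_le_const[OF lim]) blast
 thus "occ {0} t w <= 0" by simp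
 show "0 <= occ {0} t w" by (rule occ_nonneg)
qed

text \<open>By compactness Y stays away from 0 by a positive distance on [u, v]; trapezoids of
  smaller support vanish along this stretch, so \<open>Lk\<close> does not grow there.\<close>

lemma lt_constant:
 assumes w: "w \<in> space M" "w \<notin> bad" and u: "0 <= u" "u <= v" and nz: "!!s. s \<in> {u..v} ==> Y s w ~= 0"
 shows "lt v w = lt u w"
proof -
 have "continuous_on {u..v} (%s. \<bar>Y s w\<bar>)" using u by (intro continuous_on_rabs continuous_on_subset[OF cap_continuous[OF cY w(1)]]) auto
 then obtain s0 where s0: "s0 \<in> {u..v}" "!!s. s \<in> {u..v} ==> \<bar>Y s0 w\<bar> <= \<bar>Y s w\<bar>"
  using continuous_attains_inf[of "{u..v}" "%s. \<bar>Y s w\<bar>"] u by auto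
 have "EV k. ak k < \<bar>Y s0 w\<bar>" using nz[OF s0(1)] by (intro order_tendstoD(2)[OF ak_lim]) simp
 hence "EV k. Lk k v w = Lk k u w"
 proof eventually_elim
  case (elim k)
  have "ind {0..v} s *\<^sub>R F2 k (Y s w) = ind {0..u} s *\<^sub>R F2 k (Y s w)" for s
   using T2_values(2)[OF F_ab, of k "Y s w"] s0(2)[of s] elim u by (auto simp: indicator_def)
  thus ?case unfolding pint_def set_lebesgue_integral_def by (simp only:)
 qed
 hence "(%k. Lk k v w) ----> lt u w" by (rule Lim_transform_eventually[OF lt_lim[OF w u(1)] eventually_mono]) simp
 thus ?thesis using lt_lim[OF w, of v] u LIMSEQ_unique by auto
qed

text \<open>The positive times at which Y is nonzero are covered by countably many rational
  intervals on which the local time is constant; time 0 has no mass.\<close>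

lemma lt_support:
 assumes w: "w \<in> space M" "w \<notin> bad"
 shows "emeasure (pm (%t w. 1/2 * lt t w) w) {s. 0 <= s & Y s w ~= 0} = 0"
proof -
 let ?P = "pm (%t w. 1/2 * lt t w) w"
 have c: "ci (%t w. 1/2 * lt t w)" by (intro ci_cmult ci_lt) simp
 define E where "E = {(u, v) \<in> \<rat> \<times> \<rat>. 0 <= u & u <= v & (\<forall>s\<in>{u..v}. Y s w ~= 0)}"
 have "(\<Union>p\<in>E. {fst p<..snd p}) \<in> null_sets ?P"
 proof (rule null_sets_UN')
  show "countable E" unfolding E_def by (rule countable_subset[of _ "\<rat> \<times> \<rat>"]) (auto simp: countable_rat)
  show "{fst p<..snd p} \<in> null_sets ?P" if "p \<in> E" for p
   using that lt_constant[OF w, of "fst p" "snd p"] emeasure_pm_Ioc[OF c w(1), of "fst p" "snd p"] by (auto simp: E_def null_sets_def max_absorb2)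
 qed
 moreover have "{0} \<in> null_sets ?P" using emeasure_pm_Icc[OF c w(1) order_refl] ci_0[OF ci_lt w(1)] by (simp add: null_sets_def)
 ultimately have "{0} \<union> (\<Union>p\<in>E. {fst p<..snd p}) \<in> null_sets ?P" by (intro null_sets.Un)
 moreover have "{s. 0 <= s & Y s w ~= 0} \<subseteq> {0} \<union> (\<Union>p\<in>E. {fst p<..snd p})"
 proof
  fix s assume "s \<in> {s. 0 <= s & Y s w ~= 0}"
  hence s: "0 <= s" "Y s w ~= 0" by auto
  show "s \<in> {0} \<union> (\<Union>p\<in>E. {fst p<..snd p})"
  proof (cases "s = 0")
   case False
   hence s0: "0 < s" using s by simp
   have "continuous (at s within {0..}) (%t. Y t w)" using cap_continuous[OF cY w(1)] s by (simp add: continuous_on_eq_continuous_within)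
   from continuous_within_avoid[OF this s(2)]
   obtain d where d: "0 < d" "!!r. 0 <= r ==> dist s r < d ==> Y r w ~= 0" by auto
   obtain u where u: "u \<in> \<rat>" "max 0 (s - d) < u" "u < s" using Rats_dense_in_real[of "max 0 (s - d)" s] s0 d by auto
   obtain v where v: "v \<in> \<rat>" "s < v" "v < s + d" using Rats_dense_in_real[of s "s + d"] d by auto
   have "Y r w ~= 0" if "r \<in> {u..v}" for r using that u v by (intro d(2)) (auto simp: dist_real_def)
   hence "(u, v) \<in> E" using u v by (auto simp: E_def)
   thus ?thesis using u v by force
  qed simp
 qed
 ultimately show ?thesis using emeasure_mono by (metis (no_types, lifting) le_zero_eq null_setsD1 null_setsD2)
qed

end

section \<open>Change of integrator in path integrals\<close>

context stoch_base
begin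

text \<open>The time is clamped by \<open>max 0 s\<close> because nothing is known of
  \<open>b\<close> at negative times, where the path measure has no mass anyway.\<close>

lemma pm_density:
 assumes C: "ci C" and b: "cap b" and w: "w \<in> space M" and pos: "!!s w. 0 <= s ==> w \<in> space M ==> 0 <= b s w"
 shows "pm (pint C b) w = density (pm C w) (%s. ennreal (b (max 0 s) w))"
proof (rule measure_eqI_Ioc)
 have [measurable]: "(%s. b (max 0 s) w) \<in> bm borel" by (rule path_measurable[OF b w])
 have ci: "ci (pint C b)" by (rule ci_pint[OF C b pos])
 have null: "emeasure (pm C w) {x<..0} = 0" if "x <= 0" for x using emeasure_pm_Ioc[OF C w that] that by simp
 fix x y :: real assume xy: "x <= y"
 have P: "emeasure (pm (pint C b) w) {x<..y} = ennreal (pint C b (max 0 y) w - pint C b (max 0 x) w)" by (rule emeasure_pm_Ioc[OF ci w xy])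
 thus "emeasure (pm (pint C b) w) {x<..y} ~= \<infinity>" by simp
 let ?x = "max 0 x" and ?y = "max 0 y"
 have i: "set_integrable (pm C w) {0..t} (%s. b s w)" for t by (rule cap_pm_integrable[OF C b w])
 have nn: "(\<integral>\<^sup>+s. ennreal (b (max 0 s) w) * ind {0..t} s \<partial>pm C w) = ennreal (pint C b t w)" for t
 proof -
  have "(\<integral>\<^sup>+s. ennreal (b (max 0 s) w) * ind {0..t} s \<partial>pm C w) = (\<integral>\<^sup>+s. ennreal (ind {0..t} s *\<^sub>R b s w) \<partial>pm C w)"
   by (intro nn_integral_cong) (auto simp: indicator_def max_def)
  also have "... = ennreal (pint C b t w)" unfolding pint_def set_lebesgue_integral_def
   using i[of t] pos w by (intro nn_integral_eq_integral AE_I2) (auto simp: set_integrable_def indicator_def)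
  finally show ?thesis .
 qed
 have "emeasure (density (pm C w) (%s. ennreal (b (max 0 s) w))) {x<..y} =
   (\<integral>\<^sup>+s. ennreal (b (max 0 s) w) * ind {x<..y} s \<partial>pm C w)" by (simp add: emeasure_density)
 also have "... = (\<integral>\<^sup>+s. ennreal (b (max 0 s) w) * ind {?x<..?y} s \<partial>pm C w)"
 proof (rule nn_integral_cong_AE)
  have "AE s in pm C w. s \<notin> {min x 0<..0}" using null[of "min x 0"] by (intro AE_not_in) (simp add: null_sets_def)
  thus "AE s in pm C w. ennreal (b (max 0 s) w) * ind {x<..y} s = ennreal (b (max 0 s) w) * ind {?x<..?y} s"
   by eventually_elim (auto simp: indicator_def max_def min_def split: if_splits)
 qed
 finally have D: "emeasure (density (pm C w) (%s. ennreal (b (max 0 s) w))) {x<..y} =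
   (\<integral>\<^sup>+s. ennreal (b (max 0 s) w) * ind {?x<..?y} s \<partial>pm C w)" .
 have "ennreal (pint C b ?y w) = (\<integral>\<^sup>+s. ennreal (b (max 0 s) w) * ind {0..?x} s + ennreal (b (max 0 s) w) * ind {?x<..?y} s \<partial>pm C w)"
  unfolding nn[symmetric] using xy by (intro nn_integral_cong) (auto simp: indicator_def)
 also have "... = ennreal (pint C b ?x w) + emeasure (density (pm C w) (%s. ennreal (b (max 0 s) w))) {x<..y}"
  unfolding D nn[symmetric] by (intro nn_integral_add) auto
 finally show "emeasure (pm (pint C b) w) {x<..y} = emeasure (density (pm C w) (%s. ennreal (b (max 0 s) w))) {x<..y}"
  unfolding P using ci_nonneg[OF ci w, of ?x] by (simp add: ennreal_minus[symmetric])
qed simp_all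

lemma pint_pint:
 assumes C: "ci C" and b: "cap b" and w: "w \<in> space M" and pos: "!!s w. 0 <= s ==> w \<in> space M ==> 0 <= b s w"
  and h: "(%s. h (max 0 s) w) \<in> bm borel"
 shows "pint (pint C b) h t w = pint C (%s w. b s w * h s w) t w"
proof -
 have dens: "pm (pint C b) w = density (pm C w) (%s. ennreal (b (max 0 s) w))" by (rule pm_density[OF C b w]) (rule pos)
 have "pint (pint C b) h t w = (\<integral>s. ind {0..t} s *\<^sub>R h (max 0 s) w \<partial>pm (pint C b) w)"
  unfolding pint_def set_lebesgue_integral_def by (intro Bochner_Integration.integral_cong) (auto simp: indicator_def)
 also have "... = (\<integral>s. b (max 0 s) w *\<^sub>R (ind {0..t} s *\<^sub>R h (max 0 s) w) \<partial>pm C w)" unfolding dens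
  using h path_measurable[OF b w] pos w by (intro integral_density) auto
 also have "... = pint C (%s w. b s w * h s w) t w"
  unfolding pint_def set_lebesgue_integral_def by (intro Bochner_Integration.integral_cong) (auto simp: indicator_def max_def)
 finally show ?thesis .
qed

lemma ci_time: "ci (%t w. t)" by (rule ciI) (auto intro!: capI continuous_intros)

lemma pm_time: assumes w: "w \<in> space M" shows "pm (%t w. t) w = density lborel (ind {0..})"
proof (rule measure_eqI_Ioc)
 fix x y :: real assume xy: "x <= y"
 have "emeasure (density lborel (ind {0..})) {x<..y} = emeasure lborel ({0..} \<inter> {x<..y})"
  by (simp add: emeasure_density indicator_inter_arith[symmetric])
 also have "... = emeasure lborel {max 0 x<..max 0 y}"
 proof (rule emeasure_eq_AE)
  have "AE s in lborel. s ~= (0::real)" using AE_not_in[of "{0::real}" lborel] by (auto simp: null_sets_def)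
  thus "AE s in lborel. s \<in> {0..} \<inter> {x<..y} \<longleftrightarrow> s \<in> {max 0 x<..max 0 y}" by eventually_elim auto
 qed auto
 also have "... = ennreal (max 0 y - max 0 x)" using xy by (simp add: max.mono)
 finally have e: "emeasure (density lborel (ind {0..})) {x<..y} = ennreal (max 0 y - max 0 x)" .
 thus "emeasure (pm (%t w. t) w) {x<..y} = emeasure (density lborel (ind {0..})) {x<..y}" using emeasure_pm_Ioc[OF ci_time w xy] by simp
 show "emeasure (pm (%t w. t) w) {x<..y} ~= \<infinity>" unfolding emeasure_pm_Ioc[OF ci_time w xy] by simp
qed simp_all

lemma pint_time:
 assumes w: "w \<in> space M" and h: "(%s. h (max 0 s) w) \<in> bm borel"
 shows "pint (%t w. t) h t w = (LINT s:{0..t}|lborel. h s w)"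
proof -
 have dens: "pm (%t w. t) w = density lborel (%s. ennreal (ind {0..} s))"
  unfolding pm_time[OF w] by (intro arg_cong[where f="density lborel"] ext) (simp only: ennreal_indicator)
 have "pint (%t w. t) h t w = (\<integral>s. ind {0..t} s *\<^sub>R h (max 0 s) w \<partial>density lborel (%s. ennreal (ind {0..} s)))"
  unfolding pint_def set_lebesgue_integral_def dens by (intro Bochner_Integration.integral_cong) (auto simp: indicator_def)
 also have "... = (LINT s|lborel. ind {0..} s *\<^sub>R (ind {0..t} s *\<^sub>R h (max 0 s) w))" using h by (intro integral_density) auto
 also have "... = (LINT s:{0..t}|lborel. h s w)"
  unfolding set_lebesgue_integral_def by (intro Bochner_Integration.integral_cong) (auto simp: indicator_def)
 finally show ?thesis .
qed

lemma pint_sum: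
 assumes "ci C" "ci D" "w \<in> space M" and i: "set_integrable (pm C w) {0..t} (%s. h s w)" "set_integrable (pm D w) {0..t} (%s. h s w)"
 shows "pint (%t w. C t w + D t w) h t w = pint C h t w + pint D h t w"
proof -
 let ?f = "%s. ind {0..t} s *\<^sub>R h s w"
 have m: "?f \<in> bm borel" using i(1) by (auto simp: set_integrable_def)
 have "(\<integral>\<^sup>+s. ennreal (?f s) \<partial>pm C w) < \<infinity>" "(\<integral>\<^sup>+s. ennreal (- ?f s) \<partial>pm C w) < \<infinity>"
  "(\<integral>\<^sup>+s. ennreal (?f s) \<partial>pm D w) < \<infinity>" "(\<integral>\<^sup>+s. ennreal (- ?f s) \<partial>pm D w) < \<infinity>"
  using i unfolding set_integrable_def real_integrable_def by (auto simp: less_top)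
 note fin = this
 have n: "(\<integral>\<^sup>+s. ennreal (?f s) \<partial>msum (pm C w) (pm D w)) = (\<integral>\<^sup>+s. ennreal (?f s) \<partial>pm C w) + (\<integral>\<^sup>+s. ennreal (?f s) \<partial>pm D w)"
  "(\<integral>\<^sup>+s. ennreal (- ?f s) \<partial>msum (pm C w) (pm D w)) = (\<integral>\<^sup>+s. ennreal (- ?f s) \<partial>pm C w) + (\<integral>\<^sup>+s. ennreal (- ?f s) \<partial>pm D w)"
  using m by (intro nn_integral_msum; simp)+
 have int: "integrable (msum (pm C w) (pm D w)) ?f"
  unfolding real_integrable_def n using fin m by (auto simp: measurable_cong_sets[OF sets_msum refl] less_top)
 show ?thesis unfolding pint_def set_lebesgue_integral_def pm_add[OF assms(1-3)]
  unfolding real_lebesgue_integral_def[OF int] real_lebesgue_integral_def[OF i(1)[unfolded set_integrable_def]]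
   real_lebesgue_integral_def[OF i(2)[unfolded set_integrable_def]] n
   enn2real_plus[OF fin(1,3)[unfolded infinity_ennreal_def]] enn2real_plus[OF fin(2,4)[unfolded infinity_ennreal_def]] by simp
qed

end

section \<open>The reflected diffusion and the semimartingale decomposition of its kink
  coordinate\<close>

lemma locally_lipschitz_continuous:
 assumes "locally_lipschitz_on S f" shows "continuous_on S f" unfolding continuous_on_iff
proof (intro ballI allI impI)
 fix x and e :: real assume x: "x \<in> S" and e: "0 < e"
 obtain u C where u: "0 < u" and C: "lipschitz_on C (cball x u \<inter> S) f" using assms x by (auto simp: locally_lipschitz_on_def)
 have C0: "0 <= C" by (rule lipschitz_on_nonneg[OF C])
 let ?d = "min u (e / (C + 1))"
 have "dist (f y) (f x) < e" if y: "y \<in> S" "dist y x < ?d" for y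
 proof -
  have "dist (f y) (f x) <= C * dist y x" using y x u by (intro lipschitz_onD[OF C]) (auto simp: dist_commute)
  also have "... <= (C + 1) * dist y x" by (intro mult_right_mono) auto
  also have "... < (C + 1) * (e / (C + 1))" using y C0 by (intro mult_strict_left_mono) auto
  also have "... = e" using C0 by simp
  finally show ?thesis .
 qed
 thus "\<exists>d>0. \<forall>y\<in>S. dist y x < d --> dist (f y) (f x) < e" using u e C0 by (intro exI[of _ ?d]) auto
qed

lemma closed_quadrant: "closed quadrant"
proof -
 have eq: "quadrant = {x. 0 <= x $ 1} \<inter> {x. 0 <= x $ 2}" by (auto simp: quadrant_def)
 show ?thesis unfolding eq by (intro closed_Int closed_Collect_le continuous_intros)
qed

lemma kink_q_expand: "kink_q al a x = a x $ 1 $ 1 - al * (a x $ 1 $ 2) - al * (a x $ 2 $ 1) + al^2 * a x $ 2 $ 2"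
 by (simp add: kink_q_def kink_normal_def inner_vec_def sum_2 matrix_vector_mult_def power2_eq_square algebra_simps)

lemma kink_q_diffusion: "kink_q al (diffusion_matrix si) x = (si x $ 1 $ 1 - al * si x $ 2 $ 1)^2 + (si x $ 1 $ 2 - al * si x $ 2 $ 2)^2"
 by (simp add: kink_q_expand diffusion_matrix_def matrix_matrix_mult_def transpose_def sum_2 power2_eq_square algebra_simps)

lemma kink_q_formula:
 "kink_q al (diffusion_matrix si) x = diffusion_matrix si x $ 1 $ 1 - 2 * al * diffusion_matrix si x $ 1 $ 2 + al^2 * diffusion_matrix si x $ 2 $ 2"
 by (simp add: kink_q_diffusion diffusion_matrix_def matrix_matrix_mult_def transpose_def sum_2 power2_eq_square algebra_simps)

lemma payoff_kink_coordinate: "payoff al x = 1/2 * (x $ 1 + al * x $ 2 + \<bar>kink_coordinate al x\<bar>)"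
 by (simp add: payoff_def kink_coordinate_def max_def)

context stoch_base
begin

lemma pint_lin:
 assumes C: "ci C" and "cap f" "cap g" and w: "w \<in> space M"
 shows "pint C (%s w. c * f s w + d * g s w) t w = c * pint C f t w + d * pint C g t w"
 unfolding pint_def using cap_pm_integrable[OF C assms(2) w] cap_pm_integrable[OF C assms(3) w] by (simp add: set_integral_add)

lemma pint_const: "ci C ==> w \<in> space M ==> 0 <= t ==> pint C (%_ _. c) t w = c * C t w"
 using emeasure_pm_Icc[of C w t] ci_nonneg[of C w t] by (simp add: pint_def set_lebesgue_integral_def measure_def)

text \<open>Bridges a gap between the equation, which holds almost surely, and the locale
  \<open>ito\<close>, whose decomposition is an identity at every sample point.\<close>

lemma cov_AE:
 assumes c: "cov P P Q" and P': "cap P'" and eq: "AE w in M. \<forall>t\<ge>0. P t w = P' t w"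
  and 0: "!!w. w \<in> space M ==> P 0 w = 0" "!!w. w \<in> space M ==> P' 0 w = 0" "!!w. w \<in> space M ==> Q 0 w = 0"
 shows "cov P' P' Q"
proof -
 have P: "clm P" "cap Q" "clm (%t w. P t w * P t w - Q t w)" using c by (auto simp: cov_def)
 have "clm P'" by (rule clm_AE[OF P(1) P' eq 0(1,2)])
 moreover have "clm (%t w. P' t w * P' t w - Q t w)"
 proof (rule clm_AE[OF P(3)])
  show "AE w in M. \<forall>t\<ge>0. P t w * P t w - Q t w = P' t w * P' t w - Q t w" using eq by eventually_elim simp
 qed (use 0 in \<open>auto intro!: cap_diff cap_mult P' P(2)\<close>)
 ultimately show ?thesis using P(2) by (simp add: cov_def)
qed

text \<open>A process satisfying \<open>stochastic_integral\<close> vanishes at time 0 only almost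
  surely. Its initial value will be subtracted, and this controls what is subtracted.\<close>

lemma ucp_initial: assumes D: "ucp D" shows "ucp (%m t w. D m 0 w)" unfolding ucp_def
proof (intro conjI allI impI cap_initial ucp_cap[OF D])
 fix T e :: real assume e: "0 < e"
 show "(%m. measure M (supgt (%t w. D m 0 w) T e)) ----> 0"
 proof (rule Lim_null_comparison[OF always_eventually ucpD[OF D e, of "max 0 T"]], rule allI)
  fix m
  have "measure M (supgt (%t w. D m 0 w) T e) <= measure M (supgt (D m) (max 0 T) e)"
   by (intro finite_measure_mono supgt_measurable ucp_cap[OF D]) force
  thus "norm (measure M (supgt (%t w. D m 0 w) T e)) <= measure M (supgt (D m) (max 0 T) e)" by simp
 qed
qed

end

text \<open>Isolates what the probabilistic part draws on: one starting point, continuous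
  coefficients, the equation with its integrals \<open>I\<close> made explicit, and ellipticity
  reduced to positivity of the quadratic form in the direction of the kink normal.\<close>

locale reflected = stoch_base M F for M :: "'w measure" and F +
 fixes W :: "real => 'w => real^2" and mu :: "real^2 => real^2" and si :: "real^2 => real^2^2" and al :: real
  and x :: "real^2" and X L :: "real => 'w => real^2" and I :: "2 => 2 => real => 'w => real"
 assumes W: "brownian_motion M F W" and al: "0 < al"
  and cont: "continuous_on quadrant mu" "continuous_on quadrant si"
  and nondegenerate: "!!y. y \<in> quadrant ==> 0 < kink_q al (diffusion_matrix si) y"
  and X: "adapted_process F X" "continuous_process M X" "!!w t. w \<in> space M ==> 0 <= t ==> X t w \<in> quadrant"
  and ciL: "!!i. ci (%t w. L t w $ i)"
  and I: "!!i j. stochastic_integral M F (%s w. si (X s w) $ i $ j) (%t w. W t w $ j) (I i j)"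
  and sde: "AE w in M. \<forall>t\<ge>0. \<forall>i. X t w $ i = x $ i + (LINT s:{0..t}|lborel. mu (X s w) $ i)
       + (\<Sum>j\<in>UNIV. I i j t w) + L t w $ i"
begin

text \<open>Nothing is known of \<open>f\<close> outside the quadrant; times the indicator of this
  closed set it becomes a Borel function that agrees with \<open>f\<close> along the paths.\<close>

lemma cap_X: assumes f: "continuous_on quadrant f" shows "cap (%t w. f (X t w))"
proof (rule capI)
 fix t :: real assume t: "0 <= t"
 have "(%x. ind quadrant x *\<^sub>R f x) \<in> bm borel"
  by (intro borel_measurable_continuous_on_indicator f) (simp add: closed_quadrant borel_closed)
 moreover have "X t \<in> bm (F t)" using X(1) t by (simp add: adapted_process_def)
 ultimately have "(%w. ind quadrant (X t w) *\<^sub>R f (X t w)) \<in> bm (F t)" by (rule measurable_compose[rotated])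
 thus "(%w. f (X t w)) \<in> bm (F t)" by (rule measurable_cong[THEN iffD1, rotated]) (use X(3) t in simp)
next
 fix w assume "w \<in> space M"
 thus "continuous_on {0..} (%t. f (X t w))" using X(2,3) by (intro continuous_on_compose2[OF f]) (auto simp: continuous_process_def)
qed

abbreviation "h i j == %s w. si (X s w) $ i $ j"
text \<open>Primed processes are shifted to vanish at time 0 at every sample point; the originals do
  so only almost surely.\<close>

abbreviation "W' j == %t w. W t w $ j - W 0 w $ j"
abbreviation "I' i j == %t w. I i j t w - I i j 0 w"
abbreviation "b i == %s w. mu (X s w) $ i"
abbreviation "g j == %s w. h 1 j s w - al * h 2 j s w"
abbreviation "K j == %t w. I' 1 j t w - al * I' 2 j t w"
abbreviation "tm == %(t::real) (w::'w). t"

lemma cap_h: "cap (h i j)" and cap_b: "cap (b i)" and cap_g: "cap (g j)"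
 and cap_component: "cap (%t w. X t w $ i)"
proof -
 show c: "cap (h i j)" for i j by (intro cap_X continuous_on_component cont)
 show "cap (b i)" by (intro cap_X continuous_on_component cont)
 show "cap (%t w. X t w $ i)" by (intro cap_X continuous_on_component continuous_on_id)
 show "cap (g j)" by (intro cap_diff cap_cmult c)
qed

lemma cap_I: "cap (I i j)" using I[of i j] by (simp add: stochastic_integral_def cap_def)
lemma cap_I': "cap (I' i j)" by (intro cap_diff cap_I cap_initial)
lemma cap_K: "cap (K j)" by (intro cap_diff[of "I' _ _"] cap_cmult cap_I')

lemma clm_W': "clm (W' j)" using brownian_cov[OF W, of j j] by (simp add: cov_def)

lemma ucp_I': "ucp (%m t w. rsum m (h i j) (W' j) t w - I' i j t w)"
proof -
 have u: "ucp (%m t w. rsum m (h i j) (%t w. W t w $ j) t w - I i j t w)" by (rule stochastic_integral_riemann[OF I cap_h])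
 from ucp_diff[OF u ucp_initial[OF u]] show ?thesis by (simp add: sint_0[OF udata_riemann[OF cap_h]] simple_integral_def algebra_simps)
qed

lemma clm_I': "clm (I' i j)"
 by (rule clm_ucp_limit[OF clm_sint[OF clm_W' udata_riemann[OF cap_h]] ucp_I' cap_I']) (simp_all add: sint_0[OF udata_riemann[OF cap_h]])

lemma ucp_K: "ucp (%m t w. rsum m (g j) (W' j) t w - K j t w)"
proof -
 have eq: "rsum m (g j) (W' j) t w - K j t w = (rsum m (h 1 j) (W' j) t w - I' 1 j t w) - al * (rsum m (h 2 j) (W' j) t w - I' 2 j t w)" for m t w
  by (simp add: simple_integral_def algebra_simps sum.distrib sum_subtractf sum_distrib_left)
 show ?thesis unfolding eq by (intro ucp_diff ucp_cmult ucp_I')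
qed

text \<open>The hypothesis covers two cases at once: for j = l Riemann sums of the product converge
  to its time integral, and for distinct indices the integrator is zero.\<close>

lemma cov_K:
 assumes D: "ucp (%m t w. rsum m (%s w. g j s w * g l s w) (%t w. if j = l then t else 0) t w - D t w)"
  and "cap D" "!!w. w \<in> space M ==> D 0 w = 0"
 shows "cov (K j) (K l) D"
proof -
 have "ucp (%m t w. rsum m (g j) (rsum m (g l) (%t w. if j = l then t else 0)) t w - D t w)" using D unfolding rsum_rsum[of _ "g j" "g l"] .
 from cov_ucp_limit[OF cov_sint[OF brownian_cov[OF W, of j l] udata_riemann[OF cap_g[of j]] udata_riemann[OF cap_g[of l]]] ucp_K ucp_K this cap_K cap_K]
 show ?thesis by (simp add: assms sint_0[OF udata_riemann[OF cap_g]])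
qed

text \<open>The integrand is q along the path, see \<open>Qx_q\<close>. The factors 1 match the
  format of linear combinations in \<open>pint_lin\<close>.\<close>

definition Qx where "Qx = pint tm (%s w. 1 * (g 1 s w)^2 + 1 * (g 2 s w)^2)"

lemma cap_q: "cap (%s w. 1 * (g 1 s w)^2 + 1 * (g 2 s w)^2)" by (intro cap_add cap_cmult cap_power cap_g)

lemma ci_Qx: "ci Qx" unfolding Qx_def by (rule ci_pint[OF ci_time cap_q]) simp

lemma cov_N0: "cov (%t w. K 1 t w + K 2 t w) (%t w. K 1 t w + K 2 t w) Qx"
proof -
 have same: "cov (K j) (K j) (pint tm (%s w. (g j s w)^2))" for j
  by (rule cov_K) (simp_all add: power2_eq_square pint_0[OF ci_time] ucp_rsum_pint[OF ci_time cap_mult[OF cap_g cap_g]] cap_pint[OF ci_time cap_mult[OF cap_g cap_g]])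
 have diff: "cov (K j) (K l) (%t w. 0)" if "j ~= l" for j l
  by (rule cov_K) (use that in \<open>simp_all add: simple_integral_def ucp_zero cap_const\<close>)
 from cov_add_left[OF cov_sym[OF cov_add_left[OF same[of 1] diff[of 2 1]]] cov_sym[OF cov_add_left[OF diff[of 1 2] same[of 2]]]]
 have c: "cov (%t w. K 1 t w + K 2 t w) (%t w. K 1 t w + K 2 t w) (%t w. pint tm (%s w. (g 1 s w)^2) t w + pint tm (%s w. (g 2 s w)^2) t w)" by simp
 have eq: "Qx t w = pint tm (%s w. (g 1 s w)^2) t w + pint tm (%s w. (g 2 s w)^2) t w" if "w \<in> space M" for t w
  unfolding Qx_def pint_lin[OF ci_time cap_power[OF cap_g] cap_power[OF cap_g] that] by simp
 from c have c': "clm (%t w. K 1 t w + K 2 t w)" "clm (%t w. (K 1 t w + K 2 t w) * (K 1 t w + K 2 t w) -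
   (pint tm (%s w. (g 1 s w)^2) t w + pint tm (%s w. (g 2 s w)^2) t w))" by (auto simp: cov_def)
 have "clm (%t w. (K 1 t w + K 2 t w) * (K 1 t w + K 2 t w) - Qx t w)" by (rule clm_cong[OF c'(2)]) (simp only: eq)
 thus ?thesis using c'(1) ci_cap[OF ci_Qx] by (simp add: cov_def)
qed

text \<open>The drift of the kink coordinate. Its positive part and the first reflection term go
  into \<open>Ax\<close>, its negative part and al times the second reflection term into
  \<open>Bx\<close>, so that both are increasing.\<close>

abbreviation "be == %s w. 1 * b 1 s w + (- al) * b 2 s w"
abbreviation "bep == %s w. max (be s w) 0"
abbreviation "ben == %s w. max (-1 * be s w) 0"

lemma cap_be: "cap be" "cap bep" "cap ben" by (intro cap_max cap_const cap_cmult cap_add[of "%s w. 1 * b 1 s w"] cap_b)+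

definition "Yx t w = kink_coordinate al (X t w)"
definition "Ax t w = pint tm bep t w + L t w $ 1"
definition "Bx t w = pint tm ben t w + pint (%t w. L t w $ 2) (%_ _. al) t w"
text \<open>Defined as the remainder, which makes the decomposition an identity at every sample
  point. It is a local martingale because it agrees almost surely with the sum of the integrals
  \<open>K\<close>.\<close>

definition "Nx t w = Yx t w - Yx 0 w - Ax t w + Bx t w"

lemma ci_parts: "ci (pint tm bep)" "ci (pint tm ben)" "ci (pint (%t w. L t w $ 2) (%_ _. al))"
 by (intro ci_pint ci_time cap_be ciL cap_const; use al in simp)+

lemma ci_Ax: "ci Ax" and ci_Bx: "ci Bx" unfolding Ax_def[abs_def] Bx_def[abs_def] by (intro ci_add ci_parts ciL)+

lemma cap_Yx: "cap Yx" unfolding Yx_def[abs_def] kink_coordinate_def by (intro cap_diff[of "%t w. X t w $ 1"] cap_cmult cap_component)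

lemma increments: "AE w in M. \<forall>t\<ge>0. \<forall>i. X t w $ i - X 0 w $ i = pint tm (b i) t w + (I' i 1 t w + I' i 2 t w) + L t w $ i"
 using sde
proof (rule AE_mp, intro AE_I2 impI allI)
 fix w i and t :: real
 assume w: "w \<in> space M" and t: "0 <= t"
  and s: "\<forall>t\<ge>0. \<forall>i. X t w $ i = x $ i + (LINT s:{0..t}|lborel. mu (X s w) $ i) + (\<Sum>j\<in>UNIV. I i j t w) + L t w $ i"
 have eq: "X t w $ i = x $ i + pint tm (b i) t w + (I i 1 t w + I i 2 t w) + L t w $ i" if "0 <= t" for t
  using s[rule_format, OF that, of i] pint_time[where h="b i" and t=t, OF w path_measurable[OF cap_b w]] by (simp add: sum_2)
 show "X t w $ i - X 0 w $ i = pint tm (b i) t w + (I' i 1 t w + I' i 2 t w) + L t w $ i"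
  using eq[OF t] eq[OF order_refl] ci_0[OF ciL w, of i] pint_0[OF ci_time w, of "b i"] by linarith
qed

lemma pint_be: "w \<in> space M ==> pint tm (b 1) t w - al * pint tm (b 2) t w = pint tm bep t w - pint tm ben t w"
proof -
 assume w: "w \<in> space M"
 have "pint tm (%s w. 1 * bep s w + (-1) * ben s w) t w = pint tm be t w" by (intro arg_cong[where f="%f. pint tm f t w"] ext) (simp add: max_def)
 thus ?thesis using pint_lin[OF ci_time cap_b cap_b w, of 1 1 "- al" 2 t] pint_lin[OF ci_time cap_be(2,3) w, of 1 "-1" t] by simp
qed

lemma pint_L2: "w \<in> space M ==> 0 <= t ==> pint (%t w. L t w $ 2) (%_ _. al) t w = al * L t w $ 2" by (rule pint_const[OF ciL])

lemma cov_Nx: "cov Nx Nx Qx"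
proof (rule cov_AE[OF cov_N0])
 show "cap Nx" unfolding Nx_def[abs_def] by (intro cap_add cap_diff cap_Yx ci_cap ci_Ax ci_Bx cap_initial)
 show "AE w in M. \<forall>t\<ge>0. K 1 t w + K 2 t w = Nx t w" using increments
 proof (rule AE_mp, intro AE_I2 impI allI)
  fix w and t :: real assume w: "w \<in> space M" and t: "0 <= t"
   and s: "\<forall>t\<ge>0. \<forall>i. X t w $ i - X 0 w $ i = pint tm (b i) t w + (I' i 1 t w + I' i 2 t w) + L t w $ i"
  have "al * (X t w $ 2 - X 0 w $ 2) = al * (pint tm (b 2) t w + (I' 2 1 t w + I' 2 2 t w) + L t w $ 2)" using s[rule_format, OF t, of 2] by simp
  thus "K 1 t w + K 2 t w = Nx t w" using s[rule_format, OF t, of 1] pint_be[OF w, of t] pint_L2[OF w t]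
   unfolding Nx_def Yx_def Ax_def Bx_def kink_coordinate_def by (simp add: algebra_simps)
 qed
qed (simp_all add: Nx_def ci_0[OF ci_Ax] ci_0[OF ci_Bx] ci_0[OF ci_Qx])

sublocale tan: ito M F Yx Nx Ax Bx Qx by unfold_locales (simp_all add: cap_Yx cov_Nx ci_Qx ci_Ax ci_Bx Nx_def ci_0[OF ci_Ax] ci_0[OF ci_Bx])

end

section \<open>Local time of the kink coordinate and the singular term of the payoff\<close>

context reflected
begin

abbreviation "sx == %s w. sgn (Yx s w)"

lemma Qx_q: "w \<in> space M ==> 1 * (g 1 s w)^2 + 1 * (g 2 s w)^2 = kink_q al (diffusion_matrix si) (X s w)" by (simp add: kink_q_diffusion)

lemma fY_path: "w \<in> space M ==> f \<in> bm borel ==> (%s. f (Yx (max 0 s) w)) \<in> bm borel"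
 by (rule measurable_compose[OF path_measurable[OF cap_Yx]])

lemma occupation_lborel:
 assumes w: "w \<in> space M" and S: "S \<in> sets borel"
 shows "tan.occ S t w = (LINT s:{0..t}|lborel. ind S (Yx s w) * kink_q al (diffusion_matrix si) (X s w))"
proof -
 let ?q = "%s w. 1 * (g 1 s w)^2 + 1 * (g 2 s w)^2" and ?h = "%s w. ind S (Yx s w) :: real"
 have m: "(%s. ?h (max 0 s) w) \<in> bm borel" using S by (intro fY_path[OF w]) simp
 have "tan.occ S t w = pint tm (%s w. ?q s w * ?h s w) t w" unfolding Qx_def by (rule pint_pint[where h="?h", OF ci_time cap_q w _ m]) simp
 also have "... = (LINT s:{0..t}|lborel. ?q s w * ?h s w)"
  by (intro pint_time[where h="%s w. ?q s w * ?h s w", OF w] borel_measurable_times path_measurable[OF cap_q w] m)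
 finally show ?thesis unfolding Qx_q[OF w] by (simp only: mult.commute)
qed

text \<open>No occupation of level 0 means that the time spent there, weighted by q, is zero.
  Ellipticity makes q positive on the quadrant, so the weight can be removed.\<close>

lemma zero_set_null:
 assumes w: "w \<in> space M" "w \<notin> tan.bad"
 shows "emeasure lborel {s. 0 <= s & Yx s w = 0} = 0"
proof -
 let ?q = "%s w. 1 * (g 1 s w)^2 + 1 * (g 2 s w)^2"
 have m: "(%s. ind {0} (Yx (max 0 s) w) :: real) \<in> bm borel" by (rule fY_path[OF w(1)]) simp
 have qm: "(%s. ?q (max 0 s) w) \<in> bm borel" by (rule path_measurable[OF cap_q w(1)])
 let ?f = "%n s. ennreal (ind {0..real n} s * ind {0} (Yx (max 0 s) w))"
 have fm: "?f n \<in> bm borel" for n using m by measurable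
 have "AE s in lborel. \<not> (s \<in> {0..real n} & Yx s w = 0)" for n
 proof -
  have i: "integrable (pm Qx w) (%s. ind {0..real n} s *\<^sub>R (ind {0} (Yx s w) :: real))"
   using tan.fY_integrable[OF ci_Qx w(1), of "ind {0}" 1 "real n"] by (auto simp: set_integrable_def indicator_def)
  have "(\<integral>\<^sup>+s. ?f n s \<partial>pm Qx w) = (\<integral>\<^sup>+s. ennreal (ind {0..real n} s *\<^sub>R ind {0} (Yx s w)) \<partial>pm Qx w)"
   by (intro nn_integral_cong) (auto simp: indicator_def)
  also have "... = ennreal (tan.occ {0} (real n) w)" unfolding pint_def set_lebesgue_integral_def by (rule nn_integral_eq_integral[OF i]) simp
  also have "... = 0" using tan.occ_zero[OF w] by simp
  finally have 0: "(\<integral>\<^sup>+s. ?f n s \<partial>pm Qx w) = 0" .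
  define qf where "qf s = ennreal (?q (max 0 s) w)" for s
  have qf: "qf \<in> bm borel" unfolding qf_def[abs_def] by (rule measurable_compose[OF qm measurable_ennreal])
  have dens: "pm Qx w = density (pm tm w) qf" unfolding Qx_def qf_def[abs_def] by (rule pm_density[OF ci_time cap_q w(1)]) simp
  have "(\<integral>\<^sup>+s. ?f n s \<partial>pm Qx w) = (\<integral>\<^sup>+s. qf s * ?f n s \<partial>density lborel (ind {0..}))"
   unfolding dens pm_time[OF w(1)] by (rule nn_integral_density) (simp_all only: measurable_density_eq1 measurable_lborel1 measurable_lborel2 qf fm)
  also have "... = (\<integral>\<^sup>+s. ind {0..} s * (qf s * ?f n s) \<partial>lborel)" using qf fm[of n] by (intro nn_integral_density) auto
  finally have "(\<integral>\<^sup>+s. ind {0..} s * (qf s * ?f n s) \<partial>lborel) = 0" using 0 by simp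
  hence "AE s in lborel. ind {0..} s * (qf s * ?f n s) = 0" using fm[of n] qf by (subst (asm) nn_integral_0_iff_AE) auto
  thus ?thesis
  proof eventually_elim
   case (elim s)
   show ?case
   proof
    assume s: "s \<in> {0..real n} & Yx s w = 0"
    hence "0 < ?q s w" unfolding Qx_q[OF w(1)] by (intro nondegenerate X(3) w) auto
    moreover have "?q s w = 0" using elim s by (simp add: qf_def max_absorb2 ennreal_eq_0_iff del: mult_1)
    ultimately show False by simp
   qed
  qed
 qed
 hence "AE s in lborel. \<forall>n. \<not> (s \<in> {0..real n} & Yx s w = 0)" unfolding AE_all_countable by blast
 hence ae: "AE s in lborel. \<not> (0 <= s & Yx s w = 0)"
 proof eventually_elim
  fix s assume a: "\<forall>n. \<not> (s \<in> {0..real n} & Yx s w = 0)"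
  obtain n where "s <= real n" using real_arch_simple by blast
  thus "\<not> (0 <= s & Yx s w = 0)" using a by (auto dest!: spec[of _ n])
 qed
 have eq: "{s. 0 <= s & Yx s w = 0} = {0..} \<inter> (%s. Yx (max 0 s) w) -` {0}" by (auto simp: max_def)
 have "{s. 0 <= s & Yx s w = 0} \<in> sets lborel"
  unfolding eq using measurable_sets[OF path_measurable[OF cap_Yx w(1)], of "{0}"] by (auto intro!: sets.Int)
 with ae show ?thesis by (subst (asm) AE_iff_measurable) auto
qed

lemma sx_integrable:
 assumes C: "ci C" and f: "cap f" and w: "w \<in> space M"
 shows "set_integrable (pm C w) {0..t} (%s. f s w * sx s w)"
proof -
 obtain B where B: "!!s. s \<in> {0..t} ==> \<bar>f s w\<bar> <= B" by (rule cap_bounded_on[OF f w, where T=t]) blast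
 have "set_integrable (pm C w) {0..t} (%s. f (max 0 s) w * sx (max 0 s) w)"
 proof (rule pm_bounded_integrable[OF C w])
  show "(%s. f (max 0 s) w * sx (max 0 s) w) \<in> bm borel"
   by (intro borel_measurable_times path_measurable[OF f w] fY_path[OF w] borel_measurable_sgn)
  show "\<bar>f (max 0 s) w * sx (max 0 s) w\<bar> <= B" if "s \<in> {0..t}" for s
   using B[OF that] that by (auto simp: sgn_real_def abs_mult max_absorb2 intro: order_trans[OF abs_ge_zero])
 qed
 thus ?thesis by (rule set_integrable_cong[THEN iffD1, rotated 3]) (auto simp: max_absorb2)
qed

lemma sx_path: "cap f ==> w \<in> space M ==> (%s. f (max 0 s) w * sx (max 0 s) w) \<in> bm borel"
 by (intro borel_measurable_times path_measurable fY_path borel_measurable_sgn)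

text \<open>The splitting into increasing parts served the general theory; here it is undone, so
  that drift and reflection terms appear separately, as \<open>kink_singular_term\<close>
  requires.\<close>

lemma drift_sgn:
 assumes w: "w \<in> space M" and t: "0 <= t"
 shows "pint Ax sx t w - pint Bx sx t w = pint tm (%s w. be s w * sx s w) t w + pint (%t w. L t w $ 1) sx t w - al * pint (%t w. L t w $ 2) sx t w"
proof -
 let ?L1 = "%t w. L t w $ 1" and ?L2 = "%t w. L t w $ 2"
 note i = tan.sg_integrable[OF _ w, of _ t] and m = fY_path[OF w borel_measurable_sgn]
 have A: "pint Ax sx t w = pint tm (%s w. bep s w * sx s w) t w + pint ?L1 sx t w"
 proof -
  have "pint Ax sx t w = pint (pint tm bep) sx t w + pint ?L1 sx t w"
   unfolding Ax_def[abs_def] by (rule pint_sum[where C="pint tm bep" and D="?L1" and h=sx, OF ci_parts(1) ciL w i[OF ci_parts(1)] i[OF ciL]])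
  also have "pint (pint tm bep) sx t w = pint tm (%s w. bep s w * sx s w) t w"
   by (rule pint_pint[where b="bep" and h=sx, OF ci_time cap_be(2) w _ m]) simp
  finally show ?thesis .
 qed
 have B: "pint Bx sx t w = pint tm (%s w. ben s w * sx s w) t w + al * pint ?L2 sx t w"
 proof -
  have "pint Bx sx t w = pint (pint tm ben) sx t w + pint (pint ?L2 (%_ _. al)) sx t w"
   unfolding Bx_def[abs_def] by (rule pint_sum[where C="pint tm ben" and D="pint ?L2 (%_ _. al)" and h=sx, OF ci_parts(2,3) w i[OF ci_parts(2)] i[OF ci_parts(3)]])
  also have "pint (pint tm ben) sx t w = pint tm (%s w. ben s w * sx s w) t w"
   by (rule pint_pint[where b="ben" and h=sx, OF ci_time cap_be(3) w _ m]) simp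
  also have "pint (pint ?L2 (%_ _. al)) sx t w = pint ?L2 (%s w. al * sx s w) t w"
   by (rule pint_pint[where b="%_ _. al" and h=sx, OF ciL cap_const w _ m]) (use al in simp)
  finally show ?thesis by (simp only: pint_cmult)
 qed
 have "pint tm (%s w. bep s w * sx s w) t w - pint tm (%s w. ben s w * sx s w) t w = (LINT s:{0..t}|pm tm w. bep s w * sx s w - ben s w * sx s w)"
  unfolding pint_def by (rule set_integral_diff(2)[symmetric]) (intro sx_integrable ci_time cap_be w)+
 also have "... = pint tm (%s w. be s w * sx s w) t w" unfolding pint_def left_diff_distrib[symmetric]
  by (intro arg_cong[where f="%f. set_lebesgue_integral (pm tm w) {0..t} f"] ext arg_cong2[where f="(*)"]) (simp_all add: max_def)
 finally show ?thesis unfolding A B by simp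
qed

text \<open>With the mean value on the kink, the gradient components are affine in the sign: (1 +
  sgn) / 2 and al (1 - sgn) / 2. Each gradient integral is thus half an unsigned plus or minus half
  a signed integral.\<close>

lemma gradient_terms:
 assumes w: "w \<in> space M" and t: "0 <= t"
 shows "(LINT s:{0..t}|lborel. payoff_gradient al (X s w) \<bullet> mu (X s w)) =
   1/2 * pint tm (b 1) t w + 1/2 * (al * pint tm (b 2) t w) + 1/2 * pint tm (%s w. be s w * sx s w) t w"
  and "(LINT s:{0..t}|pm (%t w. L t w $ 1) w. payoff_gradient al (X s w) $ 1) = 1/2 * L t w $ 1 + 1/2 * pint (%t w. L t w $ 1) sx t w"
  and "(LINT s:{0..t}|pm (%t w. L t w $ 2) w. payoff_gradient al (X s w) $ 2) = 1/2 * (al * L t w $ 2) - 1/2 * (al * pint (%t w. L t w $ 2) sx t w)"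
proof -
 let ?k = "%s w. 1/2 * b 1 s w + 1/2 * al * b 2 s w" and ?l = "%s w. 1/2 * (be s w * sx s w)"
 have ck: "cap ?k" by (intro cap_add[of "%s w. 1/2 * b 1 s w"] cap_cmult cap_b)
 have "(LINT s:{0..t}|lborel. payoff_gradient al (X s w) \<bullet> mu (X s w)) = (LINT s:{0..t}|lborel. ?k s w + ?l s w)"
  by (intro arg_cong[where f="set_lebesgue_integral lborel {0..t}"] ext) (simp add: payoff_gradient_def Yx_def inner_vec_def sum_2 field_simps)
 also have "... = pint tm (%s w. ?k s w + ?l s w) t w" by (rule pint_time[where h="%s w. ?k s w + ?l s w", OF w, symmetric])
   (intro borel_measurable_add path_measurable[OF ck w] borel_measurable_times borel_measurable_const sx_path[OF cap_be(1) w])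
 also have "... = pint tm ?k t w + pint tm ?l t w"
  unfolding pint_def by (rule set_integral_add(2)[OF cap_pm_integrable[OF ci_time ck w] set_integrable_mult_right[OF sx_integrable[OF ci_time cap_be(1) w]]])
 also have "pint tm ?k t w = 1/2 * pint tm (b 1) t w + 1/2 * al * pint tm (b 2) t w" by (rule pint_lin[OF ci_time cap_b cap_b w])
 finally show "(LINT s:{0..t}|lborel. payoff_gradient al (X s w) \<bullet> mu (X s w)) =
   1/2 * pint tm (b 1) t w + 1/2 * (al * pint tm (b 2) t w) + 1/2 * pint tm (%s w. be s w * sx s w) t w" unfolding pint_cmult by simp
 have gen: "(LINT s:{0..t}|pm C w. c + d * sx s w) = c * C t w + d * pint C sx t w" if C: "ci C" for C and c d :: real
 proof -
  have "(LINT s:{0..t}|pm C w. c + d * sx s w) = (LINT s:{0..t}|pm C w. c) + (LINT s:{0..t}|pm C w. d * sx s w)"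
   by (rule set_integral_add(2)[OF cap_pm_integrable[OF C cap_const w] set_integrable_mult_right[OF tan.sg_integrable[OF C w]]])
  thus ?thesis using pint_const[OF C w t, of c] by (simp add: pint_def)
 qed
 have "payoff_gradient al (X s w) $ 1 = 1/2 + 1/2 * sx s w" "payoff_gradient al (X s w) $ 2 = al/2 + (- al/2) * sx s w" for s
  by (simp_all add: payoff_gradient_def Yx_def field_simps)
 note e = this
 show "(LINT s:{0..t}|pm (%t w. L t w $ 1) w. payoff_gradient al (X s w) $ 1) = 1/2 * L t w $ 1 + 1/2 * pint (%t w. L t w $ 1) sx t w"
  unfolding e gen[OF ciL] ..
 show "(LINT s:{0..t}|pm (%t w. L t w $ 2) w. payoff_gradient al (X s w) $ 2) = 1/2 * (al * L t w $ 2) - 1/2 * (al * pint (%t w. L t w $ 2) sx t w)"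
  unfolding e gen[OF ciL] by simp
qed

theorem local_time_exists: "\<exists>l. symmetric_local_time M F (%t w. kink_coordinate al (X t w)) l"
 using tan.symmetric_local_time_lt by (auto simp: Yx_def[abs_def])

theorem local_time_limit:
 assumes l: "symmetric_local_time M F (%t w. kink_coordinate al (X t w)) l"
 shows "AE w in M. \<forall>t\<ge>0. ((%ep. 1 / (2 * ep) *
   (LINT s:{0..t}|lborel. ind {s. \<bar>kink_coordinate al (X s w)\<bar> < ep} s * kink_q al (diffusion_matrix si) (X s w)))
   \<longlongrightarrow> l t w) (at_right 0)" using tan.symmetric_local_time_unique[OF l[folded Yx_def[abs_def]]] tan.AE_not_bad
proof (rule AE_mp[OF AE_conjI], intro AE_I2 impI allI, elim conjE)
 fix w and t :: real assume w: "w \<in> space M" "w \<notin> tan.bad" and t: "0 <= t" and e: "\<forall>t\<ge>0. l t w = tan.lt t w"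
 have "tan.occ {y. \<bar>y\<bar> < ep} t w = (LINT s:{0..t}|lborel. ind {s. \<bar>kink_coordinate al (X s w)\<bar> < ep} s * kink_q al (diffusion_matrix si) (X s w))" for ep
  by (subst occupation_lborel[OF w(1)]) (simp_all add: Yx_def indicator_def)
 thus "((%ep. 1 / (2 * ep) * (LINT s:{0..t}|lborel. ind {s. \<bar>kink_coordinate al (X s w)\<bar> < ep} s * kink_q al (diffusion_matrix si) (X s w)))
   \<longlongrightarrow> l t w) (at_right 0)" using tan.occupation_limit[OF w t] e t by simp
qed

text \<open>The payoff is half of X1 + al X2 + |Y|. Adding the equations of the two components to
  Tanaka's formula for |Y| reproduces the gradient integrals and leaves half the local time. Every
  local time equals \<open>tan.lt\<close> almost surely, so the support statement carries over to
  it.\<close>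

theorem singular_term:
 assumes l: "symmetric_local_time M F (%t w. kink_coordinate al (X t w)) l"
 shows "kink_singular_term M F mu al X L (%t w. 1/2 * l t w)"
proof -
 note AE_l = tan.symmetric_local_time_unique[OF l[folded Yx_def[abs_def]]]
 have ci_l: "ci (%t w. 1/2 * l t w)" using l by (intro ci_cmult) (simp_all add: symmetric_local_time_def)
 define NG where "NG t w = 1/2 * ((I' 1 1 t w + I' 1 2 t w) + al * (I' 2 1 t w + I' 2 2 t w)) + 1/2 * tan.Mt t w" for t w
 have "clm NG" unfolding NG_def[abs_def]
  by (intro clm_add[of "%t w. 1/2 * ((I' 1 1 t w + I' 1 2 t w) + al * (I' 2 1 t w + I' 2 2 t w))"] clm_cmult tan.clm_Mt
    clm_add[of "%t w. I' 1 1 t w + I' 1 2 t w"] clm_add[of "I' _ 1"] clm_I')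
 moreover have "\<forall>w\<in>space M. NG 0 w = 0" by (simp add: NG_def tan.Mt_0)
 moreover have "AE w in M. \<forall>t\<ge>0. payoff al (X t w) = payoff al (X 0 w) + NG t w
       + (LINT s:{0..t}|lborel. payoff_gradient al (X s w) \<bullet> mu (X s w))
       + (\<Sum>i\<in>UNIV. LINT s:{0..t}|pm (%t w. L t w $ i) w. payoff_gradient al (X s w) $ i) + 1/2 * l t w" using increments AE_l
 proof (rule AE_mp[OF AE_conjI], intro AE_I2 impI allI, elim conjE)
  fix w and t :: real assume w: "w \<in> space M" and t: "0 <= t" and e: "\<forall>t\<ge>0. l t w = tan.lt t w"
   and s: "\<forall>t\<ge>0. \<forall>i. X t w $ i - X 0 w $ i = pint tm (b i) t w + (I' i 1 t w + I' i 2 t w) + L t w $ i"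
  have X1: "X t w $ 1 - X 0 w $ 1 = pint tm (b 1) t w + (I' 1 1 t w + I' 1 2 t w) + L t w $ 1"
   and X2: "al * X t w $ 2 - al * X 0 w $ 2 = al * pint tm (b 2) t w + al * (I' 2 1 t w + I' 2 2 t w) + al * L t w $ 2"
   using s[rule_format, OF t, of 1] arg_cong[OF s[rule_format, OF t, of 2], of "(*) al"] by (simp_all only: right_diff_distrib distrib_left)
  have Y: "\<bar>kink_coordinate al (X t w)\<bar> - \<bar>kink_coordinate al (X 0 w)\<bar> = tan.Mt t w + l t w + (pint Ax sx t w - pint Bx sx t w)"
   using e t by (simp add: tan.Mt_def tan.Jt_def Yx_def)
  \<comment> \<open>Bookkeeping separated from the processes: the letters m stand for martingale
    parts, p and s for plain and signed drift, l with an index for reflection, k for signed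
    reflection, and plain l for the local time.\<close>
  have aux: "1/2 * (x1 + x2 + y) = 1/2 * (x1' + x2' + y') + (1/2 * (m1 + m2) + 1/2 * m) + (1/2 * p1 + 1/2 * p2 + 1/2 * s)
    + ((1/2 * l1 + 1/2 * k1) + (1/2 * l2 - 1/2 * k2)) + 1/2 * l"
   if "x1 - x1' = p1 + m1 + l1" "x2 - x2' = p2 + m2 + l2" "y - y' = m + l + (s + k1 - k2)"
   for x1 x2 y x1' x2' y' m1 m2 m p1 p2 s l1 l2 k1 k2 l :: real using that by (simp add: field_simps)
  show "payoff al (X t w) = payoff al (X 0 w) + NG t w + (LINT s:{0..t}|lborel. payoff_gradient al (X s w) \<bullet> mu (X s w))
       + (\<Sum>i\<in>UNIV. LINT s:{0..t}|pm (%t w. L t w $ i) w. payoff_gradient al (X s w) $ i) + 1/2 * l t w"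
   unfolding payoff_kink_coordinate sum_2 gradient_terms[OF w t] NG_def by (rule aux[OF X1 X2 Y[unfolded drift_sgn[OF w t]]])
 qed
 moreover have "AE w in M. emeasure (pm (%t w. 1/2 * l t w) w) {s. 0 <= s & kink_coordinate al (X s w) ~= 0} = 0 &
    emeasure lborel {s. 0 <= s & kink_coordinate al (X s w) = 0} = 0" using AE_l tan.AE_not_bad
 proof (rule AE_mp[OF AE_conjI], intro AE_I2 impI, elim conjE)
  fix w assume w: "w \<in> space M" "w \<notin> tan.bad" and e: "\<forall>t\<ge>0. l t w = tan.lt t w"
  have "pm (%t w. 1/2 * l t w) w = pm (%t w. 1/2 * tan.lt t w) w" using e by (simp add: path_measure_def)
  thus "emeasure (pm (%t w. 1/2 * l t w) w) {s. 0 <= s & kink_coordinate al (X s w) ~= 0} = 0 &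
    emeasure lborel {s. 0 <= s & kink_coordinate al (X s w) = 0} = 0" using tan.lt_support[OF w] zero_set_null[OF w] by (simp add: Yx_def)
 qed
 ultimately show ?thesis using ci_l unfolding kink_singular_term_def by blast
qed

end

section \<open>Smooth bump functions\<close>

fun Ck1 :: "nat => (real => real) => bool" where "Ck1 0 f \<longleftrightarrow> continuous_on UNIV f"
| "Ck1 (Suc k) f \<longleftrightarrow> (\<exists>f'. (\<forall>t. (f has_real_derivative f' t) (at t)) & Ck1 k f')"

lemma Ck1_Suc: "Ck1 (Suc k) f ==> Ck1 k f"
proof (induction k arbitrary: f)
 case 0
 thus ?case by (auto intro!: continuous_at_imp_continuous_on dest: DERIV_isCont)
next
 case (Suc k)
 from Suc.prems obtain f' where "\<forall>t. (f has_real_derivative f' t) (at t)" "Ck1 (Suc k) f'" by auto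
 with Suc.IH[of f'] show ?case by auto
qed

lemma Ck1_add: "Ck1 k f ==> Ck1 k g ==> Ck1 k (%t. f t + g t)"
proof (induction k arbitrary: f g)
 case (Suc k)
 then obtain f' g' where "\<forall>t. (f has_real_derivative f' t) (at t)" "Ck1 k f'" "\<forall>t. (g has_real_derivative g' t) (at t)" "Ck1 k g'" by auto
 thus ?case using Suc.IH[of f' g'] by (auto intro!: exI[of _ "%t. f' t + g' t"] derivative_intros)
qed (auto intro: continuous_intros)

lemma Ck1_mult: "Ck1 k f ==> Ck1 k g ==> Ck1 k (%t. f t * g t)"
proof (induction k arbitrary: f g)
 case (Suc k)
 then obtain f' g' where d: "\<forall>t. (f has_real_derivative f' t) (at t)" "Ck1 k f'" "\<forall>t. (g has_real_derivative g' t) (at t)" "Ck1 k g'" by auto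
 hence "Ck1 k (%t. f' t * g t + g' t * f t)" using Suc.IH Ck1_Suc[OF Suc.prems(1)] Ck1_Suc[OF Suc.prems(2)] by (intro Ck1_add) auto
 moreover have "((%t. f t * g t) has_real_derivative f' t * g t + g' t * f t) (at t)" for t using d by (intro DERIV_mult) auto
 ultimately show ?case by (auto intro!: exI[of _ "%t. f' t * g t + g' t * f t"])
qed (auto intro: continuous_intros)

lemma Ck1_affine: "Ck1 k f ==> Ck1 k (%t. f (c * t + d))"
proof (induction k arbitrary: f)
 case 0
 thus ?case by (auto intro!: continuous_on_compose2[of UNIV f] continuous_intros)
next
 case (Suc k)
 then obtain f' where d: "\<forall>t. (f has_real_derivative f' t) (at t)" "Ck1 k f'" by auto
 have "Ck1 k (%t. f' (c * t + d) * c)"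
 proof (rule Ck1_mult[OF Suc.IH[OF d(2)]])
  show "Ck1 k (%t. c)" by (induction k arbitrary: c) (auto intro!: exI[of _ "%t. 0"])
 qed
 moreover have "((%t. f (c * t + d)) has_real_derivative f' (c * t + d) * c) (at t)" for t
  using d by (intro DERIV_chain2[of f]) (auto intro!: derivative_eq_intros)
 ultimately show ?case by (auto intro!: exI[of _ "%t. f' (c * t + d) * c"])
qed

lemma poly_exp_tendsto: "((%s. poly p s * s ^ k * exp (- s)) \<longlongrightarrow> (0::real)) at_top"
proof (induction p arbitrary: k)
 case (pCons a p)
 have "((%s. a * (s ^ k / exp s) + poly p s * s ^ Suc k * exp (- s)) \<longlongrightarrow> a * 0 + 0) at_top"
  by (intro tendsto_add tendsto_mult tendsto_const tendsto_power_div_exp_0 pCons.IH)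
 thus ?case by (simp add: algebra_simps exp_minus inverse_eq_divide)
qed simp

text \<open>The class of functions \<open>p (1/t) exp (- 1/t)\<close> is closed under differentiation.\<close>

definition flat :: "real poly => real => real" where "flat p t = (if 0 < t then poly p (1 / t) * exp (- (1 / t)) else 0)"

text \<open>For t > 0 the chain rule contributes 1 / t^2, which is the polynomial
  \<open>[:0, 0, 1:]\<close> in 1 / t. At 0 the right difference quotient is again a polynomial in 1
  / t times exp (- 1 / t) and tends to 0.\<close>

lemma flat_derivative: "(flat p has_real_derivative flat ([:0, 0, 1:] * (p - pderiv p)) t) (at t)"
proof -
 consider "0 < t" | "t < 0" | "t = 0" by linarith
 thus ?thesis
 proof cases
  case 1
  have "((%t. poly p (1 / t) * exp (- (1 / t))) has_real_derivative flat ([:0, 0, 1:] * (p - pderiv p)) t) (at t)"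
   using 1 by (auto intro!: derivative_eq_intros DERIV_chain2[OF poly_DERIV] simp: flat_def field_simps power2_eq_square)
  thus ?thesis by (rule has_field_derivative_transform_within[of _ _ _ _ t]) (use 1 in \<open>auto simp: flat_def dist_real_def\<close>)
 next
  case 2
  have "((%t. 0) has_real_derivative 0) (at t)" by simp
  hence "(flat p has_real_derivative 0) (at t)"
   by (rule has_field_derivative_transform_within[of _ _ _ _ "- t"]) (use 2 in \<open>auto simp: flat_def dist_real_def\<close>)
  thus ?thesis using 2 by (simp add: flat_def)
 next
  case 3
  have "((%h. (flat p (0 + h) - flat p 0) / h) \<longlongrightarrow> 0) (at 0)"
  proof (rule filterlim_split_at)
   have "\<forall>\<^sub>F h in at_left 0. (0::real) = (flat p (0 + h) - flat p 0) / h"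
    unfolding eventually_at_left_field by (auto intro!: exI[of _ "-1"] simp: flat_def)
   thus "((%h. (flat p (0 + h) - flat p 0) / h) \<longlongrightarrow> 0) (at_left 0)" by (rule Lim_transform_eventually[OF tendsto_const])
   have "((%h. poly p (inverse h) * inverse h ^ 1 * exp (- inverse h)) \<longlongrightarrow> 0) (at_right 0)"
    by (rule filterlim_compose[OF poly_exp_tendsto filterlim_inverse_at_top_right])
   moreover have "\<forall>\<^sub>F h in at_right 0. poly p (inverse h) * inverse h ^ 1 * exp (- inverse h) = (flat p (0 + h) - flat p 0) / h"
    unfolding eventually_at_right_field by (auto intro!: exI[of _ 1] simp: flat_def field_simps)
   ultimately show "((%h. (flat p (0 + h) - flat p 0) / h) \<longlongrightarrow> 0) (at_right 0)" by (rule Lim_transform_eventually)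
  qed
  thus ?thesis using 3 by (simp add: DERIV_def flat_def)
 qed
qed

lemma Ck1_flat: "Ck1 k (flat p)"
proof (induction k arbitrary: p)
 case 0
 show ?case using DERIV_isCont[OF flat_derivative] by (auto intro!: continuous_at_imp_continuous_on)
qed (auto intro: flat_derivative)

text \<open>Positive exactly on (a, b). The factor m + 1 pushes the arguments of both factors to
  infinity inside the interval, where exp (- 1 / t) tends to 1, so the indicator of (a, b) is the
  pointwise limit.\<close>

definition bump1 :: "nat => real => real => real => real" where
 "bump1 m a b t = flat 1 (real (Suc m) * t + (- real (Suc m) * a)) * flat 1 ((- real (Suc m)) * t + real (Suc m) * b)"

lemma Ck1_bump1: "Ck1 k (bump1 m a b)" unfolding bump1_def[abs_def] by (intro Ck1_mult Ck1_affine Ck1_flat)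

lemma flat_1: "0 <= flat 1 t" "flat 1 t <= 1" by (auto simp: flat_def)

lemma bump1_bounds: "0 <= bump1 m a b t" "bump1 m a b t <= 1" unfolding bump1_def using flat_1 by (auto intro: mult_le_one)

lemma bump1_outside: "t \<notin> {a<..<b} ==> bump1 m a b t = 0" using mult_left_mono[of t a "real (Suc m)"] mult_left_mono[of b t "real (Suc m)"]
 by (auto simp: bump1_def flat_def not_less simp del: of_nat_Suc)

lemma bump1_tendsto: "(%m. bump1 m a b t) ----> ind {a<..<b} t"
proof (cases "t \<in> {a<..<b}")
 case True
 have E: "(%m. flat 1 (real (Suc m) * d)) ----> 1" if d: "0 < d" for d
 proof -
  have "(%m. exp (- (1 / (real (Suc m) * d)))) ----> 1" using d by real_asymp
  thus ?thesis using d by (simp add: flat_def del: of_nat_Suc)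
 qed
 have "(%m. flat 1 (real (Suc m) * (t - a)) * flat 1 (real (Suc m) * (b - t))) ----> 1 * 1" using True by (intro tendsto_mult E) auto
 thus ?thesis using True by (simp add: bump1_def algebra_simps del: of_nat_Suc)
qed (simp add: bump1_outside)

lemma partial_deriv_eq: "(ph has_derivative D) (at x) ==> partial_deriv i ph x = D (axis i 1)"
 unfolding partial_deriv_def using frechet_derivative_at by fastforce

text \<open>Partial derivatives of a product of one-variable functions are again such products, so
  the induction closes.\<close>

lemma Ck_product: "Ck1 k f ==> Ck1 k g ==> Ck_function k (%x. f (x $ 1) * g (x $ 2))"
proof (induction k arbitrary: f g)
 case 0
 thus ?case by (auto intro!: continuous_on_mult continuous_on_compose2[of UNIV f] continuous_on_compose2[of UNIV g] continuous_intros)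
next
 case (Suc k)
 then obtain f' g' where d: "!!t. (f has_real_derivative f' t) (at t)" "Ck1 k f'" "!!t. (g has_real_derivative g' t) (at t)" "Ck1 k g'" by auto
 have D: "((%x. f (x $ 1) * g (x $ 2)) has_derivative (%h. f (x $ 1) * (g' (x $ 2) * h $ 2) + f' (x $ 1) * h $ 1 * g (x $ 2))) (at x)" for x :: "real^2"
 proof (rule has_derivative_mult)
  have c: "((%x. x $ i) has_derivative (%h. h $ i)) (at x)" for i and x :: "real^2"
   by (rule bounded_linear_imp_has_derivative[OF bounded_linear_vec_nth])
  show "((%x. f (x $ 1)) has_derivative (%h. f' (x $ 1) * h $ 1)) (at x)" using has_derivative_compose[OF c d(1)[unfolded has_field_derivative_def]] .
  show "((%x. g (x $ 2)) has_derivative (%h. g' (x $ 2) * h $ 2)) (at x)" using has_derivative_compose[OF c d(3)[unfolded has_field_derivative_def]] .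
 qed
 have 1: "partial_deriv 1 (%x. f (x $ 1) * g (x $ 2)) = (%x. f' (x $ 1) * g (x $ 2))"
  and 2: "partial_deriv 2 (%x. f (x $ 1) * g (x $ 2)) = (%x. f (x $ 1) * g' (x $ 2))" by (auto simp: partial_deriv_eq[OF D] axis_def)
 have "Ck_function k (partial_deriv i (%x. f (x $ 1) * g (x $ 2)))" for i
  using exhaust_2[of i] 1 2 Suc.IH[OF d(2) Ck1_Suc[OF Suc.prems(2)]] Suc.IH[OF Ck1_Suc[OF Suc.prems(1)] d(4)] by auto
 thus ?case using D by (auto simp: differentiable_def)
qed

definition box2 :: "real => real => real => real => (real^2) set" where "box2 a b c d = {x. a < x $ 1 & x $ 1 < b & c < x $ 2 & x $ 2 < d}"

definition bump :: "nat => real => real => real => real => real^2 => real" where "bump m a b c d x = bump1 m a b (x $ 1) * bump1 m c d (x $ 2)"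

lemma box_box2: "box u v = box2 (u $ 1) (v $ 1) (u $ 2) (v $ 2)" by (auto simp: box2_def mem_box_cart forall_2)

lemma compact_cbox2: "compact {x::real^2. a <= x $ 1 & x $ 1 <= b & c <= x $ 2 & x $ 2 <= d}"
proof -
 have "{x::real^2. a <= x $ 1 & x $ 1 <= b & c <= x $ 2 & x $ 2 <= d} = cbox (vector [a, c]) (vector [b, d])" by (auto simp: mem_box_cart forall_2)
 thus ?thesis by simp
qed

lemma test_bump: assumes "0 < a" "0 < c" shows "test_function open_quadrant (bump m a b c d)" unfolding test_function_def
proof (intro conjI allI exI)
 show "Ck_function k (bump m a b c d)" for k unfolding bump_def[abs_def] by (intro Ck_product Ck1_bump1)
 show "compact {x::real^2. a <= x $ 1 & x $ 1 <= b & c <= x $ 2 & x $ 2 <= d}" by (rule compact_cbox2)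
 show "{x. a <= x $ 1 & x $ 1 <= b & c <= x $ 2 & x $ 2 <= d} \<subseteq> open_quadrant" using assms by (auto simp: open_quadrant_def)
 show "x \<notin> {x. a <= x $ 1 & x $ 1 <= b & c <= x $ 2 & x $ 2 <= d} --> bump m a b c d x = 0" for x
  using bump1_outside[of "x $ 1" a b m] bump1_outside[of "x $ 2" c d m] by (auto simp: bump_def)
qed

lemma bump_bounds: "0 <= bump m a b c d x" "bump m a b c d x <= ind (box2 a b c d) x"
proof -
 show "0 <= bump m a b c d x" by (simp add: bump_def bump1_bounds)
 show "bump m a b c d x <= ind (box2 a b c d) x" using bump1_outside[of "x $ 1" a b m] bump1_outside[of "x $ 2" c d m]
  by (auto simp: bump_def box2_def indicator_def bump1_bounds intro!: mult_le_one)
qed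

lemma bump_tendsto: "(%m. bump m a b c d x) ----> ind (box2 a b c d) x"
proof -
 have "(%m. bump m a b c d x) ----> ind {a<..<b} (x $ 1) * ind {c<..<d} (x $ 2)" unfolding bump_def by (intro tendsto_mult bump1_tendsto)
 also have "ind {a<..<b} (x $ 1) * ind {c<..<d} (x $ 2) = (ind (box2 a b c d) x :: real)" by (auto simp: indicator_def box2_def)
 finally show ?thesis .
qed

lemma box2_measurable [measurable]: "box2 a b c d \<in> sets borel"
proof -
 have "box2 a b c d = box (vector [a, c]) (vector [b, d])" by (simp add: box_box2)
 thus ?thesis by simp
qed

section \<open>Signed Radon measures on the open quadrant are determined by test functions\<close>

abbreviation "oq == open_quadrant"
abbreviation "radon == radon_measure_on oq"

lemma compact_in_box2:
 assumes K: "compact K" "K \<subseteq> oq"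
 obtains n where "K \<subseteq> box2 (1 / real (Suc n)) (real (Suc n)) (1 / real (Suc n)) (real (Suc n))"
proof -
 let ?B = "%n. box2 (1 / real (Suc n)) (real (Suc n)) (1 / real (Suc n)) (real (Suc n))"
 have op: "open (?B n)" for n
 proof -
  have eq: "?B n = box (vector [1 / real (Suc n), 1 / real (Suc n)]) (vector [real (Suc n), real (Suc n)])" by (simp add: box_box2)
  show ?thesis unfolding eq by (rule open_box)
 qed
 have mono: "?B m \<subseteq> ?B n" if "m <= n" for m n
 proof -
  have "1 / real (Suc n) <= 1 / real (Suc m)" "real (Suc m) <= real (Suc n)" using that by (auto intro!: divide_left_mono)
  thus ?thesis by (auto simp: box2_def simp del: of_nat_Suc)
 qed
 have cov: "K \<subseteq> (\<Union>n. ?B n)"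
 proof
  fix x assume "x \<in> K"
  hence x: "0 < x $ 1" "0 < x $ 2" using K by (auto simp: open_quadrant_def)
  obtain n1 where n1: "1 / real (Suc n1) < min (x $ 1) (x $ 2)" using reals_Archimedean[of "min (x $ 1) (x $ 2)"] x by (auto simp: inverse_eq_divide)
  obtain n2 where n2: "max (x $ 1) (x $ 2) < real n2" using reals_Archimedean2 by blast
  define n where "n = n1 + n2"
  have "1 / real (Suc n) <= 1 / real (Suc n1)" "real n2 <= real (Suc n)" by (auto simp: n_def intro!: divide_left_mono)
  hence "1 / real (Suc n) < x $ 1" "x $ 1 < real (Suc n)" "1 / real (Suc n) < x $ 2" "x $ 2 < real (Suc n)"
   using n1 n2 by (simp_all only: min_less_iff_conj max_less_iff_conj) linarith+
  hence "x \<in> ?B n" by (simp add: box2_def)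
  thus "x \<in> (\<Union>n. ?B n)" by blast
 qed
 obtain C where "C \<subseteq> UNIV" and C: "finite C" "K \<subseteq> (\<Union>n\<in>C. ?B n)" by (rule compactE_image[OF K(1) op cov])
 have "(\<Union>n\<in>C. ?B n) \<subseteq> ?B (Max (insert 0 C))"  using C(1) by (intro UN_least mono Max_ge) auto
 with C(2) show thesis by (rule that[OF subset_trans])
qed

text \<open>One class for test functions, for indicators of relatively compact Borel sets, and for
  products of these with coefficients. Every Radon measure on the open quadrant integrates
  it.\<close>

definition cs :: "(real^2 => real) => bool" where
 "cs g \<longleftrightarrow> g \<in> bm borel & (\<exists>B. \<forall>x. \<bar>g x\<bar> <= B) & (\<exists>K. compact K & K \<subseteq> oq & (\<forall>x. x \<notin> K --> g x = 0))"

lemma cs_measurable: "cs g ==> g \<in> bm borel" by (simp add: cs_def)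

lemma cs_integrable:
 assumes P: "radon P" and g: "cs g" shows "integrable P g"
proof -
 obtain B K where B: "!!x. \<bar>g x\<bar> <= B" and K: "compact K" "K \<subseteq> oq" "!!x. x \<notin> K ==> g x = 0" using g by (auto simp: cs_def)
 have s: "sets P = sets borel" using P by (simp add: radon_measure_on_def)
 have Ks: "K \<in> sets P" using K(1) s by (simp add: borel_compact)
 have "integrable P (%x. B * ind K x)" using P K by (intro integrable_mult_right integrable_real_indicator Ks) (auto simp: radon_measure_on_def)
 thus ?thesis
 proof (rule Bochner_Integration.integrable_bound)
  show "g \<in> bm P" using g by (simp add: cs_def measurable_cong_sets[OF s refl])
  show "AE x in P. norm (g x) <= norm (B * ind K x)"
  proof (rule AE_I2)
   fix x show "norm (g x) <= norm (B * ind K x)" using B[of x] K(3)[of x] by (cases "x \<in> K") auto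
  qed
 qed
qed

lemma cs_indicator: "A \<in> relatively_compact_borel oq ==> cs (ind A)" by (fastforce simp: cs_def relatively_compact_borel_def indicator_def)

lemma signed_value_integral:
 assumes "signed_radon_on oq S" "A \<in> relatively_compact_borel oq" shows "signed_integral S (ind A) = signed_value S A"
proof -
 have "A \<in> sets (fst S)" "A \<in> sets (snd S)" using assms by (auto simp: signed_radon_on_def radon_measure_on_def relatively_compact_borel_def)
 thus ?thesis by (simp add: signed_integral_def signed_value_def)
qed

lemma integral_msum:
 fixes g :: "'a => real"
 assumes s: "sets N = sets P" and i: "integrable P g" "integrable N g"
 shows "integrable (msum P N) g" "(\<integral>x. g x \<partial>msum P N) = (LINT x|P. g x) + (LINT x|N. g x)"
proof -
 have m: "g \<in> bm P" using i(1) by auto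
 have fin: "(\<integral>\<^sup>+x. ennreal (g x) \<partial>P) < \<top>" "(\<integral>\<^sup>+x. ennreal (- g x) \<partial>P) < \<top>" "(\<integral>\<^sup>+x. ennreal (g x) \<partial>N) < \<top>" "(\<integral>\<^sup>+x. ennreal (- g x) \<partial>N) < \<top>"
  using i unfolding real_integrable_def by (auto simp: less_top)
 have n: "(\<integral>\<^sup>+x. ennreal (g x) \<partial>msum P N) = (\<integral>\<^sup>+x. ennreal (g x) \<partial>P) + (\<integral>\<^sup>+x. ennreal (g x) \<partial>N)"
  "(\<integral>\<^sup>+x. ennreal (- g x) \<partial>msum P N) = (\<integral>\<^sup>+x. ennreal (- g x) \<partial>P) + (\<integral>\<^sup>+x. ennreal (- g x) \<partial>N)"
  using m by (intro nn_integral_msum s; simp)+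
 show int: "integrable (msum P N) g" unfolding real_integrable_def n using fin m by (auto simp: measurable_cong_sets[OF sets_msum refl] less_top)
 show "(\<integral>x. g x \<partial>msum P N) = (LINT x|P. g x) + (LINT x|N. g x)"
  unfolding real_lebesgue_integral_def[OF int] real_lebesgue_integral_def[OF i(1)] real_lebesgue_integral_def[OF i(2)] n
   enn2real_plus[OF fin(1,3)] enn2real_plus[OF fin(2,4)] by simp
qed

lemma bump_integral_tendsto:
 assumes P: "radon P" and ac: "0 < a" "0 < c"
 shows "(%m. LINT x|P. bump m a b c d x) ----> measure P (box2 a b c d)" "emeasure P (box2 a b c d) < \<infinity>"
proof -
 have s: "sets P = sets borel" using P by (simp add: radon_measure_on_def)
 have B: "box2 a b c d \<in> relatively_compact_borel oq" unfolding relatively_compact_borel_def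
  by (intro CollectI conjI exI[of _ "{x::real^2. a <= x $ 1 & x $ 1 <= b & c <= x $ 2 & x $ 2 <= d}"] compact_cbox2 box2_measurable)
   (use ac in \<open>auto simp: box2_def open_quadrant_def\<close>)
 have i: "integrable P (ind (box2 a b c d) :: _ => real)" by (rule cs_integrable[OF P cs_indicator[OF B]])
 thus "emeasure P (box2 a b c d) < \<infinity>" by (simp add: integrable_indicator_iff s)
 have "continuous_on UNIV (bump m a b c d)" for m using test_bump[OF ac, of m b d] by (auto simp: test_function_def dest: spec[of _ 0])
 hence m: "bump m a b c d \<in> bm P" for m unfolding measurable_cong_sets[OF s refl] by (rule borel_measurable_continuous_onI)
 have "(%m. LINT x|P. bump m a b c d x) ----> (LINT x|P. ind (box2 a b c d) x)"
 proof (rule integral_dominated_convergence[where w="ind (box2 a b c d)"])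
  show "AE x in P. norm (bump m a b c d x) <= ind (box2 a b c d) x" for m using bump_bounds by (intro AE_I2) simp
 qed (use i m bump_tendsto in auto)
 thus "(%m. LINT x|P. bump m a b c d x) ----> measure P (box2 a b c d)" using s by simp
qed

text \<open>Rearranged as P1 + N2 = P2 + N1 the claim avoids differences of infinite masses. Bumps
  give the equality on open boxes; restricted to one box around the support of \<open>g\<close>,
  both sides are finite, and boxes form a generator stable under intersection.\<close>

theorem signed_measure_unique:
 assumes S: "signed_radon_on oq S" "signed_radon_on oq S'"
  and eq: "!!ph. test_function oq ph ==> signed_integral S ph = signed_integral S' ph" and g: "cs g"
 shows "signed_integral S g = signed_integral S' g"
proof -
 obtain P1 N1 P2 N2 where SS: "S = (P1, N1)" "S' = (P2, N2)" by (meson surj_pair)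
 have R: "radon P1" "radon N1" "radon P2" "radon N2" using S by (auto simp: SS signed_radon_on_def)
 have s: "sets P1 = sets borel" "sets N1 = sets borel" "sets P2 = sets borel" "sets N2 = sets borel" using R by (auto simp: radon_measure_on_def)
 have box: "emeasure (msum P1 N2) (box2 a b c d) = emeasure (msum P2 N1) (box2 a b c d) & emeasure (msum P1 N2) (box2 a b c d) < \<infinity>"
  if ac: "0 < a" "0 < c" for a b c d
 proof -
  note l = bump_integral_tendsto(1)[OF _ ac, of _ b d] and fin = bump_integral_tendsto(2)[OF _ ac, of _ b d]
  have "(%m. signed_integral S (bump m a b c d)) ----> measure P1 (box2 a b c d) - measure N1 (box2 a b c d)"
   unfolding SS signed_integral_def fst_conv snd_conv by (intro tendsto_diff l R)
  moreover have "(%m. signed_integral S' (bump m a b c d)) ----> measure P2 (box2 a b c d) - measure N2 (box2 a b c d)"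
   unfolding SS signed_integral_def fst_conv snd_conv by (intro tendsto_diff l R)
  ultimately have "measure P1 (box2 a b c d) - measure N1 (box2 a b c d) = measure P2 (box2 a b c d) - measure N2 (box2 a b c d)"
   using eq[OF test_bump[OF ac]] LIMSEQ_unique by simp
  hence "ennreal (measure P1 (box2 a b c d) + measure N2 (box2 a b c d)) = ennreal (measure P2 (box2 a b c d) + measure N1 (box2 a b c d))"
   by (intro arg_cong[where f=ennreal]) linarith
  moreover have "emeasure P (box2 a b c d) = ennreal (measure P (box2 a b c d))" if "radon P" for P
   using fin[OF that] by (intro emeasure_eq_ennreal_measure) simp
  ultimately show ?thesis using R s by (simp add: emeasure_msum)
 qed
 obtain B K where K: "compact K" "K \<subseteq> oq" "!!x. x \<notin> K ==> g x = 0" using g by (auto simp: cs_def)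
 obtain n where n: "K \<subseteq> box2 (1 / real (Suc n)) (real (Suc n)) (1 / real (Suc n)) (real (Suc n))" by (rule compact_in_box2[OF K(1,2)])
 define Vn where "Vn = box2 (1 / real (Suc n)) (real (Suc n)) (1 / real (Suc n)) (real (Suc n))"
 have inter: "emeasure (density (msum P1 N2) (ind Vn)) (box u v) = emeasure (msum P1 N2) (box2 (max (1 / real (Suc n)) (u $ 1)) (min (real (Suc n)) (v $ 1)) (max (1 / real (Suc n)) (u $ 2)) (min (real (Suc n)) (v $ 2)))"
  "emeasure (density (msum P2 N1) (ind Vn)) (box u v) = emeasure (msum P2 N1) (box2 (max (1 / real (Suc n)) (u $ 1)) (min (real (Suc n)) (v $ 1)) (max (1 / real (Suc n)) (u $ 2)) (min (real (Suc n)) (v $ 2)))" for u v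
 proof -
  have i: "Vn \<inter> box u v = box2 (max (1 / real (Suc n)) (u $ 1)) (min (real (Suc n)) (v $ 1)) (max (1 / real (Suc n)) (u $ 2)) (min (real (Suc n)) (v $ 2))"
   by (auto simp: Vn_def box_box2 box2_def simp del: of_nat_Suc)
  have m: "Vn \<in> sets borel" unfolding Vn_def by simp
  show "emeasure (density (msum P1 N2) (ind Vn)) (box u v) = emeasure (msum P1 N2) (box2 (max (1 / real (Suc n)) (u $ 1)) (min (real (Suc n)) (v $ 1)) (max (1 / real (Suc n)) (u $ 2)) (min (real (Suc n)) (v $ 2)))"
   "emeasure (density (msum P2 N1) (ind Vn)) (box u v) = emeasure (msum P2 N1) (box2 (max (1 / real (Suc n)) (u $ 1)) (min (real (Suc n)) (v $ 1)) (max (1 / real (Suc n)) (u $ 2)) (min (real (Suc n)) (v $ 2)))"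
   unfolding i[symmetric] using s m by (simp_all add: emeasure_density measurable_cong_sets[OF sets_msum refl] indicator_inter_arith[symmetric])
 qed
 have D: "density (msum P1 N2) (ind Vn) = density (msum P2 N1) (ind Vn)"
 proof (rule measure_eqI_generator_eq[where \<Omega>=UNIV and E="range (%(a, b). box a b)" and A="%i::nat. box (- (real i *\<^sub>R One)) (real i *\<^sub>R One)"])
  show "Int_stable (range (%(a, b). box a b :: (real^2) set))" by (force simp: Int_stable_def box_Int_box)
  show "sets (density (msum P1 N2) (ind Vn)) = sigma_sets UNIV (range (%(a, b). box a b))"
   "sets (density (msum P2 N1) (ind Vn)) = sigma_sets UNIV (range (%(a, b). box a b))" using s by (simp_all add: borel_eq_box)
  show "(\<Union>i::nat. box (- (real i *\<^sub>R One)) (real i *\<^sub>R One)) = (UNIV :: (real^2) set)" by (rule UN_box_eq_UNIV)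
  have pos: "0 < max (1 / real (Suc n)) z" for z by (simp add: less_max_iff_disj)
  show "emeasure (density (msum P1 N2) (ind Vn)) X = emeasure (density (msum P2 N1) (ind Vn)) X" if "X \<in> range (%(a, b). box a b)" for X
  proof -
   from that obtain u v where X: "X = box u v" by auto
   show ?thesis unfolding X inter by (rule box[OF pos pos, THEN conjunct1])
  qed
  show "emeasure (density (msum P1 N2) (ind Vn)) (box (- (real i *\<^sub>R One)) (real i *\<^sub>R One)) ~= \<infinity>" for i :: nat
   unfolding inter by (rule less_imp_neq[OF box[OF pos pos, THEN conjunct2]])
 qed auto
 have gU: "ind Vn x *\<^sub>R g x = g x" for x using n K(3)[of x] by (auto simp: indicator_def Vn_def)
 have dens: "(\<integral>x. g x \<partial>density P (ind Vn)) = (LINT x|P. g x)" if "sets P = sets borel" for P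
 proof -
  have "(\<integral>x. g x \<partial>density P (%x. ennreal (ind Vn x))) = (LINT x|P. ind Vn x *\<^sub>R g x)"
   using that cs_measurable[OF g] unfolding Vn_def by (intro integral_density) (auto simp: measurable_cong_sets[OF that refl])
  thus ?thesis by (simp only: gU ennreal_indicator)
 qed
 have "(\<integral>x. g x \<partial>msum P1 N2) = (\<integral>x. g x \<partial>msum P2 N1)" using D dens[of "msum P1 N2"] dens[of "msum P2 N1"] s by simp
 hence "(LINT x|P1. g x) + (LINT x|N2. g x) = (LINT x|P2. g x) + (LINT x|N1. g x)" using R s g by (simp add: integral_msum cs_integrable)
 thus ?thesis by (simp add: SS signed_integral_def)
qed

section \<open>Integration by parts on the line and on coordinate sections\<close>

lemma derivative_outside_support:
 fixes ps ps' :: "real => real"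
 assumes d: "!!t. (ps has_real_derivative ps' t) (at t)" and R: "!!t. R < \<bar>t\<bar> ==> ps t = 0" and t: "R < \<bar>t\<bar>"
 shows "ps' t = 0"
proof -
 have "open {t. R < \<bar>t\<bar>}" by (intro open_Collect_less continuous_intros)
 hence "((%t. 0) has_real_derivative ps' t) (at t)" by (rule has_field_derivative_transform_within_open[OF d]) (use R t in auto)
 thus ?thesis using DERIV_unique[OF _ DERIV_const] by blast
qed

lemma compact_support_FTC:
 fixes ps ps' :: "real => real"
 assumes d: "!!t. (ps has_real_derivative ps' t) (at t)" and c: "continuous_on UNIV ps'" and R: "!!t. R < \<bar>t\<bar> ==> ps t = 0"
 shows "integrable lborel (%t. ind {k<..} t * ps' t)" "(LINT t|lborel. ind {k<..} t * ps' t) = - ps k"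
proof -
 define b where "b = max k R + 1"
 have kb: "k <= b" "R < b" by (auto simp: b_def)
 have z: "ps' t = 0" if "R < \<bar>t\<bar>" for t by (rule derivative_outside_support[OF d _ that]) (rule R)
 have [measurable]: "ps' \<in> bm borel" by (rule borel_measurable_continuous_onI[OF c])
 have eq: "AE t in lborel. ind {k..b} t *\<^sub>R ps' t = ind {k<..} t * ps' t"
 proof -
  have "AE t in lborel. t ~= k" using AE_lborel_singleton[of k] by simp
  thus ?thesis by eventually_elim (use z kb in \<open>auto simp: indicator_def\<close>)
 qed
 have I: "has_bochner_integral lborel (%t. ind {k..b} t *\<^sub>R ps' t) (ps b - ps k)" by (rule has_bochner_integral_FTC_Icc[OF kb(1)])
   (auto intro: DERIV_subset[OF d] has_vector_derivative_at_within continuous_on_subset[OF c] simp: has_real_derivative_iff_has_vector_derivative[symmetric])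
 have m: "(%t. ind {k<..} t * ps' t) \<in> bm lborel" by measurable
 have "has_bochner_integral lborel (%t. ind {k<..} t * ps' t) (ps b - ps k)"
  using I has_bochner_integral_cong_AE[OF _ m eq] by (auto simp: has_bochner_integral_iff dest: borel_measurable_integrable)
 moreover have "ps b = 0" using kb by (intro R) auto
 ultimately show "integrable lborel (%t. ind {k<..} t * ps' t)" "(LINT t|lborel. ind {k<..} t * ps' t) = - ps k"
  by (simp_all add: has_bochner_integral_iff)
qed

text \<open>For the second identity write the maximum as k plus the positive part of t - k. The
  constant integrates to 0 against \<open>ps'\<close>, and the product (t - k) ps has no boundary
  term at k.\<close>

lemma compact_support_parts:
 fixes ps ps' :: "real => real"
 assumes d: "!!t. (ps has_real_derivative ps' t) (at t)" and c: "continuous_on UNIV ps'" and R: "!!t. R < \<bar>t\<bar> ==> ps t = 0"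
 shows "(LINT t|lborel. ind {..<k} t * ps' t) = ps k"
  and "(LINT t|lborel. max t k * ps' t) = - (LINT t|lborel. ind {k<..} t * ps t)"
proof -
 have F: "integrable lborel (%t. ind {k<..} t * ps' t)" "(LINT t|lborel. ind {k<..} t * ps' t) = - ps k" for k
  using compact_support_FTC[OF d c, of R k] R by blast+
 have [measurable]: "ps' \<in> bm borel" by (rule borel_measurable_continuous_onI[OF c])
 \<comment> \<open>A point to the left of both k and the support, from which the half-line integral
   of the derivative is the full integral.\<close>
 define k0 where "k0 = - max \<bar>k\<bar> R - 1"
 have k0: "R < \<bar>k0\<bar>" "k0 < k" by (auto simp: k0_def)
 have z: "ind {k0<..} t * ps' t = ps' t" for t
 proof (cases "k0 < t")
  case False
  hence "R < \<bar>t\<bar>" by (auto simp: k0_def)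
  have "ps' t = 0" by (rule derivative_outside_support[OF d _ \<open>R < \<bar>t\<bar>\<close>]) (rule R)
  thus ?thesis by simp
 qed simp
 have i: "integrable lborel ps'" "(LINT t|lborel. ps' t) = 0" using F[of k0] R[OF k0(1)] by (simp_all add: z)
 have "(LINT t|lborel. ind {..<k} t * ps' t) = (LINT t|lborel. ps' t - ind {k<..} t * ps' t)"
 proof (rule integral_cong_AE)
  have "AE t in lborel. t ~= k" using AE_lborel_singleton[of k] by simp
  thus "AE t in lborel. ind {..<k} t * ps' t = ps' t - ind {k<..} t * ps' t" by eventually_elim (auto simp: indicator_def)
 qed simp_all
 thus "(LINT t|lborel. ind {..<k} t * ps' t) = ps k" using i F[of k] by simp
 have cpsi: "continuous_on UNIV ps" using DERIV_isCont[OF d] by (auto intro: continuous_at_imp_continuous_on)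
 have [measurable]: "ps \<in> bm borel" by (rule borel_measurable_continuous_onI[OF cpsi])
 have G: "integrable lborel (%t. ind {k<..} t * (ps t + (t - k) * ps' t))"
  "(LINT t|lborel. ind {k<..} t * (ps t + (t - k) * ps' t)) = - ((k - k) * ps k)"
 proof (rule_tac [!] compact_support_FTC[where ps="%t. (t - k) * ps t" and R=R])
  show "((%t. (t - k) * ps t) has_real_derivative ps t + (t - k) * ps' t) (at t)"
   "((%t. (t - k) * ps t) has_real_derivative ps t + (t - k) * ps' t) (at t)" for t by (auto intro!: derivative_eq_intros d)
  show "continuous_on UNIV (%t. ps t + (t - k) * ps' t)" "continuous_on UNIV (%t. ps t + (t - k) * ps' t)" by (intro continuous_intros c cpsi)+
 qed (use R in auto)
 have p: "integrable lborel (%t. ind {k<..} t * ps t)"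
 proof -
  have "integrable lborel (%t. ind {-\<bar>R\<bar>..\<bar>R\<bar>} t *\<^sub>R ps t)"
   using borel_integrable_compact[OF compact_Icc continuous_on_subset[OF cpsi], of "-\<bar>R\<bar>" "\<bar>R\<bar>"] by (simp add: indicator_def of_bool_def if_distrib cong: if_cong)
  thus ?thesis
  proof (rule Bochner_Integration.integrable_bound)
   show "AE t in lborel. norm (ind {k<..} t * ps t) <= norm (ind {-\<bar>R\<bar>..\<bar>R\<bar>} t *\<^sub>R ps t)"
   proof (rule AE_I2)
    fix t show "norm (ind {k<..} t * ps t) <= norm (ind {-\<bar>R\<bar>..\<bar>R\<bar>} t *\<^sub>R ps t)"
     using R[of t] by (cases "\<bar>t\<bar> <= \<bar>R\<bar>") (auto simp: indicator_def)
   qed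
  qed simp
 qed
 have "(LINT t|lborel. max t k * ps' t) = (LINT t|lborel. k * ps' t + (ind {k<..} t * (ps t + (t - k) * ps' t) - ind {k<..} t * ps t))"
  by (intro Bochner_Integration.integral_cong) (auto simp: indicator_def max_def algebra_simps)
 also have "... = - (LINT t|lborel. ind {k<..} t * ps t)" using i G p by (simp add: integral_add integral_diff)
 finally show "(LINT t|lborel. max t k * ps' t) = - (LINT t|lborel. ind {k<..} t * ps t)" .
qed

lemma lborel2_fubini:
 fixes f :: "real^2 => real"
 assumes "integrable lborel f"
 shows "(LINT x|lborel. f x) = (LINT y|lborel. LINT t|lborel. f (vector [t, y]))"
  and "(LINT x|lborel. f x) = (LINT t|lborel. LINT y|lborel. f (vector [t, y]))"
proof -
 have v: "(%p. vector [fst p, snd p] :: real^2) \<in> measurable (lborel \<Otimes>\<^sub>M lborel) borel"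
  using vector2_measurable by (simp add: measurable_cong_sets[OF sets_pair_measure_cong[OF sets_lborel sets_lborel] refl])
 have f: "f \<in> bm borel" using assms by auto
 have i: "integrable (lborel \<Otimes>\<^sub>M lborel) (%p. f (vector [fst p, snd p]))"
  using assms unfolding lborel_vector2 by (subst (asm) integrable_distr_eq[OF v f])
 have e: "(LINT x|lborel. f x) = (LINT p|(lborel \<Otimes>\<^sub>M lborel). f (vector [fst p, snd p]))"
  unfolding lborel_vector2 by (rule integral_distr[OF v f])
 have i': "integrable (lborel \<Otimes>\<^sub>M lborel) (%(t, y). f (vector [t, y]))" using i by (simp only: case_prod_unfold)
 show "(LINT x|lborel. f x) = (LINT t|lborel. LINT y|lborel. f (vector [t, y]))" unfolding e using lborel_pair.integral_fst'[OF i] by simp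
 show "(LINT x|lborel. f x) = (LINT y|lborel. LINT t|lborel. f (vector [t, y]))"
  unfolding e using lborel_pair.integral_snd[OF i'] by (simp only: case_prod_unfold)
qed

lemma test_continuous: "test_function U ph ==> continuous_on UNIV ph" by (auto simp: test_function_def dest: spec[of _ 0])

lemma test_derivative: "test_function U ph ==> (ph has_derivative frechet_derivative ph (at x)) (at x)"
 unfolding test_function_def by (metis Ck_function.simps(2) frechet_derivative_works)

lemma test_cs:
 assumes "test_function oq ph" shows "cs ph"
proof -
 obtain K where K: "compact K" "K \<subseteq> oq" "!!x. x \<notin> K ==> ph x = 0" using assms by (auto simp: test_function_def)
 note c = test_continuous[OF assms]
 have "bounded (ph ` K)" by (intro compact_imp_bounded compact_continuous_image continuous_on_subset[OF c] K) auto
 then obtain B where B: "!!x. x \<in> K ==> \<bar>ph x\<bar> <= B" by (auto simp: bounded_iff)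
 have "\<bar>ph x\<bar> <= max B 0" for x using B[of x] K(3)[of x] by (cases "x \<in> K") auto
 thus ?thesis using K c by (auto simp: cs_def intro: borel_measurable_continuous_onI)
qed

lemma test_partial:
 assumes ph: "test_function oq ph" shows "test_function oq (partial_deriv i ph)"
proof -
 obtain K where K: "compact K" "K \<subseteq> oq" "!!x. x \<notin> K ==> ph x = 0" using ph by (auto simp: test_function_def)
 have "partial_deriv i ph x = 0" if "x \<notin> K" for x
 proof -
  have "open (- K)" using K(1) by (simp add: compact_imp_closed open_Compl)
  hence "(ph has_derivative (%h. 0)) (at x)" using has_derivative_transform_within_open[OF has_derivative_const, of "- K" x 0 ph] K(3) that by auto
  thus ?thesis by (simp add: partial_deriv_eq)
 qed
 moreover have "Ck_function k (partial_deriv i ph)" for k using ph unfolding test_function_def by (metis Ck_function.simps(2))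
 ultimately show ?thesis using K by (auto simp: test_function_def)
qed

context
 fixes ph :: "real^2 => real" assumes ph: "test_function oq ph"
begin

lemma section_derivative: "((%t. ph (vector [t, y])) has_real_derivative partial_deriv 1 ph (vector [t, y])) (at t)"
 "((%y. ph (vector [t, y])) has_real_derivative partial_deriv 2 ph (vector [t, y])) (at y)"
proof -
 have v: "(vector [t, y] :: real^2) = t *\<^sub>R axis 1 1 + y *\<^sub>R axis 2 1" for t y :: real by (simp add: vec_eq_iff forall_2 axis_def)
 have lin: "frechet_derivative ph (at x) (h *\<^sub>R e) = h * frechet_derivative ph (at x) e" for x h e
  using linear_scale[OF has_derivative_linear[OF test_derivative[OF ph]]] by simp
 have "((%t. t *\<^sub>R axis 1 1 + y *\<^sub>R axis 2 1 :: real^2) has_derivative (%h. h *\<^sub>R axis 1 1)) (at t)"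
  by (auto intro!: derivative_eq_intros)
 from has_derivative_compose[OF this test_derivative[OF ph]]
 show "((%t. ph (vector [t, y])) has_real_derivative partial_deriv 1 ph (vector [t, y])) (at t)"
  unfolding has_field_derivative_def v partial_deriv_def by (simp add: lin mult_commute_abs)
 have "((%y. t *\<^sub>R axis 1 1 + y *\<^sub>R axis 2 1 :: real^2) has_derivative (%h. h *\<^sub>R axis 2 1)) (at y)"
  by (auto intro!: derivative_eq_intros)
 from has_derivative_compose[OF this test_derivative[OF ph]]
 show "((%y. ph (vector [t, y])) has_real_derivative partial_deriv 2 ph (vector [t, y])) (at y)"
  unfolding has_field_derivative_def v partial_deriv_def by (simp add: lin mult_commute_abs)
qed

lemma section_continuous: "continuous_on UNIV (%t. partial_deriv 1 ph (vector [t, y]))" "continuous_on UNIV (%y. partial_deriv 2 ph (vector [t, y]))"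
proof -
 have v: "(vector [t, y] :: real^2) = t *\<^sub>R axis 1 1 + y *\<^sub>R axis 2 1" for t y :: real by (simp add: vec_eq_iff forall_2 axis_def)
 note c = test_continuous[OF test_partial[OF ph]]
 show "continuous_on UNIV (%t. partial_deriv 1 ph (vector [t, y]))" "continuous_on UNIV (%y. partial_deriv 2 ph (vector [t, y]))"
  unfolding v by (intro continuous_on_compose2[OF c] continuous_intros; simp)+
qed

lemma section_support:
 obtains R where "!!t y. R < \<bar>t\<bar> ==> ph (vector [t, y]) = 0" "!!t y. R < \<bar>y\<bar> ==> ph (vector [t, y]) = 0"
proof -
 obtain K where K: "compact K" "!!x. x \<notin> K ==> ph x = 0" using ph by (auto simp: test_function_def)
 obtain R where R: "!!x. x \<in> K ==> norm x <= R" using compact_imp_bounded[OF K(1)] by (auto simp: bounded_iff)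
 have "ph (vector [t, y]) = 0" if "R < \<bar>t\<bar> \<or> R < \<bar>y\<bar>" for t y
 proof (rule K(2), rule notI)
  assume "vector [t, y] \<in> K"
  thus False using R[of "vector [t, y]"] component_le_norm_cart[of "vector [t, y] :: real^2" 1] component_le_norm_cart[of "vector [t, y] :: real^2" 2] that by auto
 qed
 thus thesis by (intro that[of R]) auto
qed

end

section \<open>Measures with locally bounded densities\<close>

abbreviation "LU == density lborel (ind oq :: real^2 => ennreal)"

lemma oq_open: "open oq"
proof -
 have eq: "oq = {x. 0 < x $ 1} \<inter> {x. 0 < x $ 2}" by (auto simp: open_quadrant_def)
 show ?thesis unfolding eq by (intro open_Int open_Collect_less continuous_intros)
qed

lemma oq_measurable [measurable]: "oq \<in> sets borel" by (simp add: oq_open)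

lemma radon_LU: "radon LU" unfolding radon_measure_on_def
proof (intro conjI allI impI)
 show "emeasure LU (- oq) = 0" by (simp add: emeasure_density indicator_inter_arith[symmetric])
 show "emeasure LU K < \<infinity>" if "compact K & K \<subseteq> oq" for K
 proof -
  have "oq \<inter> K \<in> sets lborel" "K \<in> sets lborel" using that by (auto simp: borel_compact)
  hence "emeasure LU K = emeasure lborel (oq \<inter> K)" by (simp add: emeasure_density indicator_inter_arith[symmetric])
  also have "... = emeasure lborel K" using that by (intro arg_cong[where f="emeasure lborel"]) auto
  also have "... < \<infinity>" using that emeasure_compact_finite by auto
  finally show ?thesis .
 qed
qed simp

lemma LU_integral:
 fixes h :: "real^2 => real"
 assumes "h \<in> bm borel" "!!x. x \<notin> oq ==> h x = 0"
 shows "(LINT x|LU. h x) = (LINT x|lborel. h x)" "integrable LU h ==> integrable lborel h"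
proof -
 have d: "LU = density lborel (%x. ennreal (ind oq x))" by (simp only: ennreal_indicator)
 have e: "ind oq x * h x = h x" for x using assms(2)[of x] by (cases "x \<in> oq") auto
 show "(LINT x|LU. h x) = (LINT x|lborel. h x)" unfolding d using assms(1) by (subst integral_density) (auto simp: e)
 show "integrable LU h ==> integrable lborel h" unfolding d using assms(1) by (subst (asm) integrable_density) (auto simp: e)
qed

lemma cs_zero: "cs h ==> x \<notin> oq ==> h x = 0" by (auto simp: cs_def)

lemma cs_LU: assumes "cs h" shows "(LINT x|LU. h x) = (LINT x|lborel. h x)" by (rule LU_integral(1)[OF cs_measurable[OF assms] cs_zero[OF assms]])

lemma cs_lborel: assumes "cs h" shows "integrable lborel h"
 by (rule LU_integral(2)[OF cs_measurable[OF assms] cs_zero[OF assms] cs_integrable[OF radon_LU assms]])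

text \<open>Factors that keep the class \<open>cs\<close> stable. Coefficients enter after
  multiplication by the indicator of the quadrant, since they are unconstrained outside.\<close>

definition lbd :: "(real^2 => real) => bool" where
 "lbd u \<longleftrightarrow> u \<in> bm borel & (\<forall>K. compact K --> K \<subseteq> oq --> (\<exists>C. \<forall>x\<in>K. \<bar>u x\<bar> <= C))"

lemma lbd_measurable: "lbd u ==> u \<in> bm borel" by (simp add: lbd_def)

lemma lbdD: "lbd u ==> compact K ==> K \<subseteq> oq ==> \<exists>C. \<forall>x\<in>K. \<bar>u x\<bar> <= C" by (simp add: lbd_def)

lemma lbd_mult: assumes "lbd u" "lbd v" shows "lbd (%x. u x * v x)" unfolding lbd_def
proof (intro conjI allI impI)
 fix K assume K: "compact K" "K \<subseteq> oq"
 obtain C where C: "!!x. x \<in> K ==> \<bar>u x\<bar> <= C" using lbdD[OF assms(1) K] by blast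
 obtain D where D: "!!x. x \<in> K ==> \<bar>v x\<bar> <= D" using lbdD[OF assms(2) K] by blast
 have "\<bar>u x * v x\<bar> <= \<bar>C\<bar> * \<bar>D\<bar>" if "x \<in> K" for x
  unfolding abs_mult using C[OF that] D[OF that] by (intro mult_mono) auto
 thus "\<exists>C. \<forall>x\<in>K. \<bar>u x * v x\<bar> <= C" by blast
qed (use assms in \<open>auto simp: lbd_def\<close>)

lemma lbd_add: assumes "lbd u" "lbd v" shows "lbd (%x. u x + v x)" unfolding lbd_def
proof (intro conjI allI impI)
 fix K assume K: "compact K" "K \<subseteq> oq"
 obtain C where C: "!!x. x \<in> K ==> \<bar>u x\<bar> <= C" using lbdD[OF assms(1) K] by blast
 obtain D where D: "!!x. x \<in> K ==> \<bar>v x\<bar> <= D" using lbdD[OF assms(2) K] by blast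
 have "\<bar>u x + v x\<bar> <= C + D" if "x \<in> K" for x using C[OF that] D[OF that] by linarith
 thus "\<exists>C. \<forall>x\<in>K. \<bar>u x + v x\<bar> <= C" by blast
qed (use assms in \<open>auto simp: lbd_def\<close>)

lemma lbd_const: "lbd (%_. c)" by (auto simp: lbd_def)
lemma lbd_uminus: "lbd u ==> lbd (%x. - u x)" using lbd_mult[OF lbd_const, of u "-1"] by simp
lemma lbd_indicator: "S \<in> sets borel ==> lbd (ind S)" by (auto simp: lbd_def indicator_def intro!: exI[of _ 1])

lemma lbd_continuous: assumes m: "continuous_on quadrant m" shows "lbd (%x. ind quadrant x * m x)" unfolding lbd_def
proof (intro conjI allI impI)
 have "(%x. ind quadrant x *\<^sub>R m x) \<in> bm borel"
  by (intro borel_measurable_continuous_on_indicator m) (simp add: closed_quadrant borel_closed)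
 thus "(%x. ind quadrant x * m x) \<in> bm borel" by simp
 fix K assume K: "compact K" "K \<subseteq> oq"
 hence Kq: "K \<subseteq> quadrant" by (auto simp: open_quadrant_def quadrant_def)
 have "bounded (m ` K)" by (intro compact_imp_bounded compact_continuous_image continuous_on_subset[OF m Kq] K)
 then obtain C where "!!x. x \<in> K ==> \<bar>m x\<bar> <= C" by (auto simp: bounded_iff)
 thus "\<exists>C. \<forall>x\<in>K. \<bar>ind quadrant x * m x\<bar> <= C" using Kq by (auto simp: indicator_def intro!: exI[of _ C])
qed

lemma lbd_max: assumes "lbd u" shows "lbd (%x. max 0 (u x))" unfolding lbd_def
proof (intro conjI allI impI)
 fix K assume K: "compact K" "K \<subseteq> oq"
 obtain C where C: "!!x. x \<in> K ==> \<bar>u x\<bar> <= C" using lbdD[OF assms K] by blast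
 have "\<bar>max 0 (u x)\<bar> <= C" if "x \<in> K" for x using C[OF that] by linarith
 thus "\<exists>C. \<forall>x\<in>K. \<bar>max 0 (u x)\<bar> <= C" by blast
qed (use assms in \<open>auto simp: lbd_def\<close>)

lemma cs_lbd: assumes g: "cs g" and u: "lbd u" shows "cs (%x. u x * g x)"
proof -
 obtain B K where B: "!!x. \<bar>g x\<bar> <= B" and K: "compact K" "K \<subseteq> oq" "!!x. x \<notin> K ==> g x = 0" using g by (auto simp: cs_def)
 obtain C where C: "!!x. x \<in> K ==> \<bar>u x\<bar> <= C" using lbdD[OF u K(1,2)] by blast
 have "\<bar>u x * g x\<bar> <= \<bar>C\<bar> * \<bar>B\<bar>" for x
 proof (cases "x \<in> K")
  case True
  have "\<bar>u x\<bar> <= \<bar>C\<bar>" "\<bar>g x\<bar> <= \<bar>B\<bar>" using C[OF True] B[of x] by linarith+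
  thus ?thesis unfolding abs_mult by (intro mult_mono) auto
 qed (simp add: K(3))
 moreover have "(%x. u x * g x) \<in> bm borel" using cs_measurable[OF g] lbd_measurable[OF u] by simp
 ultimately show ?thesis using K unfolding cs_def by (metis mult_zero_right)
qed

lemma cs_continuous: assumes g: "cs g" and m: "continuous_on quadrant m" shows "cs (%x. m x * g x)"
proof -
 have eq: "(%x. (ind quadrant x * m x) * g x) = (%x. m x * g x)"
 proof
  fix x show "(ind quadrant x * m x) * g x = m x * g x" using cs_zero[OF g, of x] by (cases "x \<in> oq") (auto simp: open_quadrant_def quadrant_def)
 qed
 show ?thesis using cs_lbd[OF g lbd_continuous[OF m]] unfolding eq .
qed

text \<open>\<open>ennreal\<close> sends negative values to 0, so each component of
  \<open>signed_density\<close> carries one of the two parts of the density.\<close>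

lemma density_positive_part:
 assumes P: "radon P" and u: "lbd u"
 shows "radon (density P (%x. ennreal (u x)))"
  and "cs g ==> (LINT x|density P (%x. ennreal (u x)). g x) = (LINT x|P. max 0 (u x) * g x)"
proof -
 have s: "sets P = sets borel" using P by (simp add: radon_measure_on_def)
 have um: "u \<in> bm P" using lbd_measurable[OF u] by (simp add: measurable_cong_sets[OF s refl])
 have d: "density P (%x. ennreal (u x)) = density P (%x. ennreal (max 0 (u x)))"
  by (intro arg_cong[where f="density P"] ext) (simp add: max_def ennreal_neg)
 show "cs g ==> (LINT x|density P (%x. ennreal (u x)). g x) = (LINT x|P. max 0 (u x) * g x)"
  unfolding d using um cs_measurable[of g] by (subst integral_density) (auto simp: measurable_cong_sets[OF s refl])
 show "radon (density P (%x. ennreal (u x)))" unfolding radon_measure_on_def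
 proof (intro conjI allI impI)
  show "sets (density P (%x. ennreal (u x))) = sets borel" using s by simp
  have "- oq \<in> null_sets P" using P s by (auto simp: radon_measure_on_def null_sets_def)
  thus "emeasure (density P (%x. ennreal (u x))) (- oq) = 0" using um s by (subst emeasure_density) (auto simp: nn_integral_null_set)
 next
  fix K assume K: "compact K & K \<subseteq> oq"
  have Kr: "K \<in> relatively_compact_borel oq" using K by (auto simp: relatively_compact_borel_def borel_compact)
  have "integrable P (%x. max 0 (u x) * ind K x)" by (intro cs_integrable P cs_lbd cs_indicator Kr lbd_max u)
  moreover have "emeasure (density P (%x. ennreal (u x))) K = (\<integral>\<^sup>+x. ennreal (max 0 (u x) * ind K x) \<partial>P)"
   unfolding d using um K s by (subst emeasure_density) (auto simp: borel_compact indicator_def intro!: nn_integral_cong)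
  ultimately show "emeasure (density P (%x. ennreal (u x))) K < \<infinity>" by (simp add: nn_integral_eq_integral less_top[symmetric] indicator_def)
 qed
qed

lemma signed_density_radon: "radon P ==> lbd u ==> signed_radon_on oq (signed_density u P)"
 by (simp add: signed_radon_on_def signed_density_def density_positive_part lbd_uminus)

lemma signed_density_integral:
 assumes "radon P" "lbd u" "cs g"
 shows "signed_integral (signed_density u P) g = (LINT x|P. u x * g x)"
proof -
 have "signed_integral (signed_density u P) g = (LINT x|P. max 0 (u x) * g x) - (LINT x|P. max 0 (- u x) * g x)"
  using density_positive_part(2)[OF assms(1,2,3)] density_positive_part(2)[OF assms(1) lbd_uminus[OF assms(2)] assms(3)]
  by (simp add: signed_integral_def signed_density_def)
 also have "... = (LINT x|P. max 0 (u x) * g x - max 0 (- u x) * g x)"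
  by (rule Bochner_Integration.integral_diff[symmetric]) (intro cs_integrable cs_lbd lbd_max lbd_uminus assms)+
 also have "... = (LINT x|P. u x * g x)" by (intro Bochner_Integration.integral_cong) (auto simp: max_def)
 finally show ?thesis .
qed

definition sadd :: "signed_measure => signed_measure => signed_measure" where "sadd S T = (msum (fst S) (fst T), msum (snd S) (snd T))"

lemma sadd_radon: "signed_radon_on oq S ==> signed_radon_on oq T ==> signed_radon_on oq (sadd S T)"
 by (auto simp: signed_radon_on_def sadd_def radon_measure_on_def emeasure_msum borel_compact)

lemma sadd_integral: "signed_radon_on oq S ==> signed_radon_on oq T ==> cs g ==> signed_integral (sadd S T) g = signed_integral S g + signed_integral T g"
 by (simp add: signed_radon_on_def sadd_def signed_integral_def integral_msum(2) cs_integrable radon_measure_on_def)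

lemma payoff_continuous: "continuous_on S (payoff al)" unfolding payoff_def by (intro continuous_intros)

section \<open>Distributional derivatives of the payoff\<close>

context
 fixes al :: real assumes al: "0 < al"
begin

abbreviation "line == {x::real^2. x $ 1 = al * x $ 2}"
abbreviation "ksm == kink_surface_measure al"
abbreviation "rho == sqrt (1 + al^2)"

text \<open>The components of \<open>kink_normal\<close>, and at the same time the jumps of
  \<open>grad\<close> when the kink is crossed towards larger first coordinate.\<close>

definition nu :: "2 => real" where "nu i = (if i = 1 then 1 else - al)"
text \<open>Both components are put to 0 on the line, which is Lebesgue null; this differs from the
  mean value used along the paths.\<close>

definition grad :: "2 => real^2 => real" where "grad i x = (if i = 1 then ind {x. al * x $ 2 < x $ 1} x else al * ind {x. x $ 1 < al * x $ 2} x)"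
text \<open>Integration along the line, parametrised by the second coordinate; passing to arc length
  brings in the factor \<open>rho\<close>.\<close>

definition tau :: "(real^2 => real) => real" where "tau ph = (LINT s|lborel. ph (vector [al * s, s]))"

lemma half_planes [measurable]: "{x::real^2. al * x $ 2 < x $ 1} \<in> sets borel" "{x::real^2. x $ 1 < al * x $ 2} \<in> sets borel" "line \<in> sets borel"
 by measurable

lemma line_null: "line \<in> null_sets lborel"
proof -
 have "line = {x. (vector [1, - al] :: real^2) \<bullet> x = 0}" by (auto simp: inner_vec_def sum_2)
 moreover have "(vector [1, - al] :: real^2) ~= 0" by (auto simp: vec_eq_iff forall_2)
 ultimately have "negligible line" using negligible_hyperplane[of "vector [1, - al] :: real^2" 0] by simp
 thus ?thesis using half_planes(3) by (simp add: negligible_iff_null_sets null_sets_completion_iff)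
qed

lemma lbd_grad: "lbd (grad i)" unfolding grad_def[abs_def] by (cases "i = 1") (auto intro!: lbd_mult lbd_const lbd_indicator half_planes)

lemma vector_positive: "vector [t, y] \<in> oq \<longleftrightarrow> 0 < t & 0 < y" by (simp add: open_quadrant_def)

text \<open>With the other coordinate frozen the payoff is, up to the factor al, a maximum with a
  constant, to which one-dimensional integration by parts applies.\<close>

lemma first_derivatives:
 assumes ph: "test_function oq ph"
 shows "(LINT x|lborel. payoff al x * partial_deriv j ph x) = - (LINT x|lborel. grad j x * ph x)"
proof -
 obtain R where R: "!!t y. R < \<bar>t\<bar> ==> ph (vector [t, y]) = 0" "!!t y. R < \<bar>y\<bar> ==> ph (vector [t, y]) = 0"
  by (rule section_support[OF ph]) blast
 have i1: "integrable lborel (%x. payoff al x * partial_deriv j ph x)" by (intro cs_lborel cs_continuous payoff_continuous test_cs test_partial ph)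
 have i2: "integrable lborel (%x. grad j x * ph x)" by (intro cs_lborel cs_lbd lbd_grad test_cs ph)
 consider "j = 1" | "j = 2" using exhaust_2[of j] by blast
 thus ?thesis
 proof cases
  case 1
  have "(LINT t|lborel. payoff al (vector [t, y]) * partial_deriv 1 ph (vector [t, y])) = - (LINT t|lborel. grad 1 (vector [t, y]) * ph (vector [t, y]))" for y
   using compact_support_parts(2)[OF section_derivative(1)[OF ph] section_continuous(1)[OF ph], of R y "al * y"] R(1)
   by (simp add: payoff_def grad_def indicator_def)
  thus ?thesis using lborel2_fubini(1)[OF i1] lborel2_fubini(1)[OF i2] 1 by simp
 next
  case 2
  have "(LINT y|lborel. payoff al (vector [t, y]) * partial_deriv 2 ph (vector [t, y])) = - (LINT y|lborel. grad 2 (vector [t, y]) * ph (vector [t, y]))" for t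
  proof -
   have p: "payoff al (vector [t, y]) = al * max y (t / al)" for y using al by (simp add: payoff_def max_def field_simps)
   have g: "grad 2 (vector [t, y]) = al * ind {t / al<..} y" for y using al by (simp add: grad_def indicator_def field_simps)
   show ?thesis unfolding p g mult.assoc
    using compact_support_parts(2)[OF section_derivative(2)[OF ph] section_continuous(2)[OF ph], of R t "t / al"] R(2) by simp
  qed
  thus ?thesis using lborel2_fubini(2)[OF i1] lborel2_fubini(2)[OF i2] 2 by simp
 qed
qed

text \<open>Along a coordinate line in direction i, the step function \<open>grad j\<close> has one
  jump, at the kink. For i = 1 the crossing points are parametrised by the second coordinate, which
  gives \<open>tau\<close> directly. For i = 2 they are parametrised by the first, the jump has the
  opposite sign, and the substitution supplies al; this is the factor \<open>nu 2\<close>.\<close>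

lemma second_derivatives:
 assumes ph: "test_function oq ph"
 shows "(LINT x|lborel. grad j x * partial_deriv i ph x) = - (nu i * nu j * tau ph)"
proof -
 obtain R where R: "!!t y. R < \<bar>t\<bar> ==> ph (vector [t, y]) = 0" "!!t y. R < \<bar>y\<bar> ==> ph (vector [t, y]) = 0"
  by (rule section_support[OF ph]) blast
 have i: "integrable lborel (%x. grad j x * partial_deriv i ph x)" by (intro cs_lborel cs_lbd lbd_grad test_cs test_partial ph)
 have F1: "(LINT t|lborel. ind {k<..} t * partial_deriv 1 ph (vector [t, y])) = - ph (vector [k, y])"
  "(LINT t|lborel. ind {..<k} t * partial_deriv 1 ph (vector [t, y])) = ph (vector [k, y])" for k y
  using compact_support_FTC(2)[OF section_derivative(1)[OF ph] section_continuous(1)[OF ph], of R y k]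
   compact_support_parts(1)[OF section_derivative(1)[OF ph] section_continuous(1)[OF ph], of R y k] R(1) by blast+
 have F2: "(LINT y|lborel. ind {k<..} y * partial_deriv 2 ph (vector [t, y])) = - ph (vector [t, k])"
  "(LINT y|lborel. ind {..<k} y * partial_deriv 2 ph (vector [t, y])) = ph (vector [t, k])" for k t
  using compact_support_FTC(2)[OF section_derivative(2)[OF ph] section_continuous(2)[OF ph], of R t k]
   compact_support_parts(1)[OF section_derivative(2)[OF ph] section_continuous(2)[OF ph], of R t k] R(2) by blast+
 have sub: "(LINT t|lborel. ph (vector [t, t / al])) = al * tau ph"
  using lborel_integral_real_affine[of al "%t. ph (vector [t, t / al])" 0] al by (simp add: tau_def)
 have g: "grad 1 (vector [t, y]) = ind {al * y<..} t" "grad 1 (vector [t, y]) = ind {..<t / al} y"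
  "grad 2 (vector [t, y]) = al * ind {..<al * y} t" "grad 2 (vector [t, y]) = al * ind {t / al<..} y" for t y
  using al by (simp_all add: grad_def indicator_def field_simps)
 consider "i = 1" "j = 1" | "i = 2" "j = 1" | "i = 1" "j = 2" | "i = 2" "j = 2" using exhaust_2[of i] exhaust_2[of j] by blast
 thus ?thesis
 proof cases
  case 1
  have "(LINT x|lborel. grad j x * partial_deriv i ph x) = (LINT y|lborel. - ph (vector [al * y, y]))"
   unfolding lborel2_fubini(1)[OF i] unfolding 1 g(1) F1 ..
  thus ?thesis using 1 by (simp add: tau_def nu_def)
 next
  case 2
  have "(LINT x|lborel. grad j x * partial_deriv i ph x) = (LINT t|lborel. ph (vector [t, t / al]))"
   unfolding lborel2_fubini(2)[OF i] unfolding 2 g(2) F2 ..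
  thus ?thesis using 2 sub by (simp add: nu_def)
 next
  case 3
  have "(LINT x|lborel. grad j x * partial_deriv i ph x) = (LINT y|lborel. al * ph (vector [al * y, y]))"
   unfolding lborel2_fubini(1)[OF i] unfolding 3 g(3) mult.assoc integral_mult_right_zero F1 ..
  thus ?thesis using 3 by (simp add: tau_def nu_def)
 next
  case 4
  have "(LINT x|lborel. grad j x * partial_deriv i ph x) = (LINT t|lborel. al * - ph (vector [t, t / al]))"
   unfolding lborel2_fubini(2)[OF i] unfolding 4 g(4) mult.assoc integral_mult_right_zero F2 ..
  thus ?thesis using 4 sub by (simp add: nu_def)
 qed
qed

lemma rho_pos: "0 < rho" by (simp add: add_pos_nonneg)

abbreviation "ray s == (s / rho) *\<^sub>R (vector [al, 1] :: real^2)"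

lemma ray_vector: "ray s = vector [al * (s / rho), s / rho]" by (simp add: vec_eq_iff forall_2)

lemma ray_measurable: "(%s. ray s) \<in> bm (restrict_space lborel {0..})"
proof (rule measurable_restrict_space1)
 have "(%s. ray s) \<in> bm borel" by (intro borel_measurable_continuous_onI continuous_intros) (use rho_pos in simp)
 thus "(%s. ray s) \<in> bm lborel" by simp
qed

lemma sets_ksm [simp]: "sets ksm = sets borel" by (simp add: kink_surface_measure_def)

lemma emeasure_ksm: "S \<in> sets borel ==> emeasure ksm S = emeasure lborel {s. 0 <= s & ray s \<in> S}"
proof -
 assume S: "S \<in> sets borel"
 have "emeasure ksm S = emeasure (restrict_space lborel {0..}) ((%s. ray s) -` S \<inter> {0..})"
  unfolding kink_surface_measure_def using emeasure_distr[OF ray_measurable S] by (simp add: space_restrict_space)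
 also have "... = emeasure lborel ((%s. ray s) -` S \<inter> {0..})" by (rule emeasure_restrict_space) auto
 also have "(%s. ray s) -` S \<inter> {0..} = {s. 0 <= s & ray s \<in> S}" by auto
 finally show ?thesis .
qed

text \<open>The ray leaves the open quadrant only at the origin, a single parameter value. On a
  compact set the second coordinate bounds the parameter.\<close>

lemma radon_ksm: "radon ksm" unfolding radon_measure_on_def
proof (intro conjI allI impI)
 have "emeasure ksm (- oq) = emeasure lborel {s. 0 <= s & ray s \<in> - oq}" by (rule emeasure_ksm) simp
 also have "{s. 0 <= s & ray s \<in> - oq} = {0}"
  unfolding ray_vector using al rho_pos by (auto simp: vector_positive zero_less_mult_iff zero_less_divide_iff)
 finally show "emeasure ksm (- oq) = 0" by simp
 fix K assume K: "compact K & K \<subseteq> oq"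
 obtain R where R: "!!x. x \<in> K ==> norm x <= R" using compact_imp_bounded[of K] K by (auto simp: bounded_iff)
 have "emeasure ksm K = emeasure lborel {s. 0 <= s & ray s \<in> K}" using K by (intro emeasure_ksm) (simp add: borel_compact)
 also have "... <= emeasure lborel {0..R * rho}"
 proof (rule emeasure_mono)
  show "{s. 0 <= s & ray s \<in> K} \<subseteq> {0..R * rho}"
  proof
   fix s assume s: "s \<in> {s. 0 <= s & ray s \<in> K}"
   hence "norm (ray s) <= R" using R by blast
   moreover have "\<bar>ray s $ 2\<bar> <= norm (ray s)" by (rule component_le_norm_cart)
   moreover have "ray s $ 2 = s / rho" by simp
   ultimately have "s / rho <= R" by linarith
   thus "s \<in> {0..R * rho}" using s rho_pos by (simp add: pos_divide_le_eq)
  qed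
 qed simp
 also have "... < \<infinity>" by (cases "0 <= R * rho") auto
 finally show "emeasure ksm K < \<infinity>" .
qed simp

lemma ksm_tau: assumes g: "cs g" shows "(LINT x|ksm. g x) = rho * tau g"
proof -
 have z: "g (ray s) = 0" if "s <= 0" for s
 proof (rule cs_zero[OF g])
  show "ray s \<notin> oq" unfolding ray_vector vector_positive using that rho_pos by (simp add: not_less divide_nonpos_pos)
 qed
 have "(LINT x|ksm. g x) = (LINT s|restrict_space lborel {0..}. g (ray s))"
  unfolding kink_surface_measure_def by (rule integral_distr[OF ray_measurable cs_measurable[OF g]])
 also have "... = (LINT s|lborel. ind {0..} s *\<^sub>R g (ray s))" by (rule integral_restrict_space) simp
 also have "... = (LINT s|lborel. g (ray s))"
 proof (intro Bochner_Integration.integral_cong refl)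
  fix s show "ind {0..} s *\<^sub>R g (ray s) = g (ray s)" using z[of s] by (cases "0 <= s") auto
 qed
 also have "... = rho * tau g" using lborel_integral_real_affine[of rho "%s. g (ray s)" 0] rho_pos unfolding tau_def ray_vector by simp
 finally show ?thesis .
qed

lemma ksm_line: "AE x in ksm. x \<in> kink al"
proof (rule AE_I)
 have k: "kink al \<in> sets borel"
 proof -
  have "kink al = quadrant \<inter> line" by (auto simp: kink_def)
  thus ?thesis using closed_quadrant half_planes(3) by (simp add: borel_closed)
 qed
 show "{x \<in> space ksm. \<not> x \<in> kink al} \<subseteq> - kink al" by auto
 show "- kink al \<in> sets ksm" using k by simp
 have "emeasure ksm (- kink al) = emeasure lborel {s. 0 <= s & ray s \<in> - kink al}" by (rule emeasure_ksm) (use k in simp)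
 also have "{s. 0 <= s & ray s \<in> - kink al} = {}" unfolding ray_vector using al rho_pos by (auto simp: kink_def quadrant_def)
 finally show "emeasure ksm (- kink al) = 0" by simp
qed

section \<open>The generator measure and the stopping gain\<close>

context
 fixes mu :: "real^2 => real^2" and si :: "real^2 => real^2^2" and c :: "real^2 => real" and r :: real
 assumes cont: "continuous_on quadrant mu" "continuous_on quadrant si" "continuous_on quadrant c"
begin

abbreviation "aa == diffusion_matrix si"
abbreviation "kd == kink_density al aa"

lemma continuous_a: "continuous_on quadrant (%x. aa x $ i $ j)"
 unfolding diffusion_matrix_def matrix_matrix_mult_def transpose_def by (simp add: sum_2) (intro continuous_intros cont)

lemma lbd_kd: "lbd kd"
proof -
 have q: "continuous_on quadrant (%x. kink_q al aa x / (2 * rho))" unfolding kink_q_diffusion using rho_pos by (intro continuous_intros cont) simp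
 have k: "kink al = quadrant \<inter> line" by (auto simp: kink_def)
 have "kink al \<in> sets borel" unfolding k using closed_quadrant half_planes(3) by (intro sets.Int) (auto simp: borel_closed)
 hence "lbd (%x. ind (kink al) x * (ind quadrant x * (kink_q al aa x / (2 * rho))))" by (intro lbd_mult lbd_indicator lbd_continuous q)
 moreover have "(%x. ind (kink al) x * (ind quadrant x * (kink_q al aa x / (2 * rho)))) = kd" by (auto simp: kink_density_def k indicator_def)
 ultimately show ?thesis by simp
qed

lemma kd_nonneg: "0 <= kd x" using rho_pos by (simp add: kink_density_def kink_q_diffusion)

text \<open>The indicators in \<open>drift\<close> and \<open>gain\<close> make these densities
  Borel on the plane, the coefficients being arbitrary outside the quadrant.\<close>

definition "drift x = ind quadrant x * mu x $ 1 * grad 1 x + ind quadrant x * mu x $ 2 * grad 2 x"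
definition "gain x = ind oq x * gain_density r al c mu x"

lemma lbd_drift: "lbd drift" unfolding drift_def[abs_def] by (intro lbd_add lbd_mult[OF lbd_continuous] lbd_grad continuous_intros cont)

lemma lbd_gain: "lbd gain"
proof -
 have "lbd (%x. ind oq x * (ind {x. al * x $ 2 < x $ 1} x * (ind quadrant x * (c x + r * x $ 1 - mu x $ 1))
   + ind {x. x $ 1 < al * x $ 2} x * (ind quadrant x * (c x + r * al * x $ 2 - al * mu x $ 2))))"
  by (intro lbd_mult lbd_add lbd_indicator lbd_continuous continuous_intros cont half_planes oq_measurable)
 also have "(%x. ind oq x * (ind {x. al * x $ 2 < x $ 1} x * (ind quadrant x * (c x + r * x $ 1 - mu x $ 1))
   + ind {x. x $ 1 < al * x $ 2} x * (ind quadrant x * (c x + r * al * x $ 2 - al * mu x $ 2)))) = gain"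
  by (auto simp: gain_def gain_density_def indicator_def open_quadrant_def quadrant_def)
 finally show ?thesis .
qed

text \<open>Explicit candidates for the derivatives, the generator measure and the stopping gain.
  Dividing by \<open>rho\<close> compensates for the arc length built into
  \<open>ksm\<close>.\<close>

abbreviation "D1 i == signed_density (grad i) LU"
abbreviation "D2 i j == signed_density (%_. nu i * nu j / rho) ksm"
abbreviation "Lam == sadd (signed_density drift LU) (signed_density kd ksm)"
abbreviation "Gam == sadd (signed_density gain LU) (signed_density (%x. - kd x) ksm)"

lemmas radons = signed_density_radon[OF radon_LU lbd_grad] signed_density_radon[OF radon_ksm lbd_const]
 signed_density_radon[OF radon_LU lbd_drift] signed_density_radon[OF radon_ksm lbd_kd]
 signed_density_radon[OF radon_LU lbd_gain] signed_density_radon[OF radon_ksm lbd_uminus[OF lbd_kd]]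

lemma LU_density_integral: "lbd u ==> cs g ==> signed_integral (signed_density u LU) g = (LINT x|lborel. u x * g x)"
proof -
 assume u: "lbd u" and g: "cs g"
 show ?thesis using signed_density_integral[OF radon_LU u g] cs_LU[OF cs_lbd[OF g u]] by simp
qed

lemma function_distribution_eq:
 assumes "cs (%x. f x * ph x)" shows "function_distribution oq f ph = (LINT x|lborel. f x * ph x)"
 unfolding function_distribution_def set_lebesgue_integral_def
proof (intro Bochner_Integration.integral_cong refl)
 fix x show "ind oq x *\<^sub>R (f x * ph x) = f x * ph x" using cs_zero[OF assms, of x] by (cases "x \<in> oq") auto
qed

lemma payoff_distribution: "test_function oq ph ==> function_distribution oq (payoff al) ph = (LINT x|lborel. payoff al x * ph x)"
 by (intro function_distribution_eq cs_continuous payoff_continuous test_cs)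

lemma D1_represents: "represents_distribution oq (D1 i) (dist_deriv i (function_distribution oq (payoff al)))" unfolding represents_distribution_def
proof (intro conjI allI impI radons)
 fix ph assume ph: "test_function oq ph"
 show "dist_deriv i (function_distribution oq (payoff al)) ph = signed_integral (D1 i) ph"
  using first_derivatives[OF ph, of i] by (simp add: dist_deriv_def payoff_distribution[OF test_partial[OF ph]] LU_density_integral[OF lbd_grad test_cs[OF ph]])
qed

lemma D2_represents: "represents_distribution oq (D2 i j) (dist_deriv i (dist_deriv j (function_distribution oq (payoff al))))"
 unfolding represents_distribution_def
proof (intro conjI allI impI radons)
 fix ph assume ph: "test_function oq ph"
 have "dist_deriv i (dist_deriv j (function_distribution oq (payoff al))) ph = nu i * nu j * tau ph"
  using first_derivatives[OF test_partial[OF ph], of j i] second_derivatives[OF ph, of j i]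
  by (simp add: dist_deriv_def payoff_distribution[OF test_partial[OF test_partial[OF ph]]])
 also have "... = signed_integral (D2 i j) ph"
  using rho_pos by (simp add: signed_density_integral[OF radon_ksm lbd_const test_cs[OF ph]] ksm_tau[OF test_cs[OF ph]])
 finally show "dist_deriv i (dist_deriv j (function_distribution oq (payoff al))) ph = signed_integral (D2 i j) ph" .
qed

lemma representation_unique:
 assumes S: "represents_distribution oq S D" "represents_distribution oq S' D" and g: "cs g"
 shows "signed_integral S g = signed_integral S' g"
proof (rule signed_measure_unique[OF _ _ _ g])
 show "signed_radon_on oq S" "signed_radon_on oq S'" using S by (simp_all add: represents_distribution_def)
 fix ph assume "test_function oq ph"
 hence "D ph = signed_integral S ph" "D ph = signed_integral S' ph" using S by (simp_all add: represents_distribution_def)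
 thus "signed_integral S ph = signed_integral S' ph" by simp
qed

text \<open>The representing measures \<open>E1\<close> and \<open>E2\<close> are arbitrary and are
  paired with functions that are not smooth; uniqueness on \<open>cs\<close> exchanges them for the
  explicit candidates. On the kink the four second order terms then add up to q / (2 rho).\<close>

lemma generator_functional:
 assumes E1: "!!i. represents_distribution oq (E1 i) (dist_deriv i (function_distribution oq (payoff al)))"
  and E2: "!!i j. represents_distribution oq (E2 i j) (dist_deriv i (dist_deriv j (function_distribution oq (payoff al))))"
  and ph: "test_function oq ph"
 shows "(\<Sum>i\<in>UNIV. signed_integral (E1 i) (%x. mu x $ i * ph x))
   + 1/2 * (\<Sum>i\<in>UNIV. \<Sum>j\<in>UNIV. signed_integral (E2 i j) (%x. aa x $ i $ j * ph x)) = signed_integral Lam ph"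
proof -
 note cp = test_cs[OF ph]
 have cm: "cs (%x. mu x $ i * ph x)" for i by (rule cs_continuous[OF cp continuous_on_component[OF cont(1)]])
 have ca: "cs (%x. aa x $ i $ j * ph x)" for i j by (rule cs_continuous[OF cp continuous_a])
 have e1: "signed_integral (E1 i) (%x. mu x $ i * ph x) = (LINT x|lborel. grad i x * (mu x $ i * ph x))" for i
  unfolding representation_unique[OF E1 D1_represents cm] by (rule LU_density_integral[OF lbd_grad cm])
 have e2: "signed_integral (E2 i j) (%x. aa x $ i $ j * ph x) = (LINT x|ksm. nu i * nu j / rho * (aa x $ i $ j * ph x))" for i j
  unfolding representation_unique[OF E2 D2_represents ca] by (rule signed_density_integral[OF radon_ksm lbd_const ca])
 have i1: "integrable lborel (%x. grad i x * (mu x $ i * ph x))" for i by (rule cs_lborel[OF cs_lbd[OF cm lbd_grad]])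
 have i2: "integrable ksm (%x. nu i * nu j / rho * (aa x $ i $ j * ph x))" for i j by (rule cs_integrable[OF radon_ksm cs_lbd[OF ca lbd_const]])
 have "(\<Sum>i\<in>UNIV. signed_integral (E1 i) (%x. mu x $ i * ph x)) = (LINT x|lborel. grad 1 x * (mu x $ 1 * ph x) + grad 2 x * (mu x $ 2 * ph x))"
  unfolding sum_2 e1 by (rule Bochner_Integration.integral_add[OF i1 i1, symmetric])
 also have "... = (LINT x|lborel. drift x * ph x)"
 proof (intro Bochner_Integration.integral_cong refl)
  fix x show "grad 1 x * (mu x $ 1 * ph x) + grad 2 x * (mu x $ 2 * ph x) = drift x * ph x"
   using cs_zero[OF cp, of x] by (cases "x \<in> oq") (auto simp: drift_def open_quadrant_def quadrant_def algebra_simps)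
 qed
 finally have A: "(\<Sum>i\<in>UNIV. signed_integral (E1 i) (%x. mu x $ i * ph x)) = signed_integral (signed_density drift LU) ph"
  by (simp add: LU_density_integral[OF lbd_drift cp])
 have "1/2 * (\<Sum>i\<in>UNIV. \<Sum>j\<in>UNIV. signed_integral (E2 i j) (%x. aa x $ i $ j * ph x)) =
   (LINT x|ksm. 1/2 * ((nu 1 * nu 1 / rho * (aa x $ 1 $ 1 * ph x) + nu 1 * nu 2 / rho * (aa x $ 1 $ 2 * ph x))
    + (nu 2 * nu 1 / rho * (aa x $ 2 $ 1 * ph x) + nu 2 * nu 2 / rho * (aa x $ 2 $ 2 * ph x))))"
  unfolding sum_2 e2 integral_mult_right_zero[where c="1/2"]
   Bochner_Integration.integral_add[OF Bochner_Integration.integrable_add[OF i2[of 1 1] i2[of 1 2]] Bochner_Integration.integrable_add[OF i2[of 2 1] i2[of 2 2]]]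
   Bochner_Integration.integral_add[OF i2[of 1 1] i2[of 1 2]] Bochner_Integration.integral_add[OF i2[of 2 1] i2[of 2 2]] ..
 also have "... = (LINT x|ksm. kd x * ph x)"
 proof (rule integral_cong_AE)
  show "(%x. kd x * ph x) \<in> bm ksm" using cs_integrable[OF radon_ksm cs_lbd[OF cp lbd_kd]] by auto
  show "AE x in ksm. 1/2 * ((nu 1 * nu 1 / rho * (aa x $ 1 $ 1 * ph x) + nu 1 * nu 2 / rho * (aa x $ 1 $ 2 * ph x))
    + (nu 2 * nu 1 / rho * (aa x $ 2 $ 1 * ph x) + nu 2 * nu 2 / rho * (aa x $ 2 $ 2 * ph x))) = kd x * ph x" using ksm_line
  proof eventually_elim
   case (elim x)
   have aux: "1/2 * ((1 * 1 / p * (a1 * f) + 1 * - al / p * (a2 * f)) + (- al * 1 / p * (a3 * f) + - al * - al / p * (a4 * f)))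
     = (a1 - al * a2 - al * a3 + al^2 * a4) / (2 * p) * f" if "p ~= 0" for a1 a2 a3 a4 f p :: real
    using that by (simp add: field_simps power2_eq_square)
   have n: "nu 1 = 1" "nu 2 = - al" by (simp_all add: nu_def)
   have k: "kd x = (aa x $ 1 $ 1 - al * aa x $ 1 $ 2 - al * aa x $ 2 $ 1 + al^2 * aa x $ 2 $ 2) / (2 * rho)"
    using elim by (simp add: kink_density_def kink_q_expand)
   show ?case unfolding n k by (rule aux) (use rho_pos in simp)
  qed
 qed (intro borel_measurable_times borel_measurable_add borel_measurable_const borel_measurable_integrable[OF i2])
 finally have B: "1/2 * (\<Sum>i\<in>UNIV. \<Sum>j\<in>UNIV. signed_integral (E2 i j) (%x. aa x $ i $ j * ph x)) = signed_integral (signed_density kd ksm) ph"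
  by (simp add: signed_density_integral[OF radon_ksm lbd_kd cp])
 show ?thesis unfolding A B by (rule sadd_integral[OF radons(3,4) cp, symmetric])
qed

lemma generator_exists: "generator_measure oq mu aa (payoff al) Lam" unfolding generator_measure_def
proof (intro exI conjI allI)
 show "represents_distribution oq (D1 i) (dist_deriv i (function_distribution oq (payoff al)))" for i by (rule D1_represents)
 show "represents_distribution oq (D2 i j) (dist_deriv i (dist_deriv j (function_distribution oq (payoff al))))" for i j by (rule D2_represents)
 show "represents_distribution oq Lam (%ph. (\<Sum>i\<in>UNIV. signed_integral (D1 i) (%x. mu x $ i * ph x))
       + 1/2 * (\<Sum>i\<in>UNIV. \<Sum>j\<in>UNIV. signed_integral (D2 i j) (%x. aa x $ i $ j * ph x)))" unfolding represents_distribution_def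
  by (intro conjI allI impI sadd_radon radons generator_functional D1_represents D2_represents)
qed

lemma generator_unique:
 assumes "generator_measure oq mu aa (payoff al) S"
 shows "signed_radon_on oq S" "!!g. cs g ==> signed_integral S g = signed_integral Lam g"
proof -
 obtain E1 E2 where E: "!!i. represents_distribution oq (E1 i) (dist_deriv i (function_distribution oq (payoff al)))"
   "!!i j. represents_distribution oq (E2 i j) (dist_deriv i (dist_deriv j (function_distribution oq (payoff al))))"
   "represents_distribution oq S (%ph. (\<Sum>i\<in>UNIV. signed_integral (E1 i) (%x. mu x $ i * ph x))
       + 1/2 * (\<Sum>i\<in>UNIV. \<Sum>j\<in>UNIV. signed_integral (E2 i j) (%x. aa x $ i $ j * ph x)))"
  using assms unfolding generator_measure_def by blast
 show S: "signed_radon_on oq S" using E(3) by (simp add: represents_distribution_def)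
 show "signed_integral S g = signed_integral Lam g" if g: "cs g" for g
 proof (rule signed_measure_unique[OF S sadd_radon[OF radons(3,4)] _ g])
  fix ph assume ph: "test_function oq ph"
  show "signed_integral S ph = signed_integral Lam ph" using E(3) ph generator_functional[OF E(1,2) ph] by (simp add: represents_distribution_def)
 qed
qed

text \<open>In each of the two open half-planes the densities agree pointwise, and the separating
  line is Lebesgue null; the singular part only changes sign.\<close>

lemma gain_functional:
 assumes S: "generator_measure oq mu aa (payoff al) S" and ph: "test_function oq ph"
 shows "function_distribution oq (%x. c x + r * payoff al x) ph - signed_integral S ph = signed_integral Gam ph"
proof -
 note cp = test_cs[OF ph]
 have "continuous_on quadrant (%x. c x + r * payoff al x)" by (intro continuous_intros payoff_continuous cont)
 from cs_continuous[OF cp this] have cc: "cs (%x. (c x + r * payoff al x) * ph x)" .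
 have i: "integrable lborel (%x. drift x * ph x)" "integrable lborel (%x. gain x * ph x)" by (intro cs_lborel cs_lbd cp lbd_drift lbd_gain)+
 have "(LINT x|lborel. (c x + r * payoff al x) * ph x) - (LINT x|lborel. drift x * ph x) = (LINT x|lborel. (c x + r * payoff al x) * ph x - drift x * ph x)"
  using cs_lborel[OF cc] i(1) by simp
 also have "... = (LINT x|lborel. gain x * ph x)"
 proof (rule integral_cong_AE)
  show "AE x in lborel. (c x + r * payoff al x) * ph x - drift x * ph x = gain x * ph x" using AE_not_in[OF line_null]
  proof eventually_elim
   fix x assume x: "x \<notin> line"
   show "(c x + r * payoff al x) * ph x - drift x * ph x = gain x * ph x"
   proof (cases "x \<in> oq")
    case True
    hence "x \<in> quadrant" by (auto simp: open_quadrant_def quadrant_def)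
    hence "c x + r * payoff al x - drift x = gain x"
     using True x by (cases "al * x $ 2 < x $ 1") (auto simp: gain_def drift_def grad_def gain_density_def payoff_def max_def)
    thus ?thesis by (simp only: left_diff_distrib[symmetric])
   qed (simp add: cs_zero[OF cp])
  qed
 qed (use i cs_lborel[OF cc] in auto)
 finally show ?thesis
  by (simp add: function_distribution_eq[OF cc] generator_unique(2)[OF S cp] sadd_integral[OF radons(3,4) cp] sadd_integral[OF radons(5,6) cp]
    LU_density_integral[OF lbd_drift cp] LU_density_integral[OF lbd_gain cp] signed_density_integral[OF radon_ksm lbd_kd cp]
    signed_density_integral[OF radon_ksm lbd_uminus[OF lbd_kd] cp])
qed

lemma stopping_gain_exists: "stopping_gain r c mu aa (payoff al) Gam" unfolding stopping_gain_def represents_distribution_def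
 by (intro exI[of _ Lam] conjI generator_exists allI impI gain_functional sadd_radon radons)

lemma stopping_gain_unique:
 assumes "stopping_gain r c mu aa (payoff al) S"
 shows "signed_radon_on oq S" "!!g. cs g ==> signed_integral S g = signed_integral Gam g"
proof -
 obtain T where T: "generator_measure oq mu aa (payoff al) T"
   "represents_distribution oq S (%ph. function_distribution oq (%x. c x + r * payoff al x) ph - signed_integral T ph)"
  using assms unfolding stopping_gain_def by blast
 show S: "signed_radon_on oq S" using T(2) by (simp add: represents_distribution_def)
 show "signed_integral S g = signed_integral Gam g" if g: "cs g" for g
 proof (rule signed_measure_unique[OF S sadd_radon[OF radons(5,6)] _ g])
  fix ph assume ph: "test_function oq ph"
  show "signed_integral S ph = signed_integral Gam ph" using T(2) ph gain_functional[OF T(1) ph] by (simp add: represents_distribution_def)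
 qed
qed

text \<open>The line serves as the null set that carries the singular part. Indicators of relatively
  compact Borel sets lie in \<open>cs\<close>, so equality of integrals becomes equality of
  values.\<close>

lemma decomposition:
 assumes S: "signed_radon_on oq S" and u: "lbd u" and v: "lbd v"
  and eq: "!!g. cs g ==> signed_integral S g = signed_integral (sadd (signed_density u LU) (signed_density v ksm)) g"
  and f: "!!x. x \<in> oq ==> f x = u x"
 shows "lebesgue_decomposition oq S f (signed_density v ksm)"
proof -
 note ru = signed_density_radon[OF radon_LU u] and rv = signed_density_radon[OF radon_ksm v]
 have fu: "ind A x *\<^sub>R f x = u x * ind A x" if "A \<subseteq> oq" for A x using f[of x] that by (auto simp: indicator_def)
 have Aq: "A \<subseteq> oq" if "A \<in> relatively_compact_borel oq" for A using that by (auto simp: relatively_compact_borel_def)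
 show ?thesis unfolding lebesgue_decomposition_def
 proof (intro conjI allI impI ballI bexI[OF _ line_null] S rv)
  fix K assume K: "compact K & K \<subseteq> oq"
  hence "K \<in> relatively_compact_borel oq" by (auto simp: relatively_compact_borel_def borel_compact)
  from cs_lborel[OF cs_lbd[OF cs_indicator[OF this] u]] show "set_integrable lborel K f" using K by (simp only: set_integrable_def fu)
 next
  fix A assume A: "A \<in> relatively_compact_borel oq"
  show "signed_value S A = (LINT x:A|lborel. f x) + signed_value (signed_density v ksm) A"
   unfolding signed_value_integral[OF S A, symmetric] signed_value_integral[OF rv A, symmetric] eq[OF cs_indicator[OF A]]
    sadd_integral[OF ru rv cs_indicator[OF A]] LU_density_integral[OF u cs_indicator[OF A]] set_lebesgue_integral_def fu[OF Aq[OF A]] ..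
 next
  fix A assume A: "A \<in> relatively_compact_borel oq" and l: "A \<inter> line = {}"
  have "signed_value (signed_density v ksm) A = (LINT x|ksm. v x * ind A x)"
   unfolding signed_value_integral[OF rv A, symmetric] by (rule signed_density_integral[OF radon_ksm v cs_indicator[OF A]])
  also have "... = (LINT x|ksm. 0)"
  proof (rule integral_cong_AE)
   show "AE x in ksm. v x * ind A x = 0" using ksm_line by eventually_elim (use l in \<open>auto simp: kink_def indicator_def\<close>)
   show "(%x. v x * ind A x) \<in> bm ksm" using cs_integrable[OF radon_ksm cs_lbd[OF cs_indicator[OF A] v]] by auto
  qed simp
  finally show "signed_value (signed_density v ksm) A = 0" by simp
 qed
qed

theorem generator_singular_part:
 assumes "generator_measure oq mu aa (payoff al) S"
 shows "singular_part oq S (signed_density kd ksm)" unfolding singular_part_def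
 by (rule exI[of _ drift], rule decomposition[OF generator_unique(1)[OF assms] lbd_drift lbd_kd generator_unique(2)[OF assms]]) simp_all

theorem stopping_gain_decomposition:
 assumes "stopping_gain r c mu aa (payoff al) S"
 shows "lebesgue_decomposition oq S (gain_density r al c mu) (signed_density (%x. - kd x) ksm)"
 by (rule decomposition[OF stopping_gain_unique(1)[OF assms] lbd_gain lbd_uminus[OF lbd_kd] stopping_gain_unique(2)[OF assms]]) (simp_all add: gain_def)

lemma singular_gain_nonpos:
 assumes A: "A \<in> relatively_compact_borel oq"
 shows "signed_value (signed_density (%x. - kd x) ksm) A <= 0"
proof -
 note k = lbd_uminus[OF lbd_kd]
 have "signed_value (signed_density (%x. - kd x) ksm) A = - (LINT x|ksm. kd x * ind A x)"
  unfolding signed_value_integral[OF signed_density_radon[OF radon_ksm k] A, symmetric] signed_density_integral[OF radon_ksm k cs_indicator[OF A]] by simp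
 also have "0 <= (LINT x|ksm. kd x * ind A x)" by (intro integral_nonneg_AE AE_I2 mult_nonneg_nonneg kd_nonneg) simp
 hence "- (LINT x|ksm. kd x * ind A x) <= 0" by simp
 finally show ?thesis .
qed

end
end

theorem mainTheorem3:
  fixes M :: "'w measure" and F :: "real \<Rightarrow> 'w measure"
    and W :: "real \<Rightarrow> 'w \<Rightarrow> real^2"
    and \<mu> :: "real^2 \<Rightarrow> real^2" and \<sigma> :: "real^2 \<Rightarrow> real^2^2"
    and X L :: "real^2 \<Rightarrow> real \<Rightarrow> 'w \<Rightarrow> real^2"
    and c :: "real^2 \<Rightarrow> real" and r \<alpha> :: real
  defines "a \<equiv> diffusion_matrix \<sigma>"
    and "q \<equiv> kink_q \<alpha> (diffusion_matrix \<sigma>)"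
    and "Y \<equiv> (\<lambda>x t \<omega>. kink_coordinate \<alpha> (X x t \<omega>))"
  assumes "r > 0" and "\<alpha> > 0"
    and "continuous_on quadrant c" and "\<forall>x\<in>quadrant. 0 \<le> c x"
    and "filtered_space M F" and "usual_conditions M F"
    and "brownian_motion M F W"
    and "locally_lipschitz_on quadrant \<mu>" and "linear_growth_on quadrant \<mu>"
    and "locally_lipschitz_on quadrant \<sigma>" and "linear_growth_on quadrant \<sigma>"
    and "\<forall>K. compact K \<and> K \<subseteq> quadrant \<longrightarrow> uniformly_elliptic_on K a"
    and "\<forall>x\<in>quadrant. unique_strong_solution M F W \<mu> \<sigma> x (X x) (L x)"
    and "strong_markov_family M F X"
  shows
    "(\<forall>x\<in>quadrant. q x = a x $ 1 $ 1 - 2 * \<alpha> * a x $ 1 $ 2 + \<alpha>\<^sup>2 * a x $ 2 $ 2) \<and>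
     (\<forall>x\<in>quadrant.
        (\<forall>t\<ge>0. \<forall>\<omega>\<in>space M.
           payoff \<alpha> (X x t \<omega>) = 1/2 * (X x t \<omega> $ 1 + \<alpha> * X x t \<omega> $ 2 + \<bar>Y x t \<omega>\<bar>)) \<and>
        (\<exists>l. symmetric_local_time M F (Y x) l) \<and>
        (\<forall>l. symmetric_local_time M F (Y x) l \<longrightarrow>
           (AE \<omega> in M. \<forall>t\<ge>0.
              ((\<lambda>\<epsilon>. 1 / (2 * \<epsilon>) *
                 (LINT s:{0..t}|lborel. indicator {s. \<bar>Y x s \<omega>\<bar> < \<epsilon>} s * q (X x s \<omega>)))
               \<longlongrightarrow> l t \<omega>) (at_right 0)) \<and>
           kink_singular_term M F \<mu> \<alpha> (X x) (L x) (\<lambda>t \<omega>. 1/2 * l t \<omega>))) \<and>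
     (\<exists>\<Lambda>. generator_measure open_quadrant \<mu> a (payoff \<alpha>) \<Lambda>) \<and>
     (\<forall>\<Lambda>. generator_measure open_quadrant \<mu> a (payoff \<alpha>) \<Lambda> \<longrightarrow>
        singular_part open_quadrant \<Lambda>
          (signed_density (kink_density \<alpha> a) (kink_surface_measure \<alpha>))) \<and>
     (\<exists>\<Gamma>. stopping_gain r c \<mu> a (payoff \<alpha>) \<Gamma>) \<and>
     (\<forall>\<Gamma>. stopping_gain r c \<mu> a (payoff \<alpha>) \<Gamma> \<longrightarrow>
        lebesgue_decomposition open_quadrant \<Gamma> (gain_density r \<alpha> c \<mu>)
          (signed_density (\<lambda>x. - kink_density \<alpha> a x) (kink_surface_measure \<alpha>))) \<and>
     (\<forall>x\<in>quadrant. 0 \<le> q x) \<and>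
     (\<forall>A\<in>relatively_compact_borel open_quadrant.
        signed_value (signed_density (\<lambda>x. - kink_density \<alpha> a x) (kink_surface_measure \<alpha>)) A \<le> 0)"
proof -
 interpret stoch_base M F by unfold_locales fact+
 note cont = locally_lipschitz_continuous[OF \<open>locally_lipschitz_on quadrant \<mu>\<close>] locally_lipschitz_continuous[OF \<open>locally_lipschitz_on quadrant \<sigma>\<close>]
  \<open>continuous_on quadrant c\<close>
 \<comment> \<open>Ellipticity on the one-point compact set containing y, evaluated at the nonzero
   vector \<open>kink_normal \<alpha>\<close>.\<close>
 have nondegenerate: "0 < kink_q \<alpha> (diffusion_matrix \<sigma>) y" if y: "y \<in> quadrant" for y
 proof -
  have "uniformly_elliptic_on {y} (diffusion_matrix \<sigma>)"
   using \<open>\<forall>K. compact K & K \<subseteq> quadrant --> uniformly_elliptic_on K a\<close> y by (simp add: a_def)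
  then obtain \<kappa> where \<kappa>: "0 < \<kappa>" "!!v. \<kappa> * (norm v)^2 <= v \<bullet> (diffusion_matrix \<sigma> y *v v)" by (auto simp: uniformly_elliptic_on_def)
  have "kink_normal \<alpha> ~= 0" by (auto simp: kink_normal_def vec_eq_iff forall_2)
  hence "0 < \<kappa> * (norm (kink_normal \<alpha>))^2" using \<kappa>(1) by simp
  also have "... <= kink_q \<alpha> (diffusion_matrix \<sigma>) y" unfolding kink_q_def by (rule \<kappa>(2))
  finally show ?thesis .
 qed
 have part1: "(\<exists>l. symmetric_local_time M F (Y x) l) & (\<forall>l. symmetric_local_time M F (Y x) l --> (AE w in M. \<forall>t\<ge>0.
       ((%\<epsilon>. 1 / (2 * \<epsilon>) * (LINT s:{0..t}|lborel. ind {s. \<bar>Y x s w\<bar> < \<epsilon>} s * q (X x s w)))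
        \<longlongrightarrow> l t w) (at_right 0)) &
      kink_singular_term M F \<mu> \<alpha> (X x) (L x) (%t w. 1/2 * l t w))" if x: "x \<in> quadrant" for x
 proof -
  have sol: "reflected_solution M F W \<mu> \<sigma> x (X x) (L x)"
   using \<open>\<forall>x\<in>quadrant. unique_strong_solution M F W \<mu> \<sigma> x (X x) (L x)\<close> x by (simp add: unique_strong_solution_def)
  then obtain I where I: "!!i j. stochastic_integral M F (%s w. \<sigma> (X x s w) $ i $ j) (%t w. W t w $ j) (I i j)"
   "AE w in M. \<forall>t\<ge>0. \<forall>i. X x t w $ i = x $ i + (LINT s:{0..t}|lborel. \<mu> (X x s w) $ i) + (\<Sum>j\<in>UNIV. I i j t w) + L x t w $ i"
   unfolding reflected_solution_def by blast
  have R: "reflected M F W \<mu> \<sigma> \<alpha> x (X x) (L x) I"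
  proof
   show "brownian_motion M F W" "0 < \<alpha>" by fact+
   show "continuous_on quadrant \<mu>" "continuous_on quadrant \<sigma>" by (rule cont)+
   show "0 < kink_q \<alpha> (diffusion_matrix \<sigma>) y" if "y \<in> quadrant" for y by (rule nondegenerate[OF that])
   show "adapted_process F (X x)" "continuous_process M (X x)" using sol by (simp_all add: reflected_solution_def)
   show "X x t w \<in> quadrant" if "w \<in> space M" "0 <= t" for w t using sol that by (simp add: reflected_solution_def)
   show "ci (%t w. L x t w $ i)" for i using sol by (simp add: reflected_solution_def)
  qed (rule I)+
  show ?thesis unfolding Y_def q_def
   by (intro conjI allI impI reflected.local_time_exists[OF R] reflected.local_time_limit[OF R] reflected.singular_term[OF R])
 qed
 have q0: "0 <= q y" for y by (simp add: q_def kink_q_diffusion)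
 note \<alpha> = \<open>\<alpha> > 0\<close>
 show ?thesis
 proof (intro conjI ballI allI impI)
  show "q x = a x $ 1 $ 1 - 2 * \<alpha> * a x $ 1 $ 2 + \<alpha>^2 * a x $ 2 $ 2" for x unfolding q_def a_def by (rule kink_q_formula)
  show "payoff \<alpha> (X x t w) = 1/2 * (X x t w $ 1 + \<alpha> * X x t w $ 2 + \<bar>Y x t w\<bar>)" for x t w
   unfolding Y_def by (rule payoff_kink_coordinate)
  show "\<exists>\<Lambda>. generator_measure open_quadrant \<mu> a (payoff \<alpha>) \<Lambda>"
   unfolding a_def using generator_exists[OF \<alpha> cont(1,2,3)] by blast
  show "singular_part open_quadrant \<Lambda> (signed_density (kink_density \<alpha> a) (kink_surface_measure \<alpha>))"
   if "generator_measure open_quadrant \<mu> a (payoff \<alpha>) \<Lambda>" for \<Lambda>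
   using generator_singular_part[OF \<alpha> cont(1,2,3)] that unfolding a_def by blast
  show "\<exists>\<Gamma>. stopping_gain r c \<mu> a (payoff \<alpha>) \<Gamma>"
   unfolding a_def using stopping_gain_exists[OF \<alpha> cont(1,2,3)] by blast
  show "lebesgue_decomposition open_quadrant \<Gamma> (gain_density r \<alpha> c \<mu>) (signed_density (%x. - kink_density \<alpha> a x) (kink_surface_measure \<alpha>))"
   if "stopping_gain r c \<mu> a (payoff \<alpha>) \<Gamma>" for \<Gamma>
   using stopping_gain_decomposition[OF \<alpha> cont(1,2,3)] that unfolding a_def by blast
  show "signed_value (signed_density (%x. - kink_density \<alpha> a x) (kink_surface_measure \<alpha>)) A <= 0"
   if "A \<in> relatively_compact_borel open_quadrant" for A using singular_gain_nonpos[OF \<alpha> cont(1,2,3) that] unfolding a_def .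
 qed (use part1 q0 in blast)+
qed

end
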